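(* Let $p_1$ and $p_2$ be distinct primes with $p_1\equiv p_2\equiv 3 \pmod 4$. Put $n=6$ if $\min\{p_1,p_2\}>3$ and $n=2$ otherwise. Then $$h(-p_1)\,h(-p_2)\equiv h(p_1p_2)\,\frac{\Psi(\omega_{p_1p_2})}{n}\pmod 8,$$ where $\omega_{p_1p_2}=(1+\sqrt{p_1p_2})/2$.
   Context: For a non-square integer $\Delta\equiv 0,1\pmod 4$ (a quadratic discriminant), $h(\Delta)$ denotes the (wide) class number of the quadratic order $\mathcal{O}_\Delta$ of discriminant $\Delta$; thus $h(-p)$ is the class number of $\mathbb{Q}(\sqrt{-p})$ and $h(p_1p_2)$ the class number of $\mathbb{Q}(\sqrt{p_1p_2})$. Hirzebruch sum: every real quadratic irrational $\xi$ has a regular continued fraction expansion $\xi=[\hat v_1,\dots,\hat v_k;\overline{v_0,\dots,v_{l-1}}]$ (pre-period $\hat v_1,\dots,\hat v_k$, possibly empty with $k=0$, followed by the basic, i.e. minimal, period $v_0,\dots,v_{l-1}$). Define $\Psi(\xi)=\sum_{i=0}^{l-1}(-1)^{k+i}v_i$ if $l$ is even and $\Psi(\xi)=0$ if $l$ is odd. *)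

theory Defs
  imports
    "HOL-Number_Theory.Number_Theory"
    "HOL-Computational_Algebra.Group_Closure"
    "HOL-Library.Real_Mod"
begin

text \<open>
  Quadratic orders are realised as subrings of the complex numbers. The definitions are meant for
  non-square \<open>\<Delta> \<equiv> 0, 1 (mod 4)\<close>; \<open>csqrt\<close> is \<open>\<surd>\<Delta>\<close> for \<open>\<Delta> > 0\<close> and \<open>\<i>\<surd>\<bar>\<Delta>\<bar>\<close> for \<open>\<Delta> < 0\<close>.
\<close>

definition quad_field :: "int \<Rightarrow> complex set" where
  "quad_field \<Delta> = {of_rat x + of_rat y * csqrt (of_int \<Delta>) | x y. True}"

definition quad_order :: "int \<Rightarrow> complex set" where
  "quad_order \<Delta> =
     {of_int x + of_int y * ((of_int \<Delta> + csqrt (of_int \<Delta>)) / 2) | x y. True}"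

definition fractional_ideal :: "int \<Rightarrow> complex set \<Rightarrow> bool" where
  "fractional_ideal \<Delta> I \<longleftrightarrow>
     I \<subseteq> quad_field \<Delta> \<and>
     0 \<in> I \<and> (\<forall>a\<in>I. \<forall>b\<in>I. a - b \<in> I) \<and>
     (\<forall>r\<in>quad_order \<Delta>. \<forall>a\<in>I. r * a \<in> I) \<and>
     (\<exists>d\<in>quad_order \<Delta>. d \<noteq> 0 \<and> (\<forall>a\<in>I. d * a \<in> quad_order \<Delta>))"

definition ideal_prod :: "complex set \<Rightarrow> complex set \<Rightarrow> complex set" where
  "ideal_prod I J = group_closure {a * b | a b. a \<in> I \<and> b \<in> J}"

definition invertible_ideals :: "int \<Rightarrow> complex set set" where
  "invertible_ideals \<Delta> =
     {I. fractional_ideal \<Delta> I \<and>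
         (\<exists>J. fractional_ideal \<Delta> J \<and> ideal_prod I J = quad_order \<Delta>)}"

text \<open>
  Wide equivalence: the scaling factor \<open>\<alpha>\<close> may have negative norm. The classes are the cosets of
  the principal fractional ideals in the group of invertible fractional ideals.
\<close>

definition ideal_equiv :: "int \<Rightarrow> (complex set \<times> complex set) set" where
  "ideal_equiv \<Delta> =
     {(I, J). I \<in> invertible_ideals \<Delta> \<and> J \<in> invertible_ideals \<Delta> \<and>
              (\<exists>\<alpha>\<in>quad_field \<Delta>. \<alpha> \<noteq> 0 \<and> J = (\<lambda>a. \<alpha> * a) ` I)}"

definition class_number :: "int \<Rightarrow> nat" where
  "class_number \<Delta> = card (invertible_ideals \<Delta> // ideal_equiv \<Delta>)"

text \<open>
  Regular continued fractions of irrational numbers; for rational arguments, where the expansion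
  terminates, the values below carry no meaning.
\<close>

fun cf_remainder :: "real \<Rightarrow> nat \<Rightarrow> real" where
  "cf_remainder \<xi> 0 = \<xi>"
| "cf_remainder \<xi> (Suc n) = 1 / frac (cf_remainder \<xi> n)"

definition cf_coeff :: "real \<Rightarrow> nat \<Rightarrow> int" where
  "cf_coeff \<xi> n = \<lfloor>cf_remainder \<xi> n\<rfloor>"

definition cf_periodic_from :: "real \<Rightarrow> nat \<Rightarrow> nat \<Rightarrow> bool" where
  "cf_periodic_from \<xi> k l \<longleftrightarrow> l > 0 \<and> (\<forall>i\<ge>k. cf_coeff \<xi> (i + l) = cf_coeff \<xi> i)"

definition cf_preperiod :: "real \<Rightarrow> nat" where
  "cf_preperiod \<xi> = (LEAST k. \<exists>l. cf_periodic_from \<xi> k l)"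

definition cf_period :: "real \<Rightarrow> nat" where
  "cf_period \<xi> = (LEAST l. cf_periodic_from \<xi> (cf_preperiod \<xi>) l)"

text \<open>
  The Hirzebruch sum. A longer pre-period would give the same value: for even period length,
  dropping the first term of the period and appending it at the end does not change its sign.
\<close>

definition hirzebruch_sum :: "real \<Rightarrow> int" where
  "hirzebruch_sum \<xi> =
     (let k = cf_preperiod \<xi>; l = cf_period \<xi>
      in if even l then (\<Sum>i<l. (-1) ^ (k + i) * cf_coeff \<xi> (k + i)) else 0)"

end

theory Submission
 imports Defs "HOL-Analysis.Analysis" "HOL-Real_Asymp.Real_Asymp"
  "HOL-Computational_Algebra.Polynomial" "HOL-Computational_Algebra.Nth_Powers"
begin

text \<open>In an order of discriminant \<open>-p\<close> the numbers of ideals of given norm are the coefficients of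
\<open>\<zeta>(s) L(s, \<chi>\<^sub>p)\<close>, and comparing the constant terms at \<open>s = 0\<close>, class by class and in total, gives
\<open>h(-p) = (w / 2) L(0, \<chi>\<^sub>p)\<close>. For \<open>D = p\<^sub>1 p\<^sub>2\<close> the same comparison with ideals weighted by the genus
character gives \<open>L(0, \<chi>\<^sub>1) L(0, \<chi>\<^sub>2)\<close> in total. The contribution of a single class is found by cutting
a fundamental domain of the units into unimodular cones: it is \<open>\<Psi> / 6\<close>, with the Rademacher function
\<open>\<Psi>\<close> of the matrix of the fundamental unit, that is, the number of letters \<open>T\<close> minus the number of
letters \<open>L\<close> of a word in \<open>T = (1, 1; 0, 1)\<close> and \<open>L = (1, 0; 1, 1)\<close>. For the principal class the word
is read off the continued fraction of \<open>\<omega>\<close>, so \<open>\<Psi>\<close> is the Hirzebruch sum.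

The value of \<open>\<Psi>\<close> modulo 24 is an explicit expression in the entries of the matrix and a Jacobi
symbol. It shows that \<open>\<Psi>\<close> has the same value modulo 8 on all classes and is divisible by 3 unless
\<open>3\<close> divides \<open>D\<close>. Conjugate classes have the same \<open>\<Psi>\<close> and only the principal class is its own
conjugate, which gains another factor 2.\<close>

text \<open>No function of s occurs: values at 0 are constant terms of sums of exp (- t N) as t
  tends to 0, and L(0, psi) is the finite sum \<open>char_L0\<close>. With trivial weights the real
  case gives nothing, since the two halves of a wide class, told apart by the genus character, have
  opposite constant terms; p1 = 3 mod 4 makes the character change sign under elements of negative
  norm.

  \<Psi> cannot be compared across classes directly, since the Jacobi symbols depend on the form. So
  a class is represented by a form (r, b) with r prime to 6 D u, where (t + u sqrt D) / 2 is the
  fundamental unit, and set against the principal form with the same b. In t^2 - 4 = D u^2 the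
  factor t + 2 is p1 or p2 times a square; this evaluates the symbols and also makes the ramified
  primes principal, hence no other class self-conjugate.

  The sum of \<Psi> over the classes is 6 L(0, \<chi>_1) L(0, \<chi>_2). It differs from h
  \<Psi>(\<omega>) by a multiple of 48, or of 16 if 3 divides D, where the six units of Q(sqrt (-3))
  bring a factor 3. Hence n = 6 and n = 2.\<close>

lemmas alg = algebra_simps
lemmas p2sq = power2_eq_square
lemmas sq_simps = p2sq alg
lemmas cong_mod = unique_euclidean_semiring_class.cong_def

subsection \<open>Constant terms of exponential sums\<close>

text \<open>Two mean value steps. They lose the factor 1/2 of the usual remainder, but only the
  order in \<open>h\<close> matters.\<close>

lemma taylor2_bound:
 fixes g :: "real => real"
 assumes "!!x. x >= u ==> (g has_real_derivative g1 x) (at x)"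
  and "!!x. x >= u ==> (g1 has_real_derivative g2 x) (at x)"
  and "!!x. x >= u ==> \<bar>g2 x\<bar> <= M"
  and "h >= 0"
 shows "\<bar>g (u + h) - g u - h * g1 u\<bar> <= M * h^2"
proof (cases "h = 0")
 case False
 hence h: "h > 0" using assms(4) by simp
 obtain z where z: "u < z" "z < u + h" "g (u + h) - g u = (u + h - u) * g1 z"
  using MVT2[of u "u + h" g g1] assms(1) h by auto
 obtain y where y: "u < y" "y < z" "g1 z - g1 u = (z - u) * g2 y"
  using MVT2[of u z g1 g2] assms(2) z by auto
 have "g (u + h) - g u - h * g1 u = h * (g1 z - g1 u)"
  using z(3) by (simp add: alg)
 also have "... = h * ((z - u) * g2 y)" by (simp only: y(3))
 finally have "\<bar>g (u + h) - g u - h * g1 u\<bar> = h * ((z - u) * \<bar>g2 y\<bar>)"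
  using h z by (simp add: abs_mult)
 also have "... <= h * (h * M)"
  using h z y assms(3)[of y] by (intro mult_left_mono mult_mono) auto
 finally show ?thesis by (simp add: p2sq mult_ac)
qed simp

lemma taylor3_bound:
 fixes g :: "real => real"
 assumes "!!x. x >= u ==> (g has_real_derivative g1 x) (at x)"
  and "!!x. x >= u ==> (g1 has_real_derivative g2 x) (at x)"
  and "!!x. x >= u ==> (g2 has_real_derivative g3 x) (at x)"
  and "!!x. x >= u ==> \<bar>g3 x\<bar> <= M"
  and "h >= 0"
 shows "\<bar>g (u + h) - g u - h * g1 u - h^2 / 2 * g2 u\<bar> <= M * h ^ 3"
proof (cases "h = 0")
 case False
 hence h: "h > 0" using assms(5) by simp
 \<comment> \<open>\<open>f1\<close> is the remainder of \<open>g1\<close> after its linear part, so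
   the second-order bound applies to it.\<close>
 define f where "f x = g x - (x - u) * g1 u - (x - u)^2 / 2 * g2 u" for x
 define f1 where "f1 x = g1 x - g1 u - (x - u) * g2 u" for x
 have f: "(f has_real_derivative f1 x) (at x)" if "x >= u" for x
  unfolding f_def f1_def by (rule derivative_eq_intros assms(1)[OF that] refl | simp)+
 obtain z where z: "u < z" "z < u + h" "f (u + h) - f u = (u + h - u) * f1 z"
  using MVT2[of u "u + h" f f1] f h by auto
 have "\<bar>g1 (u + (z - u)) - g1 u - (z - u) * g2 u\<bar> <= M * (z - u)^2"
  by (rule taylor2_bound[where ?g2.0 = g3]) (use assms z in auto)
 hence "\<bar>f1 z\<bar> <= M * (z - u)^2" by (simp add: f1_def)
 also have "... <= M * h^2"
  using z h assms(4)[of u] by (intro mult_left_mono power_mono) auto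
 finally have "h * \<bar>f1 z\<bar> <= h * (M * h^2)" using h by simp
 moreover have "g (u + h) - g u - h * g1 u - h^2 / 2 * g2 u = h * f1 z"
  using z(3) by (simp add: f_def)
 ultimately show ?thesis using h by (simp add: abs_mult power3_eq_cube p2sq mult_ac)
qed simp

section \<open>Sums weighted by a periodic function of mean zero\<close>

lemma exp_progression_sums:
 fixes s :: real
 assumes "s > 0"
 shows "(%n::nat. exp (- (s * real n))) sums (1 / (1 - exp (- s)))"
proof -
 have "exp (- (s * real n)) = exp (- s) ^ n" for n
  by (simp add: exp_of_nat_mult[symmetric] mult.commute)
 thus ?thesis using geometric_sums[of "exp (- s)"] assms by simp
qed

text \<open>The sum is cut into blocks of length \<open>p\<close>. On a block the difference \<open>g (u + r t) - g u\<close> is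
 replaced by \<open>r / p\<close> times the increment of \<open>g\<close> over the block, and these increments telescope.\<close>

lemma character_sum_limit:
 fixes psi :: "nat => real" and g :: "real => real"
 assumes p: "p > 0" and per: "!!n. psi (n + p) = psi n" and zero: "(\<Sum>r<p. psi r) = 0"
  and b: "!!n. \<bar>psi n\<bar> <= 1"
  and g1: "!!x. x >= 0 ==> (g has_real_derivative g1 x) (at x)"
  and g2: "!!x. x >= 0 ==> (g1 has_real_derivative g2 x) (at x)"
  and M: "!!x. x >= 0 ==> \<bar>g2 x\<bar> <= M * exp (- x)"
  and M0: "!!x. x >= 0 ==> \<bar>g x\<bar> <= M0 * exp (- x)"
 shows "((%t. \<Sum>d. psi d * g (real d * t)) \<longlongrightarrow> g 0 * - (\<Sum>r<p. real r * psi r) / real p) (at_right 0)"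
proof -
 have per': "psi (j * p + r) = psi r" for j r
  by (induction j) (use per in \<open>auto simp: add_ac, metis add.assoc add.commute\<close>)
 have Mn: "M >= 0" using M[of 0] by simp
 define A where "A = (\<Sum>r<p. real r * psi r) / real p"
 define S where "S t = (\<Sum>d. psi d * g (real d * t))" for t
 \<comment> \<open>A block costs t^2 times an exponential in its position; over all blocks this adds
   up to t^2 / (1 - exp (- p t)), which is of order t.\<close>
 have bound: "\<bar>S t - - A * g 0\<bar> <= 2 * M * real p ^ 3 * t^2 / (1 - exp (- (real p * t)))" if t: "t > 0" for t
 proof -
  have "summable (%d. psi d * g (real d * t))"
  proof (rule summable_comparison_test)
   show "EX N. \<forall>n\<ge>N. norm (psi n * g (real n * t)) <= M0 * exp (- (t * real n))"
   proof (intro exI[of _ 0] allI impI)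
    fix n
    have "\<bar>psi n\<bar> * \<bar>g (real n * t)\<bar> <= 1 * (M0 * exp (- (real n * t)))"
     using b[of n] M0[of "real n * t"] t by (intro mult_mono) auto
    thus "norm (psi n * g (real n * t)) <= M0 * exp (- (t * real n))"
     by (simp add: abs_mult mult_ac)
   qed
   show "summable (%n. M0 * exp (- (t * real n)))"
    using exp_progression_sums[OF t] by (intro summable_mult) (auto simp: sums_iff)
  qed
  hence "(%j. \<Sum>d\<in>{j*p..<j*p+p}. psi d * g (real d * t)) sums S t"
   unfolding S_def using sums_group[OF summable_sums p] by blast
  moreover have "(\<Sum>d\<in>{j*p..<j*p+p}. psi d * g (real d * t))
    = (\<Sum>r<p. psi r * g (real (j*p) * t + real r * t))" for j
   by (rule sum.reindex_bij_witness[of _ "%r. j*p + r" "%d. d - j*p"])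
    (use per' in \<open>auto simp: alg of_nat_diff\<close>, metis le_add_diff_inverse per')
  ultimately have s1: "(%j. \<Sum>r<p. psi r * g (real (j*p) * t + real r * t)) sums S t" by simp
  have lim: "(%j. g (real (j*p) * t)) \<longlonglongrightarrow> 0"
  proof (rule Lim_null_comparison)
   show "\<forall>\<^sub>F j in sequentially. norm (g (real (j*p) * t)) <= M0 * exp (- (real (j*p) * t))"
    using M0 t by (intro always_eventually) auto
   show "(%j. M0 * exp (- (real (j*p) * t))) \<longlonglongrightarrow> 0"
    using p t by real_asymp
  qed
  have s2: "(%j. A * (g (real (Suc j*p) * t) - g (real (j*p) * t))) sums (A * (0 - g (real (0*p) * t)))"
   using telescope_sums[OF lim] by (intro sums_mult)
  have e: "\<bar>(\<Sum>r<p. psi r * g (real (j*p) * t + real r * t)) - A * (g (real (Suc j*p) * t) - g (real (j*p) * t))\<bar>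
    <= 2 * M * real p ^ 3 * t^2 * exp (- (real p * t * real j))" for j
  proof -
   define u where "u = real (j*p) * t"
   have u: "u >= 0" "real (Suc j*p) * t = u + real p * t" "exp (- (real p * t * real j)) = exp (- u)"
    using t by (auto simp: u_def alg)
   define E where "E = M * exp (- u)"
   have E0: "E >= 0" using Mn by (simp add: E_def)
   have T: "\<bar>g (u + h) - g u - h * g1 u\<bar> <= E * h^2" if "h >= 0" for h
   proof (rule taylor2_bound[where ?g2.0 = g2])
    fix x assume "x >= u"
    hence "M * exp (- x) <= E" unfolding E_def using Mn by (intro mult_left_mono) auto
    thus "\<bar>g2 x\<bar> <= E" using M[of x] \<open>x >= u\<close> u by linarith
   qed (use g1 g2 u that in auto)
   define D where "D = g (u + real p * t) - g u"
   \<comment> \<open>Both \<open>g (u + r t)\<close> and \<open>g (u + p t)\<close> are replaced by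
     their linear parts at \<open>u\<close>; r / p times the second increment has the same linear
     part as the first, so only the two remainders survive.\<close>
   have each: "\<bar>g (u + real r * t) - g u - real r / real p * D\<bar> <= 2 * E * (real p * t)^2" if "r < p" for r
   proof -
    have "\<bar>real r / real p * (D - real p * t * g1 u)\<bar> <= 1 * (E * (real p * t)^2)"
     unfolding abs_mult using that T[of "real p * t"] t by (intro mult_mono) (auto simp: D_def)
    moreover have "\<bar>g (u + real r * t) - g u - real r * t * g1 u\<bar> <= E * (real r * t)^2"
     using T[of "real r * t"] t by simp
    moreover have "E * (real r * t)^2 <= E * (real p * t)^2"
     using that t E0 by (intro mult_left_mono power_mono mult_right_mono) auto
    ultimately have "\<bar>g (u + real r * t) - g u - real r * t * g1 u\<bar> + \<bar>real r / real p * (D - real p * t * g1 u)\<bar>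
      <= E * (real p * t)^2 + 1 * (E * (real p * t)^2)"
     by (intro add_mono) (erule order_trans)
    with abs_triangle_ineq4 have "\<bar>(g (u + real r * t) - g u - real r * t * g1 u) - real r / real p * (D - real p * t * g1 u)\<bar>
      <= E * (real p * t)^2 + 1 * (E * (real p * t)^2)"
     by (rule order_trans)
    moreover have "(g (u + real r * t) - g u - real r * t * g1 u) - real r / real p * (D - real p * t * g1 u)
      = g (u + real r * t) - g u - real r / real p * D"
     using p by (simp add: field_simps)
    ultimately show ?thesis by (simp only: mult_1_left mult_2[symmetric] mult.assoc)
   qed
   have "(\<Sum>r<p. psi r * g (u + real r * t)) - A * D
     = (\<Sum>r<p. psi r * (g (u + real r * t) - g u - real r / real p * D))"
   proof -
    have "(\<Sum>r<p. psi r * (g (u + real r * t) - g u - real r / real p * D))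
     = (\<Sum>r<p. psi r * g (u + real r * t)) - (\<Sum>r<p. psi r) * g u - A * D"
     unfolding A_def by (simp add: alg sum_subtractf sum.distrib sum_distrib_left sum_divide_distrib)
    thus ?thesis using zero by simp
   qed
   also have "\<bar>...\<bar> <= (\<Sum>r<p. 1 * (2 * E * (real p * t)^2))"
    by (rule sum_abs[THEN order_trans], rule sum_mono, unfold abs_mult, rule mult_mono)
     (use each b in auto)
   finally show ?thesis using u
    by (simp add: D_def u_def[symmetric] E_def p2sq power3_eq_cube mult_ac)
  qed
  have s3: "(%j. 2 * M * real p ^ 3 * t^2 * exp (- (real p * t * real j))) sums
    (2 * M * real p ^ 3 * t^2 * (1 / (1 - exp (- (real p * t)))))"
   using exp_progression_sums[of "real p * t"] p t by (intro sums_mult) auto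
  have "norm (\<Sum>j. (\<Sum>r<p. psi r * g (real (j*p) * t + real r * t)) - A * (g (real (Suc j*p) * t) - g (real (j*p) * t)))
    <= (\<Sum>j. 2 * M * real p ^ 3 * t^2 * exp (- (real p * t * real j)))"
   by (rule norm_suminf_le) (use e sums_summable[OF s3] in auto)
  hence "\<bar>S t - A * (0 - g (real (0*p) * t))\<bar> <= 2 * M * real p ^ 3 * t^2 * (1 / (1 - exp (- (real p * t))))"
   unfolding sums_unique[OF s3, symmetric] sums_unique[OF sums_diff[OF s1 s2], symmetric] real_norm_def .
  thus ?thesis by simp
 qed
 have "((%t. S t - - A * g 0) \<longlongrightarrow> 0) (at_right 0)"
 proof (rule Lim_null_comparison)
  show "\<forall>\<^sub>F t in at_right 0. norm (S t - - A * g 0) <= 2 * M * real p ^ 3 * t^2 / (1 - exp (- (real p * t)))"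
   using eventually_at_right_less[of 0] by eventually_elim (use bound in auto)
  show "((%t. 2 * M * real p ^ 3 * t^2 / (1 - exp (- (real p * t)))) \<longlongrightarrow> 0) (at_right 0)"
   using p by real_asymp
 qed
 hence "(S \<longlongrightarrow> - A * g 0) (at_right 0)" by (rule LIM_zero_cancel)
 thus ?thesis unfolding S_def[symmetric] by (simp add: A_def mult_ac)
qed

text \<open>A rational function of q = exp (- u). Such functions are closed under differentiation,
  and d/du = - q d/dq puts a factor q into the numerator, from which the exponential decay of the
  derivatives follows.\<close>

definition exp_quot :: "real poly => real poly => real => real" where
 "exp_quot N D u = poly N (exp (- u)) / poly D (exp (- u))"

definition exp_quot_deriv_num :: "real poly => real poly => real poly" where
 "exp_quot_deriv_num N D = [:0, 1:] * (N * pderiv D - pderiv N * D)"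

lemma exp_quot_has_derivative:
 assumes "poly D (exp (- u)) ~= 0"
 shows "(exp_quot N D has_real_derivative exp_quot (exp_quot_deriv_num N D) (D^2) u) (at u)"
 unfolding exp_quot_def exp_quot_deriv_num_def
 by (rule derivative_eq_intros poly_DERIV[THEN DERIV_chain2] assms refl | simp)+
  (use assms in \<open>simp add: field_simps p2sq\<close>)

lemma exp_quot_bound:
 assumes "!!q. 0 <= q ==> q <= 1 ==> poly D q ~= 0"
 shows "EX M. \<forall>u\<ge>0. \<bar>exp_quot ([:0, 1:] * N) D u\<bar> <= M * exp (- u)"
proof -
 have "continuous_on {0..1} (%q. poly N q / poly D q)"
  using assms by (intro continuous_intros) auto
 then obtain M where M: "!!q. q : {0..1} ==> norm (poly N q / poly D q) <= M"
  using compact_continuous_image[THEN compact_imp_bounded, of "{0..1}" "%q. poly N q / poly D q"]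
  unfolding bounded_iff by (metis compact_Icc image_eqI)
 have "\<bar>exp_quot ([:0, 1:] * N) D u\<bar> <= M * exp (- u)" if "u >= 0" for u
  using mult_right_mono[OF M[of "exp (- u)"], of "exp (- u)"] that by (simp add: exp_quot_def abs_mult mult_ac)
 thus ?thesis by blast
qed

lemma character_sum_exp_quot_limit:
 fixes psi :: "nat => real"
 assumes "p > 0" and "!!n. psi (n + p) = psi n" and "(\<Sum>r<p. psi r) = 0" and "!!n. \<bar>psi n\<bar> <= 1"
  and D: "!!q. 0 <= q ==> q <= 1 ==> poly D q ~= 0" and N: "poly N 0 = 0"
 shows "((%t. \<Sum>d. psi d * exp_quot N D (real d * t)) \<longlongrightarrow>
  poly N 1 / poly D 1 * - (\<Sum>r<p. real r * psi r) / real p) (at_right 0)"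
proof -
 have pos: "poly D (exp (- u)) ~= 0" if "u >= 0" for u using D that by simp
 have pos2: "poly (D ^ k) (exp (- u)) ~= 0" if "u >= 0" for u k using pos[OF that] by (simp add: poly_power)
 obtain N' where N': "N = [:0, 1:] * N'"
  using N by (metis poly_eq_0_iff_dvd dvdE minus_zero)
 obtain M0 where M0: "!!u. u >= 0 ==> \<bar>exp_quot N D u\<bar> <= M0 * exp (- u)"
  using exp_quot_bound[of D N', OF D] N' by blast
 define N1 where "N1 = exp_quot_deriv_num N D"
 have "EX M. \<forall>u\<ge>0. \<bar>exp_quot (exp_quot_deriv_num N1 (D^2)) ((D^2)^2) u\<bar> <= M * exp (- u)"
  unfolding exp_quot_deriv_num_def by (rule exp_quot_bound) (use D in \<open>simp add: poly_power\<close>)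
 then obtain M where M: "!!u. u >= 0 ==> \<bar>exp_quot (exp_quot_deriv_num N1 (D^2)) ((D^2)^2) u\<bar> <= M * exp (- u)"
  by blast
 have "((%t. \<Sum>d. psi d * exp_quot N D (real d * t)) \<longlongrightarrow>
  exp_quot N D 0 * - (\<Sum>r<p. real r * psi r) / real p) (at_right 0)"
 proof (rule character_sum_limit[OF assms(1-4)])
  show "(exp_quot N D has_real_derivative exp_quot N1 (D^2) x) (at x)" if "x >= 0" for x
   unfolding N1_def by (rule exp_quot_has_derivative[OF pos[OF that]])
  show "(exp_quot N1 (D^2) has_real_derivative exp_quot (exp_quot_deriv_num N1 (D^2)) ((D^2)^2) x) (at x)"
   if "x >= 0" for x
   by (rule exp_quot_has_derivative[OF pos2[OF that]])
 qed (use M0 M in auto)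
 thus ?thesis by (simp add: exp_quot_def)
qed

text \<open>\<open>has_asym_const Z k\<close> says that the constant term of \<open>Z t\<close> for \<open>t \<rightarrow> 0\<close> is \<open>k\<close>: the combination
 \<open>4 Z (4 t) - Z t\<close> removes a term of the form \<open>c / t\<close> and multiplies a constant by \<open>3\<close>.\<close>

definition asym_const :: "(real => real) => real => bool" where
 "asym_const Z k \<longleftrightarrow> ((%t. 4 * Z (4 * t) - Z t) \<longlongrightarrow> 3 * k) (at_right 0)"

lemma asym_const_add:
 "asym_const Z k ==> asym_const Z' k' ==> asym_const (%t. Z t + Z' t) (k + k')"
 unfolding asym_const_def
 by (drule (1) tendsto_add) (simp add: alg)

lemma asym_const_diff:
 "asym_const Z k ==> asym_const Z' k' ==> asym_const (%t. Z t - Z' t) (k - k')"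
 unfolding asym_const_def
 by (drule (1) tendsto_diff) (simp add: alg)

lemma asym_const_cmult: "asym_const Z k ==> asym_const (%t. c * Z t) (c * k)"
 unfolding asym_const_def by (drule tendsto_mult_left[of _ _ _ c]) (simp add: alg)

lemma asym_const_const: "asym_const (%_. k) k"
 by (simp add: asym_const_def)

lemma asym_const_sum:
 "finite A ==> (!!x. x : A ==> asym_const (Z x) (k x)) ==> asym_const (%t. \<Sum>x\<in>A. Z x t) (\<Sum>x\<in>A. k x)"
 by (induction A rule: finite_induct) (use asym_const_const[of 0] in \<open>auto intro: asym_const_add\<close>)

lemma asym_const_cong:
 assumes "asym_const Z k" and "!!t. t > 0 ==> Z t = Z' t"
 shows "asym_const Z' k"
proof -
 have "((%t. 4 * Z' (4 * t) - Z' t) \<longlongrightarrow> 3 * k) (at_right 0) \<longleftrightarrow> ((%t. 4 * Z (4 * t) - Z t) \<longlongrightarrow> 3 * k) (at_right 0)"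
  by (intro filterlim_cong refl eventually_mono[OF eventually_at_right_less[of 0]]) (use assms(2) in auto)
 thus ?thesis using assms(1) by (simp add: asym_const_def)
qed

lemma asym_const_unique: "asym_const Z k ==> asym_const Z k' ==> k = k'"
 unfolding asym_const_def using tendsto_unique[of "at_right (0::real)"] by fastforce

lemma asym_const_limit:
 assumes "(Z \<longlongrightarrow> k) (at_right 0)"
 shows "asym_const Z k"
proof -
 have "((%t. Z (4 * t)) \<longlongrightarrow> k) (at_right 0)"
  by (rule filterlim_compose[OF assms]) real_asymp
 from tendsto_diff[OF tendsto_mult_left[OF this, of 4] assms] show ?thesis
  by (simp add: asym_const_def)
qed

section \<open>Trapezoidal sums of quadratic exponentials over a quadrant\<close>

definition trap :: "(nat => real) => real" where "trap u = (\<Sum>n. u n) - u 0 / 2"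
definition trap_even :: "(nat => real) => real" where "trap_even u = trap (%n. u (2 * n))"
text \<open>This is the alternating sum of \<open>u\<close> with its first term halved. The half
  weight of \<open>trap\<close> at the end point removes the boundary term u(0) / 2 of the
  Euler-Maclaurin expansion and lets adjacent cones share a boundary ray equally.\<close>

definition alt_sum :: "(nat => real) => real" where "alt_sum u = 2 * trap_even u - trap u"

lemma exp_bound_sum:
 fixes u :: "nat => real"
 assumes "s > 0" and "!!n. \<bar>u n\<bar> <= K * exp (- (s * real n))"
 shows "summable u" and "\<bar>suminf u\<bar> <= K / (1 - exp (- s))"
proof -
 have s: "(%n. K * exp (- (s * real n))) sums (K * (1 / (1 - exp (- s))))"
  using exp_progression_sums[OF assms(1)] by (rule sums_mult)
 show "summable u"
  by (rule summable_comparison_test'[of "%n. K * exp (- (s * real n))" 0]) (use s assms(2) in \<open>auto simp: sums_iff\<close>)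
 show "\<bar>suminf u\<bar> <= K / (1 - exp (- s))"
  using norm_suminf_le[of u "%n. K * exp (- (s * real n))"] s assms(2) by (auto simp: sums_iff)
qed

lemma exp_bound_infsum:
 fixes u :: "nat => real"
 assumes "s > 0" and "!!n. \<bar>u n\<bar> <= K * exp (- (s * real n))"
 shows "infsum u UNIV = suminf u"
proof (rule infsumI, rule norm_summable_imp_has_sum)
 show "summable (%n. norm (u n))"
  by (rule exp_bound_sum(1)[OF assms(1), of _ K]) (use assms(2) in simp)
 show "u sums suminf u" by (rule summable_sums[OF exp_bound_sum(1)[OF assms]])
qed

lemma exp_bound_nonneg:
 fixes v :: real
 assumes "\<bar>v\<bar> <= K * exp w"
 shows "K >= 0"
 using assms abs_ge_zero[of v] by (smt (verit) exp_gt_zero mult_neg_pos)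

lemma exp_bound_dilate:
 fixes u :: "nat => real"
 assumes "s > 0" and "!!n. \<bar>u n\<bar> <= K * exp (- (s * real n))"
 shows "\<bar>u (2 * n)\<bar> <= K * exp (- (s * real n))" and "\<bar>u (2 * n + 1)\<bar> <= K * exp (- (s * real n))"
proof -
 have K: "K >= 0" using exp_bound_nonneg[OF assms(2)] .
 have "K * exp (- (s * real (2 * n))) <= K * exp (- (s * real n))"
  "K * exp (- (s * real (2 * n + 1))) <= K * exp (- (s * real n))"
  using assms(1) K by (auto intro!: mult_left_mono)
 thus "\<bar>u (2 * n)\<bar> <= K * exp (- (s * real n))" "\<bar>u (2 * n + 1)\<bar> <= K * exp (- (s * real n))"
  using assms(2)[of "2*n"] assms(2)[of "2*n+1"] by linarith+
qed

lemma trap_bound: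
 assumes "s > 0" and "!!n. \<bar>u n\<bar> <= K * exp (- (s * real n))"
 shows "\<bar>trap u\<bar> <= 2 * K / (1 - exp (- s))"
proof -
 have K: "K >= 0" using exp_bound_nonneg[OF assms(2)] .
 have "K <= K / (1 - exp (- s))"
  using assms(1) K by (simp add: field_simps mult_left_le)
 moreover have "\<bar>u 0\<bar> <= K" using assms(2)[of 0] by simp
 ultimately show ?thesis using exp_bound_sum(2)[OF assms] K unfolding trap_def by simp
qed

lemma trap_add: "summable u ==> summable v ==> trap (%n. u n + v n) = trap u + trap v"
 by (simp add: trap_def suminf_add[symmetric] add_divide_distrib)

lemma trap_diff: "summable u ==> summable v ==> trap (%n. u n - v n) = trap u - trap v"
 by (simp add: trap_def suminf_diff[symmetric] diff_divide_distrib)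

lemma trap_cmult: "summable u ==> trap (%n. c * u n) = c * trap u"
 by (simp add: trap_def suminf_mult alg)

text \<open>Sharing each even term between its two neighbours turns the alternating sum into a sum
  of halved second differences, which Taylor's formula controls.\<close>

lemma alt_sum_sums:
 assumes "s > 0" and "!!n. \<bar>u n\<bar> <= K * exp (- (s * real n))"
 shows "(%n. u (2*n) / 2 - u (2*n+1) + u (2*n+2) / 2) sums alt_sum u"
proof -
 have su: "summable u" by (rule exp_bound_sum(1)[OF assms])
 have g: "(%n. u (2*n) + u (2*n+1)) sums suminf u"
  using sums_group[OF summable_sums[OF su], of 2] by (simp add: mult.commute)
 have e: "summable (%n. u (2*n))" "summable (%n. u (2 * n + 1))"
  by (rule exp_bound_sum(1)[OF assms(1)], rule exp_bound_dilate[OF assms])+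
 have e2: "(%n. u (2*n+2)) sums ((\<Sum>n. u (2*n)) - u 0)"
  using sums_Suc_imp[of "%n. u (2 * n)"] summable_sums[OF e(1)] sums_Suc_iff[of "%n. u (2 * n)"]
  by (simp add: alg)
 have "(%n. u (2*n) / 2 - u (2*n+1) + u (2*n+2) / 2) sums
   ((\<Sum>n. u (2*n)) / 2 - (\<Sum>n. u (2*n+1)) + ((\<Sum>n. u (2*n)) - u 0) / 2)"
  by (intro sums_add sums_diff sums_divide summable_sums e e2)
 moreover have "suminf u = (\<Sum>n. u (2*n)) + (\<Sum>n. u (2*n+1))"
  using g sums_add[OF summable_sums[OF e(1)] summable_sums[OF e(2)]] sums_unique2 by blast
 ultimately show ?thesis
  by (simp add: alt_sum_def trap_even_def trap_def field_simps)
qed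

lemma exp_bound_alt_sum:
 assumes "s > 0" and "!!n. \<bar>u n\<bar> <= K * exp (- (s * real n))"
 shows "\<bar>alt_sum u\<bar> <= 6 * K / (1 - exp (- s))"
 using trap_bound[OF assms] trap_bound[OF assms(1) exp_bound_dilate(1)[OF assms]]
 unfolding alt_sum_def trap_even_def by (simp add: abs_if split: if_splits)

lemma double_exp_bound:
 fixes f :: "nat => nat => real"
 assumes "s > 0" and "!!x y. \<bar>f x y\<bar> <= K * exp (- (s * (real x + real y)))"
 shows "(%(x, y). f x y) summable_on UNIV"
  and "(\<Sum>x. \<Sum>y. f x y) = infsum (%(x, y). f x y) UNIV"
  and "(\<Sum>x. \<Sum>y. f x y) = (\<Sum>y. \<Sum>x. f x y)"
proof -
 have K: "K >= 0" using exp_bound_nonneg[OF assms(2)] .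
 have one: "((%n::nat. c * exp (- (s * real n))) has_sum (c * (1 / (1 - exp (- s))))) UNIV" for c
  by (rule has_sum_cmult_right) (rule sums_nonneg_imp_has_sum[OF exp_progression_sums[OF assms(1)]], simp)
 have sK: "(%(x, y). K * exp (- (s * (real x + real y)))) summable_on (UNIV \<times> UNIV)"
  by (rule summable_on_SigmaI[where g = "%x. K * exp (- (s * real x)) * (1 / (1 - exp (- s)))"])
   (use one[of "K * exp (- (s * real x))" for x] one[of "K * (1 / (1 - exp (- s)))"] K in
    \<open>auto simp: summable_on_def exp_add[symmetric] alg exp_diff has_sum_imp_summable\<close>)
 show S: "(%(x, y). f x y) summable_on UNIV"
  by (rule abs_summable_summable, rule Infinite_Sum.abs_summable_on_comparison_test'[OF sK[simplified]]) (use assms(2) in auto)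
 have rows: "\<bar>f x y\<bar> <= K * exp (- (s * real x)) * exp (- (s * real y))" for x y
  using assms(2)[of x y] by (simp add: exp_add[symmetric] alg)
 have r: "infsum (f x) UNIV = suminf (f x)" for x
  by (rule exp_bound_infsum[OF assms(1) rows])
 have cols: "\<bar>f x y\<bar> <= K * exp (- (s * real y)) * exp (- (s * real x))" for x y
  using rows[of x y] by (simp add: mult_ac)
 have c: "infsum (%x. f x y) UNIV = suminf (%x. f x y)" for y
  by (rule exp_bound_infsum[OF assms(1) cols])
 have rr: "\<bar>suminf (f x)\<bar> <= K / (1 - exp (- s)) * exp (- (s * real x))" for x
  using exp_bound_sum(2)[OF assms(1) rows, of x] by simp
 have cc: "\<bar>suminf (%x. f x y)\<bar> <= K / (1 - exp (- s)) * exp (- (s * real y))" for y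
  using exp_bound_sum(2)[OF assms(1) cols, of y] by simp
 have R: "infsum (%x. suminf (f x)) UNIV = (\<Sum>x. suminf (f x))"
  by (rule exp_bound_infsum[OF assms(1) rr])
 have C: "infsum (%y. suminf (%x. f x y)) UNIV = (\<Sum>y. suminf (%x. f x y))"
  by (rule exp_bound_infsum[OF assms(1) cc])
 show I: "(\<Sum>x. \<Sum>y. f x y) = infsum (%(x, y). f x y) UNIV"
  using infsum_Sigma'_banach[of f UNIV "%_. UNIV"] S by (simp add: r R)
 show "(\<Sum>x. \<Sum>y. f x y) = (\<Sum>y. \<Sum>x. f x y)"
  using infsum_swap_banach[of f UNIV UNIV] S by (simp add: r c R C)
qed

lemma trap_swap:
 fixes f :: "nat => nat => real"
 assumes "s > 0" and b: "!!x y. \<bar>f x y\<bar> <= K * exp (- (s * (real x + real y)))"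
 shows "trap (%x. trap (f x)) = trap (%y. trap (%x. f x y))"
  and "trap (%x. trap (f x)) = infsum (%(x, y). f x y) UNIV - (\<Sum>x. f x 0) / 2 - (\<Sum>y. f 0 y) / 2 + f 0 0 / 4"
proof -
 have rows: "\<bar>f x y\<bar> <= K * exp (- (s * real x)) * exp (- (s * real y))" for x y
  using b[of x y] by (simp add: exp_add[symmetric] alg)
 have cols: "\<bar>f x y\<bar> <= K * exp (- (s * real y)) * exp (- (s * real x))" for x y
  using rows[of x y] by (simp add: mult_ac)
 have rr: "summable (%x. suminf (f x))"
  by (rule exp_bound_sum(1)[OF assms(1), of _ "K / (1 - exp (- s))"])
   (use exp_bound_sum(2)[OF assms(1) rows] in simp)
 have cc: "summable (%y. suminf (%x. f x y))"
  by (rule exp_bound_sum(1)[OF assms(1), of _ "K / (1 - exp (- s))"])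
   (use exp_bound_sum(2)[OF assms(1) cols] in simp)
 have r: "summable (f x)" and c: "summable (%x. f x y)" for x y
  using exp_bound_sum(1)[OF assms(1) rows] exp_bound_sum(1)[OF assms(1) cols] by auto
 have "(\<Sum>x. suminf (f x) - f x 0 / 2) = (\<Sum>x. suminf (f x)) - (\<Sum>x. f x 0) / 2"
  using suminf_diff[OF rr summable_divide[OF c]] suminf_divide[OF c] by simp
 hence 1: "trap (%x. trap (f x)) = (\<Sum>x. suminf (f x)) - (\<Sum>x. f x 0) / 2 - (\<Sum>y. f 0 y) / 2 + f 0 0 / 4"
  by (simp add: trap_def diff_divide_distrib)
 have "(\<Sum>y. suminf (%x. f x y) - f 0 y / 2) = (\<Sum>y. suminf (%x. f x y)) - (\<Sum>y. f 0 y) / 2"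
  using suminf_diff[OF cc summable_divide[OF r]] suminf_divide[OF r] by simp
 hence 2: "trap (%y. trap (%x. f x y)) = (\<Sum>y. suminf (%x. f x y)) - (\<Sum>x. f x 0) / 2 - (\<Sum>y. f 0 y) / 2 + f 0 0 / 4"
  by (simp add: trap_def diff_divide_distrib)
 show "trap (%x. trap (f x)) = trap (%y. trap (%x. f x y))"
  using 1 2 double_exp_bound(3)[OF assms] by simp
 show "trap (%x. trap (f x)) = infsum (%(x, y). f x y) UNIV - (\<Sum>x. f x 0) / 2 - (\<Sum>y. f 0 y) / 2 + f 0 0 / 4"
  using 1 double_exp_bound(2)[OF assms] by simp
qed

text \<open>The polynomial costs a factor exp z, and 2 z - c z^2 <= 1 / c recovers exp (- z). The 27
  comes from (z / 3)^3 <= (1 + z / 3)^3 <= exp z.\<close>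

lemma poly_exp_decay:
 fixes c :: real
 assumes c: "c > 0" and z: "z >= 0" and a: "a >= 0" "b >= 0" "d >= 0"
 shows "(a + b * z + d * z ^ 3) * exp (- (c * z^2)) <= (a + b + 27 * d) * exp (1 / c) * exp (- z)"
proof -
 have e: "1 <= exp z" "z <= exp z" using z exp_ge_add_one_self[of z] by linarith+
 have "(z / 3) ^ 3 <= (1 + z / 3) ^ 3" using z by (intro power_mono) auto
 also have "... <= exp z" using exp_ge_one_plus_x_over_n_power_n[of 3 z] z by simp
 finally have "z ^ 3 <= 27 * exp z" by (simp add: power_divide)
 hence "a + b * z + d * z ^ 3 <= a * exp z + b * exp z + d * (27 * exp z)"
  using e a mult_left_mono[OF e(1) a(1)] by (intro add_mono mult_left_mono) auto
 hence "(a + b * z + d * z ^ 3) * exp (- (c * z^2)) <= ((a + b + 27 * d) * exp z) * exp (- (c * z^2))"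
  by (intro mult_right_mono) (auto simp: alg)
 also have "... = (a + b + 27 * d) * exp (2 * z - c * z^2) * exp (- z)"
  by (simp add: exp_add[symmetric] exp_diff exp_minus field_simps)
 also have "... <= (a + b + 27 * d) * exp (1 / c) * exp (- z)"
 proof -
  have "0 <= (c * z - 1)^2 / c" using c by simp
  hence "2 * z - c * z^2 <= 1 / c" using c by (simp add: p2sq field_simps)
  thus ?thesis using a by (intro mult_right_mono mult_left_mono) auto
 qed
 finally show ?thesis .
qed

text \<open>A Riemann sum for the integral of y exp (- a y^2) over y >= 0. The integrand is - 1 / (2
  a) times the derivative of \<open>E\<close>, so the sum is compared with the telescoping sum of
  the increments of \<open>E\<close>.\<close>

lemma gaussian_first_moment_limit:
 fixes a :: real
 assumes a: "a > 0"
 shows "((%s. \<Sum>n. s\<^sup>2 * real n * exp (- (a * (s * real n)^2))) \<longlongrightarrow> 1 / (2 * a)) (at_right 0)"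
proof -
 define E where "E y = exp (- (a * y^2))" for y
 define E1 where "E1 y = - 2 * a * y * E y" for y
 define E2 where "E2 y = (4 * a^2 * y^2 - 2 * a) * E y" for y
 have dE: "(E has_real_derivative E1 y) (at y)" for y
  unfolding E_def E1_def by (rule derivative_eq_intros refl | simp)+
 have dE1: "(E1 has_real_derivative E2 y) (at y)" for y
  unfolding E1_def E2_def by (rule derivative_eq_intros dE refl | simp)+
   (simp add: E1_def sq_simps)
 define K where "K = (4 * a^2 + 2 * a + 0 + 27 * (4 * a^2)) * exp (1 / a)"
 have K: "\<bar>E2 y\<bar> <= K * exp (- y)" if y: "y >= 0" for y
 proof -
  \<comment> \<open>Trades the quadratic term for a cubic one, the shape that
    \<open>poly_exp_decay\<close> accepts.\<close>
  have "y^2 <= 1 + y ^ 3"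
  proof (cases "y <= 1")
   case True
   hence "y^2 <= 1" using y by (simp add: power_le_one)
   moreover have "y ^ 3 >= 0" using y by simp
   ultimately show ?thesis by linarith
  next
   case False
   hence "y^2 <= y ^ 3" by (intro power_increasing) auto
   thus ?thesis by simp
  qed
  hence "4 * a^2 * y^2 <= 4 * a^2 * (1 + y ^ 3)" using a by (intro mult_left_mono) auto
  moreover have "0 <= 4 * a^2 * y^2" by simp
  ultimately have "\<bar>4 * a^2 * y^2 - 2 * a\<bar> <= 4 * a^2 * (1 + y ^ 3) + 2 * a"
   using a by linarith
  also have "... = (4 * a^2 + 2 * a) + 0 * y + 4 * a^2 * y ^ 3" by (simp add: alg)
  finally have "\<bar>4 * a^2 * y^2 - 2 * a\<bar> <= (4 * a^2 + 2 * a) + 0 * y + 4 * a^2 * y ^ 3" .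
  hence "\<bar>E2 y\<bar> <= ((4 * a^2 + 2 * a) + 0 * y + 4 * a^2 * y ^ 3) * exp (- (a * y^2))"
   unfolding E2_def E_def abs_mult by (intro mult_mono) auto
  also have "... <= K * exp (- y)"
   using poly_exp_decay[OF a y, of "4 * a^2 + 2 * a" 0 "4 * a^2"] a by (simp add: K_def)
  finally show ?thesis .
 qed
 have K0: "K >= 0" using K[of 0] by simp
 have bound: "\<bar>- 1 + 2 * a * (\<Sum>n. s\<^sup>2 * real n * E (s * real n))\<bar> <= K * s^2 / (1 - exp (- s))"
  if s: "s > 0" for s
 proof -
  have "(%n. E (s * real n)) \<longlonglongrightarrow> 0" unfolding E_def using a s by real_asymp
  from telescope_sums[OF this] have t: "(%n. E (s * real (Suc n)) - E (s * real n)) sums (- 1)"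
   by (simp add: E_def)
  have e: "\<bar>E (s * real (Suc n)) - E (s * real n) - s * E1 (s * real n)\<bar> <= K * s^2 * exp (- (s * real n))" for n
  proof -
   have "\<bar>E (s * real n + s) - E (s * real n) - s * E1 (s * real n)\<bar> <= (K * exp (- (s * real n))) * s^2"
   proof (rule taylor2_bound[where ?g2.0 = E2])
    fix x assume x: "s * real n <= x"
    hence "K * exp (- x) <= K * exp (- (s * real n))" using K0 by (intro mult_left_mono) auto
    moreover have "x >= 0" using x s by (meson less_imp_le mult_nonneg_nonneg of_nat_0_le_iff order_trans)
    ultimately show "\<bar>E2 x\<bar> <= K * exp (- (s * real n))" using K[of x] by linarith
   qed (use dE dE1 s in auto)
   thus ?thesis by (simp add: alg)
  qed
  note d = exp_bound_sum[OF s e]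
  from summable_diff[OF sums_summable[OF t] d(1)] have sE1: "summable (%n. s * E1 (s * real n))" by simp
  have "suminf (%n. s * E1 (s * real n)) = (\<Sum>n. (- 2 * a) * (s^2 * real n * E (s * real n)))"
   by (simp add: E1_def p2sq mult_ac)
  also have "... = - 2 * a * (\<Sum>n. s\<^sup>2 * real n * E (s * real n))"
  proof (rule suminf_mult)
   have "summable (%n. (- 1 / (2 * a)) * (s * E1 (s * real n)))" by (rule summable_mult[OF sE1])
   thus "summable (%n. s\<^sup>2 * real n * E (s * real n))"
    using a by (simp add: E1_def p2sq mult_ac)
  qed
  finally have "(\<Sum>n. E (s * real (Suc n)) - E (s * real n) - s * E1 (s * real n))
    = - 1 + 2 * a * (\<Sum>n. s\<^sup>2 * real n * E (s * real n))"
   using suminf_diff[OF sums_summable[OF t] sE1] sums_unique[OF t] by simp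
  with d(2) show ?thesis by simp
 qed
 have "((%s. - 1 + 2 * a * (\<Sum>n. s\<^sup>2 * real n * E (s * real n))) \<longlongrightarrow> 0) (at_right 0)"
 proof (rule Lim_null_comparison)
  show "\<forall>\<^sub>F s in at_right 0. norm (- 1 + 2 * a * (\<Sum>n. s\<^sup>2 * real n * E (s * real n))) <= K * s^2 / (1 - exp (- s))"
   using eventually_at_right_less[of 0] by eventually_elim (use bound in auto)
  show "((%s. K * s^2 / (1 - exp (- s))) \<longlongrightarrow> 0) (at_right 0)" by real_asymp
 qed
 from tendsto_mult_left[OF tendsto_add[OF this tendsto_const[of 1]], of "1 / (2 * a)"]
 show ?thesis using a by (simp add: E_def)
qed

definition quad_exp :: "real => real => real => real => nat => nat => real" where
 "quad_exp A B C t x y = exp (- (t * (A * real x ^ 2 + B * real x * real y + C * real y ^ 2)))"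

text \<open>Positivity is asked for on the closed quadrant only: in the real case the forms are
  indefinite.\<close>

definition quadrant_pos :: "real => real => real => bool" where
 "quadrant_pos A B C \<longleftrightarrow> (EX c>0. \<forall>x\<ge>0. \<forall>y\<ge>0. c * (x + y)^2 <= A * x^2 + B * x * y + C * y^2)"

lemma quadrant_pos_swap: "quadrant_pos A B C ==> quadrant_pos C B A"
 unfolding quadrant_pos_def
proof (elim exE conjE)
 fix c :: real assume c: "c > 0" "\<forall>x\<ge>0. \<forall>y\<ge>0. c * (x + y)^2 <= A * x^2 + B * x * y + C * y^2"
 have "c * (x + y)^2 <= C * x^2 + B * x * y + A * y^2" if "x >= 0" "y >= 0" for x y
  using c(2)[rule_format, OF that(2,1)] by (simp add: alg)
 with c(1) show "EX c>0. \<forall>x\<ge>0. \<forall>y\<ge>0. c * (x + y)^2 <= C * x^2 + B * x * y + A * y^2"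
  by blast
qed

lemma quadrant_pos_nonneg:
 assumes "A > 0" "B >= 0" "C > 0"
 shows "quadrant_pos A B C"
 unfolding quadrant_pos_def
proof (intro exI[of _ "min A C / 2"] conjI allI impI)
 fix x y :: real assume xy: "x >= 0" "y >= 0"
 have "min A C / 2 * (x + y)^2 <= min A C / 2 * (2 * x^2 + 2 * y^2)"
  using sum_squares_ge_zero[of "x - y" 0] assms by (intro mult_left_mono) (auto simp: sq_simps)
 also have "... = min A C * x^2 + min A C * y^2" by (simp add: alg)
 also have "... <= A * x^2 + C * y^2" by (intro add_mono mult_right_mono) auto
 also have "... <= A * x^2 + B * x * y + C * y^2" using assms xy by simp
 finally show "min A C / 2 * (x + y)^2 <= A * x^2 + B * x * y + C * y^2" .
qed (use assms in auto)

lemma quad_exp_bound: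
 assumes "quadrant_pos A B C" and "t > 0"
 shows "EX K s. s > 0 & (ALL x y. \<bar>quad_exp A B C t x y\<bar> <= K * exp (- (s * (real x + real y))))"
proof -
 obtain c where c: "c > 0" "!!x y. x >= 0 ==> y >= 0 ==> c * (x + y)^2 <= A * x^2 + B * x * y + C * y^2"
  using assms(1) unfolding quadrant_pos_def by auto
 have "\<bar>quad_exp A B C t x y\<bar> <= 1 * exp (- (t * c * (real x + real y)))" for x y
 proof -
  have "real x + real y <= (real x + real y)^2"
  proof (cases "x + y = 0")
   case False
   hence "1 <= real x + real y" by linarith
   from mult_left_mono[OF this, of "real x + real y"] show ?thesis by (simp add: p2sq)
  qed auto
  from mult_left_mono[OF this, of c] have "c * (real x + real y) <= c * (real x + real y)^2" using c(1) by simp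
  also have "... <= A * real x ^ 2 + B * real x * real y + C * real y ^ 2" using c(2)[of "real x" "real y"] by simp
  finally have "t * (c * (real x + real y)) <= t * (A * real x ^ 2 + B * real x * real y + C * real y ^ 2)"
   using assms(2) by (intro mult_left_mono) auto
  thus ?thesis by (simp add: quad_exp_def mult_ac)
 qed
 thus ?thesis using c assms by (intro exI[of _ 1] exI[of _ "t * c"]) auto
qed

text \<open>For fixed x the alternating sum over y consists of halved second differences of
  \<open>G\<close> with step s. Each is about s^2 / 2 times the second derivative, that is, s / 4
  times the increment of \<open>G1\<close> over a step 2 s. These increments telescope to - s / 4
  times \<open>G1 0\<close>, the boundary term in the statement.\<close>

lemma quad_exp_alt_sum_bound:
 assumes "quadrant_pos A B C"
 shows "EX K. ALL s>0. ALL x. \<bar>alt_sum (quad_exp A B C (s^2) x) - s / 4 * (B * (s * real x)) * exp (- (A * (s * real x)^2))\<bar>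
  <= K * s ^ 3 / (1 - exp (- (2 * s))) * exp (- (s * real x))"
proof -
 obtain c where c: "c > 0" "!!x y. x >= 0 ==> y >= 0 ==> c * (x + y)^2 <= A * x^2 + B * x * y + C * y^2"
  using assms(1) unfolding quadrant_pos_def by auto
 define k where "k = \<bar>B\<bar> + 2 * \<bar>C\<bar>"
 define Kb where "Kb = (0 + 6 * \<bar>C\<bar> * k + 27 * k ^ 3) * exp (1 / c)"
 have k0: "k >= 0" and Kb0: "Kb >= 0" by (auto simp: k_def Kb_def)
 have main: "\<bar>alt_sum (quad_exp A B C (s^2) x) - s / 4 * (B * (s * real x)) * exp (- (A * (s * real x)^2))\<bar>
  <= 6 * Kb * s ^ 3 / (1 - exp (- (2 * s))) * exp (- (s * real x))" if s: "s > 0" for s x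
 proof -
  define X where "X = s * real x"
  have X: "X >= 0" using s by (simp add: X_def)
  define G where "G y = exp (- (A * X^2 + B * X * y + C * y^2))" for y
  define l where "l y = B * X + 2 * C * y" for y
  define G1 where "G1 y = - l y * G y" for y
  define G2 where "G2 y = ((l y)^2 - 2 * C) * G y" for y
  define G3 where "G3 y = (6 * C * l y - (l y) ^ 3) * G y" for y
  have dG: "(G has_real_derivative G1 y) (at y)" for y
   unfolding G_def G1_def l_def by (rule derivative_eq_intros refl | simp)+
  have dG1: "(G1 has_real_derivative G2 y) (at y)" for y
   unfolding G1_def G2_def l_def by (rule derivative_eq_intros dG refl | simp)+
    (simp add: G1_def l_def sq_simps)
  have dG2: "(G2 has_real_derivative G3 y) (at y)" for y
   unfolding G2_def G3_def l_def by (rule derivative_eq_intros dG refl | simp)+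
    (simp add: G1_def l_def p2sq power3_eq_cube alg)
  have b3: "\<bar>G3 y\<bar> <= Kb * exp (- (X + y))" if y: "y >= 0" for y
  proof -
   define z where "z = X + y"
   have z: "z >= 0" using X y by (simp add: z_def)
   have "\<bar>l y\<bar> <= \<bar>B\<bar> * X + 2 * \<bar>C\<bar> * y"
    unfolding l_def using X y by (intro order_trans[OF abs_triangle_ineq]) (simp add: abs_mult)
   also have "... <= \<bar>B\<bar> * z + 2 * \<bar>C\<bar> * z" using X y by (intro add_mono mult_left_mono) (auto simp: z_def)
   finally have l: "\<bar>l y\<bar> <= k * z" by (simp add: k_def alg)
   have "\<bar>6 * C * l y - (l y) ^ 3\<bar> <= 6 * \<bar>C\<bar> * \<bar>l y\<bar> + \<bar>l y\<bar> ^ 3"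
    by (intro order_trans[OF abs_triangle_ineq4]) (simp add: abs_mult power_abs)
   also have "... <= 6 * \<bar>C\<bar> * (k * z) + (k * z) ^ 3"
    using l by (intro add_mono mult_left_mono power_mono) auto
   finally have 1: "\<bar>6 * C * l y - (l y) ^ 3\<bar> <= 0 + (6 * \<bar>C\<bar> * k) * z + k ^ 3 * z ^ 3"
    by (simp add: power_mult_distrib)
   have 2: "G y <= exp (- (c * z^2))" using c(2)[OF X y] by (simp add: G_def z_def)
   have "\<bar>G3 y\<bar> = \<bar>6 * C * l y - (l y) ^ 3\<bar> * G y" by (simp add: G3_def abs_mult G_def)
   also have "... <= (0 + (6 * \<bar>C\<bar> * k) * z + k ^ 3 * z ^ 3) * exp (- (c * z^2))"
    using 1 2 k0 z by (intro mult_mono) (auto simp: G_def)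
   also have "... <= Kb * exp (- z)" unfolding Kb_def using k0 by (intro poly_exp_decay[OF c(1) z]) auto
   finally show ?thesis by (simp add: z_def)
  qed
  have u: "quad_exp A B C (s^2) x n = G (s * real n)" for n
   by (simp add: quad_exp_def G_def X_def sq_simps)
  obtain K' s' where K': "s' > 0" "!!x y. \<bar>quad_exp A B C (s^2) x y\<bar> <= K' * exp (- (s' * (real x + real y)))"
   using quad_exp_bound[OF assms, of "s^2"] s by auto
  have K'': "\<bar>quad_exp A B C (s^2) x y\<bar> <= K' * exp (- (s' * real x)) * exp (- (s' * real y))" for y
   using K'(2)[of x y] by (simp add: exp_add[symmetric] alg)
  note a = alt_sum_sums[OF K'(1) K'', unfolded u]
  have lim: "(%n. G1 (2 * s * real n)) \<longlonglongrightarrow> 0"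
  proof -
   have "C > 0" using c(2)[of 0 1] c(1) by simp
   thus ?thesis unfolding G1_def l_def G_def using s by real_asymp
  qed
  have t: "(%n. s / 4 * (G1 (2 * s * real (Suc n)) - G1 (2 * s * real n))) sums (s / 4 * (0 - G1 (2 * s * real 0)))"
   using telescope_sums[OF lim] by (rule sums_mult)
  have e: "\<bar>(G (s * real (2*n)) / 2 - G (s * real (2*n+1)) + G (s * real (2*n+2)) / 2) -
    s / 4 * (G1 (2 * s * real (Suc n)) - G1 (2 * s * real n))\<bar>
    <= 6 * Kb * s ^ 3 * exp (- X) * exp (- (2 * s * real n))" for n
  proof -
   define v where "v = 2 * s * real n"
   define M where "M = Kb * exp (- (X + v))"
   have v: "v >= 0" using s by (simp add: v_def)
   have M: "\<bar>G3 y\<bar> <= M" if "y >= v" for y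
   proof -
    have "Kb * exp (- (X + y)) <= M" unfolding M_def using that Kb0 by (intro mult_left_mono) auto
    thus ?thesis using b3[of y] v that by linarith
   qed
   \<comment> \<open>Three Taylor remainders; the Taylor polynomials cancel in the combination
     \<open>e2 / 2 - e1 - s / 4 * e3\<close> below.\<close>
   define e1 where "e1 = G (v + s) - G v - s * G1 v - s^2 / 2 * G2 v"
   define e2 where "e2 = G (v + 2 * s) - G v - 2 * s * G1 v - (2 * s)^2 / 2 * G2 v"
   define e3 where "e3 = G1 (v + 2 * s) - G1 v - 2 * s * G2 v"
   have 1: "\<bar>e1\<bar> <= M * s ^ 3" unfolding e1_def by (rule taylor3_bound[where ?g3.0 = G3]) (use dG dG1 dG2 M s in auto)
   have 2: "\<bar>e2\<bar> <= M * (2 * s) ^ 3" unfolding e2_def by (rule taylor3_bound[where ?g3.0 = G3]) (use dG dG1 dG2 M s in auto)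
   have 3: "\<bar>e3\<bar> <= M * (2 * s)^2" unfolding e3_def by (rule taylor2_bound[where ?g2.0 = G3]) (use dG dG1 dG2 M s in auto)
   have 3: "\<bar>s / 4 * e3\<bar> <= s / 4 * (M * (2 * s)^2)" unfolding abs_mult using s 3 by (intro mult_mono) auto
   have pts: "s * real (2*n) = v" "s * real (2*n+1) = v + s" "s * real (2*n+2) = v + 2 * s"
    "2 * s * real (Suc n) = v + 2 * s" "2 * s * real n = v"
    by (simp_all add: v_def alg)
   have "(G (s * real (2*n)) / 2 - G (s * real (2*n+1)) + G (s * real (2*n+2)) / 2) -
    s / 4 * (G1 (2 * s * real (Suc n)) - G1 (2 * s * real n)) = e2 / 2 - e1 - s / 4 * e3"
    unfolding pts e1_def e2_def e3_def by (simp add: field_simps p2sq)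
   also have "\<bar>...\<bar> <= \<bar>e2\<bar> / 2 + \<bar>e1\<bar> + \<bar>s / 4 * e3\<bar>" by linarith
   also have "... <= M * (2 * s) ^ 3 / 2 + M * s ^ 3 + s / 4 * (M * (2 * s)^2)"
    using 1 2 3 by (intro add_mono divide_right_mono) auto
   \<comment> \<open>6 = 8/2 + 1 + 4/4, from the remainders at 2 s, at s and of the
     derivative.\<close>
   also have "... = 6 * Kb * s ^ 3 * exp (- X) * exp (- (2 * s * real n))"
    by (simp add: M_def v_def exp_diff exp_minus field_simps p2sq power3_eq_cube exp_add)
   finally show ?thesis .
  qed
  have "\<bar>alt_sum (%n. G (s * real n)) - s / 4 * (0 - G1 (2 * s * real 0))\<bar> <= 6 * Kb * s ^ 3 * exp (- X) / (1 - exp (- (2 * s)))"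
   using exp_bound_sum(2)[OF _ e] s sums_unique[OF sums_diff[OF a t]] by simp
  thus ?thesis by (simp add: u[abs_def] G1_def l_def G_def X_def mult_ac)
 qed
 thus ?thesis by blast
qed

text \<open>Summed over x, the boundary terms form B / 4 times a Riemann sum for the first Gaussian
  moment 1 / (2 A). The errors add up to the order s.\<close>

lemma trap_alt_sum_limit:
 assumes pos: "quadrant_pos A B C"
 shows "((%s. trap (%x. alt_sum (quad_exp A B C (s^2) x))) \<longlongrightarrow> B / (8 * A)) (at_right 0)"
proof -
 obtain K where K: "!!s x. s > 0 ==> \<bar>alt_sum (quad_exp A B C (s^2) x) - s / 4 * (B * (s * real x)) * exp (- (A * (s * real x)^2))\<bar>
  <= K * s ^ 3 / (1 - exp (- (2 * s))) * exp (- (s * real x))"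
  using quad_exp_alt_sum_bound[OF pos] by blast
 have A: "A > 0" using pos unfolding quadrant_pos_def by (force dest: spec[of _ 1] spec[of _ 0])
 define V where "V s n = s^2 * real n * exp (- (A * (s * real n)^2))" for s :: real and n :: nat
 have V: "\<bar>trap (%x. alt_sum (quad_exp A B C (s^2) x)) - B / 4 * (\<Sum>n. V s n)\<bar> <=
   2 * (K * s ^ 3 / (1 - exp (- (2 * s)))) / (1 - exp (- s))" if s: "s > 0" for s
 proof -
  have sV: "summable (V s)"
  proof (rule exp_bound_sum(1)[OF s])
   fix n
   have "\<bar>V s n\<bar> = s * ((0 + 1 * (s * real n) + 0 * (s * real n) ^ 3) * exp (- (A * (s * real n)^2)))"
    using s by (simp add: V_def abs_mult p2sq)
   also have "... <= s * ((0 + 1 + 27 * 0) * exp (1 / A) * exp (- (s * real n)))"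
    using s A by (intro mult_left_mono poly_exp_decay) auto
   finally show "\<bar>V s n\<bar> <= s * exp (1 / A) * exp (- (s * real n))" by (simp add: mult_ac)
  qed
  have eq: "s / 4 * (B * (s * real x)) * exp (- (A * (s * real x)^2)) = B / 4 * V s x" for x
   by (simp add: V_def p2sq)
  note d = K[OF s, unfolded eq]
  have "summable (%x. (alt_sum (quad_exp A B C (s^2) x) - B / 4 * V s x) + B / 4 * V s x)"
   by (intro summable_add summable_mult sV exp_bound_sum(1)[OF s d])
  hence sa: "summable (%x. alt_sum (quad_exp A B C (s^2) x))" by simp
  have "trap (%n. B / 4 * V s n) = B / 4 * (\<Sum>n. V s n)"
   using trap_cmult[OF sV, of "B / 4"] trap_def[of "V s"] V_def[of s 0] by simp
  hence "trap (%x. alt_sum (quad_exp A B C (s^2) x) - B / 4 * V s x) =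
   trap (%x. alt_sum (quad_exp A B C (s^2) x)) - B / 4 * (\<Sum>n. V s n)"
   using trap_diff[OF sa summable_mult[OF sV, of "B / 4"]] by (simp only:)
  thus ?thesis using trap_bound[OF s d] by simp
 qed
 have "((%s. trap (%x. alt_sum (quad_exp A B C (s^2) x)) - B / 4 * (\<Sum>n. V s n)) \<longlongrightarrow> 0) (at_right 0)"
 proof (rule Lim_null_comparison)
  show "\<forall>\<^sub>F s in at_right 0. norm (trap (%x. alt_sum (quad_exp A B C (s^2) x)) - B / 4 * (\<Sum>n. V s n)) <=
   2 * (K * s ^ 3 / (1 - exp (- (2 * s)))) / (1 - exp (- s))"
   using eventually_at_right_less[of 0] by eventually_elim (use V in auto)
  show "((%s. 2 * (K * s ^ 3 / (1 - exp (- (2 * s)))) / (1 - exp (- s))) \<longlongrightarrow> 0) (at_right 0)" by real_asymp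
 qed
 from tendsto_add[OF this tendsto_mult_left[OF gaussian_first_moment_limit[OF A], of "B / 4"]]
 show ?thesis by (simp add: V_def)
qed

definition quad_trap :: "real => real => real => real => real" where
 "quad_trap A B C t = trap (%x. trap (quad_exp A B C t x))"

lemma quad_trap_eq:
 assumes "quadrant_pos A B C" and "t > 0"
 shows "quad_trap A B C t = infsum (%(x, y). quad_exp A B C t x y) UNIV
   - (\<Sum>x. exp (- (t * (A * real x ^ 2)))) / 2 - (\<Sum>y. exp (- (t * (C * real y ^ 2)))) / 2 + 1 / 4"
  and "(%(x, y). quad_exp A B C t x y) summable_on UNIV"
proof -
 obtain K s where K: "s > 0" "!!x y. \<bar>quad_exp A B C t x y\<bar> <= K * exp (- (s * (real x + real y)))"
  using quad_exp_bound[OF assms] by auto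
 show "quad_trap A B C t = infsum (%(x, y). quad_exp A B C t x y) UNIV
   - (\<Sum>x. exp (- (t * (A * real x ^ 2)))) / 2 - (\<Sum>y. exp (- (t * (C * real y ^ 2)))) / 2 + 1 / 4"
 proof -
  have "quad_exp A B C t x 0 = exp (- (t * (A * real x ^ 2)))"
   "quad_exp A B C t 0 y = exp (- (t * (C * real y ^ 2)))" for x y
   by (simp_all add: quad_exp_def)
  hence "(%x. quad_exp A B C t x 0) = (%x. exp (- (t * (A * real x ^ 2))))"
   "quad_exp A B C t 0 = (%y. exp (- (t * (C * real y ^ 2))))" by blast+
  moreover have "quad_exp A B C t 0 0 = 1" by (simp add: quad_exp_def)
  ultimately show ?thesis unfolding quad_trap_def trap_swap(2)[OF K] by simp
 qed
 show "(%(x, y). quad_exp A B C t x y) summable_on UNIV"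
  by (rule double_exp_bound(1)[OF K])
qed

text \<open>With \<open>t = s\<^sup>2\<close>, passing from \<open>t\<close> to \<open>4 t\<close> means summing over even arguments. Hence the combination
 \<open>4 W (4 t) - W t\<close> contains an alternating sum in one of the variables, which is governed by the
 first derivative at the boundary.\<close>

theorem quad_trap_asym_const:
 assumes pos: "quadrant_pos A B C"
 shows "asym_const (quad_trap A B C) (B * (1 / A + 1 / C) / 24)"
proof -
 define F where "F s = quad_exp A B C (s^2)" for s
 \<comment> \<open>Restricting x to even values turns the form into 4 A x^2 + 2 B x y + C
   y^2.\<close>
 have pos2: "quadrant_pos (4 * A) (2 * B) C"
  unfolding quadrant_pos_def
 proof -
  obtain c where c: "c > 0" "!!x y. x >= 0 ==> y >= 0 ==> c * (x + y)^2 <= A * x^2 + B * x * y + C * y^2"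
   using pos unfolding quadrant_pos_def by auto
  show "EX c>0. \<forall>x\<ge>0. \<forall>y\<ge>0. c * (x + y)^2 <= 4 * A * x^2 + 2 * B * x * y + C * y^2"
  proof (intro exI[of _ c] conjI allI impI)
   fix x y :: real assume xy: "x >= 0" "y >= 0"
   have "c * (x + y)^2 <= c * (2 * x + y)^2" using xy c(1) by (intro mult_left_mono power_mono) auto
   also have "... <= A * (2 * x)^2 + B * (2 * x) * y + C * y^2" using c(2)[of "2 * x" y] xy by simp
   finally show "c * (x + y)^2 <= 4 * A * x^2 + 2 * B * x * y + C * y^2" by (simp add: p2sq)
  qed (use c in auto)
 qed
 have dil: "quad_exp (4 * A) (2 * B) C (s^2) x y = F s (2 * x) y" for s x y
  by (simp add: F_def quad_exp_def p2sq)
 hence dil': "quad_exp (4 * A) (2 * B) C (s^2) x = F s (2 * x)" for s x by blast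
 have sw: "quad_exp C B A (s^2) y x = F s x y" for s x y
  by (simp add: F_def quad_exp_def alg)
 hence sw': "quad_exp C B A (s^2) y = (%x. F s x y)" for s y by blast
 have l1: "((%s. 2 * trap_even (%x. alt_sum (F s x))) \<longlongrightarrow> 2 * (2 * B / (8 * (4 * A)))) (at_right 0)"
  using tendsto_mult_left[OF trap_alt_sum_limit[OF pos2], of 2] by (simp add: dil' trap_even_def)
 have l2: "((%s. trap (%y. alt_sum (%x. F s x y))) \<longlongrightarrow> B / (8 * C)) (at_right 0)"
  using trap_alt_sum_limit[OF quadrant_pos_swap[OF pos]] by (simp add: sw')
 \<comment> \<open>Write T for the trapezoidal sum, E for the one over even arguments and Alt = 2 E
   - T, with the variable as index. Then 4 E_x E_y - T_x T_y = 2 E_x Alt_y + T_y Alt_x.\<close>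
 have split: "4 * quad_trap A B C (4 * s^2) - quad_trap A B C (s^2)
   = 2 * trap_even (%x. alt_sum (F s x)) + trap (%y. alt_sum (%x. F s x y))" if s: "s > 0" for s
 proof -
  obtain K r where K: "r > 0" "!!x y. \<bar>F s x y\<bar> <= K * exp (- (r * (real x + real y)))"
   using quad_exp_bound[OF pos, of "s^2"] s unfolding F_def by auto
  have K0: "K >= 0" using exp_bound_nonneg[OF K(2)] .
  have rows: "\<bar>F s x y\<bar> <= (K * exp (- (r * real x))) * exp (- (r * real y))" for x y
   using K(2)[of x y] by (simp add: exp_add[symmetric] alg)
  have cols: "\<bar>F s x y\<bar> <= (K * exp (- (r * real y))) * exp (- (r * real x))" for x y
   using rows[of x y] by (simp add: mult_ac)
  have Ke: "\<bar>F s (2 * x) y\<bar> <= K * exp (- (r * (real x + real y)))" for x y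
  proof -
   have "K * exp (- (r * (real (2*x) + real y))) <= K * exp (- (r * (real x + real y)))"
    using K0 K(1) by (intro mult_left_mono) auto
   thus ?thesis using K(2)[of "2*x" y] by linarith
  qed
  have quad: "quad_trap A B C (4 * s^2) = trap_even (%x. trap_even (F s x))"
  proof -
   have "quad_exp A B C (4 * s^2) x y = F s (2 * x) (2 * y)" for x y
    by (simp add: F_def quad_exp_def sq_simps)
   hence "quad_exp A B C (4 * s^2) x = (%y. F s (2 * x) (2 * y))" for x by blast
   thus ?thesis by (simp add: quad_trap_def trap_even_def)
  qed
  have st: "summable (%x. trap (F s x))" and sa: "summable (%x. alt_sum (F s x))"
   and st': "summable (%x. trap (F s (2*x)))" and sa': "summable (%x. alt_sum (F s (2*x)))"
  proof -
   have t: "\<bar>trap (F s x)\<bar> <= 2 * K / (1 - exp (- r)) * exp (- (r * real x))" for x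
    using trap_bound[OF K(1) rows, of x] by (simp add: mult_ac)
   have a: "\<bar>alt_sum (F s x)\<bar> <= 6 * K / (1 - exp (- r)) * exp (- (r * real x))" for x
    using exp_bound_alt_sum[OF K(1) rows, of x] by (simp add: mult_ac)
   show "summable (%x. trap (F s x))" "summable (%x. alt_sum (F s x))"
    by (rule exp_bound_sum(1)[OF K(1) t] exp_bound_sum(1)[OF K(1) a])+
   show "summable (%x. trap (F s (2*x)))" "summable (%x. alt_sum (F s (2*x)))"
    by (rule exp_bound_sum(1)[OF K(1) exp_bound_dilate(1)[OF K(1) t]]
      exp_bound_sum(1)[OF K(1) exp_bound_dilate(1)[OF K(1) a]])+
  qed
  have sc: "summable (%y. trap (%x. F s x y))" and sc2: "summable (%y. trap (%x. F s (2*x) y))"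
  proof -
   have t: "\<bar>trap (%x. F s x y)\<bar> <= 2 * K / (1 - exp (- r)) * exp (- (r * real y))" for y
    using trap_bound[OF K(1) cols, of y] by (simp add: mult_ac)
   have t2: "\<bar>trap (%x. F s (2*x) y)\<bar> <= 2 * K / (1 - exp (- r)) * exp (- (r * real y))" for y
    using trap_bound[OF K(1) exp_bound_dilate(1)[OF K(1) cols], of y] by (simp add: mult_ac)
   show "summable (%y. trap (%x. F s x y))" "summable (%y. trap (%x. F s (2*x) y))"
    by (rule exp_bound_sum(1)[OF K(1) t] exp_bound_sum(1)[OF K(1) t2])+
  qed
  have "trap (%y. alt_sum (%x. F s x y)) = 2 * trap (%y. trap (%x. F s (2*x) y)) - trap (%y. trap (%x. F s x y))"
   using trap_diff[OF summable_mult[OF sc2, of 2] sc] trap_cmult[OF sc2, of 2] by (simp add: alt_sum_def trap_even_def)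
  also have "... = 2 * trap_even (%x. trap (F s x)) - trap (%x. trap (F s x))"
   using trap_swap(1)[OF K] trap_swap(1)[OF K(1) Ke] by (simp add: trap_even_def)
  finally have 1: "trap (%y. alt_sum (%x. F s x y)) = 2 * trap_even (%x. trap (F s x)) - trap (%x. trap (F s x))" .
  have "trap_even (%x. trap_even (F s x)) = trap_even (%x. (1 / 2) * (alt_sum (F s x) + trap (F s x)))"
   by (simp add: alt_sum_def)
  also have "... = 1 / 2 * (trap_even (%x. alt_sum (F s x)) + trap_even (%x. trap (F s x)))"
   unfolding trap_even_def using trap_cmult[OF summable_add[OF sa' st'], of "1/2"] trap_add[OF sa' st'] by simp
  finally have 2: "trap_even (%x. trap_even (F s x)) = 1 / 2 * (trap_even (%x. alt_sum (F s x)) + trap_even (%x. trap (F s x)))" .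
  show ?thesis unfolding quad 2 1 by (simp add: quad_trap_def F_def[symmetric])
 qed
 have "((%s. 4 * quad_trap A B C (4 * s^2) - quad_trap A B C (s^2)) \<longlongrightarrow> 2 * (2 * B / (8 * (4 * A))) + B / (8 * C)) (at_right 0)"
 proof (rule Lim_transform_eventually[OF tendsto_add[OF l1 l2]])
  show "\<forall>\<^sub>F s in at_right 0. 2 * trap_even (%x. alt_sum (F s x)) + trap (%y. alt_sum (%x. F s x y)) =
    4 * quad_trap A B C (4 * s^2) - quad_trap A B C (s^2)"
   using eventually_at_right_less[of 0] by eventually_elim (use split in auto)
 qed
 moreover have "filterlim sqrt (at_right 0) (at_right 0)" by real_asymp
 ultimately have lim: "((%t. 4 * quad_trap A B C (4 * (sqrt t)^2) - quad_trap A B C ((sqrt t)^2)) \<longlongrightarrow> 2 * (2 * B / (8 * (4 * A))) + B / (8 * C)) (at_right 0)"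
  by (rule filterlim_compose)
 have "((%t. 4 * quad_trap A B C (4 * t) - quad_trap A B C t) \<longlongrightarrow> 2 * (2 * B / (8 * (4 * A))) + B / (8 * C)) (at_right 0)"
 proof (rule Lim_transform_eventually[OF lim])
  show "\<forall>\<^sub>F t in at_right 0. 4 * quad_trap A B C (4 * (sqrt t)^2) - quad_trap A B C ((sqrt t)^2) =
    4 * quad_trap A B C (4 * t) - quad_trap A B C t"
   using eventually_at_right_less[of 0] by eventually_elim auto
 qed
 moreover have "2 * (2 * B / (8 * (4 * A))) + B / (8 * C) = 3 * (B * (1 / A + 1 / C) / 24)"
  by (simp add: field_simps)
 ultimately show ?thesis unfolding asym_const_def by (simp only:)
qed

section \<open>Periodic characters and their L-values at 0\<close>

lemma pderiv_sum_poly: "pderiv (\<Sum>i\<in>A. f i) = (\<Sum>i\<in>A. pderiv (f i))"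
 by (induction A rule: infinite_finite_induct) (auto simp: pderiv_add)

text \<open>Minus the generalised Bernoulli number B_{1,psi}, the value at 0 of the L-series of a
  function as in \<open>periodic_char\<close>.\<close>

definition char_L0 :: "nat => (nat => int) => real" where
 "char_L0 p psi = - (\<Sum>r<p. real r * of_int (psi r)) / real p"

locale periodic_char =
 fixes p :: nat and psi :: "nat => int"
 assumes p_pos: "p > 0" and periodic: "!!n. psi (n + p) = psi n" and sum_zero: "(\<Sum>r<p. psi r) = 0"
  and abs_le_1: "!!n. \<bar>psi n\<bar> <= 1" and zero: "psi 0 = 0"
begin

lemma exp_quot_limit:
 assumes "!!q. 0 <= q ==> q <= 1 ==> poly D q ~= 0" and "poly N 0 = 0"
 shows "((%t. \<Sum>d. of_int (psi d) * exp_quot N D (real d * t)) \<longlongrightarrow> poly N 1 / poly D 1 * char_L0 p psi) (at_right 0)"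
proof -
 have "(\<Sum>r<p. real_of_int (psi r)) = 0" using sum_zero by (simp flip: of_int_sum)
 moreover have "\<bar>real_of_int (psi n)\<bar> <= 1" for n using abs_le_1[of n] by (simp flip: of_int_abs)
 ultimately show ?thesis
  using character_sum_exp_quot_limit[of p "%n. of_int (psi n)", OF p_pos _ _ _ assms] periodic
  by (simp add: char_L0_def)
qed

definition geom_poly :: "real poly" where "geom_poly = (\<Sum>r<p. Polynomial.monom 1 r)"
definition char_poly :: "real poly" where "char_poly = (\<Sum>r<p. Polynomial.monom (of_int (psi r)) r)"

lemma poly_geom_poly: "poly geom_poly q = (\<Sum>r<p. q ^ r)"
 by (simp add: geom_poly_def poly_sum poly_monom)

lemma geom_poly_pos: "0 <= q ==> poly geom_poly q > 0"
proof -
 assume q: "0 <= q"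
 have "(\<Sum>r\<in>{0}. q ^ r) <= (\<Sum>r<p. q ^ r)" using p_pos q by (intro sum_mono2) auto
 thus ?thesis by (simp add: poly_geom_poly)
qed

text \<open>The zero at q = 1, which comes from \<open>sum_zero\<close>, will cancel a factor of 1 -
  q^p. The value of the cofactor at 1 is minus the derivative of \<open>char_poly\<close>, hence p
  times the L-value.\<close>

lemma char_poly_eq: "EX N. char_poly = [:1, -1:] * N & poly N 0 = 0 & poly N 1 = real p * char_L0 p psi"
proof -
 have "poly char_poly 1 = 0" using sum_zero by (simp add: char_poly_def poly_sum poly_monom flip: of_int_sum)
 then obtain M where M: "char_poly = [:-1, 1:] * M" by (metis poly_eq_0_iff_dvd dvdE minus_equation_iff)
 define N where "N = - M"
 have N: "char_poly = [:1, -1:] * N" by (simp add: M N_def)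
 have "poly char_poly 0 = 0" using zero p_pos by (simp add: char_poly_def poly_sum poly_monom power_0_left if_distrib cong: if_cong)
 hence 0: "poly N 0 = 0" by (simp add: N)
 have "poly (pderiv char_poly) 1 = (\<Sum>r<p. real r * of_int (psi r))"
  by (simp add: char_poly_def pderiv_sum_poly poly_sum pderiv_monom poly_monom mult.commute)
 moreover have "poly (pderiv char_poly) 1 = - poly N 1" unfolding N pderiv_mult by (simp add: pderiv_pCons)
 ultimately show ?thesis using N 0 p_pos by (intro exI[of _ N]) (simp add: char_L0_def)
qed

lemma char_power_series:
 assumes q: "0 <= q" "q < 1"
 shows "(%e. of_int (psi e) * q ^ e) sums (poly char_poly q / (1 - q ^ p))"
proof -
 have per: "psi (j * p + r) = psi r" for j r
  by (induction j) (use periodic in \<open>auto simp: add_ac, metis add.assoc add.commute\<close>)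
 have s: "summable (%e. of_int (psi e) * q ^ e)"
 proof (rule summable_comparison_test'[of "%e. q ^ e" 0])
  show "norm (of_int (psi e) * q ^ e) <= q ^ e" for e
   using abs_le_1[of e] q mult_right_mono[of "\<bar>real_of_int (psi e)\<bar>" 1 "q ^ e"]
   by (simp add: abs_mult flip: of_int_abs)
 qed (use q in simp)
 have "(%j. \<Sum>e\<in>{j*p..<j*p+p}. of_int (psi e) * q ^ e) sums (\<Sum>e. of_int (psi e) * q ^ e)"
  by (rule sums_group[OF summable_sums[OF s] p_pos])
 moreover have "(\<Sum>e\<in>{j*p..<j*p+p}. of_int (psi e) * q ^ e) = poly char_poly q * (q ^ p) ^ j" for j
 proof -
  have "(\<Sum>e\<in>{j*p..<j*p+p}. of_int (psi e) * q ^ e) = (\<Sum>r<p. of_int (psi (j*p+r)) * q ^ (j*p+r))"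
   by (rule sum.reindex_bij_witness[of _ "%r. j*p + r" "%d. d - j*p"]) auto
  also have "... = (\<Sum>r<p. of_int (psi r) * q ^ r) * (q ^ p) ^ j"
   by (simp add: per power_add sum_distrib_left sum_distrib_right mult_ac flip: power_mult)
  finally show ?thesis by (simp add: char_poly_def poly_sum poly_monom)
 qed
 ultimately have "(%j. poly char_poly q * (q ^ p) ^ j) sums (\<Sum>e. of_int (psi e) * q ^ e)" by simp
 moreover have "(%j. poly char_poly q * (q ^ p) ^ j) sums (poly char_poly q * (1 / (1 - q ^ p)))"
  using q p_pos power_Suc_less_one[of q "p - 1"] by (intro sums_mult geometric_sums) (cases "q = 0", auto simp: power_0_left)
 ultimately show ?thesis using summable_sums[OF s] sums_unique2 by fastforce
qed

end

lemma hyperbola_exp_bound: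
 assumes "t > 0"
 shows "exp (- (real (Suc d * Suc e) * t)) <= 1 * exp (- (t * (real d + real e)))"
proof -
 have "t * (real d + real e) <= t * (real (Suc d) * real (Suc e))"
  using assms by (intro mult_left_mono) (auto simp: alg)
 hence "t * (real d + real e) <= real (Suc d * Suc e) * t" by (simp only: of_nat_mult mult_ac)
 thus ?thesis by (simp only: mult_1_left exp_le_cancel_iff neg_le_iff_le)
qed

lemma double_char_sum_summable:
 assumes "!!d. \<bar>psi d\<bar> <= (1::int)" "!!d. \<bar>psi' d\<bar> <= (1::int)" "t > 0"
 shows "\<bar>of_int (psi (Suc d)) * of_int (psi' (Suc e)) * exp (- (real (Suc d * Suc e) * t))\<bar> <= 1 * exp (- (t * (real d + real e)))"
proof -
 have "\<bar>real_of_int (psi (Suc d)) * of_int (psi' (Suc e))\<bar> <= 1 * 1"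
  unfolding abs_mult using assms(1,2) by (intro mult_mono) (simp_all flip: of_int_abs)
 hence "\<bar>of_int (psi (Suc d)) * of_int (psi' (Suc e)) * exp (- (real (Suc d * Suc e) * t))\<bar> <= 1 * exp (- (real (Suc d * Suc e) * t))"
  unfolding abs_mult[of _ "exp _"] by (intro mult_mono) auto
 with hyperbola_exp_bound[OF assms(3), of d e] show ?thesis by linarith
qed

text \<open>The Dirichlet series of the convolution has no pole, so \<open>t \<rightarrow> 0\<close> picks out the product of
 the values at \<open>0\<close>.\<close>

theorem double_char_sum_limit:
 assumes "periodic_char p psi" "periodic_char p' psi'"
 shows "((%t. infsum (%(d, e). of_int (psi (Suc d)) * of_int (psi' (Suc e)) * exp (- (real (Suc d * Suc e) * t))) UNIV)
  \<longlongrightarrow> char_L0 p psi * char_L0 p' psi') (at_right 0)"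
proof -
 interpret A: periodic_char p psi by fact
 interpret B: periodic_char p' psi' by fact
 obtain N where N: "B.char_poly = [:1, -1:] * N" "poly N 0 = 0" "poly N 1 = real p' * char_L0 p' psi'"
  using B.char_poly_eq by blast
 \<comment> \<open>For fixed d the sum over e is a rational function of exp (- d t), whose value for
   d t = 0 is \<open>char_L0 p' psi'\<close>. So \<open>exp_quot_limit\<close> takes care of the
   outer sum.\<close>
 have inner: "(\<Sum>e. of_int (psi' (Suc e)) * exp (- (real (d * Suc e) * t))) = exp_quot N B.geom_poly (real d * t)"
  if "t > 0" "d > 0" for t d
 proof -
  define q where "q = exp (- (real d * t))"
  have q: "0 < q" "q < 1" using that by (auto simp: q_def)
  have "q ^ e = exp (- (real (d * e) * t))" for e
   by (simp add: q_def exp_of_nat_mult[symmetric] mult_ac)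
  hence s: "(%e. of_int (psi' e) * exp (- (real (d * e) * t))) sums (poly B.char_poly q / (1 - q ^ p'))"
   using B.char_power_series[of q] q by simp
  from s have "(\<Sum>e. of_int (psi' (Suc e)) * exp (- (real (d * Suc e) * t))) = poly B.char_poly q / (1 - q ^ p')"
   using suminf_split_initial_segment[of "%e. of_int (psi' e) * exp (- (real (d * e) * t))" 1] B.zero
   by (simp add: sums_iff)
  also have "1 - q ^ p' = (1 - q) * poly B.geom_poly q"
   by (simp add: B.poly_geom_poly one_diff_power_eq)
  also have "poly B.char_poly q / ((1 - q) * poly B.geom_poly q) = exp_quot N B.geom_poly (real d * t)"
  proof -
   have "poly B.char_poly q = (1 - q) * poly N q" by (simp add: N(1) alg)
   thus ?thesis using q by (simp add: exp_quot_def q_def[symmetric])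
  qed
  finally show ?thesis .
 qed
 have "((%t. \<Sum>d. of_int (psi d) * exp_quot N B.geom_poly (real d * t)) \<longlongrightarrow> poly N 1 / poly B.geom_poly 1 * char_L0 p psi) (at_right 0)"
  by (rule A.exp_quot_limit) (use N B.geom_poly_pos in \<open>auto simp: less_imp_neq[symmetric]\<close>)
 moreover have "poly N 1 / poly B.geom_poly 1 = char_L0 p' psi'"
  using N(3) B.p_pos by (simp add: B.poly_geom_poly)
 ultimately have lim: "((%t. \<Sum>d. of_int (psi d) * exp_quot N B.geom_poly (real d * t)) \<longlongrightarrow> char_L0 p psi * char_L0 p' psi') (at_right 0)"
  by (simp add: mult.commute)
 show ?thesis
 proof (rule Lim_transform_eventually[OF lim])
  show "\<forall>\<^sub>F t in at_right 0. (\<Sum>d. of_int (psi d) * exp_quot N B.geom_poly (real d * t)) =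
   infsum (%(d, e). of_int (psi (Suc d)) * of_int (psi' (Suc e)) * exp (- (real (Suc d * Suc e) * t))) UNIV"
   using eventually_at_right_less[of 0]
  proof eventually_elim
   case (elim t)
   note b = double_char_sum_summable[of psi psi' t, OF A.abs_le_1 B.abs_le_1 elim]
   have r: "(\<Sum>e. of_int (psi (Suc d)) * of_int (psi' (Suc e)) * exp (- (real (Suc d * Suc e) * t)))
     = of_int (psi (Suc d)) * exp_quot N B.geom_poly (real (Suc d) * t)" for d
   proof -
    have "summable (%e. of_int (psi' (Suc e)) * exp (- (real (Suc d * Suc e) * t)))"
    proof (rule exp_bound_sum(1)[OF elim])
     fix e
     have "\<bar>of_int (psi' (Suc e)) * exp (- (real (Suc d * Suc e) * t))\<bar> <= 1 * exp (- (real (Suc d * Suc e) * t))"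
      unfolding abs_mult using B.abs_le_1[of "Suc e"] by (intro mult_mono) (auto simp flip: of_int_abs)
     also have "... <= 1 * exp (- (t * (real d + real e)))" using hyperbola_exp_bound[OF elim, of d e] by simp
     also have "... <= 1 * exp (- (t * real e))" using elim by simp
     finally show "\<bar>of_int (psi' (Suc e)) * exp (- (real (Suc d * Suc e) * t))\<bar> <= 1 * exp (- (t * real e))" .
    qed
    from suminf_mult[OF this, of "of_int (psi (Suc d))"] inner[OF elim, of "Suc d"]
    show ?thesis by (simp add: mult.assoc)
   qed
   have b2: "\<bar>of_int (psi (Suc d)) * exp_quot N B.geom_poly (real (Suc d) * t)\<bar> <= 1 / (1 - exp (- t)) * exp (- (t * real d))" for d
   proof -
    have "\<bar>of_int (psi (Suc d)) * of_int (psi' (Suc e)) * exp (- (real (Suc d * Suc e) * t))\<bar> <= exp (- (t * real d)) * exp (- (t * real e))" for e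
     using b[of d e] by (simp add: exp_add[symmetric] alg)
    from exp_bound_sum(2)[OF elim this] r show ?thesis by simp
   qed
   have "summable (%d. of_int (psi (Suc d)) * exp_quot N B.geom_poly (real (Suc d) * t))"
    by (rule exp_bound_sum(1)[OF elim b2])
   hence s: "summable (%d. of_int (psi d) * exp_quot N B.geom_poly (real d * t))"
    using summable_iff_shift[of "%d. of_int (psi d) * exp_quot N B.geom_poly (real d * t)" 1] by simp
   show ?case
    using suminf_split_initial_segment[OF s, of 1] A.zero
    unfolding double_exp_bound(2)[OF elim b, unfolded r, symmetric] by simp
  qed
 qed
qed

text \<open>The pole of \<open>\<zeta>\<close> is cancelled in \<open>4 V (4 t) - V t\<close>, whose summand is
 \<open>4 / (e\<^sup>4\<^sup>u - 1) - 1 / (e\<^sup>u - 1) = - (q + 2 q\<^sup>2 + 3 q\<^sup>3) / (1 + q + q\<^sup>2 + q\<^sup>3)\<close> with \<open>q = e\<^sup>-\<^sup>u\<close>.\<close>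

theorem divisor_char_sum_asym_const:
 assumes "periodic_char p psi"
 shows "asym_const (%t. infsum (%(d, e). of_int (psi (Suc d)) * exp (- (real (Suc d * Suc e) * t))) UNIV) (- char_L0 p psi / 2)"
proof -
 interpret A: periodic_char p psi by fact
 \<comment> \<open>The value -6/4 of N / D at 1 is 3 zeta(0).\<close>
 define N D :: "real poly" where "N = [:0, -1, -2, -3:]" and "D = [:1, 1, 1, 1:]"
 have "((%t. \<Sum>d. of_int (psi d) * exp_quot N D (real d * t)) \<longlongrightarrow> poly N 1 / poly D 1 * char_L0 p psi) (at_right 0)"
 proof (rule A.exp_quot_limit)
  fix q :: real assume "0 <= q"
  hence "poly D q > 0" by (simp add: D_def alg add_pos_nonneg)
  thus "poly D q ~= 0" by simp
 qed (simp add: N_def)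
 hence lim: "((%t. \<Sum>d. of_int (psi d) * exp_quot N D (real d * t)) \<longlongrightarrow> 3 * (- char_L0 p psi / 2)) (at_right 0)"
  by (simp add: N_def D_def)
 show ?thesis unfolding asym_const_def
 proof (rule Lim_transform_eventually[OF lim])
  define V where "V t = infsum (%(d, e). of_int (psi (Suc d)) * exp (- (real (Suc d * Suc e) * t))) UNIV" for t
  have V: "(%d. of_int (psi (Suc d)) * (exp (- (real (Suc d) * t)) / (1 - exp (- (real (Suc d) * t))))) sums V t" if t: "t > 0" for t
  proof -
   have b: "\<bar>of_int (psi (Suc d)) * exp (- (real (Suc d * Suc e) * t))\<bar> <= 1 * exp (- (t * (real d + real e)))" for d e
    using double_char_sum_summable[of psi "%_. 1" t d e] A.abs_le_1 t by simp
   have r: "(%e. of_int (psi (Suc d)) * exp (- (real (Suc d * Suc e) * t))) sums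
     (of_int (psi (Suc d)) * (exp (- (real (Suc d) * t)) / (1 - exp (- (real (Suc d) * t)))))" for d
   proof -
    have s: "(%e. exp (- (real (Suc d) * t)) * exp (- (real (Suc d) * t * real e))) sums
      (exp (- (real (Suc d) * t)) * (1 / (1 - exp (- (real (Suc d) * t)))))"
     using t by (intro sums_mult exp_progression_sums) auto
    have "exp (- (real (Suc d) * t)) * exp (- (real (Suc d) * t * real e)) = exp (- (real (Suc d * Suc e) * t))" for e
     by (simp add: exp_add[symmetric] alg)
    with sums_mult[OF s, of "of_int (psi (Suc d))"] show ?thesis by simp
   qed
   have b2: "\<bar>of_int (psi (Suc d)) * (exp (- (real (Suc d) * t)) / (1 - exp (- (real (Suc d) * t))))\<bar> <= 1 / (1 - exp (- t)) * exp (- (t * real d))" for d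
   proof -
    have "\<bar>of_int (psi (Suc d)) * exp (- (real (Suc d * Suc e) * t))\<bar> <= exp (- (t * real d)) * exp (- (t * real e))" for e
     using b[of d e] by (simp add: exp_add[symmetric] alg)
    from exp_bound_sum(2)[OF t this] sums_unique[OF r, of d] show ?thesis by simp
   qed
   show ?thesis
    using double_exp_bound(2)[OF t b] sums_unique[OF r] summable_sums[OF exp_bound_sum(1)[OF t b2]]
    by (simp add: V_def)
  qed
  show "\<forall>\<^sub>F t in at_right 0. (\<Sum>d. of_int (psi d) * exp_quot N D (real d * t)) = 4 * V (4 * t) - V t"
   using eventually_at_right_less[of 0]
  proof eventually_elim
   case (elim t)
   have "4 * (of_int (psi (Suc d)) * (exp (- (real (Suc d) * (4 * t))) / (1 - exp (- (real (Suc d) * (4 * t))))))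
     - of_int (psi (Suc d)) * (exp (- (real (Suc d) * t)) / (1 - exp (- (real (Suc d) * t))))
     = of_int (psi (Suc d)) * exp_quot N D (real (Suc d) * t)" for d
   proof -
    define q where "q = exp (- (real (Suc d) * t))"
    have q: "0 < q" "q < 1" using elim by (auto simp: q_def)
    have q4: "exp (- (real (Suc d) * (4 * t))) = q ^ 4"
     by (simp add: q_def exp_of_nat_mult[symmetric] mult_ac)
    have f: "1 - q ^ 4 = (1 - q) * (1 + q + q^2 + q ^ 3)"
     by (simp add: alg p2sq power3_eq_cube power4_eq_xxxx)
    have pos: "1 + q + q^2 + q ^ 3 > 0" using q by (simp add: add_pos_pos)
    have "4 * (q ^ 4 / (1 - q ^ 4)) - q / (1 - q) = - (q + 2 * q^2 + 3 * q ^ 3) / (1 + q + q^2 + q ^ 3)"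
     unfolding f using q pos by (simp add: divide_simps) (simp add: alg p2sq power3_eq_cube power4_eq_xxxx)
    also have "... = exp_quot N D (real (Suc d) * t)"
     unfolding exp_quot_def q_def[symmetric]
     by (simp add: N_def D_def) (simp add: alg p2sq power3_eq_cube)
    finally have k: "4 * (q ^ 4 / (1 - q ^ 4)) - q / (1 - q) = exp_quot N D (real (Suc d) * t)" .
    show ?thesis unfolding q4 q_def[symmetric] k[symmetric] by (simp add: alg)
   qed
   hence s: "(%d. of_int (psi (Suc d)) * exp_quot N D (real (Suc d) * t)) sums (4 * V (4 * t) - V t)"
    using sums_diff[OF sums_mult[OF V, of "4 * t" 4] V[OF elim]] elim by simp
   hence "summable (%d. of_int (psi d) * exp_quot N D (real d * t))"
    using summable_iff_shift[of "%d. of_int (psi d) * exp_quot N D (real d * t)" 1] by (simp add: sums_iff)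
   from suminf_split_initial_segment[OF this, of 1] s A.zero show ?case
    by (simp add: sums_iff)
  qed
 qed
qed

subsection \<open>Jacobi symbols and divisor sums\<close>

lemma prime_int_le_2: "prime p ==> odd p ==> 2 < (p::nat)"
 using prime_ge_2_nat[of p] by (cases "p = 2") auto

lemma odd_mod_4: "odd (n::nat) ==> n mod 4 = 1 \<or> n mod 4 = 3"
 by presburger

lemma Legendre_values: "Legendre a p : {-1, 0, 1}"
 by (simp add: Legendre_def)

lemma Legendre_eq_0_iff: "Legendre a p = 0 \<longleftrightarrow> p dvd a"
 by (auto simp: Legendre_def cong_0_iff)

lemma Legendre_cong: "[a = b] (mod p) ==> Legendre a p = Legendre b p"
 unfolding Legendre_def QuadRes_def cong_mod by simp

lemma Legendre_eqI:
 assumes "prime p" "2 < (p::nat)" "[Legendre a p = v] (mod p)" "v : {-1, 0, 1}"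
 shows "Legendre a p = v"
proof -
 have "int p dvd Legendre a p - v" using assms(3) by (simp add: cong_iff_dvd_diff)
 moreover have "\<bar>Legendre a p - v\<bar> < int p" using assms(2,4) Legendre_values[of a p] by auto
 ultimately show ?thesis using dvd_imp_le_int[of "Legendre a p - v" "int p"] by (cases "Legendre a p - v = 0") auto
qed

lemma Legendre_mult:
 assumes "prime p" "2 < (p::nat)"
 shows "Legendre (a * b) p = Legendre a p * Legendre b p"
proof (rule Legendre_eqI[OF assms])
 have "[Legendre (a * b) p = (a * b) ^ ((p - 1) div 2)] (mod p)" by (rule euler_criterion[OF assms])
 moreover have "[Legendre a p * Legendre b p = a ^ ((p - 1) div 2) * b ^ ((p - 1) div 2)] (mod p)"
  by (intro cong_mult euler_criterion[OF assms])
 ultimately show "[Legendre (a * b) p = Legendre a p * Legendre b p] (mod p)"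
  by (simp add: power_mult_distrib) (meson cong_sym cong_trans)
 show "Legendre a p * Legendre b p : {-1, 0, 1}"
  using Legendre_values[of a p] Legendre_values[of b p] by auto
qed

lemma Legendre_minus_1:
 assumes "prime p" "2 < (p::nat)"
 shows "Legendre (-1) p = (if p mod 4 = 1 then 1 else -1)"
proof -
 have "odd p" using assms by (metis prime_odd_nat)
 hence "(-1::int) ^ ((p - 1) div 2) = (if p mod 4 = 1 then 1 else -1)"
  using odd_mod_4[of p] by (auto simp: minus_one_power_iff elim!: oddE; presburger)
 thus ?thesis using euler_criterion[OF assms, of "-1"] by (intro Legendre_eqI[OF assms]) auto
qed

lemma Legendre_1: "prime p ==> Legendre 1 (int p) = 1"
 unfolding Legendre_def QuadRes_def using prime_gt_1_nat[of p]
 by (auto simp: cong_0_iff intro!: exI[of _ 1])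

lemma Legendre_square:
 assumes "prime p" "2 < (p::nat)" "~ int p dvd a"
 shows "Legendre (a * a) p = 1"
 using Legendre_mult[OF assms(1,2), of a a] Legendre_values[of a p] Legendre_eq_0_iff[of a p] assms(3) by auto

definition jacobi :: "int => nat => int" where
 "jacobi a n = (\<Prod>p\<in>#prime_factorization n. Legendre a (int p))"

lemma jacobi_1 [simp]: "jacobi a 1 = 1" "jacobi a (Suc 0) = 1"
 by (simp_all add: jacobi_def)

lemma jacobi_mult_right: "m > 0 ==> n > 0 ==> jacobi a (m * n) = jacobi a m * jacobi a n"
 by (simp add: jacobi_def prime_factorization_mult)

lemma jacobi_prime: "prime p ==> jacobi a p = Legendre a p"
 by (simp add: jacobi_def prime_factorization_prime)

lemma odd_prime_factors: "odd n ==> p \<in># prime_factorization n ==> prime p & 2 < (p::nat)"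
 by (metis dvd_trans in_prime_factors_imp_dvd in_prime_factors_imp_prime prime_int_le_2)

lemma jacobi_mult_left: "odd n ==> jacobi (a * b) n = jacobi a n * jacobi b n"
 unfolding jacobi_def using odd_prime_factors[of n] Legendre_mult
 by (subst prod_mset.distrib[symmetric]) (auto intro!: arg_cong[of _ _ prod_mset] image_mset_cong)

lemma jacobi_cong: "[a = b] (mod int n) ==> jacobi a n = jacobi b n"
 unfolding jacobi_def
 by (intro arg_cong[of _ _ prod_mset] image_mset_cong Legendre_cong)
  (meson cong_dvd_modulus_nat cong_int_iff cong_dvd_modulus in_prime_factors_imp_dvd int_dvd_int_iff)

lemma odd_nat_induct [consumes 1, case_names 1 prime_mult]:
 fixes n :: nat
 assumes "odd n" and "P 1" and "!!p m. prime p ==> 2 < p ==> odd m ==> P m ==> P (p * m)"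
 shows "P n"
 using assms(1)
proof (induction n rule: less_induct)
 case (less n)
 show ?case
 proof (cases "n = 1")
  case False
  then obtain p where p: "prime p" "p dvd n" using prime_factor_nat by blast
  then obtain m where m: "n = p * m" by auto
  have "odd p" "odd m" using less.prems m by auto
  hence "0 < m" "1 < p" using prime_gt_1_nat[OF p(1)] by (auto simp: odd_pos)
  hence "m < n" using m by simp
  with less.IH[of m] \<open>odd m\<close> \<open>odd p\<close> assms(3)[of p m] prime_int_le_2 p m show ?thesis by auto
 qed (use assms(2) in simp)
qed

lemma jacobi_coprime:
 assumes "odd n" "coprime a (int n)"
 shows "jacobi a n : {-1, 1}"
 using assms
proof (induction n rule: odd_nat_induct)
 case (prime_mult p m)
 hence "~ int p dvd a"
  by (metis coprime_common_divisor dvd_triv_left int_dvd_int_iff nat_int_comparison(2) not_prime_unit of_nat_mult prime_nat_int_transfer)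
 hence "Legendre a p : {-1, 1}" using Legendre_values[of a p] Legendre_eq_0_iff[of a p] by auto
 with prime_mult show ?case
  by (auto simp: jacobi_mult_right jacobi_prime odd_pos)
qed simp

lemma jacobi_one_left: "odd n ==> jacobi 1 n = 1"
proof (induction n rule: odd_nat_induct)
 case (prime_mult p m)
 thus ?case by (simp add: jacobi_mult_right jacobi_prime odd_pos Legendre_1)
qed simp

lemma jacobi_minus_1: "odd n ==> jacobi (-1) n = (if n mod 4 = 1 then 1 else -1)"
proof (induction n rule: odd_nat_induct)
 case (prime_mult p m)
 have "p mod 4 = 1 \<or> p mod 4 = 3" "m mod 4 = 1 \<or> m mod 4 = 3"
  using odd_mod_4 prime_mult prime_odd_nat[of p] by blast+
 moreover have "(p * m) mod 4 = (p mod 4) * (m mod 4) mod 4" by (simp add: mod_mult_eq)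
 ultimately show ?case using prime_mult Legendre_minus_1[of p]
  by (auto simp: jacobi_mult_right jacobi_prime odd_pos)
qed simp

lemma half_odd: "odd (n::nat) ==> odd ((n - 1) div 2) \<longleftrightarrow> n mod 4 = 3"
 by presburger

lemma Legendre_reciprocity:
 assumes "prime p" "prime q" "2 < p" "2 < q" "p ~= q"
 shows "Legendre (int p) (int q) * Legendre (int q) (int p) = (if p mod 4 = 3 & q mod 4 = 3 then -1 else 1)"
proof -
 have "odd p" "odd q" using assms by (metis prime_odd_nat)+
 hence "(-1::int) ^ ((p - 1) div 2 * ((q - 1) div 2)) = (if p mod 4 = 3 & q mod 4 = 3 then -1 else 1)"
  using half_odd by (auto simp: minus_one_power_iff)
 thus ?thesis using Quadratic_Reciprocity[of p q] assms by simp
qed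

lemma jacobi_reciprocity:
 assumes "odd m" "odd n" "coprime m n"
 shows "jacobi (int m) n * jacobi (int n) m = (if m mod 4 = 3 & n mod 4 = 3 then -1 else 1)"
 using assms
proof (induction m rule: odd_nat_induct)
 case 1
 thus ?case by (simp add: jacobi_one_left)
next
 case (prime_mult p m)
 have "jacobi (int p) n * jacobi (int n) p = (if p mod 4 = 3 & n mod 4 = 3 then -1 else 1)"
  using \<open>odd n\<close> prime_mult.prems(2)
 proof (induction n rule: odd_nat_induct)
  case 1
  thus ?case using jacobi_one_left[of p] \<open>prime p\<close> \<open>2 < p\<close> prime_odd_nat by simp
 next
  case (prime_mult q n)
  have pq: "p ~= q" using prime_mult.prems \<open>prime q\<close> by auto
  have "q mod 4 = 1 \<or> q mod 4 = 3" "n mod 4 = 1 \<or> n mod 4 = 3"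
   using odd_mod_4 prime_mult prime_odd_nat[of q] by blast+
  moreover have "(q * n) mod 4 = (q mod 4) * (n mod 4) mod 4" by (simp add: mod_mult_eq)
  ultimately have m4: "(q * n) mod 4 = 3 \<longleftrightarrow> (q mod 4 = 3) ~= (n mod 4 = 3)" by auto
  have "odd p" using \<open>prime p\<close> \<open>2 < p\<close> prime_odd_nat by simp
  hence "jacobi (int p) (q * n) * jacobi (int (q * n)) p =
    (Legendre p q * Legendre q p) * (jacobi (int p) n * jacobi (int n) p)"
   using prime_mult \<open>prime p\<close> jacobi_mult_left[of p "int q" "int n"] jacobi_prime[of p "int q"]
   by (simp add: jacobi_mult_right jacobi_prime[of q] odd_pos)
  thus ?case
   using Legendre_reciprocity[OF \<open>prime p\<close> \<open>prime q\<close> \<open>2 < p\<close> \<open>2 < q\<close> pq] prime_mult m4 by auto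
 qed
 moreover have "(p * m) mod 4 = 3 \<longleftrightarrow> (p mod 4 = 3) ~= (m mod 4 = 3)"
 proof -
  have "p mod 4 = 1 \<or> p mod 4 = 3" "m mod 4 = 1 \<or> m mod 4 = 3"
   using odd_mod_4 prime_mult prime_odd_nat[of p] by blast+
  moreover have "(p * m) mod 4 = (p mod 4) * (m mod 4) mod 4" by (simp add: mod_mult_eq)
  ultimately show ?thesis by auto
 qed
 moreover have "jacobi (int (p * m)) n * jacobi (int n) (p * m) =
    (jacobi (int p) n * jacobi (int n) p) * (jacobi (int m) n * jacobi (int n) m)"
  using prime_mult by (simp add: jacobi_mult_right jacobi_mult_left odd_pos)
 ultimately show ?case using prime_mult by auto
qed

text \<open>Induction from n - 2 to n: modulo n, 2 is - (n - 2), and modulo n - 2, n is 2;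
  reciprocity links the two symbols. It contributes no sign, since n - 2 and n are never both 3 mod
  4.\<close>

lemma jacobi_2: "odd n ==> jacobi 2 n = (if n mod 8 = 1 \<or> n mod 8 = 7 then 1 else -1)"
proof (induction n rule: less_induct)
 case (less n)
 show ?case
 proof (cases "n = 1")
  case False
  hence n: "n >= 3" using less.prems by presburger
  define m where "m = n - 2"
  have m: "odd m" "n = m + 2" "m < n" using n less.prems by (auto simp: m_def)
  have cop: "coprime m n"
  proof -
   have "coprime m 2" using m(1) by simp
   hence "gcd m (m + 2) = 1" by (simp only: gcd_add2 coprime_iff_gcd_eq_1)
   thus ?thesis by (simp only: m(2) coprime_iff_gcd_eq_1)
  qed
  have "[2 = - 1 * int m] (mod int n)" by (simp add: cong_iff_dvd_diff m(2))
  hence "jacobi 2 n = jacobi (-1) n * jacobi (int m) n"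
   using jacobi_cong less.prems by (metis jacobi_mult_left)
  moreover have "jacobi (int n) m = jacobi 2 m"
   by (rule jacobi_cong) (simp add: cong_iff_dvd_diff m(2))
  moreover have "jacobi (int m) n * jacobi (int n) m = 1"
   proof -
   have "n mod 4 ~= 3" if "m mod 4 = 3" using that unfolding m(2) by presburger
   thus ?thesis using jacobi_reciprocity[OF m(1) less.prems cop] by auto
  qed
  moreover have "jacobi 2 m = (if m mod 8 = 1 \<or> m mod 8 = 7 then 1 else -1)"
   using less.IH m by blast
  moreover have "jacobi (-1) n = (if n mod 4 = 1 then 1 else -1)" by (rule jacobi_minus_1[OF less.prems])
  ultimately have j: "jacobi 2 n = (if n mod 4 = 1 then 1 else -1) * (if m mod 8 = 1 \<or> m mod 8 = 7 then 1 else -1)"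
   by (auto split: if_splits)
  have "m mod 8 = 1 \<or> m mod 8 = 3 \<or> m mod 8 = 5 \<or> m mod 8 = 7" using m(1) by presburger
  then consider "m mod 8 = 1" | "m mod 8 = 3" | "m mod 8 = 5" | "m mod 8 = 7" by blast
  thus ?thesis
  proof cases
   case 1 hence "n mod 8 = 3" "n mod 4 = 3" unfolding m(2) by presburger+
   with 1 show ?thesis using j by simp
  next
   case 2 hence "n mod 8 = 5" "n mod 4 = 1" unfolding m(2) by presburger+
   with 2 show ?thesis using j by simp
  next
   case 3 hence "n mod 8 = 7" "n mod 4 = 3" unfolding m(2) by presburger+
   with 3 show ?thesis using j by simp
  next
   case 4 hence "n mod 8 = 1" "n mod 4 = 1" unfolding m(2) by presburger+
   with 4 show ?thesis using j by simp
  qed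
 qed simp
qed

lemma Legendre_2:
 assumes "prime p" "2 < (p::nat)"
 shows "Legendre 2 p = (if p mod 8 = 1 \<or> p mod 8 = 7 then 1 else -1)"
 using jacobi_2[of p] jacobi_prime[OF assms(1)] assms prime_odd_nat by simp

section \<open>Dirichlet convolution of multiplicative functions\<close>

definition dconv :: "(nat => int) => (nat => int) => nat => int" where
 "dconv f g n = (\<Sum>d | d dvd n. f d * g (n div d))"

definition multiplicative :: "(nat => int) => bool" where
 "multiplicative f \<longleftrightarrow> f 1 = 1 & (ALL m n. m > 0 --> n > 0 --> coprime m n --> f (m * n) = f m * f n)"

lemma gcd_coprime_parts:
 fixes m n :: nat
 assumes "coprime m n" "a dvd m" "b dvd n"
 shows "gcd (a * b) m = a" "gcd (a * b) n = b"
proof -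
 have "coprime b m" "coprime a n" using assms by (meson coprime_commute coprime_divisors dvd_refl)+
 hence "gcd (a * b) m = gcd a m" "gcd (a * b) n = gcd b n"
  by (simp_all add: gcd_mult_right_right_cancel gcd_mult_left_right_cancel coprime_commute gcd_mult_left_left_cancel)
 thus "gcd (a * b) m = a" "gcd (a * b) n = b" using assms by (simp_all add: gcd_nat.absorb1)
qed

lemma multiplicative_dconv:
 assumes f: "multiplicative f" and g: "multiplicative g"
 shows "multiplicative (dconv f g)"
 unfolding multiplicative_def
proof (intro conjI allI impI)
 show "dconv f g 1 = 1" using f g by (simp add: dconv_def multiplicative_def)
 fix m n :: nat assume mn: "m > 0" "n > 0" "coprime m n"
 define h where "h a b = (f a * g (m div a)) * (f b * g (n div b))" for a b
 have "dconv f g (m * n) = (\<Sum>(a, b)\<in>{a. a dvd m} \<times> {b. b dvd n}. h a b)"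
  unfolding dconv_def
 proof (rule sum.reindex_bij_witness[of _ "%(a, b). a * b" "%d. (gcd d m, gcd d n)"])
  fix d assume "d : {d. d dvd m * n}"
  hence d: "d dvd m * n" by simp
  obtain a b where ab: "d = a * b" "a dvd m" "b dvd n" using division_decomp[OF d] by blast
  have gd: "gcd d m = a" "gcd d n = b" using gcd_coprime_parts[OF mn(3) ab(2,3)] ab(1) by auto
  show "(case (gcd d m, gcd d n) of (a, b) => a * b) = d" using gd ab by simp
  show "(gcd d m, gcd d n) : {a. a dvd m} \<times> {b. b dvd n}" by simp
  show "(case (gcd d m, gcd d n) of (a, b) => h a b) = f d * g (m * n div d)"
  proof -
   obtain a' b' where a': "m = a * a'" and b': "n = b * b'" using ab by blast
   have pos: "a > 0" "b > 0" "a' > 0" "b' > 0" using mn a' b' by auto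
   have cop: "coprime a b" "coprime a' b'" using mn(3) unfolding a' b' by auto
   have "m * n div d = a' * b'" using pos by (simp add: a' b' ab(1) mult_ac)
   hence "f d * g (m * n div d) = (f a * f b) * (g a' * g b')"
    using f g cop pos by (simp add: multiplicative_def ab(1))
   also have "... = h a b" using pos by (simp add: h_def a' b' mult_ac)
   finally show ?thesis by (simp add: gd)
  qed
 next
  fix x assume "x : {a. a dvd m} \<times> {b. b dvd n}"
  then obtain a b where x: "x = (a, b)" "a dvd m" "b dvd n" by auto
  show "(gcd (case x of (a, b) => a * b) m, gcd (case x of (a, b) => a * b) n) = x"
   using x gcd_coprime_parts[OF mn(3) x(2,3)] by simp
  show "(case x of (a, b) => a * b) : {d. d dvd m * n}" using x by (auto intro: mult_dvd_mono)
 qed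
 also have "... = dconv f g m * dconv f g n"
  by (simp add: sum.cartesian_product[symmetric] dconv_def sum_product h_def)
 finally show "dconv f g (m * n) = dconv f g m * dconv f g n" .
qed

lemma multiplicative_eqI:
 assumes f: "multiplicative f" and g: "multiplicative g"
  and eq: "!!q e. prime q ==> f (q ^ e) = g (q ^ e)" and "n > 0"
 shows "f n = g n"
 using \<open>n > 0\<close>
proof (induction n rule: less_induct)
 case (less n)
 show ?case
 proof (cases "n = 1")
  case True
  thus ?thesis using f g by (simp add: multiplicative_def)
 next
  case False
  then obtain q where q: "prime q" "q dvd n" using prime_factor_nat by blast
  obtain m where m: "n = q ^ multiplicity q n * m" "~ q dvd m"
   using multiplicity_decompose'[of n q] less.prems q by (metis not_prime_unit less_not_refl)
  define e where "e = multiplicity q n"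
  have "e > 0" using q less.prems by (simp add: e_def prime_multiplicity_gt_zero_iff)
  have pos: "m > 0" "q ^ e > 0" using m less.prems q by (auto simp: prime_gt_0_nat intro: Nat.gr0I)
  have "q ^ e > 1" using q(1) \<open>e > 0\<close> by (metis one_less_power prime_gt_1_nat)
  hence "1 * m < q ^ e * m" using pos by (intro mult_strict_right_mono) auto
  hence "m < n" unfolding e_def using m(1) by simp
  have cop: "coprime (q ^ e) m" using q m by (simp add: prime_imp_coprime)
  have m1: "n = q ^ e * m" using m(1) by (simp only: e_def)
  have "f (q ^ e * m) = f (q ^ e) * f m" "g (q ^ e * m) = g (q ^ e) * g m"
   using f g cop pos unfolding multiplicative_def by blast+
  hence "f n = f (q ^ e) * f m" "g n = g (q ^ e) * g m" by (simp_all only: m1[symmetric])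
  thus ?thesis using eq[OF q(1)] less.IH[OF \<open>m < n\<close> pos(1)] by simp
 qed
qed

lemma dconv_prime_power:
 assumes "prime q"
 shows "dconv f g (q ^ e) = (\<Sum>i\<le>e. f (q ^ i) * g (q ^ (e - i)))"
proof -
 have q: "q > 1" using assms by (rule prime_gt_1_nat)
 have "{d. d dvd q ^ e} = (%i. q ^ i) ` {..e}"
  using divides_primepow_nat[OF assms] by auto
 moreover have "inj_on (%i. q ^ i) {..e}" using q by (auto simp: inj_on_def)
 ultimately have "dconv f g (q ^ e) = (\<Sum>i\<le>e. f (q ^ i) * g (q ^ e div q ^ i))"
  by (simp add: dconv_def sum.reindex)
 also have "... = (\<Sum>i\<le>e. f (q ^ i) * g (q ^ (e - i)))"
  using q by (intro sum.cong refl) (simp add: power_diff)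
 finally show ?thesis .
qed

section \<open>Counting ideals by norm through the roots of x^2 + x + C\<close>

definition square_ind :: "nat => int" where "square_ind n = (if is_nth_power 2 n then 1 else 0)"

lemma multiplicative_square_ind: "multiplicative square_ind"
 by (auto simp: multiplicative_def square_ind_def is_nth_power_mult_coprime_nat_iff)

text \<open>A root x corresponds to the form (m, 2 x + 1) of discriminant 1 - 4 C with normalised
  middle coefficient, that is, to a primitive ideal of norm m.\<close>

definition qroots :: "int => nat => nat set" where
 "qroots C m = {x. x < m & int m dvd (int x)^2 + int x + C}"

lemma finite_qroots [simp]: "finite (qroots C m)"
 by (rule finite_subset[of _ "{..<m}"]) (auto simp: qroots_def)

lemma quad_cong:
 assumes "[x = y] (mod m)" shows "m dvd x^2 + x + (C::int) \<longleftrightarrow> m dvd y^2 + y + C"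
 by (rule cong_dvd_iff) (intro cong_add cong_pow assms cong_refl)

lemma card_qroots_mult:
 assumes mn: "m > 0" "n > 0" "coprime m n"
 shows "card (qroots C (m * n)) = card (qroots C m) * card (qroots C n)"
proof -
 have "bij_betw (%x. (x mod m, x mod n)) (qroots C (m * n)) (qroots C m \<times> qroots C n)"
  unfolding bij_betw_def
 proof
  show "inj_on (%x. (x mod m, x mod n)) (qroots C (m * n))"
  proof (rule inj_onI)
   fix x y assume "x : qroots C (m * n)" "y : qroots C (m * n)" "(x mod m, x mod n) = (y mod m, y mod n)"
   thus "x = y"
    by (auto simp: qroots_def simp flip: cong_mod
      intro: cong_less_modulus_unique_nat[of x y "m * n"] coprime_cong_mult_nat[OF _ _ mn(3)])
  qed
  have crt: "int (m * n) dvd z \<longleftrightarrow> int m dvd z & int n dvd z" for z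
   using mn(3) by (metis coprime_int_iff divides_mult dvd_mult_left dvd_mult_right of_nat_mult)
  have m1: "int m dvd (int x)^2 + int x + C \<longleftrightarrow> int m dvd (int (x mod m))^2 + int (x mod m) + C" for x m
   by (rule quad_cong) (simp add: cong_mod zmod_int)
  show "(%x. (x mod m, x mod n)) ` qroots C (m * n) = qroots C m \<times> qroots C n"
  proof (intro equalityI subsetI)
   fix z assume "z : (%x. (x mod m, x mod n)) ` qroots C (m * n)"
   thus "z : qroots C m \<times> qroots C n"
    using crt m1 mn by (auto simp: qroots_def)
  next
   fix z assume "z : qroots C m \<times> qroots C n"
   then obtain a b where z: "z = (a, b)" "a : qroots C m" "b : qroots C n" by auto
   obtain x where x: "x < m * n" "[x = a] (mod m)" "[x = b] (mod n)"
    using binary_chinese_remainder_unique_nat[OF mn(3), of a b] mn by auto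
   have "x mod m = a" "x mod n = b" using x z by (auto simp: cong_mod qroots_def)
   thus "z : (%x. (x mod m, x mod n)) ` qroots C (m * n)"
    using x z crt m1[of m x] m1[of n x] by (auto simp: qroots_def intro!: image_eqI[of _ _ x])
  qed
 qed
 thus ?thesis by (simp add: bij_betw_same_card card_cartesian_product)
qed

text \<open>Hensel's lemma. A root x satisfies (2 x + 1)^2 = 1 - 4 C modulo q, so the derivative 2 x
  + 1 is invertible modulo q and every root modulo q^e lifts uniquely.\<close>

lemma card_qroots_lift:
 assumes q: "prime q" and nd: "~ int q dvd 1 - 4 * C" and e: "e > 0"
 shows "card (qroots C (q ^ Suc e)) = card (qroots C (q ^ e))"
proof -
 define f where "f x = x^2 + x + C" for x :: int
 define Q where "Q = int (q ^ e)"
 have Q: "Q > 0" "int (q ^ Suc e) = int q * Q" "int q dvd Q" using q e by (auto simp: Q_def prime_gt_0_nat)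
 have simple: "~ int q dvd 2 * x + 1" if "int q dvd f x" for x
 proof
  assume "int q dvd 2 * x + 1"
  hence "int q dvd (2 * x + 1) * (2 * x + 1) - 4 * f x" using that by (intro dvd_diff dvd_mult) auto
  thus False using nd by (simp add: f_def sq_simps)
 qed
 have pq: "prime (int q)" using q by simp
 have "bij_betw (%x. x mod q ^ e) (qroots C (q ^ Suc e)) (qroots C (q ^ e))"
  unfolding bij_betw_def
 proof
  show "inj_on (%x. x mod q ^ e) (qroots C (q ^ Suc e))"
  proof (rule inj_onI)
   fix x y assume xy: "x : qroots C (q ^ Suc e)" "y : qroots C (q ^ Suc e)" "x mod q ^ e = y mod q ^ e"
   have d: "Q dvd int x - int y" using xy(3) unfolding Q_def
    by (metis cong_mod cong_iff_dvd_diff zmod_int)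
   have fx: "int q * Q dvd f (int x)" "int q * Q dvd f (int y)" using xy Q(2) by (auto simp: qroots_def f_def)
   hence "int q * Q dvd f (int x) - f (int y)" by (rule dvd_diff)
   also have "f (int x) - f (int y) = (int x - int y) * (int x + int y + 1)" by (simp add: f_def sq_simps)
   finally have dd: "int q * Q dvd (int x - int y) * (int x + int y + 1)" .
   have "~ int q dvd int x + int y + 1"
   proof
    assume "int q dvd int x + int y + 1"
    moreover have "int q dvd int x - int y" using d Q(3) dvd_trans by blast
    ultimately have "int q dvd (int x + int y + 1) + (int x - int y)" by (rule dvd_add)
    hence "int q dvd 2 * int x + 1" by simp
    thus False using simple[of "int x"] fx(1) by (meson dvd_mult_left)
   qed
   hence "coprime (int q ^ Suc e) (int x + int y + 1)" using pq by (simp add: prime_imp_coprime)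
   hence "int q ^ Suc e dvd int x - int y" using dd
    by (simp add: Q_def coprime_dvd_mult_left_iff)
   hence "int (q ^ Suc e) dvd int x - int y" by simp
   moreover have "\<bar>int x - int y\<bar> < int (q ^ Suc e)"
   proof -
    have "x < q ^ Suc e" "y < q ^ Suc e" using xy by (auto simp: qroots_def)
    thus ?thesis by linarith
   qed
   ultimately show "x = y" using dvd_imp_le_int[of "int x - int y" "int (q ^ Suc e)"] by (cases "int x - int y = 0") auto
  qed
  show "(%x. x mod q ^ e) ` qroots C (q ^ Suc e) = qroots C (q ^ e)"
  proof (intro equalityI subsetI)
   fix z assume "z : (%x. x mod q ^ e) ` qroots C (q ^ Suc e)"
   then obtain x where x: "z = x mod q ^ e" "x : qroots C (q ^ Suc e)" by auto
   have "int (q ^ e) dvd (int x)^2 + int x + C" using x(2) by (auto simp: qroots_def dest: dvd_mult_right)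
   moreover have "[int x = int z] (mod int (q ^ e))" by (simp add: x(1) cong_mod zmod_int)
   ultimately show "z : qroots C (q ^ e)" using quad_cong[of "int x" "int z" "int (q ^ e)" C] q x(1)
    by (auto simp: qroots_def prime_gt_0_nat)
  next
   fix r assume r: "r : qroots C (q ^ e)"
   then obtain k where k: "f (int r) = Q * k" by (auto simp: qroots_def f_def Q_def)
   have "int q dvd f (int r)" using k Q(3) by simp
   from simple[OF this] have cop: "coprime (2 * int r + 1) (int q)" using pq by (metis coprime_commute prime_imp_coprime)
   obtain w where w: "[(2 * int r + 1) * w = 1] (mod int q)" using cong_solve_coprime_int[OF cop] by blast
   \<comment> \<open>Newton step: \<open>w\<close> inverts the derivative modulo q.\<close>
   define z where "z = - k * w"
   have "[k + z * (2 * int r + 1) = k - k * ((2 * int r + 1) * w)] (mod int q)" by (simp add: z_def alg)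
   also have "[k - k * ((2 * int r + 1) * w) = k - k * 1] (mod int q)" by (intro cong_diff cong_mult w cong_refl)
   finally have kz: "int q dvd k + z * (2 * int r + 1)" by (simp add: cong_0_iff)
   have "f (int r + Q * z) = Q * (k + z * (2 * int r + 1)) + Q * Q * z^2"
    using k by (simp add: f_def sq_simps)
   moreover have "int q * Q dvd Q * (k + z * (2 * int r + 1))" using kz by (metis mult.commute mult_dvd_mono dvd_refl)
   moreover have "int q * Q dvd Q * Q * z^2" using Q(3) by (metis dvd_mult2 mult_dvd_mono dvd_refl)
   ultimately have fd: "int q * Q dvd f (int r + Q * z)" by (metis dvd_add)
   define x where "x = nat ((int r + Q * z) mod (int q * Q))"
   have qQ: "int q * Q > 0" using Q q by (simp add: prime_gt_0_nat)
   have x: "int x = (int r + Q * z) mod (int q * Q)" using qQ by (simp add: x_def)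
   have "int q * Q dvd f (int x)" using fd quad_cong[of "int x" "int r + Q * z" "int q * Q" C] x by (simp add: f_def cong_mod)
   moreover have "x < q ^ Suc e"
   proof -
    have "int x < int q * Q" using x qQ by simp
    thus ?thesis using Q(2) by linarith
   qed
   ultimately have "x : qroots C (q ^ Suc e)" unfolding qroots_def mem_Collect_eq Q(2) f_def by blast
   moreover have "x mod q ^ e = r"
   proof -
    have "int (x mod q ^ e) = int x mod Q" by (simp add: Q_def zmod_int)
    also have "... = (int r + Q * z) mod Q" unfolding x by (simp add: mod_mod_cancel)
    also have "... = int r" using r by (simp add: qroots_def Q_def flip: zmod_int)
    finally show ?thesis by simp
   qed
   ultimately show "r : (%x. x mod q ^ e) ` qroots C (q ^ Suc e)" by blast
  qed
 qed
 thus ?thesis by (rule bij_betw_same_card)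
qed

text \<open>A root modulo q^2 makes q divide 2 x + 1, and then q^2 divides the discriminant (2 x +
  1)^2 - 4 (x^2 + x + C).\<close>

lemma qroots_ramified:
 assumes q: "prime q" and d: "int q dvd 1 - 4 * C" "~ int q ^ 2 dvd 1 - 4 * C" and e: "e >= 2"
 shows "qroots C (q ^ e) = {}"
proof (rule ccontr)
 assume "qroots C (q ^ e) ~= {}"
 then obtain x where x: "int (q ^ e) dvd (int x)^2 + int x + C" by (auto simp: qroots_def)
 have "int q ^ 2 dvd int (q ^ e)" using e by (simp add: le_imp_power_dvd)
 with x have x2: "int q ^ 2 dvd (int x)^2 + int x + C" using dvd_trans by blast
 have id: "(2 * int x + 1)^2 = 4 * ((int x)^2 + int x + C) + (1 - 4 * C)" by (simp add: sq_simps)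
 have "int q dvd (int x)^2 + int x + C" using x2 by (metis dvd_mult_left p2sq)
 hence "int q dvd (2 * int x + 1)^2" using d(1) unfolding id by (metis dvd_add dvd_mult)
 hence "int q dvd 2 * int x + 1" using q by (metis prime_dvd_power prime_nat_int_transfer)
 hence "int q ^ 2 dvd (2 * int x + 1)^2" by (rule dvd_power_same)
 hence "int q ^ 2 dvd (2 * int x + 1)^2 - 4 * ((int x)^2 + int x + C)" using x2 by (intro dvd_diff dvd_mult)
 thus False using d(2) id by simp
qed

text \<open>The Kronecker character of the discriminant 1 - 4 C. Describing it by root counts treats
  the prime 2 like all others.\<close>

locale quad_char =
 fixes C :: int and psi :: "nat => int"
 assumes char_1: "psi 1 = 1" and char_mult: "!!m n. psi (m * n) = psi m * psi n"
  and card_roots_prime: "!!q. prime q ==> int (card (qroots C q)) = 1 + psi q"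
  and char_prime: "!!q. prime q ==> psi q : {-1, 0, 1}"
  and char_0: "!!q. prime q ==> psi q = 0 \<longleftrightarrow> int q dvd 1 - 4 * C"
  and squarefree: "!!q. prime q ==> ~ int q ^ 2 dvd 1 - 4 * C"
begin

lemma char_power: "psi (q ^ e) = psi q ^ e"
 by (induction e) (use char_1 char_mult in auto)

text \<open>One expression for three cases: 2 for split, 0 for inert and 0 for ramified primes, the
  last because the double root does not lift.\<close>

lemma card_roots_prime_power:
 assumes q: "prime q"
 shows "int (card (qroots C (q ^ (e + 2)))) = psi q ^ (e + 2) + psi q ^ (e + 1)"
proof (cases "psi q = 0")
 case True
 thus ?thesis using qroots_ramified[OF q, of C "e + 2"] char_0[OF q] squarefree[OF q] by simp
next
 case False
 have "card (qroots C (q ^ Suc k)) = card (qroots C q)" for k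
 proof (induction k)
  case (Suc k)
  thus ?case using card_qroots_lift[OF q, of C "Suc k"] False char_0[OF q] by simp
 qed simp
 from this[of "Suc e"] show ?thesis
  using card_roots_prime[OF q] char_prime[OF q] False by (auto simp: minus_one_power_iff)
qed

text \<open>Both sides count the integral ideals of norm n: on the left as multiples k I of
  primitive ideals with n = k^2 N(I), on the right as coefficients of zeta(s) L(s, psi). At prime
  powers both satisfy the same recursion from e to e + 2.\<close>

theorem sum_roots_eq_sum_char:
 assumes "n > 0"
 shows "dconv square_ind (%a. int (card (qroots C a))) n = dconv psi (%_. 1) n"
proof (rule multiplicative_eqI[OF _ _ _ assms])
 have "card (qroots C 1) = 1"
 proof -
  have "qroots C 1 = {0}" by (auto simp: qroots_def)
  thus ?thesis by simp
 qed
 thus "multiplicative (dconv square_ind (%a. int (card (qroots C a))))"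
  by (intro multiplicative_dconv multiplicative_square_ind) (simp add: multiplicative_def card_qroots_mult)
 show "multiplicative (dconv psi (%_. 1))"
  by (intro multiplicative_dconv) (auto simp: multiplicative_def char_1[simplified] char_mult)
 fix q e assume q: "prime (q::nat)"
 define r where "r i = int (card (qroots C (q ^ i)))" for i
 have r: "r 0 = 1" "r 1 = 1 + psi q" "!!i. r (i + 2) = psi q ^ (i + 2) + psi q ^ (i + 1)"
  using \<open>card (qroots C 1) = 1\<close> card_roots_prime[OF q] card_roots_prime_power[OF q] by (simp_all add: r_def)
 define F where "F e = (\<Sum>i\<le>e. square_ind (q ^ i) * r (e - i))" for e
 define G where "G e = (\<Sum>i\<le>e. psi q ^ i)" for e
 have si: "square_ind (q ^ i) = (if even i then 1 else 0)" for i
  using is_nth_power_prime_power_nat_iff[OF q] by (simp add: square_ind_def)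
 \<comment> \<open>The square divisors of q^(e+2) are 1 and q^2 times those of q^e.\<close>
 have F2: "F (e + 2) = r (e + 2) + F e" for e
  unfolding F_def by (simp add: sum.atMost_Suc_shift si del: sum.atMost_Suc)
 have G2: "G (e + 2) = psi q ^ (e + 2) + psi q ^ (e + 1) + G e" for e by (simp add: G_def)
 have "F e = G e" for e
 proof (induction e rule: nat_less_induct)
  case (1 e)
  consider "e = 0" | "e = 1" | k where "e = k + 2" by (metis One_nat_def add_2_eq_Suc' not0_implies_Suc)
  thus ?case
  proof cases
   case 3
   thus ?thesis using 1 F2[of k] G2[of k] r(3)[of k] by simp
  qed (use r si[of 0] si[of 1] in \<open>simp_all add: F_def G_def\<close>)
 qed
 thus "dconv square_ind (%a. int (card (qroots C a))) (q ^ e) = dconv psi (%_. 1) (q ^ e)"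
  by (simp add: dconv_prime_power[OF q] F_def G_def r_def char_power)
qed

end

text \<open>4 (x^2 + x + C) = (2 x + 1)^2 - (1 - 4 C) with 2 invertible, so the roots correspond to
  the square roots of the discriminant modulo q.\<close>

lemma card_qroots_odd_prime:
 assumes q: "prime q" "2 < q"
 shows "int (card (qroots C q)) = 1 + Legendre (1 - 4 * C) q"
proof -
 define D where "D = 1 - 4 * C"
 have pq: "prime (int q)" using q by simp
 have oq: "odd q" using q prime_odd_nat by simp
 have cop: "coprime (int q) 4" "coprime (int q) 2" using oq coprime_mult_right_iff[of "int q" 2 2] by auto
 have root: "int q dvd (int x)^2 + int x + C \<longleftrightarrow> int q dvd (2 * int x + 1)^2 - D" for x
 proof -
  have "(2 * int x + 1)^2 - D = 4 * ((int x)^2 + int x + C)" by (simp add: D_def sq_simps)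
  thus ?thesis by (simp only: coprime_dvd_mult_right_iff[OF cop(1)])
 qed
 have solve: "EX x. {x. x < q & int q dvd 2 * int x + 1 - y} = {x}" for y :: int
 proof -
  obtain w where w: "[2 * w = 1] (mod int q)" using cong_solve_coprime_int[of 2 "int q"] cop(2) by (auto simp: coprime_commute)
  define x where "x = nat ((y - 1) * w mod int q)"
  have q0: "int q > 0" using q by simp
  have x: "int x = (y - 1) * w mod int q" "x < q"
  proof -
   show "int x = (y - 1) * w mod int q" using q0 by (simp add: x_def)
   hence "int x < int q" using q0 by simp
   thus "x < q" by simp
  qed
  have "[2 * int x = 2 * ((y - 1) * w)] (mod int q)" unfolding x by (intro cong_mult cong_refl) (simp add: cong_mod)
  also have "2 * ((y - 1) * w) = (y - 1) * (2 * w)" by simp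
  also have "[(y - 1) * (2 * w) = (y - 1) * 1] (mod int q)" by (intro cong_mult cong_refl w)
  finally have xs: "int q dvd 2 * int x + 1 - y" by (simp add: cong_iff_dvd_diff alg)
  have "z = x" if "z < q" "int q dvd 2 * int z + 1 - y" for z
  proof -
   have "int q dvd (2 * int z + 1 - y) - (2 * int x + 1 - y)" by (rule dvd_diff[OF that(2) xs])
   moreover have "(2 * int z + 1 - y) - (2 * int x + 1 - y) = 2 * (int z - int x)" by simp
   ultimately have "int q dvd int z - int x" by (simp only: coprime_dvd_mult_right_iff[OF cop(2)])
   moreover have "\<bar>int z - int x\<bar> < int q" using that x by auto
   ultimately show ?thesis using dvd_imp_le_int[of "int z - int x" "int q"] by (cases "int z - int x = 0") auto
  qed
  hence "{z. z < q & int q dvd 2 * int z + 1 - y} = {x}" using x(2) xs by blast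
  thus ?thesis by blast
 qed
 show ?thesis
 proof (cases "Legendre D q = -1")
  case True
  have "qroots C q = {}"
  proof (rule ccontr)
   assume "qroots C q ~= {}"
   then obtain x where "int q dvd (2 * int x + 1)^2 - D" using root by (auto simp: qroots_def)
   hence "[(2 * int x + 1)\<^sup>2 = D] (mod int q)" by (simp add: cong_iff_dvd_diff)
   hence "QuadRes (int q) D" unfolding QuadRes_def by blast
   thus False using True by (simp add: Legendre_def split: if_splits)
  qed
  thus ?thesis using True by (simp add: D_def)
 next
  case False
  then obtain y where y: "[y\<^sup>2 = D] (mod int q)"
  proof (cases "Legendre D q = 0")
   case True
   hence "[0\<^sup>2 = D] (mod int q)" by (simp add: Legendre_eq_0_iff cong_iff_dvd_diff)
   thus ?thesis using that by blast
  next
   case False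
   with \<open>Legendre D q ~= -1\<close> show ?thesis using that by (auto simp: Legendre_def QuadRes_def split: if_splits)
  qed
  have iff: "int q dvd (2 * int x + 1)^2 - D \<longleftrightarrow> int q dvd 2 * int x + 1 - y \<or> int q dvd 2 * int x + 1 - (- y)" for x
  proof -
   have "int q dvd (2 * int x + 1)^2 - D \<longleftrightarrow> int q dvd (2 * int x + 1)^2 - y^2"
   proof -
    have "int q dvd y^2 - D" using y by (simp only: cong_iff_dvd_diff)
    moreover have "(2 * int x + 1)^2 - D = ((2 * int x + 1)^2 - y^2) + (y^2 - D)" by simp
    ultimately show ?thesis by (simp only: dvd_add_left_iff)
   qed
   also have "(2 * int x + 1)^2 - y^2 = (2 * int x + 1 - y) * (2 * int x + 1 - (- y))"
    by (simp add: sq_simps)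
   finally show ?thesis by (simp only: prime_dvd_mult_iff[OF pq])
  qed
  obtain a b where a: "{x. x < q & int q dvd 2 * int x + 1 - y} = {a}" and b: "{x. x < q & int q dvd 2 * int x + 1 - (- y)} = {b}"
   using solve[of y] solve[of "- y"] by blast
  have un: "qroots C q = {a, b}" using a b iff root unfolding qroots_def by blast
  have "a = b \<longleftrightarrow> int q dvd y"
  proof
   assume "a = b"
   hence "int q dvd 2 * int a + 1 - (- y)" "int q dvd 2 * int a + 1 - y" using a b by blast+
   hence "int q dvd (2 * int a + 1 - (- y)) - (2 * int a + 1 - y)" by (rule dvd_diff)
   moreover have "(2 * int a + 1 - (- y)) - (2 * int a + 1 - y) = 2 * y" by simp
   ultimately show "int q dvd y" by (simp only: coprime_dvd_mult_right_iff[OF cop(2)])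
  next
   assume d: "int q dvd y"
   have "int q dvd 2 * int x + 1 - y \<longleftrightarrow> int q dvd 2 * int x + 1 - (- y)" for x
   proof -
    have "2 * int x + 1 - (- y) = (2 * int x + 1 - y) + 2 * y" by simp
    thus ?thesis using d by (simp only: dvd_add_left_iff dvd_mult)
   qed
   hence "{a} = {b}" unfolding a[symmetric] b[symmetric] by simp
   thus "a = b" by simp
  qed
  also have "int q dvd y \<longleftrightarrow> int q dvd D"
  proof -
   have "int q dvd D \<longleftrightarrow> int q dvd y^2" using y by (metis cong_dvd_iff)
   thus ?thesis using prime_dvd_power_iff[OF pq, of 2 y] by simp
  qed
  finally have ab: "a = b \<longleftrightarrow> Legendre D q = 0" by (simp add: Legendre_eq_0_iff)
  have "Legendre D q = 0 \<or> Legendre D q = 1" using False Legendre_values[of D q] by auto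
  thus ?thesis using ab by (cases "a = b") (auto simp: un D_def)
 qed
qed

lemma card_qroots_2: "int (card (qroots C 2)) = (if even C then 2 else 0)"
proof -
 have "qroots C 2 = (if even C then {0, 1} else {})"
  by (auto simp: qroots_def less_2_cases_iff)
 thus ?thesis by simp
qed

section \<open>The characters of the discriminants -p and p1 p2\<close>

definition leg :: "nat => nat => int" where "leg p n = Legendre (int n) (int p)"

lemma leg_mult: "prime p ==> 2 < p ==> leg p (m * n) = leg p m * leg p n"
 by (simp add: leg_def Legendre_mult)

lemma leg_1: "prime p ==> leg p 1 = 1"
 by (simp add: leg_def Legendre_1)

lemma leg_values: "leg p n : {-1, 0, 1}"
 by (simp add: leg_def Legendre_values del: insert_iff)

lemma leg_eq_0_iff: "leg p n = 0 \<longleftrightarrow> p dvd n"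
 by (simp add: leg_def Legendre_eq_0_iff)

text \<open>For p = 3 mod 4 the sign in quadratic reciprocity is (-1 / q), which the change from p
  to - p absorbs.\<close>

lemma Legendre_minus_prime:
 assumes "prime p" "p mod 4 = 3" "prime q" "2 < q"
 shows "Legendre (- int p) q = leg p q"
proof (cases "q = p")
 case True
 thus ?thesis by (metis Legendre_eq_0_iff dvd_minus_iff dvd_refl leg_eq_0_iff)
next
 case False
 have p2: "2 < p" using assms(1,2) prime_ge_2_nat[of p] by (cases "p = 2") auto
 have "odd q" using assms by (metis prime_odd_nat)
 hence q4: "q mod 4 = 1 \<or> q mod 4 = 3" by (rule odd_mod_4)
 have "Legendre (- int p) q = Legendre (-1) q * Legendre p q"
  using Legendre_mult[OF assms(3,4), of "-1" "int p"] by simp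
 moreover have "Legendre (-1) q = (if q mod 4 = 1 then 1 else -1)" by (rule Legendre_minus_1[OF assms(3,4)])
 moreover have "Legendre p q * leg p q = (if q mod 4 = 3 then -1 else 1)"
  using Legendre_reciprocity[OF assms(1,3) p2 assms(4)] False assms(2) by (simp add: leg_def)
 ultimately show ?thesis using q4 Legendre_values[of p q] leg_values[of p q] by (auto split: if_splits)
qed

lemma leg_2:
 assumes "prime p" "p mod 4 = 3"
 shows "leg p 2 = (if p mod 8 = 7 then 1 else -1)"
proof -
 have "2 < p" using assms prime_ge_2_nat[of p] by (cases "p = 2") auto
 moreover have "p mod 8 = 3 \<or> p mod 8 = 7" using assms(2) by presburger
 ultimately show ?thesis using Legendre_2[OF assms(1)] by (auto simp: leg_def)
qed

lemma quad_char_neg_prime: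
 assumes p: "prime p" "p mod 4 = 3" and C: "1 - 4 * C = - int p"
 shows "quad_char C (leg p)"
proof
 have p2: "2 < p" using p prime_ge_2_nat[of p] by (cases "p = 2") auto
 show "leg p 1 = 1" by (rule leg_1[OF p(1)])
 show "leg p (m * n) = leg p m * leg p n" for m n by (rule leg_mult[OF p(1) p2])
 fix q :: nat assume q: "prime q"
 show "leg p q : {-1, 0, 1}" by (rule leg_values)
 show "int (card (qroots C q)) = 1 + leg p q"
 proof (cases "q = 2")
  case True
  have "int p = 4 * C - 1" using C by simp
  hence "even C \<longleftrightarrow> int p mod 8 = 7" by presburger
  moreover have "int p mod 8 = int (p mod 8)" by (simp add: zmod_int)
  ultimately have "even C \<longleftrightarrow> p mod 8 = 7" by simp
  thus ?thesis unfolding True card_qroots_2 leg_2[OF p] by simp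
 next
  case False
  hence "2 < q" using q prime_ge_2_nat[of q] by simp
  thus ?thesis using card_qroots_odd_prime[OF q, of C] Legendre_minus_prime[OF p q] C by simp
 qed
 show "leg p q = 0 \<longleftrightarrow> int q dvd 1 - 4 * C"
 proof -
  have "p dvd q \<longleftrightarrow> q dvd p" using primes_dvd_imp_eq p(1) q by metis
  thus ?thesis unfolding C leg_eq_0_iff by simp
 qed
 show "~ int q ^ 2 dvd 1 - 4 * C"
 proof
  assume "int q ^ 2 dvd 1 - 4 * C"
  hence "q ^ 2 dvd p" unfolding C by (metis dvd_minus_iff int_dvd_int_iff of_nat_power)
  hence "q * q dvd p" by (simp add: p2sq)
  thus False using p(1) q by (metis dvd_mult_cancel1 dvd_mult_left dvd_refl mult.right_neutral not_prime_1 prime_gt_0_nat primes_dvd_imp_eq nat_dvd_1_iff_1)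
 qed
qed

lemma quad_char_prime_product:
 assumes p1: "prime p1" "p1 mod 4 = 3" and p2: "prime p2" "p2 mod 4 = 3" and ne: "p1 ~= p2"
  and C: "1 - 4 * C = int p1 * int p2"
 shows "quad_char C (%n. leg p1 n * leg p2 n)"
proof
 have g: "2 < p1" "2 < p2" using p1 p2 prime_ge_2_nat[of p1] prime_ge_2_nat[of p2] by (cases "p1 = 2"; cases "p2 = 2"; auto)+
 show "leg p1 1 * leg p2 1 = 1" using leg_1[OF p1(1)] leg_1[OF p2(1)] by simp
 show "leg p1 (m * n) * leg p2 (m * n) = leg p1 m * leg p2 m * (leg p1 n * leg p2 n)" for m n
  by (simp add: leg_mult[OF p1(1) g(1)] leg_mult[OF p2(1) g(2)])
 fix q :: nat assume q: "prime q"
 show "leg p1 q * leg p2 q : {-1, 0, 1}" using leg_values[of p1 q] leg_values[of p2 q] by auto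
 show "int (card (qroots C q)) = 1 + leg p1 q * leg p2 q"
 proof (cases "q = 2")
  case True
  have m: "p1 mod 8 = 3 \<or> p1 mod 8 = 7" "p2 mod 8 = 3 \<or> p2 mod 8 = 7" using p1(2) p2(2) by presburger+
  have "even C \<longleftrightarrow> (int p1 * int p2) mod 8 = 1" unfolding C[symmetric] by presburger
  also have "(int p1 * int p2) mod 8 = int ((p1 mod 8) * (p2 mod 8) mod 8)" by (simp add: zmod_int mod_mult_eq)
  finally show ?thesis unfolding True card_qroots_2 leg_2[OF p1] leg_2[OF p2] using m by auto
 next
  case False
  hence "2 < q" using q prime_ge_2_nat[of q] by simp
  \<comment> \<open>A product of two prime discriminants: p1 p2 = (- p1) (- p2), and for each of
    them reciprocity has no sign.\<close>
  moreover have "Legendre (int p1 * int p2) q = leg p1 q * leg p2 q"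
   using Legendre_mult[OF q \<open>2 < q\<close>, of "- int p1" "- int p2"] Legendre_minus_prime[OF p1 q] Legendre_minus_prime[OF p2 q] \<open>2 < q\<close> by simp
  ultimately show ?thesis using card_qroots_odd_prime[OF q, of C] C by simp
 qed
 have dv: "q dvd p1 \<longleftrightarrow> p1 dvd q" "q dvd p2 \<longleftrightarrow> p2 dvd q" using primes_dvd_imp_eq p1 p2 q by metis+
 have Cn: "1 - 4 * C = int (p1 * p2)" using C by simp
 show "leg p1 q * leg p2 q = 0 \<longleftrightarrow> int q dvd 1 - 4 * C"
  unfolding Cn mult_eq_0_iff leg_eq_0_iff int_dvd_int_iff prime_dvd_mult_iff[OF q] dv by simp
 show "~ int q ^ 2 dvd 1 - 4 * C"
 proof
  assume "int q ^ 2 dvd 1 - 4 * C"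
  hence d: "q * q dvd p1 * p2" unfolding Cn by (metis int_dvd_int_iff of_nat_power p2sq)
  hence "q dvd p1 * p2" by (rule dvd_mult_left)
  hence "q = p1 \<or> q = p2" using q p1 p2 by (metis prime_dvd_mult_iff primes_dvd_imp_eq)
  hence "p1 dvd p2 \<or> p2 dvd p1" using d g by (auto simp: mult.commute[of p1 p2])
  thus False using ne p1 p2 by (metis primes_dvd_imp_eq)
 qed
qed

subsection \<open>Ideals of quadratic orders as binary forms\<close>

lemma int_subgroup_generator:
 fixes S :: "int set"
 assumes "!!x y. x : S ==> y : S ==> x - y : S" and "z : S" "z ~= 0"
 shows "EX g>0. g : S & (\<forall>y\<in>S. g dvd y)"
proof -
 have 0: "0 : S" using assms(1)[OF assms(2,2)] by simp
 have neg: "- x : S" if "x : S" for x using assms(1)[OF 0 that] by simp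
 have add: "x + y : S" if "x : S" "y : S" for x y using assms(1)[OF that(1) neg[OF that(2)]] by simp
 have mult: "n * x : S" if "x : S" for x n :: int
 proof (induction n rule: int_induct[of _ 0])
  case (step1 i) thus ?case using add[of "i * x" x] that by (simp add: alg)
 next
  case (step2 i) thus ?case using assms(1)[of "i * x" x] that by (simp add: alg)
 qed (use 0 in simp)
 define n where "n = (LEAST n. n > 0 & int n : S)"
 have "nat \<bar>z\<bar> > 0 & int (nat \<bar>z\<bar>) : S" using assms(2,3) neg by (auto simp: abs_if)
 hence n: "n > 0" "int n : S" unfolding n_def by (smt (verit, best) LeastI)+
 have "int n dvd y" if "y : S" for y
 proof -
  have "y mod int n : S" using assms(1)[OF that mult[OF n(2), of "y div int n"]] by (simp add: minus_div_mult_eq_mod)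
  moreover have m: "y mod int n < int n" "y mod int n >= 0" using n by auto
  ultimately have "y mod int n > 0 ==> n <= nat (y mod int n)" unfolding n_def by (intro Least_le) auto
  hence "y mod int n = 0" using m by linarith
  thus ?thesis by auto
 qed
 thus ?thesis using n by (intro exI[of _ "int n"]) auto
qed

section \<open>Arithmetic of a quadratic field in coordinates\<close>

locale quad_disc =
 fixes D C :: int
 assumes D: "D = 1 - 4 * C"
  and nonsquare: "!!r :: rat. r\<^sup>2 ~= of_int D"
  and squarefree: "!!q. prime q ==> ~ (int q)^2 dvd D"
begin

definition sqD :: complex where "sqD = csqrt (of_int D)"

definition emb :: "rat => rat => complex" where "emb x y = of_rat x + of_rat y * sqD"

lemma D_rat: "of_int D = (1 - 4 * of_int C :: rat)" by (simp add: D)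

lemma sqD_sq: "sqD * sqD = of_int D"
 using power2_csqrt[of "of_int D"] by (simp add: sqD_def p2sq)

lemma odd_D: "odd D" by (simp add: D)

lemma emb_eq_0 [simp]: "emb x y = 0 \<longleftrightarrow> x = 0 & y = 0"
proof
 assume e: "emb x y = 0"
 show "x = 0 & y = 0"
 proof (cases "y = 0")
  case False
  have "of_rat (x * x) = (of_rat (y * y * of_int D) :: complex)"
  proof -
   have "of_rat x = - (of_rat y * sqD)" using e by (simp add: emb_def eq_neg_iff_add_eq_0)
   hence "of_rat x * of_rat x = of_rat y * of_rat y * (sqD * sqD)" by simp
   thus ?thesis by (simp add: sqD_sq of_rat_mult)
  qed
  hence "x * x = y * y * of_int D" by (simp only: of_rat_eq_iff)
  hence "(x / y)^2 = of_int D" using False by (simp add: p2sq field_simps)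
  thus ?thesis using nonsquare by blast
 qed (use e in \<open>simp add: emb_def\<close>)
qed (simp add: emb_def)

lemma emb_add: "emb x y + emb u v = emb (x + u) (y + v)"
 by (simp add: emb_def of_rat_add alg)

lemma emb_diff: "emb x y - emb u v = emb (x - u) (y - v)"
 by (simp add: emb_def of_rat_diff alg)

lemma emb_minus: "- emb x y = emb (- x) (- y)"
 by (simp add: emb_def of_rat_minus alg)

lemma emb_mult: "emb x y * emb u v = emb (x * u + of_int D * y * v) (x * v + y * u)"
proof -
 have "emb x y * emb u v = of_rat x * of_rat u + of_rat y * of_rat v * (sqD * sqD) + (of_rat x * of_rat v + of_rat y * of_rat u) * sqD"
  by (simp add: emb_def alg)
 thus ?thesis by (simp add: sqD_sq emb_def of_rat_add of_rat_mult alg)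
qed

lemma of_rat_emb: "of_rat x = emb x 0" by (simp add: emb_def)
lemma of_int_emb: "of_int n = emb (of_int n) 0" by (simp add: emb_def)
lemma one_emb: "1 = emb 1 0" by (simp add: emb_def)

lemma emb_eq_iff [simp]: "emb x y = emb u v \<longleftrightarrow> x = u & y = v"
 using emb_eq_0[of "x - u" "y - v"] by (simp add: emb_diff[symmetric])

text \<open>Coordinates with respect to 1 and sqrt D serve to define the Galois conjugation
  \<open>cj\<close>; complex conjugation would not do, as it is trivial on the field for D >
  0.\<close>

definition cr :: "complex => rat" where "cr z = (THE x. EX y. z = emb x y)"
definition ci :: "complex => rat" where "ci z = (THE y. EX x. z = emb x y)"
definition cj :: "complex => complex" where "cj z = emb (cr z) (- ci z)"
definition nm :: "complex => rat" where "nm z = (cr z)^2 - of_int D * (ci z)^2"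

lemma cr_emb [simp]: "cr (emb x y) = x" and ci_emb [simp]: "ci (emb x y) = y"
 by (auto simp: cr_def ci_def)

lemma cj_emb [simp]: "cj (emb x y) = emb x (- y)" by (simp add: cj_def)
lemma nm_emb [simp]: "nm (emb x y) = x^2 - of_int D * y^2" by (simp add: nm_def)

abbreviation "K \<equiv> quad_field D"
abbreviation "R \<equiv> quad_order D"

lemma K_iff: "z : K \<longleftrightarrow> (EX x y. z = emb x y)"
 by (auto simp: quad_field_def emb_def sqD_def)

lemma K_emb [simp, intro]: "emb x y : K" by (auto simp: K_iff)

lemma K_mult [intro]: "z : K ==> w : K ==> z * w : K" by (auto simp: K_iff emb_mult)
lemma K_cj [intro]: "z : K ==> cj z : K" by (auto simp: K_iff)
lemma K_of_rat [intro]: "of_rat x : K" by (simp add: of_rat_emb)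

lemma nm_mult: "z : K ==> w : K ==> nm (z * w) = nm z * nm w"
 by (auto simp: K_iff emb_mult sq_simps)

lemma cj_mult: "z : K ==> w : K ==> cj (z * w) = cj z * cj w"
 by (auto simp: K_iff emb_mult)

lemma cj_cj: "z : K ==> cj (cj z) = z" by (auto simp: K_iff)
lemma nm_cj: "z : K ==> nm (cj z) = nm z" by (auto simp: K_iff)

lemma mult_cj: "z : K ==> z * cj z = of_rat (nm z)"
 by (auto simp: K_iff emb_mult of_rat_emb sq_simps)

lemma nm_eq_0_iff: "z : K ==> nm z = 0 \<longleftrightarrow> z = 0"
proof
 assume "z : K" "nm z = 0"
 hence "z * cj z = 0" using mult_cj[of z] by simp
 thus "z = 0" using \<open>z : K\<close> by (auto simp: K_iff)
next
 have "nm (emb 0 0) = 0" by simp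
 moreover have "emb 0 0 = 0" by simp
 ultimately show "z = 0 ==> nm z = 0" by simp
qed

lemma K_inverse: "z : K ==> inverse z : K"
proof (cases "z = 0")
 case False
 assume z: "z : K"
 hence "nm z ~= 0" using False nm_eq_0_iff by simp
 hence "of_rat (nm z) * of_rat (inverse (nm z)) = (1 :: complex)" by (simp flip: of_rat_mult)
 hence "inverse z = cj z * of_rat (inverse (nm z))"
  by (intro inverse_unique) (simp only: mult_cj[OF z] mult.assoc[symmetric])
 thus ?thesis using z by auto
qed auto

lemma K_divide [intro]: "z : K ==> w : K ==> z / w : K"
 using K_inverse[of w] by (simp add: divide_inverse K_mult)

lemma R_iff: "z : R \<longleftrightarrow> (EX t u :: int. z = emb (of_int t / 2) (of_int u / 2) & even (t + u))"
proof
 assume "z : R"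
 then obtain x y where z: "z = of_int x + of_int y * ((of_int D + sqD) / 2)"
  by (auto simp: quad_order_def sqD_def)
 have "z = emb (of_int (2 * x + y * D) / 2) (of_int y / 2)"
  unfolding z by (simp add: emb_def of_rat_add of_rat_divide of_rat_mult field_simps)
 moreover have "even ((2 * x + y * D) + y)" using odd_D by auto
 ultimately show "EX t u :: int. z = emb (of_int t / 2) (of_int u / 2) & even (t + u)" by blast
next
 assume "EX t u :: int. z = emb (of_int t / 2) (of_int u / 2) & even (t + u)"
 then obtain t u :: int where z: "z = emb (of_int t / 2) (of_int u / 2)" "even (t + u)" by blast
 hence "even (t - u * D)" using odd_D by auto
 then obtain x where x: "t = 2 * x + u * D" by (metis dvdE diff_eq_eq)
 have "z = of_int x + of_int u * ((of_int D + sqD) / 2)"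
  unfolding z x by (simp add: emb_def of_rat_add of_rat_divide of_rat_mult field_simps)
 thus "z : R" by (auto simp: quad_order_def sqD_def)
qed

lemma R_K: "z : R ==> z : K" by (auto simp: R_iff)
lemma R_cj: "z : R ==> cj z : R"
 unfolding R_iff by (elim exE conjE, rule_tac x = t in exI, rule_tac x = "- u" in exI) auto
lemma R_of_int: "of_int n : R"
 unfolding R_iff of_int_emb by (intro exI[of _ "2 * n"] exI[of _ 0]) auto
lemma R_diff: "z : R ==> w : R ==> z - w : R"
 unfolding R_iff
proof (elim exE conjE)
 fix t u t' u' assume "z = emb (of_int t / 2) (of_int u / 2)" "even (t + u)" "w = emb (of_int t' / 2) (of_int u' / 2)" "even (t' + u')"
 thus "EX t u. z - w = emb (of_int t / 2) (of_int u / 2) & even (t + u)"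
  by (intro exI[of _ "t - t'"] exI[of _ "u - u'"]) (auto simp: emb_diff diff_divide_distrib)
qed
lemma R_mult: "z : R ==> w : R ==> z * w : R"
 unfolding R_iff
proof (elim exE conjE)
 fix t u t' u' assume z: "z = emb (of_int t / 2) (of_int u / 2)" "even (t + u)" and w: "w = emb (of_int t' / 2) (of_int u' / 2)" "even (t' + u')"
 obtain k where k: "t = 2 * k - u" using z(2) by (metis dvdE add_diff_cancel_right')
 obtain k' where k': "t' = 2 * k' - u'" using w(2) by (metis dvdE add_diff_cancel_right')
 define T where "T = 2 * k * k' - k * u' - u * k' + u * u' * (1 - 2 * C)"
 define U where "U = k * u' + u * k' - u * u'"
 have eq: "of_int t * of_int t' + of_int D * of_int u * of_int u' = 2 * (of_int T :: rat)" "of_int t * of_int u' + of_int u * of_int t' = 2 * (of_int U :: rat)"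
  unfolding k k' T_def U_def D_rat by (simp_all add: alg)
 have "of_int t / 2 * (of_int t' / 2) + of_int D * (of_int u / 2) * (of_int u' / 2) = (of_int T / 2 :: rat)"
  "of_int t / 2 * (of_int u' / 2) + of_int u / 2 * (of_int t' / 2) = (of_int U / 2 :: rat)"
  using eq by (simp_all add: field_simps)
 hence "z * w = emb (of_int T / 2) (of_int U / 2)" unfolding z w emb_mult by simp
 moreover have "even (T + U)" unfolding T_def U_def by (simp add: alg)
 ultimately show "EX t u. z * w = emb (of_int t / 2) (of_int u / 2) & even (t + u)" by blast
qed
lemma R_add: "z : R ==> w : R ==> z + w : R"
 using R_diff[of z "0 - w"] R_diff[of 0 w] R_of_int[of 0] by simp

lemma R_nm: "z : R ==> EX n. nm z = of_int n"
proof -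
 assume "z : R"
 then obtain t u where z: "z = emb (of_int t / 2) (of_int u / 2)" "even (t + u)" by (auto simp: R_iff)
 obtain k where k: "t = 2 * k - u" using z(2) by (metis dvdE add_diff_cancel_right')
 have "nm z = of_int (k * k - k * u + C * u * u)"
  unfolding z(1) nm_emb k D_rat by (simp add: p2sq field_simps)
 thus ?thesis by blast
qed

text \<open>The form a x^2 + b x y + c y^2 of discriminant D is stored as (a, b), with c =
  \<open>cc a b\<close>. Its lattice Z a + Z (b + sqrt D) / 2 is a primitive ideal of norm a;
  \<open>pt\<close> parametrises it, and the norm of a point is a times the value of the
  form.\<close>

definition is_form :: "int => int => bool" where
 "is_form a b \<longleftrightarrow> a > 0 & 4 * a dvd b^2 - D"

definition cc :: "int => int => int" where "cc a b = (b^2 - D) div (4 * a)"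

definition qf :: "int => int => int => int => int" where
 "qf a b x y = a * x^2 + b * x * y + cc a b * y^2"

definition pt :: "int => int => int => int => complex" where
 "pt a b x y = emb (of_int a * of_int x + of_int b * of_int y / 2) (of_int y / 2)"

definition lat :: "int => int => complex set" where "lat a b = {pt a b x y | x y. True}"

definition scale :: "complex => complex set => complex set" where "scale c I = (%z. c * z) ` I"

lemma form_eq: "is_form a b ==> b^2 - D = 4 * a * cc a b"
 by (simp add: is_form_def cc_def)

lemma form_odd: "is_form a b ==> odd b"
proof
 assume "is_form a b" "even b"
 hence "even (b^2 - D)" using form_eq[of a b] by simp
 thus False using odd_D \<open>even b\<close> by simp
qed

lemma form_pos: "is_form a b ==> a > 0" by (simp add: is_form_def)

lemma form_eq_rat: "is_form a b ==> of_int D = (of_int b)^2 - 4 * of_int a * (of_int (cc a b) :: rat)"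
proof -
 assume "is_form a b"
 hence "D = b^2 - 4 * a * cc a b" using form_eq[of a b] by simp
 from arg_cong[OF this, of "of_int :: int => rat"] show ?thesis by simp
qed

lemma nm_pt: "is_form a b ==> nm (pt a b x y) = of_int (a * qf a b x y)"
 by (simp add: pt_def qf_def form_eq_rat[of a b] p2sq field_simps)

lemma pt_eq_0: "is_form a b ==> pt a b x y = 0 \<longleftrightarrow> x = 0 & y = 0"
 using form_pos[of a b] by (auto simp: pt_def)

lemma pt_inj: "is_form a b ==> pt a b x y = pt a b x' y' \<longleftrightarrow> x = x' & y = y'"
 using form_pos[of a b] by (auto simp: pt_def)

lemma pt_K [intro, simp]: "pt a b x y : K" by (simp add: pt_def)

lemma pt_R: "is_form a b ==> pt a b x y : R"
proof -
 assume "is_form a b"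
 hence "odd b" by (rule form_odd)
 hence "even ((2 * a * x + b * y) + y)" by simp
 moreover have "pt a b x y = emb (of_int (2 * a * x + b * y) / 2) (of_int y / 2)"
  by (simp add: pt_def field_simps)
 ultimately show ?thesis unfolding R_iff by blast
qed

lemma pt_diff: "pt a b x y - pt a b x' y' = pt a b (x - x') (y - y')"
 by (simp add: pt_def emb_diff alg diff_divide_distrib)

text \<open>For t^2 - D u^2 = 4 this matrix is the classical automorph of the form (a, b).\<close>

lemma mult_pt:
 assumes f: "is_form a b" and e: "even (t + u)"
 shows "emb (of_int t / 2) (of_int u / 2) * pt a b x y =
  pt a b ((t - b * u) div 2 * x - cc a b * u * y) (a * u * x + (t + b * u) div 2 * y)"
proof -
 have ob: "odd b" by (rule form_odd[OF f])
 have "even (t - b * u)" "even (t + b * u)" using ob e by auto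
 obtain k where k: "t - b * u = 2 * k" using \<open>even (t - b * u)\<close> by (metis dvdE)
 hence t: "t = 2 * k + b * u" by simp
 have l: "(t + b * u) div 2 = k + b * u" unfolding t by simp
 have l': "(t - b * u) div 2 = k" unfolding k by simp
 show ?thesis
  unfolding pt_def emb_mult l l' emb_eq_iff unfolding t
  by (simp add: form_eq_rat[OF f] p2sq field_simps)
qed

end

lemma card_quotient_eq:
 assumes R: "equiv A R" and S: "equiv B S" and g: "!!x. x : B ==> g x : A"
  and iff: "!!x y. x : B ==> y : B ==> (x, y) : S \<longleftrightarrow> (g x, g y) : R"
  and onto: "!!z. z : A ==> \<exists>x\<in>B. (g x, z) : R"
 shows "card (A // R) = card (B // S)"
proof -
 define h where "h c = (\<Union>x\<in>c. R `` {g x})" for c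
 have h: "h (S `` {x}) = R `` {g x}" if "x : B" for x
 proof -
  have "R `` {g y} = R `` {g x}" if "y : S `` {x}" for y
  proof -
   have "y : B" "(x, y) : S" using that S by (auto simp: equiv_def refl_on_def)
   hence "(g x, g y) : R" using iff \<open>x : B\<close> by blast
   thus ?thesis using R by (metis equiv_class_eq)
  qed
  moreover have "x : S `` {x}" by (rule equiv_class_self[OF S that])
  ultimately show ?thesis unfolding h_def by blast
 qed
 have "bij_betw h (B // S) (A // R)"
  unfolding bij_betw_def
 proof
  show "inj_on h (B // S)"
  proof (rule inj_onI)
   fix c d assume cd: "c : B // S" "d : B // S" "h c = h d"
   then obtain x y where x: "x : B" "c = S `` {x}" and y: "y : B" "d = S `` {y}" by (auto elim!: quotientE)
   have "R `` {g x} = R `` {g y}" using cd(3) h x y by simp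
   hence "(g x, g y) : R" using eq_equiv_class_iff[OF R] g x y by blast
   thus "c = d" using iff x y eq_equiv_class_iff[OF S] by blast
  qed
  show "h ` (B // S) = A // R"
  proof (intro equalityI subsetI)
   fix c assume "c : h ` (B // S)"
   then obtain x where "x : B" "c = R `` {g x}" using h by (auto elim!: quotientE)
   thus "c : A // R" using g by (auto intro: quotientI)
  next
   fix c assume "c : A // R"
   then obtain z where z: "z : A" "c = R `` {z}" by (auto elim!: quotientE)
   then obtain x where x: "x : B" "(g x, z) : R" using onto by blast
   hence "c = h (S `` {x})" using h z R by (metis equiv_class_eq)
   thus "c : h ` (B // S)" using x by (auto intro: quotientI)
  qed
 qed
 thus ?thesis by (metis bij_betw_same_card)
qed

section \<open>Lattices of forms as ideals\<close>

context quad_disc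
begin

lemma scale_scale: "scale c (scale d I) = scale (c * d) I"
 by (auto simp: scale_def image_image mult.assoc)

lemma scale_1 [simp]: "scale 1 I = I" by (simp add: scale_def)

lemma scale_mem: "z : I ==> c * z : scale c I" unfolding scale_def by (rule imageI)

lemma scale_mono: "I \<subseteq> J ==> scale c I \<subseteq> scale c J" by (auto simp: scale_def)

lemma scale_cancel: "c ~= 0 ==> scale c I = J \<longleftrightarrow> I = scale (inverse c) J"
 by (metis left_inverse right_inverse scale_1 scale_scale)

lemma lat_pt [simp, intro]: "pt a b x y : lat a b" by (auto simp: lat_def)

lemma lat_diff: "z : lat a b ==> w : lat a b ==> z - w : lat a b"
 by (auto simp: lat_def) (metis pt_diff)

lemma pt_0 [simp]: "pt a b 0 0 = 0" by (simp add: pt_def)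

lemma lat_0: "0 : lat a b" by (metis pt_0 lat_pt)

lemma lat_uminus: "z : lat a b ==> - z : lat a b" using lat_diff[OF lat_0] by fastforce

lemma lat_add: "z : lat a b ==> w : lat a b ==> z + w : lat a b"
 using lat_diff[of z a b "- w"] lat_uminus by simp

lemma scale_lat_diff: "z : scale c (lat a b) ==> w : scale c (lat a b) ==> z - w : scale c (lat a b)"
 using lat_diff scale_mem[of _ "lat a b" c] by (auto simp: scale_def simp flip: right_diff_distrib)

lemma lat_K: "z : lat a b ==> z : K" by (auto simp: lat_def)

lemma lat_R: "is_form a b ==> lat a b \<subseteq> R" using pt_R by (auto simp: lat_def)

lemma lat_mult_R:
 assumes "is_form a b" "r : R" "z : lat a b" shows "r * z : lat a b"
proof -
 obtain t u where r: "r = emb (of_int t / 2) (of_int u / 2)" "even (t + u)" using assms(2) unfolding R_iff by blast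
 obtain x y where z: "z = pt a b x y" using assms(3) by (auto simp: lat_def)
 show ?thesis unfolding r(1) z mult_pt[OF assms(1) r(2)] by (rule lat_pt)
qed

lemma scale_minus_lat: "scale (- 1) (lat a b) = lat a b"
proof
 show "scale (- 1) (lat a b) \<subseteq> lat a b" using lat_uminus by (auto simp: scale_def)
 hence "scale (- 1) (scale (- 1) (lat a b)) \<subseteq> scale (- 1) (lat a b)" by (rule scale_mono)
 thus "lat a b \<subseteq> scale (- 1) (lat a b)" by (simp add: scale_scale)
qed

lemma is_form_uminus: "is_form a b ==> is_form a (- b)" by (simp add: is_form_def)
lemma cc_uminus: "cc a (- b) = cc a b" by (simp add: cc_def)

lemma cj_pt: "cj (pt a b x y) = pt a (- b) x (- y)" by (simp add: pt_def)

lemma pt_theta: "pt a b x y = of_int (a * x) + of_int y * pt a b 0 1"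
 unfolding pt_def of_int_emb emb_mult emb_add by simp

lemma cj_pt_theta: "cj (pt a b x y) = of_int (a * x) + of_int y * cj (pt a b 0 1)"
 using pt_theta[of a "-b" x "-y"] pt_theta[of a "-b" 0 "-1"] by (simp add: cj_pt)

lemma theta_norm: "is_form a b ==> pt a b 0 1 * cj (pt a b 0 1) = of_int (a * cc a b)"
 using mult_cj[of "pt a b 0 1"] nm_pt[of a b 0 1] by (simp add: qf_def del: of_int_mult)

lemma theta_trace: "pt a b 0 1 + cj (pt a b 0 1) = of_int b"
 by (simp add: pt_def emb_add of_int_emb)

lemma pt_mult_cj_pt:
 assumes f: "is_form a b"
 shows "\<exists>r\<in>R. pt a b x y * cj (pt a b x' y') = of_int a * r"
proof
 define t where "t = pt a b 0 1"
 have t: "t : R" unfolding t_def by (rule pt_R[OF f])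
 show "of_int (a * x * x') + of_int (x * y') * cj t + of_int (x' * y) * t + of_int (y * y' * cc a b) : R"
  by (intro R_add R_mult R_of_int R_cj t)
 have "pt a b x y * cj (pt a b x' y') = of_int a * (of_int (a * x * x') + of_int (x * y') * cj t + of_int (x' * y) * t) + of_int (y * y') * (t * cj t)"
  unfolding pt_theta[of a b x y] cj_pt_theta[of a b x' y'] t_def by (simp add: alg)
 also have "t * cj t = of_int (a * cc a b)" unfolding t_def by (rule theta_norm[OF f])
 finally show "pt a b x y * cj (pt a b x' y') = of_int a * (of_int (a * x * x') + of_int (x * y') * cj t + of_int (x' * y) * t + of_int (y * y' * cc a b))"
  by (simp add: alg)
qed

text \<open>The square of a prime dividing all three coefficients would divide D = b^2 - 4 a
  c.\<close>

lemma form_coprime: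
 assumes f: "is_form a b"
 shows "EX i j k. i * a + j * b + k * cc a b = 1"
proof -
 define g where "g = gcd a (gcd b (cc a b))"
 have "g = 1"
 proof (rule ccontr)
  assume "g ~= 1"
  moreover have "g > 0" using form_pos[OF f] by (simp add: g_def)
  ultimately have "nat g ~= 1" by simp
  then obtain p where p: "prime p" "p dvd nat g" using prime_factor_nat by blast
  hence "int p dvd g" using \<open>g > 0\<close> by (metis int_dvd_int_iff int_nat_eq less_imp_le)
  hence d: "int p dvd a" "int p dvd b" "int p dvd cc a b" by (auto simp: g_def)
  have "(int p)^2 dvd 4 * (a * cc a b)"
   unfolding p2sq by (intro dvd_mult mult_dvd_mono d)
  hence "(int p)^2 dvd b^2 - 4 * (a * cc a b)"
   by (intro dvd_diff dvd_power_same d)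
  also have "b^2 - 4 * (a * cc a b) = D" using form_eq[OF f] by simp
  finally show False using squarefree[OF p(1)] by simp
 qed
 moreover obtain u v where "u * a + v * gcd b (cc a b) = gcd a (gcd b (cc a b))" using bezout_int by blast
 moreover obtain u' v' where "u' * b + v' * cc a b = gcd b (cc a b)" using bezout_int by blast
 ultimately have "u * a + v * (u' * b + v' * cc a b) = 1" by (simp add: g_def)
 hence "u * a + (v * u') * b + (v * v') * cc a b = 1" by (simp add: alg)
 thus ?thesis by blast
qed

text \<open>This replaces the equation \<open>L * cj L = a R\<close> of ideals.\<close>

lemma lat_absorb:
 assumes f: "is_form a b"
 shows "EX i j k. \<forall>alp. alp * of_int a = (alp * pt a b 1 0) * cj (pt a b i j) + (alp * pt a b 0 1) * cj (pt a b j k)"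
proof -
 obtain i j k where e: "i * a + j * b + k * cc a b = 1" using form_coprime[OF f] by blast
 define t where "t = pt a b 0 1"
 have "pt a b 1 0 * cj (pt a b i j) + t * cj (pt a b j k)
   = of_int a * (of_int (a * i) + of_int j * cj t) + t * (of_int (a * j) + of_int k * cj t)"
  unfolding cj_pt_theta[of a b i j] cj_pt_theta[of a b j k] pt_theta[of a b 1 0] t_def by simp
 also have "... = of_int a * of_int (a * i) + of_int a * of_int j * (t + cj t) + of_int k * (t * cj t)"
  by (simp add: alg)
 also have "... = of_int (a * (i * a + j * b + k * cc a b))"
  unfolding t_def theta_trace theta_norm[OF f] by (simp add: alg)
 finally have "of_int a = pt a b 1 0 * cj (pt a b i j) + t * cj (pt a b j k)" using e by simp
 hence "\<forall>alp. alp * of_int a = (alp * pt a b 1 0) * cj (pt a b i j) + (alp * pt a b 0 1) * cj (pt a b j k)"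
  by (simp add: t_def alg)
 thus ?thesis by blast
qed

lemma cj_add: "z : K ==> w : K ==> cj (z + w) = cj z + cj w"
 by (auto simp: K_iff emb_add)

text \<open>The inverse of the lattice L is \<open>cj\<close> L / a: \<open>lat_absorb\<close>
  writes alp a as a combination of elements of alp L, which are integral, with coefficients in
  \<open>cj\<close> L.\<close>

lemma lat_colon:
 assumes f: "is_form a b" and alp: "alp : K" "scale alp (lat a b) \<subseteq> R"
 shows "cj (alp * of_int a) : lat a b"
proof -
 obtain i j k where e: "alp * of_int a = (alp * pt a b 1 0) * cj (pt a b i j) + (alp * pt a b 0 1) * cj (pt a b j k)"
  using lat_absorb[OF f] by blast
 have r: "alp * pt a b 1 0 : R" "alp * pt a b 0 1 : R" using alp(2) by (auto simp: scale_def)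
 have "cj (alp * of_int a) = cj (alp * pt a b 1 0) * pt a b i j + cj (alp * pt a b 0 1) * pt a b j k"
  unfolding e using r R_K by (simp add: cj_add cj_mult cj_cj K_mult K_cj)
 thus ?thesis using lat_mult_R[OF f R_cj] r lat_add by auto
qed

text \<open>Primitivity of the form, through \<open>lat_absorb\<close>, makes R the full ring of
  multipliers of the lattice.\<close>

lemma lat_multiplier:
 assumes f: "is_form a b" and s: "scale \<eta> (lat a b) \<subseteq> lat a b"
 shows "\<eta> : R"
proof -
 obtain i j k where e: "\<eta> * of_int a = (\<eta> * pt a b 1 0) * cj (pt a b i j) + (\<eta> * pt a b 0 1) * cj (pt a b j k)"
  using lat_absorb[OF f] by blast
 have "\<eta> * pt a b 1 0 : lat a b" "\<eta> * pt a b 0 1 : lat a b" using s by (auto simp: scale_def)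
 then obtain x y x' y' where l: "\<eta> * pt a b 1 0 = pt a b x y" "\<eta> * pt a b 0 1 = pt a b x' y'" by (auto simp: lat_def)
 obtain r r' where r: "r : R" "pt a b x y * cj (pt a b i j) = of_int a * r" "r' : R" "pt a b x' y' * cj (pt a b j k) = of_int a * r'"
  using pt_mult_cj_pt[OF f] by meson
 have "of_int a * \<eta> = of_int a * (r + r')" using e l r by (simp add: alg)
 hence "\<eta> = r + r'" using form_pos[OF f] by simp
 thus ?thesis using r R_add by simp
qed

text \<open>Hermite normal form. With omega = (1 + sqrt D) / 2 let m be the least positive integer
  in J, and x0 + g omega an element with the least positive omega-coordinate. Stability under omega
  forces g to divide m and x0, and division by g leaves the lattice of a form.\<close>

lemma integral_ideal_lat:
 assumes J: "J \<subseteq> R" "!!z w. z : J ==> w : J ==> z - w : J" "!!r z. r : R ==> z : J ==> r * z : J"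
  and nz: "z0 : J" "z0 ~= 0"
 shows "EX g a b. g > 0 & is_form a b & J = scale (of_int g) (lat a b)"
proof -
 define h where "h x y = emb (of_int x + of_int y / 2) (of_int y / 2)" for x y :: int
 have h_R: "h x y : R" for x y
  unfolding R_iff by (intro exI[of _ "2 * x + y"] exI[of _ y]) (simp add: h_def field_simps)
 have R_h: "EX x y. z = h x y" if zR: "z : R" for z
 proof -
  obtain t u where z: "z = emb (of_int t / 2) (of_int u / 2)" "even (t + u)" using zR unfolding R_iff by blast
  then obtain k where "t = 2 * k + u" by (metis even_diff dvdE diff_eq_eq)
  hence "z = h k u" using z by (simp add: h_def field_simps)
  thus ?thesis by blast
 qed
 have h_diff: "h x y - h x' y' = h (x - x') (y - y')" for x y x' y'
  by (simp add: h_def emb_diff alg diff_divide_distrib)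
 define \<omega> where "\<omega> = emb (1/2) (1/2)"
 have w: "\<omega> : R" unfolding R_iff \<omega>_def by (intro exI[of _ 1]) auto
 have h_w: "\<omega> * h x y = h (- C * y) (x + y)" for x y
  unfolding \<omega>_def h_def emb_mult emb_eq_iff D_rat by (simp add: field_simps)
 have h_int: "of_int n * h x y = h (n * x) (n * y)" for n x y
  unfolding of_int_emb h_def emb_mult by (simp add: alg)
 have h_inj: "h x y = h x' y' \<longleftrightarrow> x = x' & y = y'" for x y x' y' by (auto simp: h_def)
 define H where "H = {(x, y). h x y : J}"
 have Hd: "(x - x', y - y') : H" if "(x, y) : H" "(x', y') : H" for x y x' y'
  using that J(2) by (auto simp: H_def simp flip: h_diff)
 have Hi: "(n * x, n * y) : H" if "(x, y) : H" for n x y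
  using that J(3)[OF R_of_int[of n]] by (auto simp: H_def simp flip: h_int)
 have Hw: "(- C * y, x + y) : H" if "(x, y) : H" for x y
  using that J(3)[OF w, of "h x y"] by (simp only: H_def mem_Collect_eq case_prod_conv h_w)
 have H0: "(0, 0) : H" using J(2)[OF nz(1) nz(1)] by (simp add: H_def h_def emb_def)
 have z0: "z0 : R" using nz J by auto
 obtain n where n: "nm z0 = of_int n" using R_nm[OF z0] by blast
 have n0: "n ~= 0" using n nm_eq_0_iff[OF R_K[OF z0]] nz(2) by auto
 have "h n 0 = cj z0 * z0" using mult_cj[OF R_K[OF z0]] n by (simp add: h_def of_rat_emb mult.commute)
 hence nH: "n : {x. (x, 0) : H}" using J(3)[OF R_cj[OF z0] nz(1)] by (simp add: H_def)
 have "EX m>0. m : {x. (x, 0) : H} & (\<forall>y\<in>{x. (x, 0) : H}. m dvd y)"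
  by (rule int_subgroup_generator[OF _ nH n0]) (use Hd in fastforce)
 then obtain m where m: "m > 0" "(m, 0) : H" "!!x. (x, 0) : H ==> m dvd x" by blast
 have "EX g>0. g : {y. EX x. (x, y) : H} & (\<forall>y\<in>{y. EX x. (x, y) : H}. g dvd y)"
 proof (rule int_subgroup_generator)
  show "m : {y. EX x. (x, y) : H}" using Hw[OF m(2)] by auto
  show "m ~= 0" using m by simp
 qed (use Hd in blast)
 then obtain g x0 where g: "g > 0" "(x0, g) : H" "!!x y. (x, y) : H ==> g dvd y" by blast
 have H_iff: "(x, y) : H \<longleftrightarrow> (EX i j. x = m * i + x0 * j & y = g * j)" for x y
 proof
  assume xy: "(x, y) : H"
  then obtain j where j: "y = g * j" using g(3) by blast
  have "(x - j * x0, y - j * g) : H" using Hd[OF xy Hi[OF g(2), of j]] .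
  hence "m dvd x - j * x0" using m(3) j by (simp add: mult.commute)
  then obtain i where "x - j * x0 = m * i" by blast
  thus "EX i j. x = m * i + x0 * j & y = g * j" using j by (intro exI[of _ i] exI[of _ j]) (simp add: alg)
 next
  assume "EX i j. x = m * i + x0 * j & y = g * j"
  then obtain i j where ij: "x = m * i + x0 * j" "y = g * j" by blast
  have "(j * x0 - (- i) * m, j * g - (- i) * 0) : H" by (rule Hd[OF Hi[OF g(2)] Hi[OF m(2)]])
  thus "(x, y) : H" using ij by (simp add: alg)
 qed
 have "g dvd m" using g(3)[OF Hw[OF m(2)]] by simp
 then obtain a where a: "m = g * a" by blast
 have "g dvd x0 + g" using g(3)[OF Hw[OF g(2)]] .
 then obtain bet where bet: "x0 = g * bet" by (metis dvd_add_triv_right_iff dvdE)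
 have "a > 0" using a m(1) g(1) by (simp add: zero_less_mult_iff)
 obtain i j where ij: "- C * g = m * i + x0 * j" "x0 + g = g * j" using Hw[OF g(2)] H_iff by blast
 have "j = bet + 1" using ij(2) g(1) unfolding bet by (metis distrib_left less_irrefl mult.right_neutral mult_cancel_left)
 hence "g * (- C) = g * (a * i + bet * (bet + 1))" using ij(1) unfolding a bet by (simp add: alg)
 hence "- C = a * i + bet * (bet + 1)" using g(1) by (simp only: mult_cancel_left) simp
 hence "(2 * bet + 1)^2 - D = 4 * a * (- i)" unfolding D by (simp add: sq_simps)
 hence f: "is_form a (2 * bet + 1)" using \<open>a > 0\<close> by (simp add: is_form_def)
 have "J = scale (of_int g) (lat a (2 * bet + 1))"
 proof (intro equalityI subsetI)
  fix z assume z: "z : J"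
  then obtain x y where xy: "z = h x y" using R_h J(1) by blast
  then obtain i j where "x = m * i + x0 * j" "y = g * j" using z H_iff[of x y] by (auto simp: H_def)
  hence "z = of_int g * pt a (2 * bet + 1) i j"
   unfolding xy h_def pt_def of_int_emb emb_mult emb_eq_iff a bet by (simp add: field_simps)
  thus "z : scale (of_int g) (lat a (2 * bet + 1))" by (simp add: scale_mem)
 next
  fix z assume "z : scale (of_int g) (lat a (2 * bet + 1))"
  then obtain i j where z: "z = of_int g * pt a (2 * bet + 1) i j" by (auto simp: scale_def lat_def)
  have "z = h (m * i + x0 * j) (g * j)"
   unfolding z h_def pt_def of_int_emb emb_mult emb_eq_iff a bet by (simp add: field_simps)
  moreover have "(m * i + x0 * j, g * j) : H" using H_iff by blast
  ultimately show "z : J" by (simp add: H_def)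
 qed
 thus ?thesis using g(1) f by blast
qed

lemma fractional_ideal_lat:
 assumes "fractional_ideal D I" "I ~= {0}"
 shows "EX q a b. q > 0 & is_form a b & I = scale (of_rat q) (lat a b)"
proof -
 have I: "I \<subseteq> K" "0 : I" "!!a b. a : I ==> b : I ==> a - b : I" "!!r a. r : R ==> a : I ==> r * a : I"
  using assms(1) by (auto simp: fractional_ideal_def)
 obtain d where d: "d : R" "d ~= 0" "!!a. a : I ==> d * a : R"
  using assms(1) by (auto simp: fractional_ideal_def)
 obtain N where N: "nm d = of_int N" using R_nm[OF d(1)] by blast
 have N0: "N ~= 0" using N nm_eq_0_iff[OF R_K[OF d(1)]] d(2) by auto
 obtain z0 where z0: "z0 : I" "z0 ~= 0" using assms(2) I(2) by blast
 define J where "J = scale (of_int N) I"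
 have "EX g a b. g > 0 & is_form a b & J = scale (of_int g) (lat a b)"
 proof (rule integral_ideal_lat)
  show "J \<subseteq> R"
  proof
   fix z assume "z : J"
   then obtain w where w: "z = of_int N * w" "w : I" by (auto simp: J_def scale_def)
   have "z = cj d * (d * w)" using w mult_cj[OF R_K[OF d(1)]] N by (simp add: mult_ac)
   thus "z : R" using d(3)[OF w(2)] d(1) by (simp add: R_mult R_cj)
  qed
  show "z - w : J" if "z : J" "w : J" for z w
   using that I(3) by (auto simp: J_def scale_def simp flip: right_diff_distrib)
  show "r * z : J" if rz: "r : R" "z : J" for r z
  proof -
   obtain w where "z = of_int N * w" "w : I" using rz(2) by (auto simp: J_def scale_def)
   thus ?thesis using scale_mem[OF I(4)[OF rz(1)], of w "of_int N"] by (simp add: J_def mult.left_commute)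
  qed
  show "of_int N * z0 : J" "of_int N * z0 ~= 0" using z0 N0 by (auto simp: J_def scale_def)
 qed
 then obtain g a b where g: "g > 0" "is_form a b" "J = scale (of_int g) (lat a b)" by blast
 have "I = scale (inverse (of_int N)) J" using N0 scale_cancel[of "of_int N" I J] by (simp add: J_def)
 hence I': "I = scale (of_int g / of_int N) (lat a b)" using g(3) by (simp add: scale_scale field_simps)
 \<comment> \<open>N may be negative; a lattice is its own negative, so |N| serves as well.\<close>
 have "I = scale (of_rat (of_int g / of_int \<bar>N\<bar>)) (lat a b)"
 proof (cases "N > 0")
  case False
  have "scale (of_int g / of_int N) (lat a b) = scale (of_int g / of_int N) (scale (- 1) (lat a b))" by (simp add: scale_minus_lat)
  thus ?thesis using I' False by (simp add: scale_scale of_rat_divide of_rat_minus)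
 qed (use I' in \<open>simp add: of_rat_divide\<close>)
 moreover have "of_int g / of_int \<bar>N\<bar> > (0 :: rat)" using g N0 by simp
 ultimately show ?thesis using g(2) by blast
qed

text \<open>The second coordinates of the scaled lattice form (q / 2) Z, the elements with second
  coordinate 0 determine q a, and those with second coordinate q / 2 determine b modulo 2 a.\<close>

lemma scale_lat_unique:
 assumes f: "is_form a b" "is_form a' b'" and q: "q > 0" "q' > 0"
  and e: "scale (of_rat q) (lat a b) = scale (of_rat q') (lat a' b')"
 shows "q = q'" "a = a'" "[b = b'] (mod 2 * a)"
proof -
 have sub: "EX x y. q * (of_int a * of_int x0 + of_int b * of_int y0 / 2) = q' * (of_int a' * of_int x + of_int b' * of_int y / 2) & q * of_int y0 = q' * of_int y"
  if "scale (of_rat q) (lat a b) \<subseteq> scale (of_rat q') (lat a' b')" for q q' a b a' b' x0 y0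
 proof -
  have "of_rat q * pt a b x0 y0 : scale (of_rat q') (lat a' b')" using that scale_mem[OF lat_pt] by blast
  then obtain x y where "of_rat q * pt a b x0 y0 = of_rat q' * pt a' b' x y" by (auto simp: scale_def lat_def)
  thus ?thesis unfolding of_rat_emb pt_def emb_mult emb_eq_iff by (intro exI[of _ x] exI[of _ y]) simp
 qed
 note s1 = sub[OF equalityD1[OF e]] and s2 = sub[OF equalityD2[OF e]]
 have pos_unit: "m = 1" if "m * n = 1" "m > 0" for m n :: int
  using that by (metis pos_zmult_eq_1_iff)
 have eqI: "q = q'" if pq: "q > 0" "q' > 0" "q = q' * of_int m" "q' = q * of_int n" for q q' :: rat and m n
 proof -
  have "q * of_int n = q' * of_int m * of_int n" by (simp only: pq(3)[symmetric])
  hence "q' * of_int (m * n) = q' * of_int 1" unfolding pq(4)[symmetric] by (simp add: mult.assoc)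
  hence "m * n = 1" using pq(2) by (metis less_irrefl mult_cancel_left of_int_eq_iff)
  moreover have "m > 0" using pq by (metis of_int_0_less_iff zero_less_mult_pos)
  ultimately show ?thesis using pos_unit pq(3) by simp
 qed
 obtain x y where xy: "q * of_int 1 = q' * of_int y" using s1[of 0 1] by blast
 obtain x' y' where xy': "q' * of_int 1 = q * of_int y'" using s2[of 0 1] by blast
 show qq: "q = q'" by (rule eqI[OF q, of y y']) (use xy xy' in simp_all)
 obtain x y where 1: "q * (of_int a * of_int 1 + of_int b * of_int 0 / 2) = q' * (of_int a' * of_int x + of_int b' * of_int y / 2)" "q * of_int 0 = q' * of_int y"
  using s1[of 1 0] by blast
 obtain x' y' where 2: "q' * (of_int a' * of_int 1 + of_int b' * of_int 0 / 2) = q * (of_int a * of_int x' + of_int b * of_int y' / 2)" "q' * of_int 0 = q * of_int y'"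
  using s2[of 1 0] by blast
 have ea: "of_int a = of_int a' * (of_int x :: rat)" "of_int a' = of_int a * (of_int x' :: rat)"
  using 1 2 q qq by auto
 hence "(of_int a :: rat) = of_int a'" proof -
  have "(of_int a :: rat) > 0" "(of_int a' :: rat) > 0" using form_pos f by simp_all
  thus ?thesis by (rule eqI[OF _ _ ea])
 qed
 thus aa: "a = a'" by simp
 obtain x y where 3: "q * (of_int a * of_int 0 + of_int b * of_int 1 / 2) = q' * (of_int a' * of_int x + of_int b' * of_int y / 2)" "q * of_int 1 = q' * of_int y"
  using s1[of 0 1] by blast
 have "q * of_int b = q * (2 * of_int a * of_int x + of_int b' :: rat)" using 3 q qq aa by (simp add: field_simps)
 hence "of_int b = (2 * of_int a * of_int x + of_int b' :: rat)" using q by (simp only: mult_cancel_left) simp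
 hence "(of_int b :: rat) = of_int (2 * a * x + b')" by simp
 hence "b = 2 * a * x + b'" by (simp only: of_int_eq_iff)
 thus "[b = b'] (mod 2 * a)" by (simp add: cong_mod)
qed

lemma lat_shift: "is_form a b ==> [b = b'] (mod 2 * a) ==> is_form a b' & lat a b' = lat a b"
proof -
 assume f: "is_form a b" and "[b = b'] (mod 2 * a)"
 then obtain k where k: "b' = b + 2 * a * k" by (metis cong_iff_lin mult.assoc)
 have "b'^2 - D = (b^2 - D) + 4 * a * (b * k + a * k^2)" unfolding k by (simp add: sq_simps)
 hence "is_form a b'" using f unfolding is_form_def by (metis dvd_add dvd_triv_left)
 moreover have "pt a b' x y = pt a b (x + k * y) y" "pt a b x y = pt a b' (x - k * y) y" for x y
  unfolding pt_def k by (simp_all add: alg add_divide_distrib)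
 hence "lat a b' = lat a b" unfolding lat_def by (metis (no_types, opaque_lifting))
 ultimately show ?thesis by blast
qed

end

section \<open>Invertible ideals and classes of forms\<close>

context quad_disc
begin

lemma cj_lat: "cj ` lat a b = lat a (- b)"
proof (intro equalityI subsetI)
 fix z assume "z : cj ` lat a b"
 then obtain x y where "z = cj (pt a b x y)" by (auto simp: lat_def)
 thus "z : lat a (- b)" by (simp add: cj_pt)
next
 fix z assume "z : lat a (- b)"
 then obtain x y where "z = pt a (- b) x y" by (auto simp: lat_def)
 hence "z = cj (pt a b x (- y))" by (simp add: cj_pt)
 thus "z : cj ` lat a b" by simp
qed

lemma fractional_ideal_scale_lat:
 assumes f: "is_form a b" and q: "q ~= 0"
 shows "fractional_ideal D (scale (of_rat q) (lat a b))"
 unfolding fractional_ideal_def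
proof (intro conjI ballI)
 show "scale (of_rat q) (lat a b) \<subseteq> K" using lat_K by (auto simp: scale_def)
 show "0 : scale (of_rat q) (lat a b)" using lat_0 by (force simp: scale_def)
 fix z w assume "z : scale (of_rat q) (lat a b)" "w : scale (of_rat q) (lat a b)"
 thus "z - w : scale (of_rat q) (lat a b)" by (rule scale_lat_diff)
next
 fix r z assume r: "r : R" and "z : scale (of_rat q) (lat a b)"
 then obtain w where w: "z = of_rat q * w" "w : lat a b" by (auto simp: scale_def)
 show "r * z : scale (of_rat q) (lat a b)"
  using scale_mem[OF lat_mult_R[OF f r w(2)], of "of_rat q"] w(1) by (simp add: mult.left_commute)
next
 obtain n m where nm: "quotient_of q = (n, m)" by fastforce
 have m: "m > 0" "q = of_int n / of_int m" using quotient_of_denom_pos[OF nm] quotient_of_div[OF nm] by auto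
 have "of_int m * (of_rat q * w) : R" if "w : lat a b" for w
 proof -
  have "of_int m * (of_rat q * w) = of_int n * w" using m by (simp add: of_rat_divide)
  moreover have "w : R" using lat_R[OF f] that by blast
  ultimately show ?thesis using R_mult[OF R_of_int] by metis
 qed
 thus "\<exists>d\<in>R. d ~= 0 & (\<forall>a\<in>scale (of_rat q) (lat a b). d * a : R)"
  using m(1) by (intro bexI[of _ "of_int m"] R_of_int) (auto simp: scale_def)
qed

lemma group_closure_int_mult: "z : group_closure S ==> of_int n * z : group_closure (S :: complex set)"
proof (cases "n >= 0")
 case True
 assume "z : group_closure S"
 hence "of_nat (nat n) * z : group_closure S" by (rule group_closure_scalar_mult_left)
 thus ?thesis using True by simp
next
 case False
 assume "z : group_closure S"
 hence "of_nat (nat (- n)) * z : group_closure S" by (rule group_closure_scalar_mult_left)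
 hence "- (of_int (- n) * z) : group_closure S" using False by simp
 thus ?thesis by simp
qed

text \<open>The ideal equation L \<open>cj\<close> L = a R: one inclusion is
  \<open>pt_mult_cj_pt\<close>, the other comes from \<open>lat_absorb\<close>.\<close>

lemma ideal_prod_lat:
 assumes f: "is_form a b" and q: "q ~= 0"
 shows "ideal_prod (scale (of_rat q) (lat a b)) (scale (of_rat (1 / (q * of_int a))) (lat a (- b))) = R"
proof -
 define S where "S = {z * w | z w. z : scale (of_rat q) (lat a b) & w : scale (of_rat (1 / (q * of_int a))) (lat a (- b))}"
 have a0: "a ~= 0" using form_pos[OF f] by simp
 have S_iff: "z : S \<longleftrightarrow> (EX x y x' y'. of_int a * z = pt a b x y * cj (pt a b x' y'))" for z
 proof
  assume "z : S"
  then obtain z1 z2 where z12: "z = z1 * z2" "z1 : scale (of_rat q) (lat a b)" "z2 : scale (of_rat (1 / (q * of_int a))) (lat a (- b))"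
   unfolding S_def by blast
  obtain x y where z1: "z1 = of_rat q * pt a b x y" using z12(2) unfolding scale_def lat_def by blast
  obtain w where z2: "z2 = of_rat (1 / (q * of_int a)) * w" "w : lat a (- b)" using z12(3) unfolding scale_def by blast
  have z: "z = (of_rat q * pt a b x y) * (of_rat (1 / (q * of_int a)) * w)" "w : lat a (- b)"
   by (simp_all only: z12 z1 z2)
  from z(2) obtain x' y' where w: "w = cj (pt a b x' y')" unfolding cj_lat[symmetric] by (auto simp: lat_def)
  have "of_int a * z = pt a b x y * cj (pt a b x' y')" unfolding z(1) w using q a0 by (simp add: of_rat_divide of_rat_mult)
  thus "EX x y x' y'. of_int a * z = pt a b x y * cj (pt a b x' y')" by blast
 next
  assume "EX x y x' y'. of_int a * z = pt a b x y * cj (pt a b x' y')"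
  then obtain x y x' y' where z: "of_int a * z = pt a b x y * cj (pt a b x' y')" by blast
  have "z = (of_rat q * pt a b x y) * (of_rat (1 / (q * of_int a)) * cj (pt a b x' y'))"
   using z q a0 by (simp add: of_rat_divide of_rat_mult field_simps)
  moreover have "of_rat q * pt a b x y : scale (of_rat q) (lat a b)" by (rule scale_mem[OF lat_pt])
  moreover have "of_rat (1 / (q * of_int a)) * cj (pt a b x' y') : scale (of_rat (1 / (q * of_int a))) (lat a (- b))"
   by (rule scale_mem) (simp flip: cj_lat)
  ultimately show "z : S" unfolding S_def by blast
 qed
 have "group_closure S \<subseteq> R"
 proof
  fix z assume "z : group_closure S"
  thus "z : R"
  proof (induction rule: group_closure.induct)
   case (base s)
   show ?case
   proof (cases "s = 0")
    case False
    then obtain x y x' y' where "of_int a * s = pt a b x y * cj (pt a b x' y')" using base S_iff by auto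
    then obtain r where "r : R" "of_int a * s = of_int a * r" using pt_mult_cj_pt[OF f] by metis
    thus ?thesis using a0 by simp
   qed (use R_of_int[of 0] in simp)
  qed (rule R_diff)
 qed
 moreover have "R \<subseteq> group_closure S"
 proof
  fix r assume r: "r : R"
  obtain i j k where e: "r * of_int a = (r * pt a b 1 0) * cj (pt a b i j) + (r * pt a b 0 1) * cj (pt a b j k)"
   using lat_absorb[OF f] by blast
  obtain x y x' y' where l: "r * pt a b 1 0 = pt a b x y" "r * pt a b 0 1 = pt a b x' y'"
  proof -
   have "r * pt a b 1 0 : lat a b" "r * pt a b 0 1 : lat a b" by (rule lat_mult_R[OF f r lat_pt])+
   thus ?thesis using that unfolding lat_def by blast
  qed
  have "pt a b x y * cj (pt a b x' y') / of_int a : S" for x y x' y'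
   unfolding S_iff by (intro exI[of _ x] exI[of _ y] exI[of _ x'] exI[of _ y']) (use a0 in simp)
  hence "pt a b x y * cj (pt a b i j) / of_int a : group_closure S" "pt a b x' y' * cj (pt a b j k) / of_int a : group_closure S"
   by (blast intro: group_closure.base)+
  hence "pt a b x y * cj (pt a b i j) / of_int a + pt a b x' y' * cj (pt a b j k) / of_int a : group_closure S"
   by (rule group_closure_add)
  moreover have "r = pt a b x y * cj (pt a b i j) / of_int a + pt a b x' y' * cj (pt a b j k) / of_int a"
   using e a0 unfolding l by (simp add: field_simps)
  ultimately show "r : group_closure S" by simp
 qed
 ultimately show ?thesis by (simp add: ideal_prod_def S_def)
qed

lemma invertible_ideals_iff:
 "I : invertible_ideals D \<longleftrightarrow> (EX q a b. q > 0 & is_form a b & I = scale (of_rat q) (lat a b))"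
proof
 assume I: "I : invertible_ideals D"
 have "I ~= {0}"
 proof
  assume "I = {0}"
  then obtain J where J: "ideal_prod {0} J = R" using I by (auto simp: invertible_ideals_def)
  have "z = 0" if "z : group_closure {a * b |a b. a : {0::complex} & b : J}" for z
   using that by (induction rule: group_closure.induct) auto
  hence "ideal_prod {0} J \<subseteq> {0}" unfolding ideal_prod_def by blast
  hence "(1 :: complex) = 0" using J R_of_int[of 1] by auto
  thus False by simp
 qed
 thus "EX q a b. q > 0 & is_form a b & I = scale (of_rat q) (lat a b)"
  using I fractional_ideal_lat by (auto simp: invertible_ideals_def)
next
 assume "EX q a b. q > 0 & is_form a b & I = scale (of_rat q) (lat a b)"
 then obtain q a b where q: "q > 0" "is_form a b" "I = scale (of_rat q) (lat a b)" by blast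
 have "1 / (q * of_int a) ~= 0" using q form_pos[OF q(2)] by simp
 thus "I : invertible_ideals D"
  unfolding invertible_ideals_def using q
   fractional_ideal_scale_lat[OF q(2), of q] fractional_ideal_scale_lat[OF is_form_uminus[OF q(2)], of "1 / (q * of_int a)"]
   ideal_prod_lat[OF q(2), of q] by auto
qed

definition forms :: "(int \<times> int) set" where "forms = {(a, b). is_form a b}"

definition form_rel :: "((int \<times> int) \<times> (int \<times> int)) set" where
 "form_rel = {((a, b), (a', b')). is_form a b & is_form a' b' & (\<exists>alp\<in>K. alp ~= 0 & lat a' b' = scale alp (lat a b))}"

lemma form_rel_iff:
 "((a, b), (a', b')) : form_rel \<longleftrightarrow> is_form a b & is_form a' b' & (\<exists>alp\<in>K. alp ~= 0 & lat a' b' = scale alp (lat a b))"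
 by (simp add: form_rel_def)

lemma one_K: "1 : K" by (simp add: one_emb)

lemma equiv_scaling:
 "equiv A {(I, J). I : A & J : A & (\<exists>alp\<in>K. alp ~= 0 & g J = scale alp (g I))}"
proof (rule equivI)
 show "sym {(I, J). I : A & J : A & (\<exists>alp\<in>K. alp ~= 0 & g J = scale alp (g I))}"
 proof (rule symI)
  fix I J assume "(I, J) : {(I, J). I : A & J : A & (\<exists>alp\<in>K. alp ~= 0 & g J = scale alp (g I))}"
  then obtain alp where a: "I : A" "J : A" "alp : K" "alp ~= 0" "g J = scale alp (g I)" by blast
  have "g I = scale (inverse alp) (g J)" using a(4,5) scale_cancel by metis
  moreover have "inverse alp : K" "inverse alp ~= 0" using a(4) K_inverse[OF a(3)] by auto
  ultimately have "\<exists>bet\<in>K. bet ~= 0 & g I = scale bet (g J)" by blast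
  thus "(J, I) : {(I, J). I : A & J : A & (\<exists>alp\<in>K. alp ~= 0 & g J = scale alp (g I))}"
   using a(1,2) by blast
 qed
 show "trans {(I, J). I : A & J : A & (\<exists>alp\<in>K. alp ~= 0 & g J = scale alp (g I))}"
 proof (rule transI)
  fix I J L assume "(I, J) : {(I, J). I : A & J : A & (\<exists>alp\<in>K. alp ~= 0 & g J = scale alp (g I))}"
   "(J, L) : {(I, J). I : A & J : A & (\<exists>alp\<in>K. alp ~= 0 & g J = scale alp (g I))}"
  then obtain alp bet where a: "I : A" "L : A" "alp : K" "alp ~= 0" "bet : K" "bet ~= 0" "g J = scale alp (g I)" "g L = scale bet (g J)" by blast
  hence "g L = scale (bet * alp) (g I)" "bet * alp : K" "bet * alp ~= 0" by (auto simp: scale_scale)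
  thus "(I, L) : {(I, J). I : A & J : A & (\<exists>alp\<in>K. alp ~= 0 & g J = scale alp (g I))}" using a by blast
 qed
qed (use one_K in \<open>auto simp: refl_on_def intro!: bexI[of _ 1]\<close>)

abbreviation "Cl == forms // form_rel"

lemma equiv_form_rel: "equiv forms form_rel"
 using equiv_scaling[of forms "%(a, b). lat a b"]
 by (auto simp: form_rel_def forms_def case_prod_beta' elim!: back_subst[of "equiv _"])

lemma equiv_ideal_equiv: "equiv (invertible_ideals D) (ideal_equiv D)"
 using equiv_scaling[of "invertible_ideals D" "%I. I"] unfolding ideal_equiv_def scale_def .

theorem class_number_forms: "class_number D = card (Cl)"
 unfolding class_number_def
proof (rule card_quotient_eq[OF equiv_ideal_equiv equiv_form_rel, where g = "%(a, b). lat a b"])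
 have lat_inv: "lat a b : invertible_ideals D" if "is_form a b" for a b
  unfolding invertible_ideals_iff using that by (intro exI[of _ 1] exI[of _ a] exI[of _ b]) simp
 thus "(case x of (a, b) => lat a b) : invertible_ideals D" if "x : forms" for x
  using that by (auto simp: forms_def)
 show "(x, y) : form_rel \<longleftrightarrow> (case x of (a, b) => lat a b, case y of (a, b) => lat a b) : ideal_equiv D"
  if "x : forms" "y : forms" for x y
  using that lat_inv by (auto simp: forms_def form_rel_def ideal_equiv_def scale_def)
 fix I assume I: "I : invertible_ideals D"
 then obtain q a b where q: "q > 0" "is_form a b" "I = scale (of_rat q) (lat a b)" unfolding invertible_ideals_iff by blast
 have "(lat a b, I) : ideal_equiv D"
  unfolding ideal_equiv_def using I lat_inv[OF q(2)] q by (auto simp: scale_def intro!: bexI[of _ "of_rat q"])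
 thus "\<exists>x\<in>forms. (case x of (a, b) => lat a b, I) : ideal_equiv D"
  using q(2) by (auto simp: forms_def)
qed

text \<open>Comparing norms of points shows that the values of either form are one fixed rational
  multiple of values of the other. As the values of a primitive form generate Z, this multiple is a
  unit, and only the sign of \<open>nm alp\<close> is left.\<close>

lemma scale_lat_norm:
 assumes f: "is_form a b" "is_form a' b'" and k: "k > 0" and alp: "alp : K"
  and e: "scale (of_int k) (lat a' b') = scale alp (lat a b)"
 shows "of_int (k^2 * a') = \<bar>nm alp\<bar> * of_int a"
  and "EX u v. of_int (qf a' b' x y) = sgn (nm alp) * of_int (qf a b u v)"
proof -
 define P where "P = (of_int (k^2 * a') :: rat)"
 define Q where "Q = nm alp * of_int a"
 have P0: "P > 0" using k form_pos[OF f(2)] by (simp add: P_def)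
 have v1: "EX u v. P * of_int (qf a' b' x y) = Q * of_int (qf a b u v)" for x y
 proof -
  have "of_int k * pt a' b' x y : scale alp (lat a b)" unfolding e[symmetric] by (rule scale_mem[OF lat_pt])
  then obtain u v where "of_int k * pt a' b' x y = alp * pt a b u v" by (auto simp: scale_def lat_def)
  hence "nm (of_int k * pt a' b' x y) = nm (alp * pt a b u v)" by simp
  hence "nm (of_int k) * nm (pt a' b' x y) = nm alp * nm (pt a b u v)" using alp by (simp add: nm_mult of_int_emb)
  hence "P * of_int (qf a' b' x y) = Q * of_int (qf a b u v)"
   unfolding nm_pt[OF f(1)] nm_pt[OF f(2)] by (simp add: of_int_emb P_def Q_def mult_ac)
  thus ?thesis by blast
 qed
 have v2: "EX u v. Q * of_int (qf a b x y) = P * of_int (qf a' b' u v)" for x y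
 proof -
  have "alp * pt a b x y : scale (of_int k) (lat a' b')" unfolding e by (rule scale_mem[OF lat_pt])
  then obtain u v where "alp * pt a b x y = of_int k * pt a' b' u v" by (auto simp: scale_def lat_def)
  hence "nm (alp * pt a b x y) = nm (of_int k * pt a' b' u v)" by simp
  hence "nm alp * nm (pt a b x y) = nm (of_int k) * nm (pt a' b' u v)" using alp by (simp add: nm_mult of_int_emb)
  hence "Q * of_int (qf a b x y) = P * of_int (qf a' b' u v)"
   unfolding nm_pt[OF f(1)] nm_pt[OF f(2)] by (simp add: of_int_emb P_def Q_def mult_ac)
  thus ?thesis by blast
 qed
 \<comment> \<open>The three coefficients are combinations of the values at (1, 0), (1, 1) and (0,
   1), so 1 is an integral combination of values.\<close>
 have comb: "EX m. P = Q * of_int m" if f: "is_form a' b'" and v: "!!x y. EX u v. P * of_int (qf a' b' x y) = Q * of_int (qf a b u v)"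
  for P Q :: rat and a b a' b'
 proof -
  obtain i j k where 1: "i * a' + j * b' + k * cc a' b' = 1" using form_coprime[OF f] by blast
  have "P * of_int (i * qf a' b' 1 0 + j * (qf a' b' 1 1 - qf a' b' 1 0 - qf a' b' 0 1) + k * qf a' b' 0 1) = P"
   using 1 by (simp add: qf_def flip: of_int_mult of_int_add)
  moreover obtain w1 w2 w3 :: int where "P * of_int (qf a' b' 1 0) = Q * of_int w1" "P * of_int (qf a' b' 0 1) = Q * of_int w2" "P * of_int (qf a' b' 1 1) = Q * of_int w3"
   using v by metis
  moreover have "P * of_int (i * qf a' b' 1 0 + j * (qf a' b' 1 1 - qf a' b' 1 0 - qf a' b' 0 1) + k * qf a' b' 0 1)
   = of_int i * (P * of_int (qf a' b' 1 0)) + of_int j * (P * of_int (qf a' b' 1 1) - P * of_int (qf a' b' 1 0) - P * of_int (qf a' b' 0 1))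
    + of_int k * (P * of_int (qf a' b' 0 1))" by (simp add: alg)
  ultimately have "P = of_int i * (Q * of_int w1) + of_int j * (Q * of_int w3 - Q * of_int w1 - Q * of_int w2) + of_int k * (Q * of_int w2)"
   by (simp only:)
  also have "... = Q * of_int (i * w1 + j * (w3 - w1 - w2) + k * w2)" by (simp add: alg)
  finally show ?thesis by blast
 qed
 obtain m where m: "P = Q * of_int m" using comb[OF f(2) v1] by blast
 obtain m' where m': "Q = P * of_int m'" using comb[OF f(1) v2] by blast
 have "P * of_int (m' * m) = P * 1" using m unfolding m' by simp
 hence "m' * m = 1" using P0 by (simp only: mult_cancel_left) (metis less_irrefl of_int_1 of_int_eq_iff)
 hence "m' = 1 \<or> m' = -1" by (metis zmult_eq_1_iff)
 hence QP: "\<bar>Q\<bar> = P" "Q = sgn Q * P" using m' P0 by auto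
 have sg: "sgn Q = sgn (nm alp)" using form_pos[OF f(1)] by (simp add: Q_def sgn_mult)
 show "of_int (k^2 * a') = \<bar>nm alp\<bar> * of_int a" using QP(1) form_pos[OF f(1)] by (simp add: P_def Q_def abs_mult)
 obtain u v where "P * of_int (qf a' b' x y) = Q * of_int (qf a b u v)" using v1 by blast
 hence "P * of_int (qf a' b' x y) = P * (sgn (nm alp) * of_int (qf a b u v))" using QP(2) sg by (metis mult.assoc mult.commute)
 thus "EX u v. of_int (qf a' b' x y) = sgn (nm alp) * of_int (qf a b u v)" using P0 by auto
qed

text \<open>The lattice depends on b' modulo 2 a' only; the bounds on b' make the triple
  unique.\<close>

definition is_Theta :: "int => int => int => int => int \<times> int \<times> int => bool" where
 "is_Theta a b x y = (%(k, a', b'). k > 0 & is_form a' b' & 0 <= b' & b' < 2 * a' &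
   scale (of_int k) (lat a' b') = scale (cj (pt a b x y) / of_int a) (lat a b))"

text \<open>A nonzero point \<open>\<beta>\<close> of the lattice \<open>L\<close> of the form \<open>(a, b)\<close> gives the integral ideal
 \<open>(cj \<beta> / a) L\<close>, encoded as \<open>(k, a', b')\<close> with \<open>k L'\<close> for the lattice \<open>L'\<close> of \<open>(a', b')\<close>.\<close>

definition Theta :: "int => int => int => int => int \<times> int \<times> int" where
 "Theta a b x y = (SOME t. is_Theta a b x y t)"

lemma Theta_exists:
 assumes f: "is_form a b" and nz: "(x, y) ~= (0, 0)"
 shows "EX t. is_Theta a b x y t"
proof -
 define bet where "bet = pt a b x y"
 have b0: "bet ~= 0" using nz pt_eq_0[OF f] by (auto simp: bet_def)
 have cb0: "cj bet ~= 0" using b0 cj_cj[of bet] by (auto simp: bet_def) (metis cj_emb emb_eq_0 minus_zero)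
 have a0: "a ~= 0" using form_pos[OF f] by simp
 define J where "J = scale (cj bet / of_int a) (lat a b)"
 have "EX g a' b'. g > 0 & is_form a' b' & J = scale (of_int g) (lat a' b')"
 proof (rule integral_ideal_lat)
  show "J \<subseteq> R"
  proof
   fix z assume "z : J"
   then obtain x' y' where z: "z = cj bet / of_int a * pt a b x' y'" by (auto simp: J_def scale_def lat_def)
   obtain r where "r : R" "pt a b x' y' * cj bet = of_int a * r" using pt_mult_cj_pt[OF f] unfolding bet_def by blast
   hence "z = r" using a0 by (simp add: z field_simps)
   thus "z : R" using \<open>r : R\<close> by simp
  qed
  show "z - w : J" if "z : J" "w : J" for z w
   using that unfolding J_def by (rule scale_lat_diff)
  show "r * z : J" if rz: "r : R" "z : J" for r z
  proof -
   obtain w where "z = (cj bet / of_int a) * w" "w : lat a b" using rz(2) by (auto simp: J_def scale_def)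
   thus ?thesis using scale_mem[OF lat_mult_R[OF f rz(1)], of w "cj bet / of_int a"] by (simp add: J_def mult.left_commute)
  qed
  show "(cj bet / of_int a) * pt a b 1 0 : J" unfolding J_def by (rule scale_mem[OF lat_pt])
  show "(cj bet / of_int a) * pt a b 1 0 ~= 0" using cb0 a0 pt_eq_0[OF f, of 1 0] by simp
 qed
 then obtain g a' b' where g: "g > 0" "is_form a' b'" "J = scale (of_int g) (lat a' b')" by blast
 have "[b' = b' mod (2 * a')] (mod 2 * a')" by (simp add: cong_mod)
 from lat_shift[OF g(2) this] have "is_Theta a b x y (g, a', b' mod (2 * a'))"
  using g form_pos[OF g(2)] by (simp add: is_Theta_def J_def bet_def)
 thus ?thesis by blast
qed

lemma is_Theta_Theta: "is_form a b ==> (x, y) ~= (0, 0) ==> is_Theta a b x y (Theta a b x y)"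
 unfolding Theta_def using someI_ex[OF Theta_exists] by blast

lemma is_Theta_unique:
 assumes "is_Theta a b x y t" "is_Theta a b x y t'"
 shows "t = t'"
proof -
 obtain k c d k' c' d' where t: "t = (k, c, d)" "t' = (k', c', d')" by (metis prod_cases3)
 have 1: "is_form c d" "is_form c' d'" "(of_int k :: rat) > 0" "(of_int k' :: rat) > 0"
  "scale (of_rat (of_int k)) (lat c d) = scale (of_rat (of_int k')) (lat c' d')" "0 <= d" "d < 2 * c" "0 <= d'" "d' < 2 * c'"
  using assms by (auto simp: is_Theta_def t)
 note u = scale_lat_unique[OF 1(1-5)]
 have "d = d'" using u(2,3) 1 by (simp add: cong_mod)
 thus ?thesis using u t by simp
qed

lemma Theta_eqI: "is_form a b ==> (x, y) ~= (0, 0) ==> is_Theta a b x y t ==> Theta a b x y = t"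
 using is_Theta_unique is_Theta_Theta by blast

lemma cj_pt_ne_0: "is_form a b ==> (x, y) ~= (0, 0) ==> cj (pt a b x y) ~= 0"
 using pt_eq_0[of a "-b" x "-y"] by (auto simp: cj_pt is_form_uminus)

lemma nm_cj_pt_div:
 assumes f: "is_form a b"
 shows "nm (cj (pt a b x y) / of_int a) = of_int (qf a b x y) / of_int a"
proof -
 have a0: "(of_int a :: rat) ~= 0" using form_pos[OF f] by simp
 have "of_int a * (cj (pt a b x y) / of_int a) = cj (pt a b x y)" using form_pos[OF f] by simp
 hence "nm (of_int a) * nm (cj (pt a b x y) / of_int a) = nm (pt a b x y)"
  using nm_mult[of "of_int a" "cj (pt a b x y) / of_int a"] nm_cj[of "pt a b x y"] by (simp add: of_int_emb K_divide K_cj)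
 thus ?thesis using a0 unfolding nm_pt[OF f] by (simp add: of_int_emb field_simps p2sq)
qed

lemma Theta_props:
 assumes f: "is_form a b" and nz: "(x, y) ~= (0, 0)" and T: "Theta a b x y = (k, a', b')"
 shows "k > 0" "is_form a' b'" "0 <= b'" "b' < 2 * a'" "((a, b), (a', b')) : form_rel"
  "k^2 * a' = \<bar>qf a b x y\<bar>" "EX u v. qf a' b' x' y' = sgn (qf a b x y) * qf a b u v"
proof -
 define alp where "alp = cj (pt a b x y) / of_int a"
 have alp: "alp : K" "alp ~= 0" using cj_pt_ne_0[OF f nz] form_pos[OF f] by (auto simp: alp_def K_divide K_cj of_int_emb)
 have a0: "a > 0" by (rule form_pos[OF f])
 have t: "is_Theta a b x y (k, a', b')" using is_Theta_Theta[OF f nz] T by simp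
 thus k: "k > 0" and f': "is_form a' b'" and "0 <= b'" "b' < 2 * a'" by (auto simp: is_Theta_def)
 have e: "scale (of_int k) (lat a' b') = scale alp (lat a b)" using t by (simp add: is_Theta_def alp_def)
 have "lat a' b' = scale (inverse (of_int k)) (scale alp (lat a b))" using e k scale_cancel[of "of_int k"] by simp
 hence "lat a' b' = scale (alp / of_int k) (lat a b)" by (simp add: scale_scale field_simps)
 moreover have "alp / of_int k : K" "alp / of_int k ~= 0" using alp k by (auto simp: of_int_emb)
 ultimately show "((a, b), (a', b')) : form_rel" unfolding form_rel_iff using f f' by blast
 note n = scale_lat_norm[OF f f' k alp(1) e]
 have nma: "nm alp = of_int (qf a b x y) / of_int a" unfolding alp_def by (rule nm_cj_pt_div[OF f])
 have "of_int (k^2 * a') = (of_int \<bar>qf a b x y\<bar> :: rat)" using n(1) a0 by (simp add: nma abs_mult)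
 thus "k^2 * a' = \<bar>qf a b x y\<bar>" by (simp only: of_int_eq_iff)
 have "sgn (nm alp) = of_int (sgn (qf a b x y))" using a0 by (auto simp: nma sgn_if divide_less_0_iff zero_less_divide_iff)
 then obtain u v where "(of_int (qf a' b' x' y') :: rat) = of_int (sgn (qf a b x y)) * of_int (qf a b u v)" using n(2) by metis
 hence "qf a' b' x' y' = sgn (qf a b x y) * qf a b u v" by (simp only: of_int_eq_iff flip: of_int_mult)
 thus "EX u v. qf a' b' x' y' = sgn (qf a b x y) * qf a b u v" by blast
qed

text \<open>An integral ideal in the class has the form alp L, and by \<open>lat_colon\<close>
  integrality forces alp = cj beta / a with beta in L.\<close>

lemma Theta_surj:
 assumes r: "((a, b), (a', b')) : form_rel" and k: "k > 0" and b': "0 <= b'" "b' < 2 * a'"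
 shows "EX x y. (x, y) ~= (0, 0) & Theta a b x y = (k, a', b')"
proof -
 have f: "is_form a b" "is_form a' b'" using r by (auto simp: form_rel_iff)
 obtain alp0 where a0: "alp0 : K" "alp0 ~= 0" "lat a' b' = scale alp0 (lat a b)" using r by (auto simp: form_rel_iff)
 define alp where "alp = of_int k * alp0"
 have alp: "alp : K" "alp ~= 0" using a0 k by (auto simp: alp_def of_int_emb)
 have e: "scale (of_int k) (lat a' b') = scale alp (lat a b)" by (simp add: a0(3) scale_scale alp_def)
 have "scale alp (lat a b) \<subseteq> R" unfolding e[symmetric] using lat_R[OF f(2)] by (auto simp: scale_def intro!: R_mult R_of_int)
 from lat_colon[OF f(1) alp(1) this] obtain x y where xy: "cj (alp * of_int a) = pt a b x y" by (auto simp: lat_def)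
 have aK: "alp * of_int a : K" using alp(1) by (auto simp: of_int_emb)
 have "cj (pt a b x y) = alp * of_int a" using xy cj_cj[OF aK] by simp
 hence al: "cj (pt a b x y) / of_int a = alp" using form_pos[OF f(1)] by simp
 have nz: "(x, y) ~= (0, 0)" using al alp(2) by (auto simp: cj_pt)
 have "is_Theta a b x y (k, a', b')" using k f(2) b' e al by (simp add: is_Theta_def)
 from Theta_eqI[OF f(1) nz this] show ?thesis using nz by blast
qed

lemma unit_parity: "t^2 - D * u^2 = 4 * s ==> even (t + u)"
proof -
 assume h: "t^2 - D * u^2 = 4 * s"
 have "even (4 * s)" by simp
 hence "even (t^2 - D * u^2)" unfolding h[symmetric] .
 thus ?thesis using odd_D by simp
qed

text \<open>Points with the same ideal differ by a multiplier of the lattice, hence by an element of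
  R of norm 1 or -1; the two linear expressions are its matrix from \<open>mult_pt\<close>.\<close>

lemma Theta_fibre:
 assumes f: "is_form a b" and nz: "(x, y) ~= (0, 0)" "(x', y') ~= (0, 0)"
 shows "Theta a b x y = Theta a b x' y' \<longleftrightarrow>
  (EX t u. (t^2 - D * u^2 = 4 \<or> t^2 - D * u^2 = - 4) &
   x' = (t - b * u) div 2 * x - cc a b * u * y & y' = a * u * x + (t + b * u) div 2 * y)"
proof
 assume T: "Theta a b x y = Theta a b x' y'"
 obtain k c d where k: "Theta a b x y = (k, c, d)" by (metis prod_cases3)
 define bet bet' where "bet = pt a b x y" and "bet' = pt a b x' y'"
 have K: "bet : K" "bet' : K" by (auto simp: bet_def bet'_def)
 have a0: "(of_int a :: complex) ~= 0" using form_pos[OF f] by simp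
 have b0: "cj bet ~= 0" "bet ~= 0" using cj_pt_ne_0[OF f nz(1)] pt_eq_0[OF f] nz(1) by (auto simp: bet_def)
 have "scale (cj bet / of_int a) (lat a b) = scale (cj bet' / of_int a) (lat a b)"
  using is_Theta_Theta[OF f nz(1)] is_Theta_Theta[OF f nz(2)] T k by (auto simp: is_Theta_def bet_def bet'_def)
 hence "lat a b = scale (inverse (cj bet / of_int a)) (scale (cj bet' / of_int a) (lat a b))"
  using scale_cancel[of "cj bet / of_int a"] b0 a0 by simp
 also have "... = scale (cj bet' / cj bet) (lat a b)" using a0 by (simp add: scale_scale field_simps)
 finally have "cj bet' / cj bet : R" using lat_multiplier[OF f] by simp
 moreover define \<eta> where "\<eta> = bet' / bet"
 have e: "bet' = \<eta> * bet" and eK: "\<eta> : K" using b0 K by (auto simp: \<eta>_def)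
 have "cj bet' = cj \<eta> * cj bet" unfolding e using eK K by (simp add: cj_mult)
 hence "cj bet' / cj bet = cj \<eta>" using b0 by simp
 ultimately have "cj \<eta> : R" by simp
 hence "\<eta> : R" using R_cj cj_cj[OF eK] by metis
 then obtain t u where tu: "\<eta> = emb (of_int t / 2) (of_int u / 2)" "even (t + u)" unfolding R_iff by blast
 \<comment> \<open>The ideals have the same norm, so the quotient of the points has norm 1 or
   -1.\<close>
 have "\<bar>qf a b x y\<bar> = \<bar>qf a b x' y'\<bar>" using Theta_props(6)[OF f nz(1) k] Theta_props(6)[OF f nz(2) k[unfolded T]] by simp
 hence "\<bar>nm bet\<bar> = \<bar>nm bet'\<bar>" by (simp add: bet_def bet'_def nm_pt[OF f] abs_mult flip: of_int_abs)
 moreover have "nm bet' = nm \<eta> * nm bet" unfolding e using eK K by (simp add: nm_mult)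
 moreover have "nm bet ~= 0" using nm_eq_0_iff[OF K(1)] b0 by simp
 ultimately have "\<bar>nm \<eta>\<bar> = 1" by (simp add: abs_mult)
 hence "\<bar>of_int (t^2 - D * u^2) :: rat\<bar> = of_int 4" unfolding tu by (simp add: p2sq field_simps abs_if split: if_splits)
 hence "\<bar>t^2 - D * u^2\<bar> = 4" by (simp only: of_int_eq_iff flip: of_int_abs)
 hence "t^2 - D * u^2 = 4 \<or> t^2 - D * u^2 = - 4" by linarith
 moreover have "pt a b x' y' = pt a b ((t - b * u) div 2 * x - cc a b * u * y) (a * u * x + (t + b * u) div 2 * y)"
  using e unfolding bet_def bet'_def tu(1) mult_pt[OF f tu(2)] .
 ultimately show "EX t u. (t^2 - D * u^2 = 4 \<or> t^2 - D * u^2 = - 4) &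
   x' = (t - b * u) div 2 * x - cc a b * u * y & y' = a * u * x + (t + b * u) div 2 * y"
  unfolding pt_inj[OF f] by blast
next
 assume "EX t u. (t^2 - D * u^2 = 4 \<or> t^2 - D * u^2 = - 4) &
   x' = (t - b * u) div 2 * x - cc a b * u * y & y' = a * u * x + (t + b * u) div 2 * y"
 then obtain t u where tu: "t^2 - D * u^2 = 4 \<or> t^2 - D * u^2 = - 4"
  and xy: "x' = (t - b * u) div 2 * x - cc a b * u * y" "y' = a * u * x + (t + b * u) div 2 * y" by blast
 have ev: "even (t + u)" using tu unit_parity[of t u 1] unit_parity[of t u "-1"] by auto
 define \<eta> where "\<eta> = emb (of_int t / 2) (of_int u / 2)"
 have "\<eta> : R" using ev unfolding \<eta>_def R_iff by blast
 hence eR: "\<eta> : R" "cj \<eta> : R" by (auto intro: R_cj)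
 have pe: "pt a b x' y' = \<eta> * pt a b x y" unfolding xy \<eta>_def mult_pt[OF f ev] ..
 have "nm \<eta> = of_int (t^2 - D * u^2) / 4" by (simp add: \<eta>_def p2sq field_simps)
 hence "nm \<eta> = of_int 4 / 4 \<or> nm \<eta> = of_int (- 4) / 4" using tu by metis
 hence "nm \<eta> = 1 \<or> nm \<eta> = -1" by simp
 hence n: "\<eta> * cj \<eta> = 1 \<or> \<eta> * cj \<eta> = -1" using mult_cj[OF R_K[OF eR(1)]] by (auto simp: of_rat_minus)
 have sub: "scale r (lat a b) \<subseteq> lat a b" if "r : R" for r using lat_mult_R[OF f that] by (auto simp: scale_def)
 have "scale (cj \<eta>) (lat a b) = lat a b"
 proof
  show "scale (cj \<eta>) (lat a b) \<subseteq> lat a b" by (rule sub[OF eR(2)])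
  have "scale (cj \<eta>) (scale \<eta> (lat a b)) \<subseteq> scale (cj \<eta>) (lat a b)" by (rule scale_mono[OF sub[OF eR(1)]])
  moreover have "scale (cj \<eta>) (scale \<eta> (lat a b)) = lat a b"
   using n by (auto simp: scale_scale mult.commute scale_minus_lat)
  ultimately show "lat a b \<subseteq> scale (cj \<eta>) (lat a b)" by simp
 qed
 hence "scale (cj (pt a b x' y') / of_int a) (lat a b) = scale (cj (pt a b x y) / of_int a) (lat a b)"
  unfolding pe using R_K[OF eR(1)] by (simp add: cj_mult) (metis (no_types, opaque_lifting) mult.commute scale_scale times_divide_eq_right)
 hence "is_Theta a b x y = is_Theta a b x' y'" by (simp add: is_Theta_def)
 thus "Theta a b x y = Theta a b x' y'" by (simp add: Theta_def)
qed

end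

subsection \<open>Lattice sums over ideal classes and the imaginary case\<close>

lemma infsum_fibres:
 fixes F :: "'a => real" and f :: "'a => 'b"
 assumes F: "F summable_on S" and f: "f ` S \<subseteq> T" and fin: "!!t. t : T ==> finite {s : S. f s = t}"
 shows "infsum F S = infsum (%t. \<Sum>s | s : S & f s = t. F s) T"
  and "(%t. \<Sum>s | s : S & f s = t. F s) summable_on T"
proof -
 have bij: "bij_betw snd (SIGMA t:T. {s : S. f s = t}) S"
  by (rule bij_betwI[where g = "%s. (f s, s)"]) (use f in auto)
 hence S: "(%(t, s). F s) summable_on (SIGMA t:T. {s : S. f s = t})"
  using F summable_on_reindex_bij_betw[OF bij, of F] by (simp add: case_prod_beta')
 have inner: "infsum F {s : S. f s = t} = (\<Sum>s | s : S & f s = t. F s)" if "t : T" for t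
  using fin[OF that] by simp
 have "infsum F S = infsum (%(t, s). F s) (SIGMA t:T. {s : S. f s = t})"
  using infsum_reindex_bij_betw[OF bij, of F] by (simp add: case_prod_beta')
 also have "... = infsum (%t. infsum F {s : S. f s = t}) T"
  using infsum_Sigma'_banach[OF S] by simp
 also have "... = infsum (%t. \<Sum>s | s : S & f s = t. F s) T"
  by (rule infsum_cong[OF inner])
 finally show "infsum F S = infsum (%t. \<Sum>s | s : S & f s = t. F s) T" .
 show "(%t. \<Sum>s | s : S & f s = t. F s) summable_on T"
  using summable_on_Sigma_banach[OF S] summable_on_cong[of T "%t. infsum F {s : S. f s = t}", OF inner] by simp
qed

lemma infsum_eq_levels:
 fixes F :: "'a => real" and G :: "'b => real" and f :: "'a => 'c" and g :: "'b => 'c"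
 assumes F: "F summable_on S" and G: "G summable_on T"
  and fin: "!!n. finite {s : S. f s = n}" "!!n. finite {s : T. g s = n}"
  and eq: "!!n. (\<Sum>s | s : S & f s = n. F s) = (\<Sum>s | s : T & g s = n. G s)"
 shows "infsum F S = infsum G T"
 using infsum_fibres(1)[OF F, of f UNIV] infsum_fibres(1)[OF G, of g UNIV] fin eq by simp

lemma infsum_finite_partition:
 fixes F :: "'a => real"
 assumes "finite A" and "!!x. x : A ==> F summable_on B x" and "disjoint_family_on B A"
 shows "F summable_on (\<Union>x\<in>A. B x) & infsum F (\<Union>x\<in>A. B x) = (\<Sum>x\<in>A. infsum F (B x))"
 using assms
proof (induction A rule: finite_induct)
 case (insert x A)
 have d: "B x \<inter> (\<Union>y\<in>A. B y) = {}" using insert.prems(2) insert.hyps(2) by (auto simp: disjoint_family_on_def)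
 have IH: "F summable_on (\<Union>y\<in>A. B y) & infsum F (\<Union>y\<in>A. B y) = (\<Sum>y\<in>A. infsum F (B y))"
  using insert by (auto simp: disjoint_family_on_def)
 thus ?case
  using summable_on_Un_disjoint[OF _ _ d, of F] infsum_Un_disjoint[OF _ _ d, of F] insert by simp
qed simp

definition theta_sum :: "real => real => real" where
 "theta_sum A t = (\<Sum>x. exp (- (t * (A * real x ^ 2))))"

lemma theta_sum_infsum:
 assumes "A > 0" "t > 0"
 shows "infsum (%x::nat. exp (- (t * (A * real x ^ 2)))) UNIV = theta_sum A t"
 unfolding theta_sum_def
proof (rule exp_bound_infsum[of "t * A" _ 1])
 fix n :: nat
 have "real n <= real n ^ 2" by (cases n) (auto simp: p2sq)
 thus "\<bar>exp (- (t * (A * real n ^ 2)))\<bar> <= 1 * exp (- (t * A * real n))"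
  using assms by (simp add: mult.assoc)
qed (use assms in simp)

definition cone_sum :: "real => real => real => real => real" where
 "cone_sum A B C t = infsum (%(x, y). quad_exp A B C t x y) ({1..} \<times> UNIV)"

text \<open>\<open>quad_trap\<close> counts both boundary rays with weight 1/2 and the origin with
  1/4, whereas the half-open quadrant contains the ray y = 0 and omits the ray x = 0 together with
  the origin.\<close>

lemma cone_sum_eq:
 assumes pos: "quadrant_pos A B C" and t: "t > 0"
 shows "cone_sum A B C t = quad_trap A B C t + theta_sum A t / 2 - theta_sum C t / 2 - 1 / 4"
  and "(%(x, y). quad_exp A B C t x y) summable_on ({1..} \<times> UNIV)"
proof -
 have AC: "A > 0" "C > 0" using pos unfolding quadrant_pos_def by (force dest: spec[of _ 1] spec[of _ 0])+
 note s = quad_trap_eq(2)[OF pos t]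
 have un: "({1..} \<times> UNIV) \<union> ({0} \<times> UNIV) = (UNIV :: (nat \<times> nat) set)" by (auto simp: not_less_eq_eq)
 show s1: "(%(x, y). quad_exp A B C t x y) summable_on ({1..} \<times> UNIV)" by (rule summable_on_subset_banach[OF s]) auto
 have s2: "(%(x, y). quad_exp A B C t x y) summable_on ({0} \<times> UNIV)" by (rule summable_on_subset_banach[OF s]) auto
 have bij: "bij_betw (%y. (0::nat, y::nat)) UNIV ({0} \<times> UNIV)" by (auto simp: bij_betw_def inj_on_def)
 have "infsum (%(x, y). quad_exp A B C t x y) ({0} \<times> UNIV) = infsum (%y. quad_exp A B C t 0 y) UNIV"
  using infsum_reindex_bij_betw[OF bij, of "%(x, y). quad_exp A B C t x y"] by simp
 also have "... = theta_sum C t" using theta_sum_infsum[OF AC(2) t] by (simp add: quad_exp_def)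
 finally have z: "infsum (%(x, y). quad_exp A B C t x y) ({0} \<times> UNIV) = theta_sum C t" .
 have "infsum (%(x, y). quad_exp A B C t x y) UNIV = cone_sum A B C t + theta_sum C t"
 proof -
  have "({1..} \<times> UNIV) \<inter> ({0} \<times> UNIV) = ({} :: (nat \<times> nat) set)" by auto
  from infsum_Un_disjoint[OF s1 s2 this] show ?thesis unfolding un by (simp only: cone_sum_def z)
 qed
 thus "cone_sum A B C t = quad_trap A B C t + theta_sum A t / 2 - theta_sum C t / 2 - 1 / 4"
  using quad_trap_eq(1)[OF pos t] by (simp add: theta_sum_def)
qed

text \<open>The smaller eigenvalue is at least determinant over trace, \<open>e / (A + C)\<close>,
  and (x + y)^2 <= 2 (x^2 + y^2).\<close>

lemma quadrant_pos_definite: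
 assumes "A > 0" "C > 0" "B^2 < 4 * A * C"
 shows "quadrant_pos A B C"
 unfolding quadrant_pos_def
proof (intro exI[of _ "(A * C - B^2 / 4) / (A + C) / 2"] conjI allI impI)
 define e where "e = A * C - B^2 / 4"
 have e: "e > 0" using assms by (simp add: e_def)
 fix x y :: real
 have "e * (x + y)^2 <= 2 * (e * (x^2 + y^2))"
 proof -
  have "(x + y)^2 <= 2 * (x^2 + y^2)" using zero_le_power2[of "x - y"] by (simp add: sq_simps)
  thus ?thesis using e mult_left_mono[of "(x + y)^2" _ e] by simp
 qed
 also have "e * (x^2 + y^2) <= (A + C) * (A * x^2 + B * x * y + C * y^2)"
 proof -
  have "(A + C) * (A * x^2 + B * x * y + C * y^2) - e * (x^2 + y^2) = (A * x + B * y / 2)^2 + (C * y + B * x / 2)^2"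
   by (simp add: e_def p2sq field_simps)
  moreover have "... >= 0" by simp
  ultimately show ?thesis by linarith
 qed
 finally have "e * (x + y)^2 <= (A * x^2 + B * x * y + C * y^2) * (2 * (A + C))" by (simp only: mult_ac)
 hence "e * (x + y)^2 / (2 * (A + C)) <= A * x^2 + B * x * y + C * y^2"
  using assms by (subst pos_divide_le_eq) auto
 moreover have "(A * C - B^2 / 4) / (A + C) / 2 * (x + y)^2 = e * (x + y)^2 / (2 * (A + C))"
  by (simp add: e_def mult.commute)
 ultimately show "(A * C - B^2 / 4) / (A + C) / 2 * (x + y)^2 <= A * x^2 + B * x * y + C * y^2"
  by simp
next
 have "A * C - B^2 / 4 > 0" using assms by simp
 thus "(A * C - B^2 / 4) / (A + C) / 2 > 0" using assms by (intro divide_pos_pos) auto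
qed

section \<open>Reduction, finiteness of the class set, ideals sorted by norm\<close>

context quad_disc
begin

lemma form_rel_shift: "is_form a b ==> [b = b'] (mod 2 * a) ==> ((a, b), (a, b')) : form_rel"
proof -
 assume f: "is_form a b" and "[b = b'] (mod 2 * a)"
 from lat_shift[OF this] have "is_form a b'" "lat a b' = scale 1 (lat a b)" by simp_all
 thus ?thesis unfolding form_rel_iff using f one_K one_neq_zero by blast
qed

lemma class_mem:
 assumes "c : Cl" "(a, b) : c"
 shows "is_form a b" "((a, b), (a', b')) : form_rel \<longleftrightarrow> (a', b') : c"
proof -
 obtain x where c: "c = form_rel `` {x}" "x : forms" using assms(1) by (auto elim!: quotientE)
 show f: "is_form a b" using assms(2) c by (cases x) (auto simp: form_rel_iff)
 have x: "(x, (a, b)) : form_rel" using assms(2) c by simp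
 have eq: "trans form_rel" "sym form_rel" using equiv_form_rel by (auto elim: equivE)
 show "((a, b), (a', b')) : form_rel \<longleftrightarrow> (a', b') : c"
  using x eq unfolding c by (metis Image_singleton_iff symD transD)
qed

lemma class_nonempty: "c : Cl ==> EX a b. (a, b) : c"
 using equiv_form_rel by (metis in_quotient_imp_non_empty ex_in_conv surj_pair)

lemma cc_nonzero: "is_form a b ==> cc a b ~= 0"
proof
 assume "is_form a b" "cc a b = 0"
 hence "b^2 = D" using form_eq[of a b] by simp
 hence "(of_int b)^2 = (of_int D :: rat)" by (metis of_int_power)
 thus False using nonsquare by blast
qed

text \<open>Take a minimal in the class and shift b into [-a, a]. The last coefficient is the value
  at (0, 1), so its absolute value is a square times the first coefficient of a form in the class,
  hence at least a. The argument covers both signs of D.\<close>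

lemma reduced_form:
 assumes c: "c : Cl"
 shows "EX a b. (a, b) : c & \<bar>b\<bar> <= a & 4 * a^2 <= \<bar>b^2 - D\<bar>"
proof -
 obtain a0 b0 where "(a0, b0) : c" using class_nonempty[OF c] by blast
 then obtain z where z: "z : c" "!!y. y : c ==> nat (fst z) <= nat (fst y)"
  using ex_has_least_nat[of "%z. z : c" _ "%z. nat (fst z)"] by blast
 obtain a b1 where ab: "z = (a, b1)" by (cases z)
 have f1: "is_form a b1" using class_mem(1)[OF c] z(1) ab by blast
 have a: "a > 0" by (rule form_pos[OF f1])
 define b where "b = (b1 + a) mod (2 * a) - a"
 have "b1 - b = 2 * a * ((b1 + a) div (2 * a))" using minus_mod_eq_mult_div[of "b1 + a" "2 * a"] by (simp add: b_def)
 hence "[b1 = b] (mod 2 * a)" by (simp add: cong_iff_dvd_diff)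
 hence bc: "(a, b) : c" using form_rel_shift[OF f1] class_mem(2)[OF c] z(1) ab by blast
 have f: "is_form a b" by (rule class_mem(1)[OF c bc])
 have "0 <= (b1 + a) mod (2 * a)" "(b1 + a) mod (2 * a) < 2 * a" using a by auto
 hence b: "\<bar>b\<bar> <= a" unfolding b_def by linarith
 obtain k a' b' where T: "Theta a b 0 1 = (k, a', b')" by (metis prod_cases3)
 have nz: "(0::int, 1::int) ~= (0, 0)" by simp
 note P = Theta_props[OF f nz T]
 have "(a', b') : c" using P(5) class_mem(2)[OF c bc] by blast
 hence "a <= a'" using z(2) ab form_pos[OF P(2)] by fastforce
 also have "a' <= k^2 * a'" using P(1) form_pos[OF P(2)] by simp
 also have "... = \<bar>cc a b\<bar>" using P(6) by (simp add: qf_def)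
 finally have "4 * a * a <= 4 * a * \<bar>cc a b\<bar>" using a by simp
 also have "... = \<bar>4 * a * cc a b\<bar>" using a by (simp add: abs_mult)
 also have "4 * a * cc a b = b^2 - D" using form_eq[OF f] by simp
 finally have "4 * a^2 <= \<bar>b^2 - D\<bar>" by (simp only: p2sq mult.assoc)
 thus ?thesis using bc b by blast
qed

lemma finite_classes: "finite (Cl)"
proof -
 define S where "S = {(a, b). is_form a b & \<bar>b\<bar> <= a & a <= \<bar>D\<bar>}"
 have "finite S" by (rule finite_subset[of _ "{0..\<bar>D\<bar>} \<times> {-\<bar>D\<bar>..\<bar>D\<bar>}"]) (auto simp: S_def dest: form_pos)
 moreover have "Cl \<subseteq> (%z. form_rel `` {z}) ` S"
 proof
  fix c assume c: "c : Cl"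
  obtain a b where ab: "(a, b) : c" "\<bar>b\<bar> <= a" "4 * a^2 <= \<bar>b^2 - D\<bar>" using reduced_form[OF c] by blast
  have f: "is_form a b" by (rule class_mem(1)[OF c ab(1)])
  have "b^2 <= a^2" using ab(2) by (metis abs_ge_zero power2_abs power_mono)
  moreover have "\<bar>b^2 - D\<bar> <= b^2 + \<bar>D\<bar>" using abs_triangle_ineq4[of "b^2" D] by simp
  ultimately have "3 * a^2 <= \<bar>D\<bar>" using ab(3) by linarith
  moreover have "a <= a^2" using form_pos[OF f] by (simp add: p2sq)
  moreover have "0 <= a^2" by simp
  ultimately have "a <= \<bar>D\<bar>" by linarith
  hence "(a, b) : S" using f ab by (simp add: S_def)
  moreover have "c = form_rel `` {(a, b)}"
  proof -
   have "z : c \<longleftrightarrow> z : form_rel `` {(a, b)}" for z using class_mem(2)[OF c ab(1)] by (cases z) auto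
   thus ?thesis by blast
  qed
  ultimately show "c : (%z. form_rel `` {z}) ` S" by blast
 qed
 ultimately show ?thesis by (meson finite_imageI finite_subset)
qed

text \<open>A triple (k, a, b) with normalised b stands for the integral ideal k L, where L is the
  lattice of (a, b); \<open>tnorm\<close> is its norm.\<close>

definition triples :: "(int \<times> int) set => (int \<times> int \<times> int) set" where
 "triples c = {(k, a, b). k > 0 & (a, b) : c & 0 <= b & b < 2 * a}"

definition tnorm :: "int \<times> int \<times> int => nat" where "tnorm = (%(k, a, b). nat (k^2 * a))"

definition level :: "nat => (int \<times> int \<times> int) set" where "level n = {s : triples forms. tnorm s = n}"

lemma triples_partition: "triples forms = (\<Union>c\<in>Cl. triples c)"
proof -
 have "forms = \<Union> (Cl)" using Union_quotient[OF equiv_form_rel] by simp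
 thus ?thesis unfolding triples_def by blast
qed

lemma triples_disjoint: "disjoint_family_on triples (Cl)"
 unfolding disjoint_family_on_def
proof (intro ballI impI)
 fix c d assume "c : Cl" "d : Cl" "c ~= d"
 hence "c \<inter> d = {}" using quotient_disj[OF equiv_form_rel] by blast
 thus "triples c \<inter> triples d = {}" by (auto simp: triples_def)
qed

lemma form_root_iff: "a > 0 ==> is_form a (2 * x + 1) \<longleftrightarrow> a dvd x^2 + x + C"
proof -
 assume "a > 0"
 have "(2 * x + 1)^2 - D = 4 * (x^2 + x + C)" by (simp add: D sq_simps)
 thus ?thesis using \<open>a > 0\<close> unfolding is_form_def by (simp only: dvd_mult_cancel_left) simp
qed

lemma level_bij:
 assumes n: "n > 0"
 shows "bij_betw (%(k, x). (int k, int (n div k\<^sup>2), 2 * int x + 1))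
  (SIGMA k:{k. k > 0 & k^2 dvd n}. qroots C (n div k\<^sup>2)) (level n)"
proof (rule bij_betwI[where g = "%(k, a, b). (nat k, nat ((b - 1) div 2))"])
 show "(%(k, x). (int k, int (n div k\<^sup>2), 2 * int x + 1)) : (SIGMA k:{k. k > 0 & k^2 dvd n}. qroots C (n div k\<^sup>2)) \<rightarrow> level n"
 proof (rule Pi_I, clarify)
  fix k x assume k: "k > 0" "k^2 dvd n" and x: "x : qroots C (n div k\<^sup>2)"
  have pos: "n div k\<^sup>2 > 0" using n k by (auto elim!: dvdE)
  have "is_form (int (n div k\<^sup>2)) (2 * int x + 1)" using x pos by (subst form_root_iff) (auto simp: qroots_def)
  moreover have "int k ^ 2 * int (n div k\<^sup>2) = int n" using k by (metis dvd_mult_div_cancel of_nat_mult of_nat_power)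
  ultimately show "(int k, int (n div k\<^sup>2), 2 * int x + 1) : level n"
   using k x by (auto simp: level_def triples_def forms_def tnorm_def qroots_def)
 qed
 show "(%(k, a, b). (nat k, nat ((b - 1) div 2))) : level n \<rightarrow> (SIGMA k:{k. k > 0 & k^2 dvd n}. qroots C (n div k\<^sup>2))"
 proof (rule Pi_I)
  fix s assume s: "s : level n"
  obtain k a b where s': "s = (k, a, b)" by (metis prod_cases3)
  have h: "k > 0" "is_form a b" "0 <= b" "b < 2 * a" "k^2 * a = int n"
   using n s by (auto simp: level_def triples_def forms_def tnorm_def s')
  have a: "a > 0" by (rule form_pos[OF h(2)])
  obtain x where x: "b = 2 * x + 1" using form_odd[OF h(2)] by (elim oddE)
  have xx: "0 <= x" "x < a" using h x by auto
  have n': "n = (nat k)^2 * nat a" using h(1,5) a by (metis int_eq_iff less_imp_le nat_mult_distrib nat_power_eq zero_le_power2 nat_int)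
  hence "n div (nat k)\<^sup>2 = nat a" using h(1) by simp
  moreover have "int (nat a) dvd (int (nat x))^2 + int (nat x) + C" using h(2) form_root_iff[OF a, of x] xx a by (simp add: x)
  ultimately show "(%(k, a, b). (nat k, nat ((b - 1) div 2))) s : (SIGMA k:{k. k > 0 & k^2 dvd n}. qroots C (n div k\<^sup>2))"
   using h(1) xx n' by (auto simp: qroots_def x s')
 qed
next
 fix s assume "s : (SIGMA k:{k. k > 0 & k^2 dvd n}. qroots C (n div k\<^sup>2))"
 thus "(%(k, a, b). (nat k, nat ((b - 1) div 2))) ((%(k, x). (int k, int (n div k\<^sup>2), 2 * int x + 1)) s) = s"
  by auto
next
 fix s assume s: "s : level n"
 obtain k a b where s': "s = (k, a, b)" by (metis prod_cases3)
 have h: "k > 0" "is_form a b" "0 <= b" "b < 2 * a" "k^2 * a = int n"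
  using n s by (auto simp: level_def triples_def forms_def tnorm_def s')
 have a: "a > 0" by (rule form_pos[OF h(2)])
 obtain x where x: "b = 2 * x + 1" using form_odd[OF h(2)] by (elim oddE)
 have n': "n = (nat k)^2 * nat a" using h(1,5) a by (metis int_eq_iff less_imp_le nat_mult_distrib nat_power_eq zero_le_power2 nat_int)
 hence "n div (nat k)\<^sup>2 = nat a" using h(1) by simp
 thus "(%(k, x). (int k, int (n div k\<^sup>2), 2 * int x + 1)) ((%(k, a, b). (nat k, nat ((b - 1) div 2))) s) = s"
  using h a by (simp add: s' x)
qed

lemma level_0: "level 0 = {}"
 by (auto simp: level_def triples_def forms_def tnorm_def dest!: form_pos)

lemma finite_level: "finite (level n)"
proof (cases "n = 0")
 case False
 have "finite {k. k > 0 & k^2 dvd n}"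
 proof (rule finite_subset)
  show "{k. k > 0 & k^2 dvd n} \<subseteq> {..n}"
  proof
   fix k assume "k : {k. k > 0 & k^2 dvd n}"
   hence "k <= k^2" "k^2 <= n" using False by (auto simp: p2sq dvd_imp_le)
   thus "k : {..n}" by simp
  qed
 qed simp
 hence "finite (SIGMA k:{k. k > 0 & k^2 dvd n}. qroots C (n div k\<^sup>2))" by simp
 thus ?thesis using level_bij[of n] False bij_betw_finite by blast
qed (simp add: level_0)

text \<open>An ideal of norm n is k times a primitive ideal of norm n / k^2, whence the convolution
  with the indicator of squares; the weight sees the primitive part only.\<close>

lemma level_sum:
 assumes n: "n > 0"
 shows "(\<Sum>(k, a, b)\<in>level n. w (nat a)) = dconv square_ind (%a. w a * int (card (qroots C a))) n"
proof -
 define Kn where "Kn = {k. k > 0 & k^2 dvd n}"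
 have fin: "finite Kn"
  by (rule finite_subset[of _ "{..n}"]) (use n in \<open>auto simp: Kn_def p2sq dest!: dvd_imp_le intro: order_trans[rotated]\<close>)
 have "(\<Sum>(k, a, b)\<in>level n. w (nat a)) = (\<Sum>(k, x)\<in>(SIGMA k:Kn. qroots C (n div k\<^sup>2)). w (n div k\<^sup>2))"
  unfolding Kn_def by (subst sum.reindex_bij_betw[OF level_bij[OF n], symmetric]) (simp add: case_prod_beta')
 also have "... = (\<Sum>k\<in>Kn. w (n div k\<^sup>2) * int (card (qroots C (n div k\<^sup>2))))"
  using fin by (simp add: sum.Sigma[symmetric] mult.commute)
 also have "... = (\<Sum>d | d dvd n & is_nth_power 2 d. w (n div d) * int (card (qroots C (n div d))))"
  by (rule sum.reindex_bij_witness[of _ "%d. nth_root_nat 2 d" "%k. k\<^sup>2"])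
   (use n in \<open>auto simp: Kn_def is_nth_power_def power_0_left intro!: Nat.gr0I\<close>)
 also have "... = (\<Sum>d | d dvd n. square_ind d * (w (n div d) * int (card (qroots C (n div d)))))"
  using n by (intro sum.mono_neutral_cong_left) (auto simp: square_ind_def)
 finally show ?thesis by (simp add: dconv_def)
qed

end

section \<open>Sums over definite lattices\<close>

lemma cone_sum_int:
 assumes pos: "quadrant_pos A B C" and t: "t > 0"
  and bij: "bij_betw h ({1..} \<times> (UNIV :: nat set)) S"
  and val: "!!x y. x >= 1 ==> F (h (x, y)) = quad_exp A B C t x y"
 shows "infsum F S = cone_sum A B C t" and "F summable_on S"
proof -
 have eq: "F (h z) = (case z of (x, y) => quad_exp A B C t x y)" if "z : {1..} \<times> UNIV" for z
  using that val by auto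
 show "infsum F S = cone_sum A B C t"
  using infsum_reindex_bij_betw[OF bij, of F] infsum_cong[of "{1..} \<times> UNIV" "%z. F (h z)", OF eq]
  by (simp add: cone_sum_def)
 show "F summable_on S"
  using summable_on_reindex_bij_betw[OF bij, of F] summable_on_cong[of "{1..} \<times> UNIV" "%z. F (h z)", OF eq]
   cone_sum_eq(2)[OF pos t] by simp
qed

text \<open>Four quadrants, each rotated by a right angle from the previous one.\<close>

lemma definite_lattice_sum:
 fixes a b c :: int
 assumes a: "a > 0" and disc: "b^2 < 4 * a * c" and t: "t > 0"
 defines "F \<equiv> %(x, y). exp (- (t * real_of_int (a * x^2 + b * x * y + c * y^2)))"
 shows "F summable_on (UNIV - {(0, 0)})"
  and "infsum F (UNIV - {(0, 0)}) = 2 * quad_trap a b c t + 2 * quad_trap c (- b) a t - 1"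
proof -
 have c: "c > 0" using a disc by (smt (verit) mult_nonneg_nonpos zero_le_power2)
 have disc': "(real_of_int b)^2 < 4 * real_of_int a * real_of_int c"
  using disc by (metis of_int_less_iff of_int_mult of_int_numeral of_int_power)
 have p1: "quadrant_pos a b c" and p2: "quadrant_pos c (- b) a"
  using a c disc' by (auto intro!: quadrant_pos_definite simp: mult_ac)
 define S1 :: "(int \<times> int) set" where "S1 = {(x, y). x > 0 & y >= 0}"
 define S2 :: "(int \<times> int) set" where "S2 = {(x, y). x <= 0 & y > 0}"
 define S3 :: "(int \<times> int) set" where "S3 = {(x, y). x < 0 & y <= 0}"
 define S4 :: "(int \<times> int) set" where "S4 = {(x, y). x >= 0 & y < 0}"
 have b1: "bij_betw (%(x, y). (int x, int y)) ({1..} \<times> UNIV) S1"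
  by (rule bij_betwI[where g = "%(x, y). (nat x, nat y)"]) (auto simp: S1_def)
 have b2: "bij_betw (%(x, y). (- int y, int x)) ({1..} \<times> UNIV) S2"
  by (rule bij_betwI[where g = "%(x, y). (nat y, nat (- x))"]) (auto simp: S2_def)
 have b3: "bij_betw (%(x, y). (- int x, - int y)) ({1..} \<times> UNIV) S3"
  by (rule bij_betwI[where g = "%(x, y). (nat (- x), nat (- y))"]) (auto simp: S3_def)
 have b4: "bij_betw (%(x, y). (int y, - int x)) ({1..} \<times> UNIV) S4"
  by (rule bij_betwI[where g = "%(x, y). (nat (- y), nat x)"]) (auto simp: S4_def)
 have i1: "infsum F S1 = cone_sum a b c t" "F summable_on S1"
  by (rule cone_sum_int[OF p1 t b1]; simp add: F_def quad_exp_def)+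
 have i2: "infsum F S2 = cone_sum c (- b) a t" "F summable_on S2"
  by (rule cone_sum_int[OF p2 t b2]; simp add: F_def quad_exp_def alg)+
 have i3: "infsum F S3 = cone_sum a b c t" "F summable_on S3"
  by (rule cone_sum_int[OF p1 t b3]; simp add: F_def quad_exp_def)+
 have i4: "infsum F S4 = cone_sum c (- b) a t" "F summable_on S4"
  by (rule cone_sum_int[OF p2 t b4]; simp add: F_def quad_exp_def alg)+
 have d: "S1 \<inter> S2 = {}" "(S1 \<union> S2) \<inter> S3 = {}" "(S1 \<union> S2 \<union> S3) \<inter> S4 = {}"
  by (auto simp: S1_def S2_def S3_def S4_def)
 have un: "UNIV - {(0, 0)} = S1 \<union> S2 \<union> S3 \<union> S4"
  by (auto simp: S1_def S2_def S3_def S4_def)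
 have s12: "F summable_on (S1 \<union> S2)" by (rule summable_on_Un_disjoint[OF i1(2) i2(2) d(1)])
 have s123: "F summable_on (S1 \<union> S2 \<union> S3)" by (rule summable_on_Un_disjoint[OF s12 i3(2) d(2)])
 show "F summable_on (UNIV - {(0, 0)})" unfolding un by (rule summable_on_Un_disjoint[OF s123 i4(2) d(3)])
 have "infsum F (UNIV - {(0, 0)}) = 2 * cone_sum a b c t + 2 * cone_sum c (- b) a t"
  unfolding un infsum_Un_disjoint[OF s123 i4(2) d(3)] infsum_Un_disjoint[OF s12 i3(2) d(2)] infsum_Un_disjoint[OF i1(2) i2(2) d(1)] i1(1) i2(1) i3(1) i4(1)
  by simp
 \<comment> \<open>The halved theta sums of the four quadrants cancel, and the constant is 4 times
   -1/4.\<close>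
 thus "infsum F (UNIV - {(0, 0)}) = 2 * quad_trap a b c t + 2 * quad_trap c (- b) a t - 1"
  using cone_sum_eq(1)[OF p1 t] cone_sum_eq(1)[OF p2 t] by simp
qed

text \<open>Adjacent quadrants have middle coefficients b and - b, so these contributions cancel.
  What remains is the removed origin: the Epstein zeta function of a definite form has the value -1
  at 0.\<close>

lemma definite_lattice_sum_asym_const:
 fixes a b c :: int
 assumes a: "a > 0" and disc: "b^2 < 4 * a * c"
 shows "asym_const (%t. infsum (%(x, y). exp (- (t * real_of_int (a * x^2 + b * x * y + c * y^2)))) (UNIV - {(0, 0)})) (- 1)"
proof -
 have c: "c > 0" using a disc by (smt (verit) mult_nonneg_nonpos zero_le_power2)
 have disc': "(real_of_int b)^2 < 4 * real_of_int a * real_of_int c"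
  using disc by (metis of_int_less_iff of_int_mult of_int_numeral of_int_power)
 have p1: "quadrant_pos a b c" and p2: "quadrant_pos c (- b) a"
  using a c disc' by (auto intro!: quadrant_pos_definite simp: mult_ac)
 have "asym_const (%t. 2 * quad_trap a b c t + 2 * quad_trap c (- b) a t - 1)
   (2 * (b * (1 / a + 1 / c) / 24) + 2 * (real_of_int (- b) * (1 / c + 1 / a) / 24) - 1)"
  by (intro asym_const_diff asym_const_add asym_const_cmult asym_const_const
    quad_trap_asym_const[OF p1] quad_trap_asym_const[OF p2])
 moreover have "2 * (b * (1 / a + 1 / c) / 24) + 2 * (real_of_int (- b) * (1 / c + 1 / a) / 24) - 1 = - 1"
 proof -
  have "b * (1 / a + 1 / c) = - (real_of_int (- b) * (1 / c + 1 / a))" by (simp add: alg)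
  thus ?thesis by (simp only:)
 qed
 ultimately have h: "asym_const (%t. 2 * quad_trap a b c t + 2 * quad_trap c (- b) a t - 1) (- 1)" by (simp only:)
 show ?thesis by (rule asym_const_cong[OF h]) (use definite_lattice_sum(2)[OF a disc] in auto)
qed

context quad_disc
begin

definition tsum :: "(int \<times> int) set => real => real" where
 "tsum c t = infsum (%s. exp (- (t * real (tnorm s)))) (triples c)"

lemma unit_action_inj:
 assumes f: "is_form a b" and nz: "(x, y) ~= (0, 0)" and ev: "even (t + u)" "even (t' + u')"
  and eq: "(t - b * u) div 2 * x - cc a b * u * y = (t' - b * u') div 2 * x - cc a b * u' * y"
   "a * u * x + (t + b * u) div 2 * y = a * u' * x + (t' + b * u') div 2 * y"
 shows "t = t' & u = u'"
proof -
 have "emb (of_int t / 2) (of_int u / 2) * pt a b x y = emb (of_int t' / 2) (of_int u' / 2) * pt a b x y"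
  unfolding mult_pt[OF f ev(1)] mult_pt[OF f ev(2)] eq ..
 hence "emb (of_int t / 2) (of_int u / 2) = emb (of_int t' / 2) (of_int u' / 2)"
  using nz pt_eq_0[OF f] by auto
 thus ?thesis by simp
qed

lemma unit_action_nonzero:
 assumes f: "is_form a b" and nz: "(x, y) ~= (0, 0)" and u: "t^2 - D * u^2 = 4 \<or> t^2 - D * u^2 = - 4"
 shows "((t - b * u) div 2 * x - cc a b * u * y, a * u * x + (t + b * u) div 2 * y) ~= (0, 0)"
proof
 assume z: "((t - b * u) div 2 * x - cc a b * u * y, a * u * x + (t + b * u) div 2 * y) = (0, 0)"
 have ev: "even (t + u)" using u unit_parity[of t u 1] unit_parity[of t u "-1"] by auto
 have "emb (of_int t / 2) (of_int u / 2) * pt a b x y = 0" unfolding mult_pt[OF f ev] using z by simp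
 hence "t = 0" "u = 0" using nz pt_eq_0[OF f] by auto
 thus False using u by simp
qed

lemma Theta_triples:
 assumes c: "c : Cl" "(a, b) : c"
 shows "(%(x, y). Theta a b x y) ` (UNIV - {(0, 0)}) = triples c"
proof -
 have f: "is_form a b" by (rule class_mem(1)[OF c])
 show ?thesis
 proof (intro equalityI subsetI)
  fix s assume "s : (%(x, y). Theta a b x y) ` (UNIV - {(0, 0)})"
  then obtain x y where xy: "(x, y) ~= (0, 0)" "s = Theta a b x y" by auto
  obtain k a' b' where T: "Theta a b x y = (k, a', b')" by (metis prod_cases3)
  note P = Theta_props[OF f xy(1) T]
  have "(a', b') : c" using P(5) class_mem(2)[OF c] by blast
  thus "s : triples c" using P(1,3,4) by (simp add: xy(2) T triples_def)
 next
  fix s assume s: "s : triples c"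
  obtain k a' b' where s': "s = (k, a', b')" by (metis prod_cases3)
  have h: "k > 0" "(a', b') : c" "0 <= b'" "b' < 2 * a'" using s by (auto simp: triples_def s')
  have "((a, b), (a', b')) : form_rel" using class_mem(2)[OF c, of a' b'] h(2) by simp
  from Theta_surj[OF this h(1,3,4)] obtain x y where xy: "(x, y) ~= (0, 0) & Theta a b x y = (k, a', b')" by (elim exE)
  hence "(%(x, y). Theta a b x y) (x, y) = s" "(x, y) : UNIV - {(0, 0)}" by (simp_all add: s')
  thus "s : (%(x, y). Theta a b x y) ` (UNIV - {(0, 0)})" by (metis imageI)
 qed
qed

lemma tnorm_Theta:
 assumes f: "is_form a b" and nz: "(x, y) ~= (0, 0)"
 shows "tnorm (Theta a b x y) = nat \<bar>qf a b x y\<bar>"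
proof -
 obtain k a' b' where T: "Theta a b x y = (k, a', b')" by (metis prod_cases3)
 thus ?thesis using Theta_props(6)[OF f nz T] by (simp add: tnorm_def)
qed

text \<open>Both sides are regrouped by the norm n, and \<open>eq\<close> matches the coefficients.
  The weight \<open>h\<close> will be 1 in the imaginary case and the genus character in the real
  case.\<close>

lemma triples_sum_eq_pairs:
 assumes sm: "!!c. c : Cl ==> (%s. exp (- (t * real (tnorm s)))) summable_on (triples c)"
  and t: "t > 0" and psi: "!!n. \<bar>psi n\<bar> <= (1::int)" "!!n. \<bar>psi' n\<bar> <= (1::int)"
  and w: "!!k a b. (k, a, b) : triples forms ==> h (k, a, b) = w (nat a)" "!!n. \<bar>w n\<bar> <= (1::int)"
  and eq: "!!n. n > 0 ==> dconv square_ind (%a. w a * int (card (qroots C a))) n = dconv psi psi' n"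
 shows "(\<Sum>c\<in>Cl. infsum (%s. of_int (h s) * exp (- (t * real (tnorm s)))) (triples c))
  = infsum (%(d, e). of_int (psi (Suc d)) * of_int (psi' (Suc e)) * exp (- (real (Suc d * Suc e) * t))) UNIV"
proof -
 define F where "F s = of_int (h s) * exp (- (t * real (tnorm s)))" for s
 define G where "G = (%(d, e). of_int (psi (Suc d)) * of_int (psi' (Suc e)) * exp (- (real (Suc d * Suc e) * t)))"
 have F: "F summable_on triples c" if c: "c : Cl" for c
 proof (rule abs_summable_summable, rule Infinite_Sum.abs_summable_on_comparison_test'[OF sm[OF c]])
  fix s assume "s : triples c"
  hence "s : triples forms" using c triples_partition by blast
  hence "\<bar>h s\<bar> <= 1" using w by (cases s) auto
  hence "\<bar>real_of_int (h s)\<bar> <= 1" by (simp flip: of_int_abs)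
  thus "norm (F s) <= exp (- (t * real (tnorm s)))" by (simp add: F_def abs_mult)
 qed
 have FT: "F summable_on triples forms" "infsum F (triples forms) = (\<Sum>c\<in>Cl. infsum F (triples c))"
  using infsum_finite_partition[OF finite_classes F triples_disjoint] unfolding triples_partition by auto
 have GS: "G summable_on UNIV"
  unfolding G_def by (rule double_exp_bound(1)[OF t double_char_sum_summable[OF psi t]])
 have fin: "finite {z :: nat \<times> nat. Suc (fst z) * Suc (snd z) = n}" for n
 proof (rule finite_subset)
  show "{z :: nat \<times> nat. Suc (fst z) * Suc (snd z) = n} \<subseteq> {..n} \<times> {..n}" by auto
 qed simp
 have "infsum F (triples forms) = infsum G UNIV"
 proof (rule infsum_eq_levels[OF FT(1) GS, where f = tnorm and g = "%z. Suc (fst z) * Suc (snd z)"])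
  show "finite {s : triples forms. tnorm s = n}" for n using finite_level[of n] by (simp add: level_def)
  show "finite {s : UNIV. Suc (fst s) * Suc (snd s) = n}" for n using fin by simp
  show "(\<Sum>s | s : triples forms & tnorm s = n. F s) = (\<Sum>s | s : UNIV & Suc (fst s) * Suc (snd s) = n. G s)" for n
  proof (cases "n = 0")
   case True
   have 1: "{s. s : triples forms & tnorm s = n} = {}" using level_0 True by (auto simp: level_def)
   have 2: "{s :: nat \<times> nat. s : UNIV & Suc (fst s) * Suc (snd s) = n} = {}" using True by auto
   show ?thesis unfolding 1 2 by simp
  next
   case False
   hence n: "n > 0" by simp
   have "(\<Sum>s\<in>level n. h s) = (\<Sum>(k, a, b)\<in>level n. w (nat a))"
    by (rule sum.cong) (use w(1) in \<open>auto simp: level_def\<close>)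
   also have "... = dconv psi psi' n" unfolding level_sum[OF n] by (rule eq[OF n])
   finally have hs: "(\<Sum>s\<in>level n. h s) = dconv psi psi' n" .
   have "(\<Sum>s | s : triples forms & tnorm s = n. F s) = (\<Sum>s\<in>level n. of_int (h s) * exp (- (t * real n)))"
    by (rule sum.cong) (auto simp: level_def F_def)
   also have "... = of_int (dconv psi psi' n) * exp (- (t * real n))"
    unfolding hs[symmetric] by (simp add: sum_distrib_right)
   \<comment> \<open>A pair (d, e) stands for the factorisation n = (d + 1) (e + 1).\<close>
   also have "dconv psi psi' n = (\<Sum>z | Suc (fst z) * Suc (snd z) = n. psi (Suc (fst z)) * psi' (Suc (snd z)))"
    unfolding dconv_def
   proof (rule sum.reindex_bij_witness[of _ "%z. Suc (fst z)" "%d. (d - 1, n div d - 1)"])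
    fix d assume "d : {d. d dvd n}"
    hence d: "d dvd n" "d > 0" "n div d > 0" using n by (auto intro: Nat.gr0I elim!: dvdE)
    thus "(d - 1, n div d - 1) : {z. Suc (fst z) * Suc (snd z) = n}"
     by (simp only: mem_Collect_eq fst_conv snd_conv Suc_diff_1 dvd_mult_div_cancel)
    show "Suc (fst (d - 1, n div d - 1)) = d"
     "psi (Suc (fst (d - 1, n div d - 1))) * psi' (Suc (snd (d - 1, n div d - 1))) = psi d * psi' (n div d)" using d by simp_all
   next
    fix z assume "z : {z :: nat \<times> nat. Suc (fst z) * Suc (snd z) = n}"
    hence z: "n = Suc (fst z) * Suc (snd z)" by simp
    show "Suc (fst z) : {d. d dvd n}" unfolding mem_Collect_eq z by (rule dvd_triv_left)
    have "n div Suc (fst z) = Suc (snd z)" unfolding z by (rule nonzero_mult_div_cancel_left) simp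
    thus "(Suc (fst z) - 1, n div Suc (fst z) - 1) = z" by simp
   qed
   also have "of_int ... * exp (- (t * real n)) = (\<Sum>z | Suc (fst z) * Suc (snd z) = n. G z)"
    unfolding of_int_sum sum_distrib_right by (rule sum.cong) (auto simp: G_def mult_ac case_prod_beta')
   finally show ?thesis by simp
  qed
 qed
 thus ?thesis using FT(2) by (simp add: F_def[abs_def] G_def)
qed

end

section \<open>The class number formula for negative discriminants\<close>

locale imag_quad_disc = quad_disc +
 assumes D_neg: "D < 0"
begin

definition units :: "(int \<times> int) set" where "units = {(t, u). t\<^sup>2 - D * u^2 = 4}"

lemma norm_nonneg: "t^2 - D * u^2 >= 0"
 using D_neg by (simp add: mult_nonpos_nonneg order_trans[OF _ zero_le_power2])

lemma finite_units: "finite units"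
proof (rule finite_subset)
 show "units \<subseteq> {-2..2} \<times> {-2..2}"
 proof
  fix z assume "z : units"
  then obtain t u where z: "z = (t, u)" "t^2 - D * u^2 = 4" by (auto simp: units_def)
  have "u^2 <= - D * u^2" using mult_right_mono[of 1 "- D" "u^2"] D_neg by simp
  moreover have "D * u^2 <= 0" using D_neg by (simp add: mult_nonpos_nonneg)
  moreover have "0 <= t^2" by simp
  ultimately have "t^2 <= 4" "u^2 <= 4" using z(2) unfolding mult_minus_left by linarith+
  hence "\<bar>t\<bar> <= 2" "\<bar>u\<bar> <= 2" using abs_le_square_iff[of t 2] abs_le_square_iff[of u 2] by auto
  thus "z : {-2..2} \<times> {-2..2}" by (auto simp: z)
 qed
qed simp

text \<open>An ideal of the class comes from one orbit of units, which has exactly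
  \<open>card units\<close> lattice points, and the form is positive, so its values are the
  norms.\<close>

lemma class_sum:
 assumes c: "c : Cl" "(a, b) : c" and t: "t > 0"
 shows "(%s. exp (- (t * real (tnorm s)))) summable_on triples c"
  and "real (card units) * tsum c t =
   infsum (%(x, y). exp (- (t * real_of_int (a * x^2 + b * x * y + cc a b * y^2)))) (UNIV - {(0, 0)})"
proof -
 have f: "is_form a b" by (rule class_mem(1)[OF c])
 have a: "a > 0" by (rule form_pos[OF f])
 have disc: "b^2 < 4 * a * cc a b" using form_eq[OF f] D_neg by simp
 define F where "F = (%(x, y). exp (- (t * real_of_int (a * x^2 + b * x * y + cc a b * y^2))))"
 define Th where "Th = (%(x, y). Theta a b x y)"
 define Z where "Z = (UNIV :: (int \<times> int) set) - {(0, 0)}"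
 define act where "act = (%(x, y) (t, u). ((t - b * u) div 2 * x - cc a b * u * y, a * u * x + (t + b * u) div 2 * y))"
 have qpos: "qf a b x y >= 0" for x y
 proof -
  have "4 * a * qf a b x y = (2 * a * x + b * y)^2 - (b^2 - 4 * a * cc a b) * y^2"
   unfolding qf_def by (simp add: sq_simps)
  also have "b^2 - 4 * a * cc a b = D" using form_eq[OF f] by simp
  finally have "4 * a * qf a b x y = (2 * a * x + b * y)^2 - D * y^2" .
  hence "4 * a * qf a b x y >= 0" using norm_nonneg by simp
  thus ?thesis using a by (simp add: zero_le_mult_iff)
 qed
 have FT: "F z = exp (- (t * real (tnorm (Th z))))" if "z : Z" for z
  using that tnorm_Theta[OF f] qpos by (cases z) (auto simp: F_def Th_def Z_def qf_def)
 have fib: "{z : Z. Th z = Th z0} = act z0 ` units" if z0: "z0 : Z" for z0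
 proof -
  obtain x0 y0 where xy: "z0 = (x0, y0)" "(x0, y0) ~= (0, 0)" using z0 by (cases z0) (auto simp: Z_def)
  have m4: "t^2 - D * u^2 ~= - 4" for t u using norm_nonneg[of t u] by linarith
  show ?thesis
  proof (intro equalityI subsetI)
   fix z assume "z : {z : Z. Th z = Th z0}"
   then obtain x y where z: "z = (x, y)" "(x, y) ~= (0, 0)" "Theta a b x0 y0 = Theta a b x y"
    using xy by (cases z) (auto simp: Z_def Th_def)
   thus "z : act z0 ` units"
    using Theta_fibre[OF f xy(2) z(2)] m4 unfolding xy(1) by (auto simp: act_def units_def)
  next
   fix z assume "z : act z0 ` units"
   then obtain t u where tu: "t^2 - D * u^2 = 4" "z = act (x0, y0) (t, u)" by (auto simp: units_def xy)
   obtain x y where z: "z = (x, y)" by (cases z)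
   have nz: "(x, y) ~= (0, 0)" using unit_action_nonzero[OF f xy(2)] tu z by (auto simp: act_def)
   have "Theta a b x0 y0 = Theta a b x y"
    unfolding Theta_fibre[OF f xy(2) nz] by (rule exI[of _ t], rule exI[of _ u]) (use tu z in \<open>auto simp: act_def\<close>)
   thus "z : {z : Z. Th z = Th z0}" using nz by (auto simp: z Z_def Th_def xy)
  qed
 qed
 have cardf: "card {z : Z. Th z = Th z0} = card units" if z0: "z0 : Z" for z0
 proof -
  obtain x0 y0 where xy: "z0 = (x0, y0)" "(x0, y0) ~= (0, 0)" using z0 by (cases z0) (auto simp: Z_def)
  have "inj_on (act z0) units"
  proof (rule inj_onI)
   fix v w assume v: "v : units" and w: "w : units" and e: "act z0 v = act z0 w"
   obtain t u t' u' where tu: "v = (t, u)" "w = (t', u')" by (cases v; cases w)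
   have "even (t + u)" "even (t' + u')" using v w unit_parity[of _ _ 1] by (auto simp: units_def tu)
   thus "v = w" using unit_action_inj[OF f xy(2)] e by (auto simp: act_def tu xy)
  qed
  thus ?thesis unfolding fib[OF z0] by (rule card_image)
 qed
 have S: "F summable_on Z" unfolding F_def Z_def by (rule definite_lattice_sum(1)[OF a disc t])
 have im: "Th ` Z = triples c" unfolding Th_def Z_def by (rule Theta_triples[OF c])
 have inner: "(\<Sum>z | z : Z & Th z = s. F z) = real (card units) * exp (- (t * real (tnorm s)))" if "s : triples c" for s
 proof -
  have "s : Th ` Z" using that im by simp
  then obtain z0 where z0: "z0 : Z" "s = Th z0" by (elim imageE)
  have "(\<Sum>z | z : Z & Th z = s. F z) = (\<Sum>z | z : Z & Th z = s. exp (- (t * real (tnorm s))))"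
   by (rule sum.cong) (auto simp: FT)
  thus ?thesis using cardf[OF z0(1)] by (simp add: z0(2))
 qed
 have fin: "finite {z : Z. Th z = s}" if "s : triples c" for s
 proof -
  have "s : Th ` Z" using that im by simp
  then obtain z0 where "z0 : Z" "s = Th z0" by (elim imageE)
  thus ?thesis using fib finite_units by simp
 qed
 have im': "Th ` Z \<subseteq> triples c" using im by simp
 note r = infsum_fibres[OF S im' fin]
 have w0: "card units > 0"
 proof -
  have "(2, 0) : units" by (simp add: units_def)
  thus ?thesis using finite_units card_gt_0_iff by blast
 qed
 have "(%s. real (card units) * exp (- (t * real (tnorm s)))) summable_on triples c"
  by (rule summable_on_cong[OF inner, THEN iffD1, OF _ r(2)])
 from summable_on_cmult_right[OF this, of "1 / real (card units)"] w0
 show "(%s. exp (- (t * real (tnorm s)))) summable_on triples c" by simp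
 have "infsum F Z = infsum (%s. real (card units) * exp (- (t * real (tnorm s)))) (triples c)"
  using r(1) infsum_cong[OF inner] by simp
 thus "real (card units) * tsum c t =
   infsum (%(x, y). exp (- (t * real_of_int (a * x^2 + b * x * y + cc a b * y^2)))) (UNIV - {(0, 0)})"
  by (simp add: tsum_def infsum_cmult_right' F_def Z_def)
qed

text \<open>Each class has the constant term -1 / w, with w the number of units, while the total has
  zeta(0) L(0, psi) = - L(0, psi) / 2.\<close>

theorem class_number_eq_L0:
 assumes psi: "periodic_char p psi" and q: "quad_char C psi"
 shows "real (class_number D) = real (card units) / 2 * char_L0 p psi"
proof -
 have w0: "card units > 0"
 proof -
  have "(2, 0) : units" by (simp add: units_def)
  thus ?thesis using finite_units card_gt_0_iff by blast
 qed
 have one: "asym_const (tsum c) (- 1 / real (card units))" if c: "c : Cl" for c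
 proof -
  obtain a b where ab: "(a, b) : c" using class_nonempty[OF c] by blast
  have f: "is_form a b" by (rule class_mem(1)[OF c ab])
  have disc: "b^2 < 4 * a * cc a b" using form_eq[OF f] D_neg by simp
  have "asym_const (%t. real (card units) * tsum c t) (- 1)"
   by (rule asym_const_cong[OF definite_lattice_sum_asym_const[OF form_pos[OF f] disc]]) (use class_sum(2)[OF c ab] in simp)
  from asym_const_cmult[OF this, of "1 / real (card units)"] show ?thesis using w0 by simp
 qed
 have "asym_const (%t. \<Sum>c\<in>Cl. tsum c t) (\<Sum>c\<in>Cl. - 1 / real (card units))"
  by (rule asym_const_sum[OF finite_classes one])
 moreover have "asym_const (%t. \<Sum>c\<in>Cl. tsum c t) (- char_L0 p psi / 2)"
 proof (rule asym_const_cong[OF divisor_char_sum_asym_const[OF psi]])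
  fix t :: real assume t: "t > 0"
  interpret P: periodic_char p psi by fact
  interpret Q: quad_char C psi by fact
  have "(\<Sum>c\<in>Cl. infsum (%s. of_int 1 * exp (- (t * real (tnorm s)))) (triples c))
   = infsum (%(d, e). of_int (psi (Suc d)) * of_int 1 * exp (- (real (Suc d * Suc e) * t))) UNIV"
  proof (rule triples_sum_eq_pairs[where h = "%_. 1" and w = "%_. 1" and psi' = "%_. 1"])
   show "(%s. exp (- (t * real (tnorm s)))) summable_on triples c" if "c : Cl" for c
    using class_sum(1)[OF that _ t] class_nonempty[OF that] by blast
   show "dconv square_ind (%a. 1 * int (card (qroots C a))) n = dconv psi (%_. 1) n" if "n > 0" for n
    using Q.sum_roots_eq_sum_char[OF that] by simp
  qed (use t P.abs_le_1 in auto)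
  thus "infsum (%(d, e). of_int (psi (Suc d)) * exp (- (real (Suc d * Suc e) * t))) UNIV = (\<Sum>c\<in>Cl. tsum c t)"
   by (simp add: tsum_def)
 qed
 ultimately have "(\<Sum>c\<in>Cl. - 1 / real (card units)) = - char_L0 p psi / 2"
  by (rule asym_const_unique)
 thus ?thesis using w0 unfolding class_number_forms by (simp add: field_simps)
qed

end

subsection \<open>Words and cone decompositions\<close>

text \<open>A word in \<open>T = (1, 1; 0, 1)\<close> (\<open>True\<close>) and \<open>L = (1, 0; 1, 1)\<close> (\<open>False\<close>); a matrix is
 given by its entries row by row.\<close>

fun word_mat :: "bool list => int \<times> int \<times> int \<times> int" where
 "word_mat [] = (1, 0, 0, 1)"
| "word_mat (True # V) = (case word_mat V of (a, b, c, d) => (a + c, b + d, c, d))"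
| "word_mat (False # V) = (case word_mat V of (a, b, c, d) => (a, b, c + a, d + b))"

definition word_psi :: "bool list => int" where
 "word_psi W = (\<Sum>x\<leftarrow>W. if x then 1 else - 1)"

lemma word_psi_simps [simp]:
 "word_psi [] = 0" "word_psi (True # V) = word_psi V + 1" "word_psi (False # V) = word_psi V - 1"
 "word_psi (V @ W) = word_psi V + word_psi W"
 by (simp_all add: word_psi_def)

lemma word_mat_props:
 "word_mat W = (a, b, c, d) ==> a >= 0 & b >= 0 & c >= 0 & d >= 0 & a * d - b * c = 1"
 by (induction W arbitrary: a b c d rule: word_mat.induct) (auto split: prod.splits simp: alg)

text \<open>Nonnegative entries and determinant 1 force one row to dominate the other, unless the
  matrix is the identity; subtracting the smaller row removes a letter \<open>T\<close> or
  \<open>L\<close>.\<close>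

lemma word_exists:
 assumes "a >= 0" "b >= 0" "c >= 0" "d >= (0::int)" "a * d - b * c = 1"
 shows "EX W. word_mat W = (a, b, c, d)"
 using assms
proof (induction "nat (a + b + c + d)" arbitrary: a b c d rule: less_induct)
 case less
 note h = less.prems
 consider "a >= c" "b >= d" | "a <= c" "b <= d" | "a > c" "b < d" | "a < c" "b > d" by linarith
 thus ?case
 proof cases
  case 1
  have "c + d > 0"
  proof (rule ccontr)
   assume "~ c + d > 0"
   hence "c = 0" "d = 0" using h(3,4) by linarith+
   thus False using h(5) by simp
  qed
  moreover have "(a - c) * d - (b - d) * c = 1" using h by (simp add: alg)
  ultimately obtain W where "word_mat W = (a - c, b - d, c, d)"
   using less.hyps[of "a - c" "b - d" c d] 1 h by auto
  hence "word_mat (True # W) = (a, b, c, d)" by simp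
  thus ?thesis by blast
 next
  case 2
  have "a + b > 0"
  proof (rule ccontr)
   assume "~ a + b > 0"
   hence "a = 0" "b = 0" using h(1,2) by linarith+
   thus False using h(5) by simp
  qed
  moreover have "a * (d - b) - b * (c - a) = 1" using h by (simp add: alg)
  ultimately obtain W where "word_mat W = (a, b, c - a, d - b)"
   using less.hyps[of a b "c - a" "d - b"] 2 h by auto
  hence "word_mat (False # W) = (a, b, c, d)" by simp
  thus ?thesis by blast
 next
  case 3
  \<comment> \<open>With a >= c + 1 and d >= b + 1 the determinant leaves room for b = c = 0
    only.\<close>
  have "(c + 1) * (b + 1) <= a * d" using 3 h by (intro mult_mono) auto
  hence "b + c <= 0" using h(5) by (simp add: alg)
  hence bc: "b = 0" "c = 0" using h by auto
  hence "a = 1" "d = 1" using h by (auto simp: zmult_eq_1_iff)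
  hence "word_mat [] = (a, b, c, d)" using bc by simp
  thus ?thesis by blast
 next
  case 4
  have "a * d <= c * b" using 4 h by (intro mult_mono) auto
  thus ?thesis using h by (simp add: mult.commute)
 qed
qed

lemma word_mat_append:
 assumes "word_mat V = (a, b, c, d)" "word_mat W = (a', b', c', d')"
 shows "word_mat (V @ W) = (a * a' + b * c', a * b' + b * d', c * a' + d * c', c * b' + d * d')"
 using assms
 by (induction V arbitrary: a b c d rule: word_mat.induct) (auto split: prod.splits simp: alg)

text \<open>Transposition followed by conjugation with the swap fixes \<open>T\<close> and \<open>L\<close> and reverses words.\<close>

lemma word_mat_rev: "word_mat W = (a, b, c, d) ==> word_mat (rev W) = (d, b, c, a)"
proof (induction W arbitrary: a b c d rule: word_mat.induct)
 case (2 V)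
 obtain a' b' c' d' where V: "word_mat V = (a', b', c', d')" by (metis prod_cases4)
 have "word_mat [True] = (1, 1, 0, 1)" by simp
 from word_mat_append[OF 2(1)[OF V] this] show ?case using 2(2) V by (simp add: alg)
next
 case (3 V)
 obtain a' b' c' d' where V: "word_mat V = (a', b', c', d')" by (metis prod_cases4)
 have "word_mat [False] = (1, 0, 1, 1)" by simp
 from word_mat_append[OF 3(1)[OF V] this] show ?case using 3(2) V by (simp add: alg)
qed simp

lemma word_psi_rev: "word_psi (rev W) = word_psi W"
 by (induction W) (simp_all add: word_psi_def)

text \<open>Conjugation with the swap of the coordinates exchanges \<open>T\<close> and
  \<open>L\<close>.\<close>

lemma word_mat_swap: "word_mat W = (a, b, c, d) ==> word_mat (map Not W) = (d, c, b, a)"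
 by (induction W arbitrary: a b c d rule: word_mat.induct) (auto split: prod.splits)

lemma word_psi_swap: "word_psi (map Not W) = - word_psi W"
 by (induction W) (simp_all add: word_psi_def)

section \<open>Totally positive cones for an indefinite form\<close>

locale indef_form =
 fixes a b c :: int and sq :: real
 assumes a_pos: "a > 0" and sq_pos: "sq > 0" and sq: "sq^2 = real_of_int (b^2 - 4 * a * c)"
begin

definition f :: "int \<times> int => int" where "f = (%(x, y). a * x^2 + b * x * y + c * y^2)"
definition polar :: "int \<times> int => int \<times> int => int" where
 "polar = (%(x, y) (x', y'). 2 * a * x * x' + b * (x * y' + x' * y) + 2 * c * y * y')"
text \<open>\<open>r1\<close> and \<open>r2\<close> are the two real embeddings of the lattice point
  \<open>pt a b x y\<close>.\<close>

definition r1 :: "int \<times> int => real" where "r1 = (%(x, y). a * x + y * (b + sq) / 2)"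
definition r2 :: "int \<times> int => real" where "r2 = (%(x, y). a * x + y * (b - sq) / 2)"
definition dt :: "int \<times> int => int \<times> int => int" where "dt = (%(x, y) (x', y'). x * y' - y * x')"
definition tpos :: "int \<times> int => bool" where "tpos z \<longleftrightarrow> r1 z > 0 & r2 z > 0"
definition comb :: "int => int \<times> int => int => int \<times> int => int \<times> int" where
 "comb m u n w = (m * fst u + n * fst w, m * snd u + n * snd w)"

lemma sq': "sq * sq = real_of_int b * b - 4 * a * c"
 using sq by (simp add: p2sq)

lemma r12: "r1 z * r2 z = a * f z"
proof -
 obtain x y where z: "z = (x, y)" by (cases z)
 have "r1 z * r2 z = real_of_int a * a * x * x + a * x * y * b + y * y * (real_of_int b * b - sq * sq) / 4"
  by (simp add: z r1_def r2_def field_simps)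
 thus ?thesis by (simp add: sq' z f_def sq_simps)
qed

lemma r_comb: "r1 (comb m u n w) = m * r1 u + n * r1 w" "r2 (comb m u n w) = m * r2 u + n * r2 w"
 by (cases u; cases w; simp add: comb_def r1_def r2_def field_simps)+

lemma r_cross: "r1 w * r2 u - r1 u * r2 w = a * sq * dt u w"
 by (cases u; cases w; simp add: r1_def r2_def dt_def field_simps)

lemma r_polar: "r1 u * r2 w + r1 w * r2 u = a * polar u w"
proof -
 obtain x y x' y' where u: "u = (x, y)" "w = (x', y')" by (cases u; cases w)
 have "r1 u * r2 w + r1 w * r2 u = 2 * (real_of_int a * a * x * x') + a * b * (x * y' + x' * y) + y * y' * (real_of_int b * b - sq * sq) / 2"
  by (simp add: u r1_def r2_def field_simps)
 thus ?thesis by (simp add: sq' u polar_def alg)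
qed

lemma tpos_f: "tpos z ==> f z > 0"
proof -
 assume "tpos z"
 hence "r1 z * r2 z > 0" by (simp add: tpos_def)
 hence "real_of_int a * real_of_int (f z) > 0" by (simp only: r12 of_int_mult)
 thus ?thesis using a_pos by (simp add: zero_less_mult_iff)
qed

lemma tpos_polar: "tpos u ==> tpos w ==> polar u w > 0"
proof -
 assume "tpos u" "tpos w"
 hence "r1 u * r2 w + r1 w * r2 u > 0" by (simp add: tpos_def add_pos_pos)
 hence "real_of_int a * real_of_int (polar u w) > 0" by (simp only: r_polar of_int_mult)
 thus ?thesis using a_pos by (simp add: zero_less_mult_iff)
qed

lemma f_comb: "f (comb m u n w) = f u * m^2 + polar u w * m * n + f w * n^2"
 by (cases u; cases w; simp add: comb_def f_def polar_def sq_simps)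

lemma dt_iff:
 assumes "tpos u" "tpos w"
 shows "dt u w >= 0 \<longleftrightarrow> r1 u / r2 u <= r1 w / r2 w" and "dt u w > 0 \<longleftrightarrow> r1 u / r2 u < r1 w / r2 w"
proof -
 have p: "r2 u > 0" "r2 w > 0" "real_of_int a * sq > 0" using assms a_pos sq_pos by (auto simp: tpos_def)
 have "dt u w >= 0 \<longleftrightarrow> a * sq * dt u w >= 0" "dt u w > 0 \<longleftrightarrow> a * sq * dt u w > 0"
  using p(3) mult_le_cancel_left_pos[OF p(3), of 0 "dt u w"] mult_less_cancel_left_pos[OF p(3), of 0 "dt u w"] by simp_all
 thus "dt u w >= 0 \<longleftrightarrow> r1 u / r2 u <= r1 w / r2 w" "dt u w > 0 \<longleftrightarrow> r1 u / r2 u < r1 w / r2 w"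
  unfolding r_cross[symmetric] using p(1,2) by (simp_all add: field_simps)
qed

text \<open>A half-open cone; by the lemma above it is an interval for the slope \<open>r1 / r2\<close>.\<close>

definition cone :: "int \<times> int => int \<times> int => (int \<times> int) set" where
 "cone u v = {z. tpos z & dt u z >= 0 & dt z v > 0}"

definition cone_fun :: "real => int \<times> int => real" where "cone_fun t z = exp (- (t * f z))"

text \<open>By Cramer's rule \<open>dt z v\<close> and \<open>dt u z\<close> are the coordinates of
  z in the basis u, v. In them the form has the coefficients \<open>f u\<close>,
  \<open>polar u v\<close> and \<open>f v\<close>, which are positive although f is
  indefinite.\<close>

lemma cone_unimodular:
 assumes u: "tpos u" "tpos v" "dt u v = 1" and t: "t > 0"
 shows "cone_fun t summable_on cone u v"
  and "infsum (cone_fun t) (cone u v) = cone_sum (f u) (polar u v) (f v) t"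
proof -
 have dtc: "dt u (comb m u n v) = n" "dt (comb m u n v) v = m" for m n
 proof -
  have "dt u (comb m u n v) = n * dt u v" "dt (comb m u n v) v = m * dt u v"
   by (cases u; cases v; simp add: dt_def comb_def alg)+
  thus "dt u (comb m u n v) = n" "dt (comb m u n v) v = m" using u(3) by simp_all
 qed
 have cr: "z = comb (dt z v) u (dt u z) v" for z
 proof -
  obtain x y x' y' p q where uv: "u = (x, y)" "v = (x', y')" "z = (p, q)" by (cases u; cases v; cases z)
  have e: "x * y' - y * x' = 1" using u(3) by (simp add: uv dt_def)
  have "(p * y' - q * x') * x + (x * q - y * p) * x' = p * (x * y' - y * x')"
   "(p * y' - q * x') * y + (x * q - y * p) * y' = q * (x * y' - y * x')" by (simp_all add: alg)
  thus ?thesis unfolding e by (simp add: uv dt_def comb_def)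
 qed
 have bij: "bij_betw (%(m, n). comb (int m) u (int n) v) ({1..} \<times> UNIV) (cone u v)"
 proof (rule bij_betwI[where g = "%z. (nat (dt z v), nat (dt u z))"])
  show "(%(m, n). comb (int m) u (int n) v) : {1..} \<times> UNIV \<rightarrow> cone u v"
  proof (rule Pi_I)
   fix s :: "nat \<times> nat" assume "s : {1..} \<times> UNIV"
   then obtain m n where s: "s = (m, n)" "m >= 1" by auto
   have "tpos (comb (int m) u (int n) v)" using u s by (simp add: tpos_def r_comb add_pos_nonneg)
   thus "(%(m, n). comb (int m) u (int n) v) s : cone u v" using s by (simp add: cone_def dtc)
  qed
  show "(%z. (nat (dt z v), nat (dt u z))) : cone u v \<rightarrow> {1..} \<times> UNIV" by (auto simp: cone_def)
  show "(%z. (nat (dt z v), nat (dt u z))) ((%(m, n). comb (int m) u (int n) v) s) = s" for s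
   by (cases s) (simp add: dtc)
  show "(%(m, n). comb (int m) u (int n) v) ((%z. (nat (dt z v), nat (dt u z))) z) = z" if "z : cone u v" for z
   using that cr[of z] by (simp add: cone_def)
 qed
 have pos: "quadrant_pos (f u) (polar u v) (f v)"
  using tpos_f[OF u(1)] tpos_f[OF u(2)] tpos_polar[OF u(1,2)] by (intro quadrant_pos_nonneg) auto
 have val: "cone_fun t ((%(m, n). comb (int m) u (int n) v) (m, n)) = quad_exp (f u) (polar u v) (f v) t m n" for m n
  by (simp add: cone_fun_def quad_exp_def f_comb)
 show "cone_fun t summable_on cone u v" "infsum (cone_fun t) (cone u v) = cone_sum (f u) (polar u v) (f v) t"
  using cone_sum_int[OF pos t bij, of "cone_fun t"] val by auto
qed

lemma cone_split:
 assumes "tpos u" "tpos w" "tpos v" "dt u w >= 0" "dt w v >= 0"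
 shows "cone u v = cone u w \<union> cone w v" "cone u w \<inter> cone w v = {}" "dt u v >= 0"
proof -
 have l: "r1 u / r2 u <= r1 w / r2 w" "r1 w / r2 w <= r1 v / r2 v" using assms dt_iff by auto
 have c: "z : cone x y \<longleftrightarrow> tpos z & r1 x / r2 x <= r1 z / r2 z & r1 z / r2 z < r1 y / r2 y"
  if "tpos x" "tpos y" for x y z
  using dt_iff[of x z] dt_iff[of z y] that by (auto simp: cone_def)
 show "cone u v = cone u w \<union> cone w v" "cone u w \<inter> cone w v = {}"
  using c[OF assms(1,3)] c[OF assms(1,2)] c[OF assms(2,3)] l by (auto; linarith)+
 show "dt u v >= 0" using dt_iff(1)[OF assms(1,3)] l by linarith
qed

text \<open>Makes the contributions of neighbouring cones telescope: for u' = u + w, the constant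
  \<open>polar u u' * (1 / f u + 1 / f u')\<close> of a cone equals
  \<open>4 + tau u w - tau u' w\<close>.\<close>

definition tau :: "int \<times> int => int \<times> int => real" where "tau u w = polar u w / f u"

text \<open>The theta sums give both boundary rays the weight 1/2, so that the quantity is additive
  under subdivision; a unimodular cone contributes its \<open>quad_trap\<close> minus 1/4.\<close>

definition cone_zeta :: "int \<times> int => int \<times> int => real => real" where
 "cone_zeta u v t = infsum (cone_fun t) (cone u v) - theta_sum (f u) t / 2 + theta_sum (f v) t / 2"

text \<open>Along a word the cone from the first to the last vector is cut into unimodular cones, one for
 each letter \<open>L\<close>; the contributions of \<open>tau\<close> telescope.\<close>

lemma cone_word:
 assumes "word_mat W = (m, n, k, l)" "dt u w = 1" "tpos u" "tpos (comb m u k w)"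
 shows "asym_const (cone_zeta u (comb m u k w)) ((tau u w - tau (comb m u k w) (comb n u l w) + 2 * word_psi W) / 24)
  & (ALL t>0. cone_fun t summable_on cone u (comb m u k w)) & dt u (comb m u k w) >= 0"
 using assms
proof (induction W arbitrary: m n k l u w rule: word_mat.induct)
 case 1
 hence e: "m = 1" "n = 0" "k = 0" "l = 1" by auto
 have c: "comb 1 u 0 w = u" "comb 0 u 1 w = w" by (auto simp: comb_def)
 have cu: "cone u u = {}"
 proof -
  have "dt z u = - dt u z" for z by (cases z; cases u) (simp add: dt_def)
  thus ?thesis by (auto simp: cone_def)
 qed
 have "dt u u = 0" by (cases u) (simp add: dt_def)
 thus ?case unfolding e c using asym_const_const[of 0] by (simp add: cone_zeta_def cu)
next
 case (2 V)
 obtain m' n' k' l' where V: "word_mat V = (m', n', k', l')" by (metis prod_cases4)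
 have e: "m = m' + k'" "n = n' + l'" "k = k'" "l = l'" using 2(2) V by auto
 \<comment> \<open>A letter \<open>T\<close> changes only the auxiliary vector w, not the cone;
   \<open>tau\<close> grows by 2, which is the contribution of the letter.\<close>
 define w' where "w' = comb 1 u 1 w"
 have c: "comb m' u k' w' = comb m u k w" "comb n' u l' w' = comb n u l w"
  by (simp_all add: comb_def w'_def e alg)
 have d: "dt u w' = 1" using 2(3) by (cases u; cases w; simp add: dt_def w'_def comb_def alg)
 have tau: "tau u w' = tau u w + 2"
 proof -
  have "polar u w' = polar u w + 2 * f u"
   by (cases u; cases w; simp add: polar_def f_def w'_def comb_def sq_simps)
  thus ?thesis using tpos_f[OF 2(4)] by (simp add: tau_def add_divide_distrib)
 qed
 have "tpos (comb m' u k' w')" unfolding c by (rule 2(5))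
 from 2(1)[OF V d 2(4) this] show ?case unfolding c tau by (simp add: alg)
next
 case (3 V)
 obtain m' n' k' l' where V: "word_mat V = (m', n', k', l')" by (metis prod_cases4)
 have e: "m = m'" "n = n'" "k = k' + m'" "l = l' + n'" using 3(2) V by auto
 define u' where "u' = comb 1 u 1 w"
 define v where "v = comb m u k w"
 have c: "comb m' u' k' w = v" "comb n' u' l' w = comb n u l w"
  by (simp_all add: comb_def u'_def v_def e alg)
 have d: "dt u' w = 1" "dt u u' = 1" using 3(3) by (cases u; cases w; simp add: dt_def u'_def comb_def alg)+
 have mk: "m' >= 0" "k' >= 0" "m' + k' > 0"
 proof -
  note p = word_mat_props[OF V]
  show "m' >= 0" "k' >= 0" using p by blast+
  show "m' + k' > 0"
  proof (rule ccontr)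
   assume "~ m' + k' > 0"
   hence "m' = 0" "k' = 0" using p by linarith+
   thus False using p by simp
  qed
 qed
 have vpos: "tpos v" using 3(5) by (simp add: v_def)
 \<comment> \<open>\<open>u'\<close> lies in the cone spanned by u and v, as (m' + k') u' = v + k'
   u.\<close>
 have upos: "tpos u'"
 proof -
  have "comb (m' + k') u' 0 u' = comb 1 v k' u" by (simp add: comb_def u'_def v_def e alg)
  hence "r1 (comb (m' + k') u' 0 u') = r1 (comb 1 v k' u)" "r2 (comb (m' + k') u' 0 u') = r2 (comb 1 v k' u)" by simp_all
  hence "(m' + k') * r1 u' = r1 v + k' * r1 u" "(m' + k') * r2 u' = r2 v + k' * r2 u" unfolding r_comb by simp_all
  moreover have "r1 v + k' * r1 u > 0" "r2 v + k' * r2 u > 0"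
   using vpos 3(4) mk by (simp_all add: tpos_def add_pos_nonneg)
  ultimately have "real_of_int (m' + k') * r1 u' > 0" "real_of_int (m' + k') * r2 u' > 0" by simp_all
  thus ?thesis using mk by (simp add: tpos_def zero_less_mult_iff)
 qed
 have "tpos (comb m' u' k' w)" unfolding c by (rule vpos)
 note IH = 3(1)[OF V d(1) upos this, unfolded c]
 have sp: "cone u v = cone u u' \<union> cone u' v" "cone u u' \<inter> cone u' v = {}" "dt u v >= 0"
  using cone_split[OF 3(4) upos vpos] d(2) IH by simp_all
 note un = cone_unimodular[OF 3(4) upos d(2)]
 have S: "cone_fun t summable_on cone u v" if "t > 0" for t
  unfolding sp(1) using summable_on_Un_disjoint[OF un(1)[OF that] _ sp(2)] IH that by blast
 have pos: "quadrant_pos (f u) (polar u u') (f u')"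
  using tpos_f[OF 3(4)] tpos_f[OF upos] tpos_polar[OF 3(4) upos] by (intro quadrant_pos_nonneg) auto
 have add: "cone_zeta u v t = (quad_trap (f u) (polar u u') (f u') t - 1 / 4) + cone_zeta u' v t" if "t > 0" for t
 proof -
  have "infsum (cone_fun t) (cone u v) = infsum (cone_fun t) (cone u u') + infsum (cone_fun t) (cone u' v)"
   unfolding sp(1) using infsum_Un_disjoint[OF un(1)[OF that] _ sp(2)] IH that by blast
  thus ?thesis using un(2)[OF that] cone_sum_eq(1)[OF pos that] by (simp add: cone_zeta_def)
 qed
 \<comment> \<open>A letter \<open>L\<close> splits off one unimodular cone: 4 / 24 from its
   coefficients and - 1 / 4 from the origin give - 2 / 24.\<close>
 have k: "(polar u u' * (1 / f u + 1 / f u') / 24 - 1 / 4) + (tau u' w - tau v (comb n u l w) + 2 * word_psi V) / 24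
   = (tau u w - tau v (comb n u l w) + 2 * word_psi (False # V)) / 24"
 proof -
  have p: "polar u u' = 2 * f u + polar u w" "polar u u' = 2 * f u' - polar u' w"
   by (cases u; cases w; simp add: polar_def f_def u'_def comb_def sq_simps)+
  have "polar u u' / f u = 2 + tau u w" using tpos_f[OF 3(4)] by (simp add: p(1) tau_def add_divide_distrib)
  moreover have "polar u u' / f u' = 2 - tau u' w" using tpos_f[OF upos] by (simp add: p(2) tau_def diff_divide_distrib)
  ultimately have e: "polar u u' * (1 / f u + 1 / f u') = 4 + tau u w - tau u' w" by (simp add: alg)
  show ?thesis unfolding e by (simp add: field_simps)
 qed
 have "asym_const (%t. (quad_trap (f u) (polar u u') (f u') t - 1 / 4) + cone_zeta u' v t)
   ((polar u u' * (1 / f u + 1 / f u') / 24 - 1 / 4) + (tau u' w - tau v (comb n u l w) + 2 * word_psi V) / 24)"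
  by (intro asym_const_add asym_const_diff asym_const_const quad_trap_asym_const[OF pos]) (use IH in simp)
 hence "asym_const (cone_zeta u v) ((tau u w - tau v (comb n u l w) + 2 * word_psi (False # V)) / 24)"
  unfolding k by (rule asym_const_cong) (simp add: add)
 thus ?case using S sp(3) unfolding v_def by blast
qed

text \<open>The word is the product of an automorph and the K-th power of \<open>T\<close>. The
  automorph preserves \<open>f\<close> and \<open>polar\<close>, so the theta sums of the two
  boundary rays cancel and the two values of \<open>tau\<close> differ by 2 K only.\<close>

lemma cone_automorph:
 assumes W: "word_mat W = (m11, m12 + K * m11, m21, m22 + K * m21)"
  and pos: "tpos (m11, m21)" and inv: "f (m11, m21) = a" "polar (m11, m21) (m12, m22) = b"
 shows "asym_const (%t. infsum (cone_fun t) (cone (1, 0) (m11, m21))) ((word_psi W - K) / 12)"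
  and "t > 0 ==> cone_fun t summable_on cone (1, 0) (m11, m21)"
proof -
 have e1: "tpos (1, 0)" using a_pos by (simp add: tpos_def r1_def r2_def)
 have c: "comb m11 (1, 0) m21 (0, 1) = (m11, m21)"
  "comb (m12 + K * m11) (1, 0) (m22 + K * m21) (0, 1) = (m12 + K * m11, m22 + K * m21)" by (simp_all add: comb_def)
 have d: "dt (1, 0) (0, 1) = 1" by (simp add: dt_def)
 have "tpos (comb m11 (1, 0) m21 (0, 1))" unfolding c by (rule pos)
 note cw = cone_word[OF W d e1 this, unfolded c]
 have t1: "tau (1, 0) (0, 1) = b / a" by (simp add: tau_def polar_def f_def)
 have "polar (m11, m21) (m12 + K * m11, m22 + K * m21) = polar (m11, m21) (m12, m22) + 2 * K * f (m11, m21)"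
  by (simp add: polar_def f_def sq_simps)
 hence t2: "tau (m11, m21) (m12 + K * m11, m22 + K * m21) = b / a + 2 * K"
  using a_pos by (simp add: tau_def inv add_divide_distrib)
 have fe: "f (1, 0) = a" by (simp add: f_def)
 have "(b / a - (b / a + 2 * K) + 2 * word_psi W) / 24 = (word_psi W - K) / 12" by (simp add: field_simps)
 hence "asym_const (cone_zeta (1, 0) (m11, m21)) ((word_psi W - K) / 12)"
  using cw unfolding t1 t2 by (simp only:)
 thus "asym_const (%t. infsum (cone_fun t) (cone (1, 0) (m11, m21))) ((word_psi W - K) / 12)"
  by (rule asym_const_cong) (simp add: cone_zeta_def inv fe)
 show "t > 0 ==> cone_fun t summable_on cone (1, 0) (m11, m21)" using cw by blast
qed

end

subsection \<open>The genus character in the real case\<close>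

lemma prime_3_mod_4: "prime p ==> p mod 4 = 3 ==> 2 < (p::nat)"
 using prime_ge_2_nat[of p] by (cases "p = 2") auto

lemma periodic_char_leg:
 assumes p: "prime p" "p mod 4 = 3"
 shows "periodic_char p (leg p)"
proof
 have p2: "2 < p" by (rule prime_3_mod_4[OF p])
 show "p > 0" using p2 by simp
 show "leg p (n + p) = leg p n" for n unfolding leg_def by (rule Legendre_cong) (simp add: cong_iff_dvd_diff)
 show z: "leg p 0 = 0" by (simp add: leg_eq_0_iff)
 show "\<bar>leg p n\<bar> <= 1" for n using leg_values[of p n] by auto
 have m: "leg p (p - r) = - leg p r" if "r <= p" for r
 proof -
  have "leg p (p - r) = Legendre (-1 * int r) (int p)"
   unfolding leg_def by (rule Legendre_cong) (use that in \<open>simp add: cong_iff_dvd_diff\<close>)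
  thus ?thesis using Legendre_mult[OF p(1) p2, of "-1" "int r"] Legendre_minus_1[OF p(1) p2] p(2) by (simp add: leg_def)
 qed
 have "{..<p} = insert 0 {1..<p}" using p2 by auto
 hence "(\<Sum>r<p. leg p r) = (\<Sum>r\<in>{1..<p}. leg p r)" using z by simp
 moreover have "(\<Sum>r\<in>{1..<p}. leg p r) = (\<Sum>r\<in>{1..<p}. leg p (p - r))"
  by (rule sum.reindex_bij_witness[of _ "%r. p - r" "%r. p - r"]) auto
 moreover have "(\<Sum>r\<in>{1..<p}. leg p (p - r)) = (\<Sum>r\<in>{1..<p}. - leg p r)"
  by (rule sum.cong) (auto simp: m)
 ultimately show "(\<Sum>r<p. leg p r) = 0" by (simp add: sum_negf)
qed

text \<open>The completely multiplicative function giving the sign of the genus character on ideals of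
 norm \<open>n\<close>.\<close>

definition genus_char :: "nat => nat => nat => int" where
 "genus_char p1 p2 n = (\<Prod>q\<in>#prime_factorization n. if q = p1 then leg p2 p1 else leg p1 q)"

lemma genus_char_mult: "m > 0 ==> n > 0 ==> genus_char p1 p2 (m * n) = genus_char p1 p2 m * genus_char p1 p2 n"
 by (simp add: genus_char_def prime_factorization_mult)

lemma genus_char_1: "genus_char p1 p2 (Suc 0) = 1"
 by (simp add: genus_char_def)

lemma genus_char_prime: "prime q ==> genus_char p1 p2 q = (if q = p1 then leg p2 p1 else leg p1 q)"
 by (simp add: genus_char_def prime_factorization_prime)

lemma genus_char_eq_leg:
 assumes "prime p1" "2 < p1" "n > 0" "~ p1 dvd n"
 shows "genus_char p1 p2 n = leg p1 n"
 using assms(3,4)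
proof (induction n rule: prime_divisors_induct)
 case (unit x)
 thus ?case using leg_1[OF assms(1)] by (simp add: genus_char_1)
next
 case (factor q x)
 hence "x > 0" "q ~= p1" "~ p1 dvd x" "q > 0" by (auto simp: prime_gt_0_nat intro: Nat.gr0I)
 thus ?case using factor genus_char_mult[of q x p1 p2] genus_char_prime[of q p1 p2] leg_mult[OF assms(1,2)] by simp
qed simp

lemma genus_char_square:
 assumes "prime p1" "prime p2" "p1 ~= p2" "n > 0"
 shows "genus_char p1 p2 n * genus_char p1 p2 n = 1"
 using assms(4)
proof (induction n rule: prime_divisors_induct)
 case (unit x)
 thus ?case by (simp add: genus_char_1)
next
 case (factor q x)
 have "leg p2 p1 ~= 0" using assms primes_dvd_imp_eq[of p2 p1] by (auto simp: leg_eq_0_iff)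
 moreover have "q ~= p1 ==> leg p1 q ~= 0" using assms factor(1) primes_dvd_imp_eq[of p1 q] by (auto simp: leg_eq_0_iff)
 ultimately have "genus_char p1 p2 q * genus_char p1 p2 q = 1"
  using leg_values[of p2 p1] leg_values[of p1 q] by (auto simp: genus_char_prime[OF factor(1)])
 moreover have "x > 0" "q > 0" using factor(1,3) by (auto intro: Nat.gr0I)
 ultimately show ?case using factor(2) genus_char_mult[of q x p1 p2] by (simp add: mult_ac)
qed simp

lemma genus_char_power: "q > 0 ==> genus_char p1 p2 (q ^ e) = genus_char p1 p2 q ^ e"
 by (induction e) (simp_all add: genus_char_1 genus_char_mult)

text \<open>The function h is completely multiplicative with values 1 and -1 on positive integers,
  hence 1 on squares, so the weighted count is h n times the count of ideals. At q^e with q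
  different from p1 and p2, h q is the symbol of q modulo p1, and its e-th power turns the i-th
  power of both symbols into the product of the (e - i)-th power of the first and the i-th power of
  the second.\<close>

lemma genus_char_roots:
 assumes p1: "prime p1" "p1 mod 4 = 3" and p2: "prime p2" "p2 mod 4 = 3" and ne: "p1 ~= p2"
  and C: "1 - 4 * C = int p1 * int p2" and n: "n > 0"
 shows "dconv square_ind (%a. genus_char p1 p2 a * int (card (qroots C a))) n = dconv (leg p1) (leg p2) n"
proof -
 define h where "h = genus_char p1 p2"
 have g: "2 < p1" "2 < p2" using prime_3_mod_4 p1 p2 by blast+
 interpret Q: quad_char C "%n. leg p1 n * leg p2 n" by (rule quad_char_prime_product[OF p1 p2 ne C])
 have "dconv square_ind (%a. h a * int (card (qroots C a))) n = h n * dconv square_ind (%a. int (card (qroots C a))) n"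
  unfolding dconv_def sum_distrib_left
 proof (rule sum.cong[OF refl])
  fix d assume "d : {d. d dvd n}"
  then obtain e where e: "n = d * e" by (auto elim: dvdE)
  have pos: "d > 0" "e > 0" using n e by (auto intro: Nat.gr0I)
  show "square_ind d * (h (n div d) * int (card (qroots C (n div d)))) = h n * (square_ind d * int (card (qroots C (n div d))))"
  proof (cases "is_nth_power 2 d")
   case True
   then obtain k where k: "d = k * k" by (auto simp: is_nth_power_def p2sq)
   hence "k > 0" using pos by (auto intro: Nat.gr0I)
   hence "h d = 1" unfolding k h_def using genus_char_mult genus_char_square[OF p1(1) p2(1) ne] by simp
   hence "h n = h e" unfolding e h_def using genus_char_mult pos by simp
   thus ?thesis using e pos by simp
  qed (simp add: square_ind_def)
 qed
 also have "... = h n * dconv (%n. leg p1 n * leg p2 n) (%_. 1) n" using Q.sum_roots_eq_sum_char[OF n] by simp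
 also have "... = dconv (leg p1) (leg p2) n"
 proof (rule multiplicative_eqI[OF _ _ _ n])
  have ml: "multiplicative (leg p1)" "multiplicative (leg p2)"
   using leg_mult[OF p1(1) g(1)] leg_mult[OF p2(1) g(2)] leg_1[OF p1(1)] leg_1[OF p2(1)] by (simp_all add: multiplicative_def)
  hence "multiplicative (%n. leg p1 n * leg p2 n)" by (simp add: multiplicative_def mult_ac)
  moreover have "multiplicative (%_. 1)" by (simp add: multiplicative_def)
  ultimately have "multiplicative (dconv (%n. leg p1 n * leg p2 n) (%_. 1))" by (rule multiplicative_dconv)
  thus "multiplicative (%n. h n * dconv (%n. leg p1 n * leg p2 n) (%_. 1) n)"
   by (auto simp: multiplicative_def h_def genus_char_mult genus_char_1)
  show "multiplicative (dconv (leg p1) (leg p2))" by (rule multiplicative_dconv[OF ml])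
  fix q e :: nat assume q: "prime q"
  have pw: "leg p1 (q ^ i) = leg p1 q ^ i" "leg p2 (q ^ i) = leg p2 q ^ i" for i
   using leg_1[OF p1(1)] leg_1[OF p2(1)] by (induction i) (simp_all add: leg_mult[OF p1(1) g(1)] leg_mult[OF p2(1) g(2)])
  have hq: "h (q ^ e) = h q ^ e" using genus_char_power[of q p1 p2 e] prime_gt_0_nat[OF q] by (simp add: h_def)
  have L: "h (q ^ e) * dconv (%n. leg p1 n * leg p2 n) (%_. 1) (q ^ e) = (\<Sum>i\<le>e. h q ^ e * (leg p1 q * leg p2 q) ^ i)"
   unfolding dconv_prime_power[OF q] hq by (simp add: pw sum_distrib_left power_mult_distrib)
  have Rr: "dconv (leg p1) (leg p2) (q ^ e) = (\<Sum>i\<le>e. leg p1 q ^ i * leg p2 q ^ (e - i))"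
   unfolding dconv_prime_power[OF q] by (simp add: pw)
  show "h (q ^ e) * dconv (%n. leg p1 n * leg p2 n) (%_. 1) (q ^ e) = dconv (leg p1) (leg p2) (q ^ e)"
  proof (cases "q = p1 \<or> q = p2")
   case True
   have s0: "(\<Sum>i\<le>e. x * (0::int) ^ i * y i) = x * y 0" for x y
    by (subst sum.remove[of _ 0]) (auto intro!: sum.neutral)
   have s1: "(\<Sum>i\<le>e. x ^ i * (0::int) ^ (e - i)) = x ^ e" for x
    by (subst sum.remove[of _ e]) (auto intro!: sum.neutral)
   from True show ?thesis
   proof
    assume q1: "q = p1"
    have "leg p1 q = 0" "h q = leg p2 q" using q1 genus_char_prime[OF q] by (simp_all add: leg_eq_0_iff h_def)
    thus ?thesis unfolding L Rr using s0[of _ "%_. 1"] s0[of 1 "%i. leg p2 q ^ (e - i)"] by simp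
   next
    assume q2: "q = p2"
    have "leg p2 q = 0" "h q = leg p1 q" using q2 ne genus_char_prime[OF q] by (simp_all add: leg_eq_0_iff h_def)
    thus ?thesis unfolding L Rr using s0[of _ "%_. 1"] s1 by simp
   qed
  next
   case False
   have "leg p1 q ~= 0" using False q p1(1) primes_dvd_imp_eq[of p1 q] by (auto simp: leg_eq_0_iff)
   hence sq: "leg p1 q * leg p1 q = 1" using leg_values[of p1 q] by auto
   have "h q = leg p1 q" using False genus_char_prime[OF q] by (simp add: h_def)
   hence "(\<Sum>i\<le>e. h q ^ e * (leg p1 q * leg p2 q) ^ i) = (\<Sum>i\<le>e. leg p1 q ^ (e - i) * leg p2 q ^ i)"
   proof (intro sum.cong refl)
    fix i assume hq: "h q = leg p1 q" and "i : {..e}"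
    hence "leg p1 q ^ e = leg p1 q ^ (e - i) * leg p1 q ^ i" by (simp flip: power_add)
    hence "leg p1 q ^ e * leg p1 q ^ i = leg p1 q ^ (e - i) * (leg p1 q * leg p1 q) ^ i"
     by (simp only: power_mult_distrib mult.assoc)
    thus "h q ^ e * (leg p1 q * leg p2 q) ^ i = leg p1 q ^ (e - i) * leg p2 q ^ i"
     unfolding hq sq power_mult_distrib by (simp add: mult.assoc[symmetric])
   qed
   also have "... = (\<Sum>i\<le>e. leg p1 q ^ i * leg p2 q ^ (e - i))"
    by (rule sum.reindex_bij_witness[of _ "%i. e - i" "%i. e - i"]) auto
   finally show ?thesis unfolding L Rr .
  qed
 qed
 finally show ?thesis by (simp add: h_def)
qed

section \<open>The genus character on forms\<close>

locale real_quad_disc = quad_disc +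
 fixes p1 p2 :: nat
 assumes p1: "prime p1" "p1 mod 4 = 3" and p2: "prime p2" "p2 mod 4 = 3" and p_ne: "p1 ~= p2"
  and D_eq: "D = int p1 * int p2"
begin

lemma p_gt: "2 < p1" "2 < p2" using prime_3_mod_4 p1 p2 by blast+

lemma p1_int: "prime (int p1)" using p1 by simp

lemma D_pos: "D > 0" using p_gt by (simp add: D_eq)

lemma p1_dvd_D: "int p1 dvd D" by (simp add: D_eq)

lemma Leg_mult: "Legendre (x * y) (int p1) = Legendre x (int p1) * Legendre y (int p1)"
 by (rule Legendre_mult[OF p1(1) p_gt(1)])

lemma Leg_m1: "Legendre (- 1) (int p1) = - 1"
 using Legendre_minus_1[OF p1(1) p_gt(1)] p1(2) by simp

lemma Leg_sq: "~ int p1 dvd x ==> Legendre (x * x) (int p1) = 1"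
 by (rule Legendre_square[OF p1(1) p_gt(1)])

lemma p1_ndvd_2: "~ int p1 dvd 2"
 using p_gt(1) zdvd_imp_le[of "int p1" 2] by auto

lemma Leg_4: "Legendre (4 * x) (int p1) = Legendre x (int p1)"
 using Leg_mult[of "2 * 2" x] Leg_sq[OF p1_ndvd_2] by simp

lemma Leg_unit: "~ int p1 dvd x ==> Legendre x (int p1) : {-1, 1}"
 using Legendre_values[of x "int p1"] Legendre_eq_0_iff[of x "int p1"] by auto

text \<open>The genus character: the Legendre symbol modulo p1 of any value of the form prime to p1.
  It is read off at (1, 0) or at (0, 1), since p1 cannot divide both outer coefficients.\<close>

definition chi :: "int => int => int" where
 "chi a b = Legendre (if int p1 dvd a then cc a b else a) (int p1)"

lemma p1_dvd_b: "is_form a b ==> int p1 dvd a ==> int p1 dvd b"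
proof -
 assume "is_form a b" "int p1 dvd a"
 hence "b^2 = D + 4 * a * cc a b" "int p1 dvd D + 4 * a * cc a b" using form_eq[of a b] p1_dvd_D by auto
 thus ?thesis using p1_int prime_dvd_power by metis
qed

lemma p1_ndvd_cc: "is_form a b ==> int p1 dvd a ==> ~ int p1 dvd cc a b"
proof
 assume h: "is_form a b" "int p1 dvd a" "int p1 dvd cc a b"
 obtain i j k where "i * a + j * b + k * cc a b = 1" using form_coprime[OF h(1)] by blast
 moreover have "int p1 dvd i * a + j * b + k * cc a b" using h p1_dvd_b by auto
 ultimately show False using p_gt(1) by simp
qed

lemma chi_values: "is_form a b ==> chi a b : {-1, 1}"
 unfolding chi_def by (rule Leg_unit) (use p1_ndvd_cc in auto)

lemma disc_qf: "is_form a b ==> 4 * a * qf a b x y = (2 * a * x + b * y) * (2 * a * x + b * y) - D * y^2"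
proof -
 assume f: "is_form a b"
 have "4 * a * qf a b x y = (2 * a * x + b * y) * (2 * a * x + b * y) - (b^2 - 4 * a * cc a b) * y^2"
  unfolding qf_def by (simp add: sq_simps)
 also have "b^2 - 4 * a * cc a b = D" using form_eq[OF f] by simp
 finally show ?thesis .
qed

text \<open>If p1 does not divide a, then 4 a m = s^2 - D y^2 shows that a times the value m is a
  square modulo p1. Otherwise p1 divides b as well, and only c y^2 is left of the value.\<close>

lemma chi_value:
 assumes f: "is_form a b" and nd: "~ int p1 dvd qf a b x y"
 shows "Legendre (qf a b x y) (int p1) = chi a b"
proof (cases "int p1 dvd a")
 case False
 define s where "s = 2 * a * x + b * y"
 define m where "m = qf a b x y"
 have e: "4 * (a * m) = s * s - D * y^2" using disc_qf[OF f, of x y] by (simp add: s_def m_def)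
 have n4: "~ int p1 dvd 4 * (a * m)"
  using False nd p1_ndvd_2 prime_dvd_mult_iff[OF p1_int] prime_dvd_mult_iff[OF p1_int, of 2 2] by (auto simp: m_def)
 hence "~ int p1 dvd s" unfolding e using p1_dvd_D by auto
 hence "Legendre (s * s) (int p1) = 1" by (rule Leg_sq)
 moreover have "Legendre (4 * (a * m)) (int p1) = Legendre (s * s) (int p1)"
  unfolding e by (rule Legendre_cong) (use p1_dvd_D in \<open>simp add: cong_iff_dvd_diff\<close>)
 ultimately have "Legendre a (int p1) * Legendre m (int p1) = 1" by (simp only: Leg_4) (simp only: Leg_mult)
 thus ?thesis using Leg_unit[OF False] Leg_unit[OF nd] False by (auto simp: chi_def m_def)
next
 case True
 have "[qf a b x y = cc a b * (y * y)] (mod int p1)"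
  unfolding qf_def using True p1_dvd_b[OF f True] by (simp add: cong_iff_dvd_diff p2sq)
 moreover from this have "~ int p1 dvd y" using nd cong_dvd_iff by (metis dvd_mult)
 ultimately have "Legendre (qf a b x y) (int p1) = Legendre (cc a b) (int p1)"
  using Legendre_cong[of "qf a b x y" "cc a b * (y * y)" "int p1"] Leg_sq by (simp add: Leg_mult)
 thus ?thesis using True by (simp add: chi_def)
qed

lemma qf_nonzero: "is_form a b ==> (x, y) ~= (0, 0) ==> qf a b x y ~= 0"
proof -
 assume f: "is_form a b" and nz: "(x, y) ~= (0, 0)"
 obtain k a' b' where T: "Theta a b x y = (k, a', b')" by (metis prod_cases3)
 have "k^2 * a' > 0" using Theta_props(1,2)[OF f nz T] form_pos by simp
 thus ?thesis using Theta_props(6)[OF f nz T] by auto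
qed

text \<open>By \<open>Theta_props\<close> the values of the new form are values of the old one up to
  the sign of \<open>qf a b x y\<close>, and -1 is a nonresidue modulo p1. So \<open>chi\<close> is
  not constant on a wide class.\<close>

lemma chi_Theta:
 assumes f: "is_form a b" and nz: "(x, y) ~= (0, 0)" and T: "Theta a b x y = (k, a', b')"
 shows "chi a' b' = sgn (qf a b x y) * chi a b"
proof -
 note P = Theta_props[OF f nz T]
 obtain x' y' where xy: "~ int p1 dvd qf a' b' x' y'"
 proof (cases "int p1 dvd a'")
  case True
  hence "~ int p1 dvd qf a' b' 0 1" using p1_ndvd_cc[OF P(2) True] by (simp add: qf_def)
  thus ?thesis by (rule that)
 next
  case False
  hence "~ int p1 dvd qf a' b' 1 0" by (simp add: qf_def)
  thus ?thesis by (rule that)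
 qed
 obtain u v where uv: "qf a' b' x' y' = sgn (qf a b x y) * qf a b u v" using P(7) by blast
 have sg: "sgn (qf a b x y) = 1 \<or> sgn (qf a b x y) = -1" using qf_nonzero[OF f nz] by (auto simp: sgn_if)
 have nd: "~ int p1 dvd qf a b u v" using xy unfolding uv by auto
 have "chi a' b' = Legendre (sgn (qf a b x y) * qf a b u v) (int p1)" using chi_value[OF P(2) xy] uv by simp
 also have "... = sgn (qf a b x y) * Legendre (qf a b u v) (int p1)"
  using sg Leg_m1 Leg_mult Legendre_1[OF p1(1)] by auto
 finally show ?thesis using chi_value[OF f nd] by simp
qed

text \<open>Only p1 | a is delicate: a = p1 a' and b = p1 b' give p1 b'^2 - p2 = 4 a' c, so 4 a' c =
  - p2 modulo p1, and reciprocity for two primes that are 3 mod 4 turns the symbol of c into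
  \<open>leg p2 p1\<close> times that of a'.\<close>

lemma chi_genus_char:
 assumes f: "is_form a b"
 shows "chi a b = genus_char p1 p2 (nat a)"
proof -
 have a: "a > 0" by (rule form_pos[OF f])
 show ?thesis
 proof (cases "int p1 dvd a")
  case False
  hence "~ p1 dvd nat a" using a by (simp add: int_dvd_int_iff[symmetric])
  thus ?thesis using genus_char_eq_leg[OF p1(1) p_gt(1), of "nat a"] False a by (simp add: chi_def leg_def)
 next
  case True
  then obtain a' where a': "a = int p1 * a'" by (rule dvdE)
  obtain b' where b': "b = int p1 * b'" using p1_dvd_b[OF f True] by (rule dvdE)
  have "int p1 * (int p1 * b'^2 - int p2) = int p1 * (4 * (a' * cc a b))"
   using form_eq[OF f] unfolding D_eq by (simp add: a' b' sq_simps)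
  hence e: "int p1 * b'^2 - int p2 = 4 * (a' * cc a b)" using p_gt by simp
  have p1p2: "~ p1 dvd p2" using p1 p2 p_ne primes_dvd_imp_eq by blast
  have nd: "~ int p1 dvd a'"
  proof
   assume "int p1 dvd a'"
   hence "int p1 dvd int p1 * b'^2 - (int p1 * b'^2 - int p2)" unfolding e by (simp del: diff_diff_eq2)
   thus False using p1p2 by simp
  qed
  have a'0: "a' > 0" using a p_gt by (simp add: a' zero_less_mult_iff)
  have "[4 * (a' * cc a b) = -1 * int p2] (mod int p1)" unfolding e[symmetric] by (simp add: cong_iff_dvd_diff)
  hence "Legendre a' (int p1) * Legendre (cc a b) (int p1) = - leg p1 p2"
   using Legendre_cong[of "4 * (a' * cc a b)" "-1 * int p2" "int p1"] Leg_mult[of "-1" "int p2"]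
   by (simp only: Leg_4) (simp add: Leg_mult[of a'] Leg_m1 leg_def)
  moreover have "leg p2 p1 * leg p1 p2 = -1"
   using Legendre_reciprocity[OF p1(1) p2(1) p_gt p_ne] p1(2) p2(2) by (simp add: leg_def)
  ultimately have "Legendre (cc a b) (int p1) = leg p2 p1 * Legendre a' (int p1)"
   using Leg_unit[OF nd] leg_values[of p2 p1] leg_values[of p1 p2] by auto
  moreover have "genus_char p1 p2 (nat a) = leg p2 p1 * Legendre a' (int p1)"
  proof -
   have na: "nat a = p1 * nat a'" using a'0 by (simp add: a' nat_mult_distrib)
   have "~ p1 dvd nat a'" using nd a'0 by (simp add: int_dvd_int_iff[symmetric])
   thus ?thesis unfolding na using genus_char_mult[of p1 "nat a'"] genus_char_prime[OF p1(1)]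
     genus_char_eq_leg[OF p1(1) p_gt(1), of "nat a'"] p_gt a'0 by (simp add: leg_def)
  qed
  ultimately show ?thesis using True by (simp add: chi_def)
 qed
qed

text \<open>Otherwise -4 would be a square modulo p1.\<close>

lemma norm_minus_4: "t^2 - D * u^2 ~= - 4"
proof
 assume h: "t^2 - D * u^2 = - 4"
 have "t * t = -1 * (2 * 2) + D * u^2" using h by (simp add: p2sq)
 hence c: "[t * t = -1 * (2 * 2)] (mod int p1)" using p1_dvd_D by (simp add: cong_iff_dvd_diff)
 have "~ int p1 dvd t"
 proof
  assume "int p1 dvd t"
  hence "int p1 dvd -1 * (2 * 2)" using c cong_dvd_iff by (metis dvd_mult)
  thus False using p1_ndvd_2 prime_dvd_mult_iff[OF p1_int, of 2 2] by simp
 qed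
 thus False using Legendre_cong[OF c] Leg_sq[of t] Leg_mult[of "-1" "2 * 2"] Leg_sq[OF p1_ndvd_2] Leg_m1 by simp
qed

end

section \<open>The fundamental unit\<close>

context real_quad_disc
begin

definition sq :: real where "sq = sqrt (real_of_int D)"

lemma sq_pos: "sq > 0" using D_pos by (simp add: sq_def)

lemma sq_sq: "sq * sq = real_of_int D" using D_pos by (simp add: sq_def)

lemma principal_form: "is_form 1 1" "cc 1 1 = C"
 unfolding is_form_def cc_def by (simp_all add: D)

text \<open>With theta = (sq - 1) / 2 the form factors as (x - y theta) (x - y theta + y sq), so
  good approximations x / y of theta give small values. A finite set would leave a positive lower
  bound for |x - y theta|, which Dirichlet's theorem undercuts.\<close>

lemma infinite_small_values:
 "infinite {(x, y). y > 0 & \<bar>real_of_int (qf 1 1 x y)\<bar> <= 1 + sq}" (is "infinite ?S")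
proof
 assume fin: "finite ?S"
 define \<theta> where "\<theta> = (sq - 1) / 2"
 have fac: "real_of_int (qf 1 1 x y) = (x - y * \<theta>) * ((x - y * \<theta>) + y * sq)" for x y
 proof -
  have "(x - y * \<theta>) * ((x - y * \<theta>) + y * sq) = real_of_int x * x + x * y + real_of_int y * y * (1 - sq * sq) / 4"
   by (simp add: \<theta>_def field_simps)
  moreover have "real_of_int D = 1 - 4 * real_of_int C" by (simp add: D)
  ultimately show ?thesis unfolding sq_sq by (simp add: qf_def principal_form(2) sq_simps)
 qed
 define d where "d = Min (insert 1 ((%(x, y). \<bar>real_of_int x - y * \<theta>\<bar>) ` ?S))"
 have "z > 0" if "z : insert 1 ((%(x, y). \<bar>real_of_int x - y * \<theta>\<bar>) ` ?S)" for z
 proof -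
  have "real_of_int x - y * \<theta> ~= 0" if "y > 0" for x y :: int
  proof
   assume "real_of_int x - y * \<theta> = 0"
   hence "qf 1 1 x y = 0" using fac[of x y] by simp
   thus False using qf_nonzero[OF principal_form(1), of x y] that by simp
  qed
  thus ?thesis using that by auto
 qed
 hence d0: "d > 0" unfolding d_def using fin by (subst Min_gr_iff) auto
 then obtain N where N: "N > 0" "1 / real N < d" using reals_Archimedean[OF d0]
  by (metis inverse_eq_divide of_nat_0_less_iff zero_less_Suc)
 obtain h k where hk: "0 < k" "k <= int N" "\<bar>of_int k * \<theta> - of_int h\<bar> < 1 / N" using Dirichlet_approx[OF N(1)] by blast
 have s1: "\<bar>real_of_int h - k * \<theta>\<bar> < 1 / N" using hk(3) by (simp add: abs_minus_commute)
 have "1 / real N <= 1 / real_of_int k"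
 proof -
  have "real_of_int k <= real N" using hk(2) by (metis of_int_le_iff of_int_of_nat_eq)
  thus ?thesis using hk(1) by (simp add: frac_le)
 qed
 hence s2: "\<bar>real_of_int h - k * \<theta>\<bar> <= 1 / k" using s1 by linarith
 have k1: "1 / real_of_int k <= 1" using hk(1) by simp
 have s3: "\<bar>(real_of_int h - k * \<theta>) + k * sq\<bar> <= 1 + k * sq"
 proof -
  have "\<bar>real_of_int k * sq\<bar> = k * sq" using hk(1) sq_pos by simp
  thus ?thesis using s2 k1 abs_triangle_ineq[of "real_of_int h - k * \<theta>" "k * sq"] by linarith
 qed
 have "\<bar>real_of_int (qf 1 1 h k)\<bar> <= 1 / k * (1 + k * sq)"
  unfolding fac abs_mult using s2 s3 hk(1) by (intro mult_mono) auto
 also have "... <= 1 + sq" using k1 hk(1) by (simp add: distrib_left)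
 finally have "(h, k) : ?S" using hk(1) by simp
 hence "\<bar>real_of_int h - k * \<theta>\<bar> : (%(x, y). \<bar>real_of_int x - y * \<theta>\<bar>) ` ?S" by force
 hence "d <= \<bar>real_of_int h - k * \<theta>\<bar>" unfolding d_def using fin by (intro Min_le) auto
 thus False using s1 N(2) by linarith
qed

text \<open>Two points in the same fibre of \<open>Theta\<close> differ by a unit, so the pigeonhole principle
 produces a nontrivial one.\<close>

lemma unit_exists: "EX t u. t > 0 & u > 0 & t^2 - D * u^2 = 4"
proof -
 define S where "S = {(x, y). y > (0::int) & \<bar>real_of_int (qf 1 1 x y)\<bar> <= 1 + sq}"
 define Th where "Th = (%(x, y). Theta 1 1 x y)"
 define B where "B = nat \<lceil>1 + sq\<rceil>"
 have "Th ` S \<subseteq> (\<Union>n\<in>{..B}. level n)"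
 proof
  fix s assume "s : Th ` S"
  then obtain x y where xy: "y > 0" "\<bar>real_of_int (qf 1 1 x y)\<bar> <= 1 + sq" "s = Theta 1 1 x y"
   by (auto simp: Th_def S_def)
  have nz: "(x, y) ~= (0, 0)" using xy by simp
  obtain k a' b' where T: "Theta 1 1 x y = (k, a', b')" by (metis prod_cases3)
  note P = Theta_props(1-4)[OF principal_form(1) nz T]
  have "s : triples forms" using P by (simp add: xy(3) T triples_def forms_def)
  moreover have "tnorm s <= B"
  proof -
   have "real_of_int \<bar>qf 1 1 x y\<bar> <= of_int \<lceil>1 + sq\<rceil>" using xy(2) le_of_int_ceiling[of "1 + sq"] unfolding of_int_abs by linarith
   hence "\<bar>qf 1 1 x y\<bar> <= \<lceil>1 + sq\<rceil>" by (simp only: of_int_le_iff)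
   thus ?thesis unfolding xy(3) tnorm_Theta[OF principal_form(1) nz] B_def by (rule nat_mono)
  qed
  ultimately show "s : (\<Union>n\<in>{..B}. level n)" by (simp add: level_def)
 qed
 hence "finite (Th ` S)" by (rule finite_subset) (simp add: finite_level)
 moreover have "infinite S" using infinite_small_values unfolding S_def .
 ultimately obtain z0 where z0: "z0 : S" "infinite {z : S. Th z = Th z0}" using pigeonhole_infinite[of S Th] by blast
 hence "~ {z : S. Th z = Th z0} \<subseteq> {z0}" using finite_subset by blast
 then obtain z1 where z1: "z1 : S" "Th z1 = Th z0" "z1 ~= z0" by blast
 obtain x y x' y' where z: "z0 = (x, y)" "z1 = (x', y')" by (cases z0; cases z1)
 have yy: "y > 0" "y' > 0" using z0(1) z1(1) by (auto simp: S_def z)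
 have "Theta 1 1 x y = Theta 1 1 x' y'" using z1(2) by (simp add: Th_def z)
 then obtain t u where tu: "t^2 - D * u^2 = 4" "x' = (t - 1 * u) div 2 * x - cc 1 1 * u * y" "y' = 1 * u * x + (t + 1 * u) div 2 * y"
  using Theta_fibre[OF principal_form(1), of x y x' y'] norm_minus_4 yy by auto
 have u0: "u ~= 0"
 proof
  assume u: "u = 0"
  hence "t^2 = 2^2" using tu(1) by simp
  hence "t = 2 \<or> t = -2" by (simp only: power2_eq_iff)
  thus False using tu(2,3) u yy z1(3) z by auto
 qed
 have "t ~= 0"
 proof
  assume "t = 0"
  hence "D * u^2 = -4" using tu(1) by simp
  moreover have "D * u^2 >= 0" using D_pos by simp
  ultimately show False by simp
 qed
 hence "\<bar>t\<bar> > 0 & \<bar>u\<bar> > 0 & \<bar>t\<bar>\<^sup>2 - D * \<bar>u\<bar>\<^sup>2 = 4" using u0 tu(1) by simp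
 thus ?thesis by blast
qed

lemma fundamental_unit_exists:
 "EX t u. t > 0 & u > 0 & t^2 - D * u^2 = 4 & (ALL t' u'. t'\<^sup>2 - D * u'^2 = 4 --> u' ~= 0 --> u <= \<bar>u'\<bar>)"
proof -
 define P where "P n \<longleftrightarrow> n > 0 & (EX t. t\<^sup>2 - D * (int n)^2 = 4)" for n
 obtain t u where tu: "t > 0" "u > 0" "t^2 - D * u^2 = 4" using unit_exists by blast
 hence "P (nat u)" unfolding P_def by auto
 hence L: "P (Least P)" by (rule LeastI)
 then obtain t' where t': "t'^2 - D * (int (Least P))^2 = 4" "Least P > 0" by (auto simp: P_def)
 have "t' ~= 0"
 proof
  assume "t' = 0"
  hence "D * (int (Least P))^2 = -4" using t'(1) by simp
  moreover have "D * (int (Least P))^2 >= 0" using D_pos by simp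
  ultimately show False by simp
 qed
 moreover have "int (Least P) <= \<bar>u'\<bar>" if h: "t''^2 - D * u'^2 = 4" "u' ~= 0" for t'' u'
 proof -
  have "P (nat \<bar>u'\<bar>)" unfolding P_def using h by auto
  hence "Least P <= nat \<bar>u'\<bar>" by (rule Least_le)
  thus ?thesis by simp
 qed
 ultimately show ?thesis using t' by (intro exI[of _ "\<bar>t'\<bar>"] exI[of _ "int (Least P)"]) auto
qed

definition fund :: "int \<times> int" where
 "fund = (SOME (t, u). t > 0 & u > 0 & t^2 - D * u^2 = 4 & (ALL t' u'. t'\<^sup>2 - D * u'^2 = 4 --> u' ~= 0 --> u <= \<bar>u'\<bar>))"
definition et :: int where "et = fst fund"
definition eu :: int where "eu = snd fund"

lemma fund: "et > 0" "eu > 0" "et^2 - D * eu^2 = 4"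
 and fund_min: "t^2 - D * u^2 = 4 ==> u ~= 0 ==> eu <= \<bar>u\<bar>"
proof -
 have "case fund of (t, u) => t > 0 & u > 0 & t^2 - D * u^2 = 4 & (ALL t' u'. t'\<^sup>2 - D * u'^2 = 4 --> u' ~= 0 --> u <= \<bar>u'\<bar>)"
  unfolding fund_def by (rule someI_ex) (use fundamental_unit_exists in auto)
 thus "et > 0" "eu > 0" "et^2 - D * eu^2 = 4" "t^2 - D * u^2 = 4 ==> u ~= 0 ==> eu <= \<bar>u\<bar>"
  unfolding et_def eu_def by (auto simp: case_prod_beta')
qed

definition uval :: "int => int => real" where "uval t u = (t + u * sq) / 2"
definition eps :: real where "eps = uval et eu"

lemma uval_conj: "t^2 - D * u^2 = 4 ==> uval t u * uval t (- u) = 1"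
proof -
 assume h: "t^2 - D * u^2 = 4"
 have "uval t u * uval t (- u) = (real_of_int t * t - real_of_int u * u * (sq * sq)) / 4"
  by (simp add: uval_def field_simps)
 also have "real_of_int t * t - real_of_int u * u * (sq * sq) = real_of_int (t^2 - D * u^2)"
  by (simp add: sq_sq p2sq)
 finally show ?thesis by (simp add: h)
qed

lemma et_gt: "et > 2"
proof -
 have "D * eu^2 > 0" using D_pos fund(2) by simp
 hence "2^2 < et^2" using fund(3) by simp
 thus ?thesis using fund(1) power2_less_imp_less[of 2 et] by simp
qed

lemma eps_gt: "eps > 1"
proof -
 have "eu * sq > 0" using fund(2) sq_pos by simp
 thus ?thesis using et_gt by (simp add: eps_def uval_def field_simps)
qed

text \<open>On t^2 - D u^2 = 4 with t, u > 0, t grows with u, so the minimal u gives the smallest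
  unit.\<close>

lemma uval_ge_eps:
 assumes "t > 0" "u > 0" "t^2 - D * u^2 = 4"
 shows "uval t u >= eps"
proof -
 have u: "eu <= u" using fund_min[OF assms(3)] assms(2) by simp
 hence "eu^2 <= u^2" using fund(2) by (intro power_mono) auto
 hence "D * eu^2 <= D * u^2" using D_pos by simp
 hence "et^2 <= t^2" using fund(3) assms(3) by linarith
 hence "et <= t" using assms(1) power2_le_imp_le[of et t] by simp
 moreover have "real_of_int eu * sq <= u * sq" using u sq_pos by simp
 ultimately show ?thesis unfolding eps_def uval_def by (simp add: divide_right_mono add_mono)
qed

lemma unit_power: "EX t u. t\<^sup>2 - D * u^2 = 4 & uval t u = eps ^ n"
proof (induction n)
 case 0
 show ?case by (rule exI[of _ 2], rule exI[of _ 0]) (simp add: uval_def)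
next
 case (Suc n)
 then obtain t u where tu: "t^2 - D * u^2 = 4" "uval t u = eps ^ n" by blast
 have ev: "even (t + u)" "even (et + eu)" using unit_parity[of _ _ 1] tu(1) fund(3) by auto
 have "even (t * et + D * u * eu)" "even (t * eu + u * et)" using ev odd_D by (simp_all only: even_add even_mult_iff) blast+
 then obtain t' u' where tu': "t * et + D * u * eu = 2 * t'" "t * eu + u * et = 2 * u'" by (elim evenE)
 have "4 * (t'^2 - D * u'^2) = (2 * t')^2 - D * (2 * u')^2" by (simp add: p2sq)
 also have "... = (t^2 - D * u^2) * (et^2 - D * eu^2)"
  unfolding tu'[symmetric] by (simp add: sq_simps)
 finally have n: "t'^2 - D * u'^2 = 4" using tu(1) fund(3) by simp
 have "real_of_int (2 * t') + real_of_int (2 * u') * sq = 4 * (uval t u * eps)"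
 proof -
  have "4 * (uval t u * eps) = real_of_int t * et + real_of_int u * eu * (sq * sq) + (real_of_int t * eu + real_of_int u * et) * sq"
   by (simp add: uval_def eps_def alg)
  thus ?thesis unfolding sq_sq tu'[symmetric] by (simp add: mult_ac)
 qed
 moreover have "uval t' u' = (real_of_int (2 * t') + real_of_int (2 * u') * sq) / 4" by (simp add: uval_def field_simps)
 ultimately have "uval t' u' = eps ^ Suc n" by (simp add: tu(2) mult.commute)
 thus ?case using n by blast
qed

lemma unit_zpower: "EX t u. t\<^sup>2 - D * u^2 = 4 & uval t u = eps powi n"
proof (cases "n >= 0")
 case True
 thus ?thesis using unit_power[of "nat n"] by (simp add: power_int_def)
next
 case False
 obtain t u where tu: "t^2 - D * u^2 = 4" "uval t u = eps ^ nat (- n)" using unit_power by blast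
 have "uval t (- u) = 1 / uval t u" using uval_conj[OF tu(1)] by (metis mult_eq_0_iff nonzero_eq_divide_eq mult.commute zero_neq_one)
 also have "... = eps powi n" using False unfolding tu(2) by (simp add: power_int_def power_inverse inverse_eq_divide power_one_over)
 finally show ?thesis using tu(1) by (intro exI[of _ t] exI[of _ "- u"]) simp
qed

section \<open>A fundamental domain for the units\<close>

definition act :: "int => int => int => int => int \<times> int => int \<times> int" where
 "act a b t u = (%(x, y). ((t - b * u) div 2 * x - cc a b * u * y, a * u * x + (t + b * u) div 2 * y))"

abbreviation "R1 a b \<equiv> indef_form.r1 a b sq"
abbreviation "R2 a b \<equiv> indef_form.r2 a b sq"

lemma indef: "is_form a b ==> indef_form a b (cc a b) sq"
proof
 assume f: "is_form a b"
 show "a > 0" by (rule form_pos[OF f])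
 show "sq > 0" by (rule sq_pos)
 have "b^2 - 4 * a * cc a b = D" using form_eq[OF f] by simp
 thus "sq^2 = real_of_int (b^2 - 4 * a * cc a b)" by (simp only: p2sq[of sq] sq_sq)
qed

lemma act_r:
 assumes f: "is_form a b" and u: "t^2 - D * u^2 = 4"
 shows "R1 a b (act a b t u z) = uval t u * R1 a b z" "R2 a b (act a b t u z) = uval t (- u) * R2 a b z"
proof -
 interpret I: indef_form a b "cc a b" sq by (rule indef[OF f])
 obtain x y where z: "z = (x, y)" by (cases z)
 have ev: "even (t + u)" using unit_parity[of t u 1] u by simp
 have h: "real_of_int ((t - b * u) div 2) = (t - b * u) / 2" "real_of_int ((t + b * u) div 2) = (t + b * u) / 2"
  using ev form_odd[OF f] by (simp_all add: real_of_int_div)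
 have k: "real_of_int b * b = sq * sq + 4 * a * cc a b" using I.sq' by simp
 have "R1 a b (act a b t u z) - uval t u * R1 a b z = y * u * (real_of_int b * b - sq * sq - 4 * a * cc a b) / 4"
  by (simp add: z act_def I.r1_def uval_def h alg add_divide_distrib diff_divide_distrib)
 thus "R1 a b (act a b t u z) = uval t u * R1 a b z" unfolding k by simp
 have "R2 a b (act a b t u z) - uval t (- u) * R2 a b z = y * u * (real_of_int b * b - sq * sq - 4 * a * cc a b) / 4"
  by (simp add: z act_def I.r2_def uval_def h alg add_divide_distrib diff_divide_distrib)
 thus "R2 a b (act a b t u z) = uval t (- u) * R2 a b z" unfolding k by simp
qed

abbreviation "tposf a b \<equiv> indef_form.tpos a b sq"

text \<open>The point (1, 0) is the number a, and multiplication by \<open>eps\<close> multiplies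
  the slope r1 / r2 by \<open>eps\<close>^2. So the cone is the window [1, eps^2) of slopes, a
  fundamental domain for the totally positive units.\<close>

definition unit_cone :: "int => int => (int \<times> int) set" where
 "unit_cone a b = indef_form.cone a b sq (1, 0) (act a b et eu (1, 0))"

lemma unit_cone_iff:
 assumes f: "is_form a b"
 shows "z : unit_cone a b \<longleftrightarrow> tposf a b z & 1 <= R1 a b z / R2 a b z & R1 a b z / R2 a b z < eps^2"
  and "tposf a b (act a b et eu (1, 0))"
proof -
 interpret I: indef_form a b "cc a b" sq by (rule indef[OF f])
 have r: "R1 a b (1, 0) = a" "R2 a b (1, 0) = a" by (simp_all add: I.r1_def I.r2_def)
 have t1: "I.tpos (1, 0)" using r I.a_pos by (simp add: I.tpos_def)
 have c: "eps * uval et (- eu) = 1" using uval_conj[OF fund(3)] by (simp add: eps_def)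
 hence cp: "uval et (- eu) > 0" using eps_gt by (metis mult.commute zero_less_mult_pos2 less_trans zero_less_one)
 have ra: "R1 a b (act a b et eu (1, 0)) = eps * a" "R2 a b (act a b et eu (1, 0)) = uval et (- eu) * a"
  unfolding act_r[OF f fund(3)] r by (simp_all add: eps_def)
 show t2: "I.tpos (act a b et eu (1, 0))" using ra cp eps_gt I.a_pos by (simp add: I.tpos_def)
 have s: "R1 a b (act a b et eu (1, 0)) / R2 a b (act a b et eu (1, 0)) = eps^2"
  unfolding ra using c cp I.a_pos by (simp add: field_simps p2sq)
 have "R1 a b (1, 0) / R2 a b (1, 0) = 1" unfolding r using I.a_pos by simp
 thus "z : unit_cone a b \<longleftrightarrow> I.tpos z & 1 <= R1 a b z / R2 a b z & R1 a b z / R2 a b z < eps^2"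
  unfolding unit_cone_def I.cone_def using I.dt_iff(1)[OF t1, of z] I.dt_iff(2)[OF _ t2, of z] s by auto
qed

lemma tposf_nonzero: "tposf a b z ==> is_form a b ==> z ~= (0, 0)"
proof -
 assume t: "tposf a b z" and f: "is_form a b"
 interpret I: indef_form a b "cc a b" sq by (rule indef[OF f])
 show ?thesis using t by (auto simp: I.tpos_def I.r1_def)
qed

lemma Theta_act:
 assumes f: "is_form a b" and nz: "(x, y) ~= (0, 0)" and u: "t^2 - D * u^2 = 4" and z: "act a b t u (x, y) = (x', y')"
 shows "Theta a b x' y' = Theta a b x y" "(x', y') ~= (0, 0)"
proof -
 show nz': "(x', y') ~= (0, 0)" using unit_action_nonzero[OF f nz, of t u] u z by (simp add: act_def)
 show "Theta a b x' y' = Theta a b x y"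
  using Theta_fibre[OF f nz nz'] u z by (auto simp: act_def)
qed

text \<open>A totally positive unit with u different from 0, or its inverse, is at least
  \<open>eps\<close> and moves the slope out of the window.\<close>

lemma unit_cone_inj:
 assumes f: "is_form a b" and z: "(x, y) : unit_cone a b" "(x', y') : unit_cone a b" and T: "Theta a b x y = Theta a b x' y'"
 shows "(x, y) = (x', y')"
proof -
 interpret I: indef_form a b "cc a b" sq by (rule indef[OF f])
 note c = z[unfolded unit_cone_iff(1)[OF f]]
 have nz: "(x, y) ~= (0, 0)" "(x', y') ~= (0, 0)" using c tposf_nonzero[OF _ f] by blast+
 obtain t u where tu: "t^2 - D * u^2 = 4" "(x', y') = act a b t u (x, y)"
  using Theta_fibre[OF f nz] T norm_minus_4 by (auto simp: act_def)
 define e e' where "e = uval t u" and "e' = uval t (- u)"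
 have r: "R1 a b (x', y') = e * R1 a b (x, y)" "R2 a b (x', y') = e' * R2 a b (x, y)"
  unfolding tu(2) act_r[OF f tu(1)] by (simp_all add: e_def e'_def)
 have p: "R1 a b (x, y) > 0" "R2 a b (x, y) > 0" "R1 a b (x', y') > 0" "R2 a b (x', y') > 0" using c by (auto simp: I.tpos_def)
 have e: "e > 0" "e' > 0" using p r by (auto simp: zero_less_mult_iff)
 have ee: "e * e' = 1" using uval_conj[OF tu(1)] by (simp add: e_def e'_def)
 have "e + e' = t" by (simp add: e_def e'_def uval_def field_simps)
 hence t0: "t > 0" using e by (metis add_pos_pos of_int_0_less_iff)
 define l l' where "l = R1 a b (x, y) / R2 a b (x, y)" and "l' = R1 a b (x', y') / R2 a b (x', y')"
 have l: "1 <= l" "l < eps^2" "1 <= l'" "l' < eps^2" using c by (auto simp: l_def l'_def)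
 have "l' = (e / e') * l" unfolding l_def l'_def r by simp
 moreover have "e / e' = e^2" "e' / e = e'^2" using ee e by (simp_all add: field_simps p2sq)
 ultimately have l1: "l' = e^2 * l" by simp
 have l2: "l = e'^2 * l'" using l1 ee by (simp add: power_mult_distrib[symmetric] mult.assoc[symmetric] mult.commute[of e'])
 have "~ u > 0"
 proof
  assume "u > 0"
  hence "e >= eps" unfolding e_def by (rule uval_ge_eps[OF t0 _ tu(1)])
  hence "eps^2 <= e^2" using eps_gt by (intro power_mono) auto
  hence "eps^2 * 1 <= e^2 * l" using l(1) by (intro mult_mono) auto
  thus False using l1 l(4) by simp
 qed
 moreover have "~ u < 0"
 proof
  assume "u < 0"
  hence "e' >= eps" unfolding e'_def using tu(1) by (intro uval_ge_eps[OF t0]) auto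
  hence "eps^2 <= e'^2" using eps_gt by (intro power_mono) auto
  hence "eps^2 * 1 <= e'^2 * l'" using l(3) by (intro mult_mono) auto
  thus False using l2 l(2) by simp
 qed
 ultimately have u0: "u = 0" by simp
 hence "t^2 = 2^2" using tu(1) by simp
 hence "t = 2" using t0 by (simp only: power2_eq_iff) auto
 thus ?thesis using tu(2) u0 by (simp add: act_def)
qed

end

context real_quad_disc
begin

lemma eps_power_shift:
 assumes l: "l > 0"
 shows "EX n::int. 1 <= l * (eps powi n)^2 & l * (eps powi n)^2 < eps^2"
proof -
 define L where "L = 2 * ln eps"
 have L0: "L > 0" using eps_gt by (simp add: L_def)
 define m where "m = \<lfloor>ln l / L\<rfloor>"
 have "m <= ln l / L" "ln l / L < m + 1" unfolding m_def by linarith+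
 hence m: "m * L <= ln l" "ln l < (m + 1) * L"
  using L0 by (simp_all only: pos_le_divide_eq pos_divide_less_eq)
 have e: "(eps powi (- m))^2 = exp (- (m * L))"
 proof -
  have "eps powi (- m) = exp (ln eps) powi (- m)" using eps_gt by simp
  also have "... = exp (- (m * ln eps))" by (simp only: exp_power_int) simp
  finally show ?thesis by (simp add: L_def exp_double[symmetric] mult_ac)
 qed
 have "l * (eps powi (- m))^2 = exp (ln l - m * L)"
  unfolding e using l by (simp add: exp_diff exp_minus field_simps)
 moreover have "eps^2 = exp L" using eps_gt by (simp add: L_def exp_double)
 moreover have "0 <= ln l - m * L" "ln l - m * L < L" using m by (simp_all add: distrib_right)
 ultimately show ?thesis by (intro exI[of _ "- m"]) simp
qed

text \<open>A point of positive norm is totally positive up to sign; a power of \<open>eps\<close>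
  then moves its slope into the window.\<close>

lemma unit_cone_surj:
 assumes f: "is_form a b" and nz: "(x, y) ~= (0, 0)" and pos: "qf a b x y > 0"
 shows "EX x' y'. (x', y') : unit_cone a b & Theta a b x' y' = Theta a b x y"
proof -
 interpret I: indef_form a b "cc a b" sq by (rule indef[OF f])
 have qf: "I.f (x, y) = qf a b x y" for x y by (simp add: I.f_def qf_def)
 have p: "I.r1 (x, y) * I.r2 (x, y) > 0" unfolding I.r12 qf using pos I.a_pos by simp
 obtain x1 y1 where z1: "I.tpos (x1, y1)" "(x1, y1) ~= (0, 0)" "Theta a b x1 y1 = Theta a b x y"
 proof (cases "I.r1 (x, y) > 0")
  case True
  hence "I.tpos (x, y)" using p by (simp add: I.tpos_def zero_less_mult_iff)
  thus ?thesis using nz by (intro that[of x y]) simp_all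
 next
  case False
  \<comment> \<open>(t, u) = (-2, 0) is the unit -1.\<close>
  have m: "act a b (- 2) 0 (x, y) = (- x, - y)" by (simp add: act_def)
  have u: "(- 2)^2 - D * 0^2 = 4" by simp
  have "I.r1 (- x, - y) = - I.r1 (x, y)" "I.r2 (- x, - y) = - I.r2 (x, y)" by (simp_all add: I.r1_def I.r2_def field_simps)
  hence "I.tpos (- x, - y)" using p False by (simp add: I.tpos_def zero_less_mult_iff)
  thus ?thesis using Theta_act[OF f nz u m] by (intro that[of "- x" "- y"])
 qed
 have rp: "I.r1 (x1, y1) > 0" "I.r2 (x1, y1) > 0" using z1(1) by (auto simp: I.tpos_def)
 obtain n :: int where n: "1 <= I.r1 (x1, y1) / I.r2 (x1, y1) * (eps powi n)^2"
  "I.r1 (x1, y1) / I.r2 (x1, y1) * (eps powi n)^2 < eps^2"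
  using eps_power_shift[of "I.r1 (x1, y1) / I.r2 (x1, y1)"] rp by auto
 obtain t u where tu: "t^2 - D * u^2 = 4" "uval t u = eps powi n" using unit_zpower by blast
 obtain x2 y2 where z2: "act a b t u (x1, y1) = (x2, y2)" by (cases "act a b t u (x1, y1)")
 have e: "eps powi n > 0" using eps_gt by (simp add: zero_less_power_int)
 have c: "uval t (- u) = 1 / (eps powi n)" using uval_conj[OF tu(1)] e unfolding tu(2)
  by (metis less_irrefl mult.commute nonzero_eq_divide_eq)
 have r: "I.r1 (x2, y2) = eps powi n * I.r1 (x1, y1)" "I.r2 (x2, y2) = 1 / (eps powi n) * I.r2 (x1, y1)"
  using act_r[OF f tu(1), of "(x1, y1)"] unfolding z2 tu(2) c by auto
 have "I.tpos (x2, y2)" unfolding I.tpos_def r using rp e by simp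
 moreover have "I.r1 (x2, y2) / I.r2 (x2, y2) = I.r1 (x1, y1) / I.r2 (x1, y1) * (eps powi n)^2"
  unfolding r using e by (simp add: p2sq)
 ultimately have "(x2, y2) : unit_cone a b" unfolding unit_cone_iff(1)[OF f] using n by simp
 moreover have "Theta a b x2 y2 = Theta a b x y" using Theta_act(1)[OF f z1(2) tu(1) z2] z1(3) by simp
 ultimately show ?thesis by blast
qed

section \<open>The contribution of a class and the total in the real case\<close>

definition chi3 :: "int \<times> int \<times> int => int" where "chi3 = (%(k, a, b). chi a b)"

text \<open>A wide class consists of two narrow classes, since there is no unit of norm -1; their
  ideals are told apart by \<open>chi\<close>.\<close>

definition half_triples :: "(int \<times> int) set => int => (int \<times> int \<times> int) set" where
 "half_triples c s = {z : triples c. chi3 z = s}"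

definition half_sum :: "(int \<times> int) set => int => real => real" where
 "half_sum c s t = infsum (%z. exp (- (t * real (tnorm z)))) (half_triples c s)"

lemma chi3_Theta: "is_form a b ==> (x, y) ~= (0, 0) ==> chi3 (Theta a b x y) = sgn (qf a b x y) * chi a b"
 using chi_Theta[of a b x y] by (cases "Theta a b x y") (simp add: chi3_def)

lemma unit_cone_bij:
 assumes c: "c : Cl" "(a, b) : c"
 shows "bij_betw (%(x, y). Theta a b x y) (unit_cone a b) (half_triples c (chi a b))"
proof -
 have f: "is_form a b" by (rule class_mem(1)[OF c])
 interpret I: indef_form a b "cc a b" sq by (rule indef[OF f])
 have qf: "I.f (x, y) = qf a b x y" for x y by (simp add: I.f_def qf_def)
 have cp: "(x, y) ~= (0, 0) & qf a b x y > 0" if "(x, y) : unit_cone a b" for x y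
  using that tposf_nonzero[OF _ f] I.tpos_f[of "(x, y)"] unfolding unit_cone_iff(1)[OF f] qf by auto
 show ?thesis
 proof (rule bij_betw_imageI)
  show "inj_on (%(x, y). Theta a b x y) (unit_cone a b)"
  proof (rule inj_onI)
   fix z w assume h: "z : unit_cone a b" "w : unit_cone a b" "(case z of (x, y) => Theta a b x y) = (case w of (x, y) => Theta a b x y)"
   obtain x y x' y' where zw: "z = (x, y)" "w = (x', y')" by (cases z; cases w)
   show "z = w" using unit_cone_inj[OF f h(1)[unfolded zw] h(2)[unfolded zw]] h(3) by (simp add: zw)
  qed
  show "(%(x, y). Theta a b x y) ` unit_cone a b = half_triples c (chi a b)"
  proof (intro equalityI subsetI)
   fix s assume "s : (%(x, y). Theta a b x y) ` unit_cone a b"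
   then obtain z where z: "z : unit_cone a b" "s = (case z of (x, y) => Theta a b x y)" by (elim imageE)
   obtain x y where xy: "z = (x, y)" by (cases z)
   have h: "(x, y) ~= (0, 0)" "qf a b x y > 0" using cp z xy by auto
   have "(x, y) : UNIV - {(0, 0)}" using h by simp
   hence "s : triples c" unfolding Theta_triples[OF c, symmetric] z(2) xy by (rule imageI)
   moreover have "chi3 s = chi a b" using chi3_Theta[OF f h(1)] h(2) by (simp add: z(2) xy)
   ultimately show "s : half_triples c (chi a b)" by (simp add: half_triples_def)
  next
   fix s assume "s : half_triples c (chi a b)"
   hence s: "s : triples c" "chi3 s = chi a b" by (auto simp: half_triples_def)
   from s(1) obtain z where z: "z : UNIV - {(0, 0)}" "s = (case z of (x, y) => Theta a b x y)"
    unfolding Theta_triples[OF c, symmetric] by (elim imageE)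
   obtain x y where xy: "z = (x, y)" by (cases z)
   have nz: "(x, y) ~= (0, 0)" using z xy by simp
   have "sgn (qf a b x y) * chi a b = chi a b" using chi3_Theta[OF f nz] s(2) by (simp add: z(2) xy)
   hence "sgn (qf a b x y) = 1" using chi_values[OF f] by auto
   hence "qf a b x y > 0" by (simp add: sgn_if split: if_splits)
   from unit_cone_surj[OF f nz this] obtain x' y' where x': "(x', y') : unit_cone a b" "Theta a b x' y' = Theta a b x y" by (elim exE conjE)
   have "s = (%(x, y). Theta a b x y) (x', y')" using x'(2) by (simp add: z(2) xy)
   thus "s : (%(x, y). Theta a b x y) ` unit_cone a b" using x'(1) by (rule image_eqI)
  qed
 qed
qed

text \<open>The matrix of multiplication by the fundamental unit, followed by \<open>T\<^sup>j\<close>, is a word in \<open>T\<close>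
 and \<open>L\<close>.\<close>

definition unit_word :: "int => int => int => bool list => bool" where
 "unit_word a b j W \<longleftrightarrow> word_mat W =
   ((et - b * eu) div 2, - cc a b * eu + j * ((et - b * eu) div 2), a * eu, (et + b * eu) div 2 + j * (a * eu))"

text \<open>The fundamental unit has norm 1, so its matrix preserves \<open>f\<close> and
  \<open>polar\<close> and \<open>cone_automorph\<close> applies with K = j;
  \<open>unit_cone_bij\<close> turns the sum over the cone into the sum over the ideals with sign
  \<open>chi a b\<close>.\<close>

lemma half_sum_asym_const:
 assumes c: "c : Cl" "(a, b) : c" and W: "unit_word a b j W"
 shows "asym_const (half_sum c (chi a b)) ((word_psi W - j) / 12)"
  and "t > 0 ==> (%z. exp (- (t * real (tnorm z)))) summable_on half_triples c (chi a b)"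
proof -
 have f: "is_form a b" by (rule class_mem(1)[OF c])
 interpret I: indef_form a b "cc a b" sq by (rule indef[OF f])
 have qf: "I.f (x, y) = qf a b x y" for x y by (simp add: I.f_def qf_def)
 have a10: "act a b et eu (1, 0) = ((et - b * eu) div 2, a * eu)" by (simp add: act_def)
 have a01: "act a b et eu (0, 1) = (- cc a b * eu, (et + b * eu) div 2)" by (simp add: act_def)
 have ee: "eps * uval et (- eu) = 1" using uval_conj[OF fund(3)] by (simp add: eps_def)
 have r: "I.r1 (1, 0) = a" "I.r2 (1, 0) = a" "I.r1 (0, 1) + I.r2 (0, 1) = b" by (simp_all add: I.r1_def I.r2_def field_simps)
 have fa: "I.f ((et - b * eu) div 2, a * eu) = a"
 proof -
  have "a * real_of_int (I.f (act a b et eu (1, 0))) = (eps * uval et (- eu)) * (a * a)"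
   using I.r12[of "act a b et eu (1, 0)", symmetric] unfolding act_r[OF f fund(3)] r eps_def[symmetric] by (simp add: mult_ac)
  thus ?thesis using I.a_pos unfolding ee a10 by simp
 qed
 have pb: "I.polar ((et - b * eu) div 2, a * eu) (- cc a b * eu, (et + b * eu) div 2) = b"
 proof -
  have "a * real_of_int (I.polar (act a b et eu (1, 0)) (act a b et eu (0, 1))) = (eps * uval et (- eu)) * (a * (I.r1 (0, 1) + I.r2 (0, 1)))"
   using I.r_polar[of "act a b et eu (1, 0)" "act a b et eu (0, 1)"] unfolding act_r[OF f fund(3)] r(1,2) eps_def[symmetric] by (simp add: alg)
  thus ?thesis using I.a_pos unfolding ee r a10 a01 by simp
 qed
 have tp: "I.tpos ((et - b * eu) div 2, a * eu)" using unit_cone_iff(2)[OF f] unfolding a10 .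
 note ca = I.cone_automorph[OF W[unfolded unit_word_def] tp fa pb]
 have cone: "I.cone (1, 0) ((et - b * eu) div 2, a * eu) = unit_cone a b" by (simp add: unit_cone_def a10)
 note bij = unit_cone_bij[OF c]
 have val: "exp (- (t * real (tnorm (case z of (x, y) => Theta a b x y)))) = I.cone_fun t z" if zc: "z : unit_cone a b" for z t
 proof -
  obtain x y where z: "z = (x, y)" by (cases z)
  have tz: "I.tpos (x, y)" using zc unfolding z unit_cone_iff(1)[OF f] by blast
  have "(x, y) ~= (0, 0)" by (rule tposf_nonzero[OF tz f])
  thus ?thesis using tnorm_Theta[OF f, of x y] I.tpos_f[OF tz] by (simp add: z I.cone_fun_def qf)
 qed
 show "(%z. exp (- (t * real (tnorm z)))) summable_on half_triples c (chi a b)" if t: "t > 0"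
 proof -
  have "(%z. exp (- (t * real (tnorm (case z of (x, y) => Theta a b x y))))) summable_on unit_cone a b"
   by (rule summable_on_cong[OF val, THEN iffD2, OF _ ca(2)[OF t, unfolded cone]])
  thus ?thesis by (rule summable_on_reindex_bij_betw[OF bij, THEN iffD1])
 qed
 have "infsum (I.cone_fun t) (unit_cone a b) = half_sum c (chi a b) t" for t
  unfolding half_sum_def infsum_reindex_bij_betw[OF bij, symmetric] by (rule infsum_cong) (simp only: val)
 thus "asym_const (half_sum c (chi a b)) ((word_psi W - j) / 12)"
  by (intro asym_const_cong[OF ca(1)[unfolded cone]])
qed

lemma unit_det: "is_form a b ==> (et - b * eu) div 2 * ((et + b * eu) div 2) - (- cc a b * eu) * (a * eu) = 1"
proof -
 assume f: "is_form a b"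
 have "even (et + eu)" using unit_parity[of et eu 1] fund(3) by simp
 hence "even (et - b * eu)" "even (et + b * eu)" using form_odd[OF f] by simp_all
 then obtain m n where mn: "et - b * eu = 2 * m" "et + b * eu = 2 * n" by (elim evenE)
 have "4 * (m * n) = (2 * m) * (2 * n)" by simp
 also have "... = et^2 - b\<^sup>2 * eu^2" unfolding mn[symmetric] by (simp add: sq_simps)
 finally have "4 * (m * n + cc a b * eu * (a * eu)) = et^2 - (b^2 - 4 * a * cc a b) * eu^2" by (simp add: sq_simps)
 also have "b^2 - 4 * a * cc a b = D" using form_eq[OF f] by simp
 finally have "m * n + cc a b * eu * (a * eu) = 1" using fund(3) by simp
 thus ?thesis unfolding mn by simp
qed

lemma et_gt_b: "b^2 < D ==> \<bar>b\<bar> * eu < et"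
proof -
 assume b: "b^2 < D"
 have "(\<bar>b\<bar> * eu)^2 = b^2 * eu^2" by (simp add: power_mult_distrib)
 also have "... <= D * eu^2" using b by (simp add: mult_right_mono)
 also have "... < et^2" using fund(3) by simp
 finally show ?thesis using fund(1) power2_less_imp_less by fastforce
qed

text \<open>For b^2 < D the last coefficient is negative and |b| eu < et, so the matrix of the unit
  has no negative entry.\<close>

lemma unit_word_exists:
 assumes f: "is_form a b" and b: "b^2 < D"
 shows "EX W. unit_word a b 0 W"
proof -
 have a: "a > 0" by (rule form_pos[OF f])
 have "4 * a * cc a b < 0" using form_eq[OF f] b by simp
 hence c: "cc a b < 0" using a by (simp add: mult_less_0_iff)
 have "\<bar>b * eu\<bar> < et" using et_gt_b[OF b] fund(2) by (simp add: abs_mult)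
 hence "(et - b * eu) div 2 >= 0" "(et + b * eu) div 2 >= 0" by linarith+
 moreover have "- cc a b * eu >= 0" "a * eu >= 0" using a c fund(2) by (simp_all add: mult_nonpos_nonneg)
 ultimately show ?thesis using word_exists[OF _ _ _ _ unit_det[OF f]] by (simp add: unit_word_def)
qed

text \<open>Interchanging the two coefficients of an indefinite form stays within the class but reverses
 the sign of both the genus character and \<open>\<Psi>\<close>.\<close>

lemma swap_form:
 assumes c: "c : Cl" "(a, b) : c" and b: "b^2 < D" and W: "unit_word a b 0 W"
 shows "(- cc a b, - b) : c" "chi (- cc a b) (- b) = - chi a b" "unit_word (- cc a b) (- b) 0 (map Not W)"
proof -
 have f: "is_form a b" by (rule class_mem(1)[OF c])
 have a: "a > 0" by (rule form_pos[OF f])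
 have e: "b^2 - D = 4 * a * cc a b" by (rule form_eq[OF f])
 hence "4 * a * cc a b < 0" using b by simp
 hence cn: "cc a b < 0" using a by (simp add: mult_less_0_iff)
 have e2: "(- b)^2 - D = 4 * (- cc a b) * (- a)" using e by simp
 hence f': "is_form (- cc a b) (- b)" unfolding is_form_def using cn by (metis dvd_triv_left neg_0_less_iff_less)
 have c': "cc (- cc a b) (- b) = - a"
 proof -
  have "4 * (- cc a b) * cc (- cc a b) (- b) = 4 * (- cc a b) * (- a)"
   unfolding form_eq[OF f', symmetric] by (rule e2)
  moreover have "4 * (- cc a b) ~= 0" using cn by simp
  ultimately show ?thesis using mult_left_cancel[of "4 * (- cc a b)"] by blast
 qed
 \<comment> \<open>\<open>alp\<close> is the conjugate of (b + sqrt D) / 2 divided by a. Its norm c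
   / a is negative, which explains the change of sign of \<open>chi\<close>.\<close>
 define alp where "alp = pt a (- b) 0 (- 1) / of_int a"
 have m: "alp * pt a b x y = pt (- cc a b) (- b) (- y) (- x)" for x y
 proof -
  have D': "of_int D = (of_int b)^2 - 4 * of_int a * (of_int (cc a b) :: rat)" by (rule form_eq_rat[OF f])
  have "pt a (- b) 0 (- 1) * pt a b x y = of_int a * pt (- cc a b) (- b) (- y) (- x)"
   by (simp add: pt_def emb_mult of_int_emb D' p2sq field_simps)
  thus ?thesis using a by (simp add: alp_def)
 qed
 have "lat (- cc a b) (- b) = scale alp (lat a b)"
 proof (intro equalityI subsetI)
  fix z assume "z : lat (- cc a b) (- b)"
  then obtain x y where "z = pt (- cc a b) (- b) x y" by (auto simp: lat_def)
  hence "z = alp * pt a b (- y) (- x)" by (simp add: m)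
  thus "z : scale alp (lat a b)" by (simp add: scale_mem)
 next
  fix z assume "z : scale alp (lat a b)"
  then obtain x y where "z = alp * pt a b x y" by (auto simp: lat_def scale_def)
  thus "z : lat (- cc a b) (- b)" by (simp add: m)
 qed
 moreover have "alp : K" unfolding alp_def by (simp add: K_divide of_int_emb)
 moreover have "alp ~= 0" using pt_eq_0[OF is_form_uminus[OF f], of 0 "-1"] a by (simp add: alp_def)
 ultimately have "((a, b), (- cc a b, - b)) : form_rel" unfolding form_rel_iff using f f' by blast
 thus "(- cc a b, - b) : c" using class_mem(2)[OF c] by simp
 show "chi (- cc a b) (- b) = - chi a b"
 proof (cases "int p1 dvd a")
  case False
  hence "~ int p1 dvd qf (- cc a b) (- b) 0 1" by (simp add: qf_def c')
  from chi_value[OF f' this] show ?thesis using False Leg_mult[of "-1" a] Leg_m1 by (simp add: chi_def qf_def c')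
 next
  case True
  hence "~ int p1 dvd qf (- cc a b) (- b) 1 0" using p1_ndvd_cc[OF f True] by (simp add: qf_def)
  from chi_value[OF f' this] show ?thesis using True Leg_mult[of "-1" "cc a b"] Leg_m1 by (simp add: chi_def qf_def)
 qed
 show "unit_word (- cc a b) (- b) 0 (map Not W)"
  using W word_mat_swap[of W] by (simp add: unit_word_def c')
qed

lemma class_reduced:
 assumes c: "c : Cl"
 shows "EX a b. (a, b) : c & b^2 < D"
proof -
 obtain a b where ab: "(a, b) : c" "\<bar>b\<bar> <= a" "4 * a^2 <= \<bar>b^2 - D\<bar>" using reduced_form[OF c] by (elim exE conjE)
 have "b^2 <= a^2" using ab(2) abs_le_square_iff[of b a] by simp
 moreover have "a^2 > 0" using form_pos[OF class_mem(1)[OF c ab(1)]] by simp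
 ultimately have "b^2 < D" using ab(3) D_pos by linarith
 thus ?thesis using ab(1) by blast
qed

text \<open>A form with b^2 < D accounts for one half of the class and the swapped form for the
  other, with the opposite sign of \<Psi>; so a single integer serves both.\<close>

lemma class_psi_exists:
 assumes c: "c : Cl"
 shows "EX k::int. (\<forall>s\<in>{-1, 1}. asym_const (half_sum c s) (real_of_int s * k / 12)) &
  (\<forall>s\<in>{-1, 1}. ALL t>0. (%z. exp (- (t * real (tnorm z)))) summable_on half_triples c s)"
proof -
 obtain a b where ab: "(a, b) : c" "b^2 < D" using class_reduced[OF c] by (elim exE conjE)
 have f: "is_form a b" by (rule class_mem(1)[OF c ab(1)])
 obtain W where W: "unit_word a b 0 W" using unit_word_exists[OF f ab(2)] by blast
 note s = swap_form[OF c ab W]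
 note h1 = half_sum_asym_const[OF c ab(1) W] and h2 = half_sum_asym_const[OF c s(1) s(3), unfolded s(2)]
 consider "chi a b = 1" | "chi a b = -1" using chi_values[OF f] by auto
 thus ?thesis
 proof cases
  case 1
  thus ?thesis using h1 h2 by (intro exI[of _ "word_psi W"]) (simp add: word_psi_swap)
 next
  case 2
  thus ?thesis using h1 h2 by (intro exI[of _ "- word_psi W"]) (simp add: word_psi_swap)
 qed
qed

definition class_psi :: "(int \<times> int) set => int" where
 "class_psi c = (SOME k. \<forall>s\<in>{-1, 1}. asym_const (half_sum c s) (real_of_int s * of_int k / 12))"

lemma class_psi:
 assumes c: "c : Cl" and s: "s : {-1, 1}"
 shows "asym_const (half_sum c s) (real_of_int s * class_psi c / 12)"
  and "t > 0 ==> (%z. exp (- (t * real (tnorm z)))) summable_on half_triples c s"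
proof -
 have "EX k. \<forall>s\<in>{-1, 1}. asym_const (half_sum c s) (real_of_int s * of_int k / 12)"
  using class_psi_exists[OF c] by blast
 from someI_ex[OF this] show "asym_const (half_sum c s) (real_of_int s * class_psi c / 12)"
  unfolding class_psi_def using s by blast
 show "t > 0 ==> (%z. exp (- (t * real (tnorm z)))) summable_on half_triples c s"
  using class_psi_exists[OF c] s by blast
qed

lemma class_psi_word:
 assumes c: "c : Cl" "(a, b) : c" and W: "unit_word a b j W"
 shows "chi a b * class_psi c = word_psi W - j"
proof -
 have ch: "chi a b : {-1, 1}" by (rule chi_values[OF class_mem(1)[OF c]])
 have "real_of_int (chi a b) * class_psi c / 12 = (word_psi W - j) / 12"
  by (rule asym_const_unique[OF class_psi(1)[OF c(1) ch] half_sum_asym_const(1)[OF c W]])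
 hence "real_of_int (chi a b * class_psi c) = real_of_int (word_psi W - j)" by simp
 thus ?thesis by (simp only: of_int_eq_iff)
qed

text \<open>In the difference of the halves with \<open>chi\<close> equal to 1 and -1, a class
  contributes \<open>class_psi c / 6\<close>. In total this difference is the constant term
  belonging to L(s, \<chi>_1) L(s, \<chi>_2).\<close>

theorem sum_class_psi:
 "(\<Sum>c\<in>Cl. real_of_int (class_psi c)) = 6 * (char_L0 p1 (leg p1) * char_L0 p2 (leg p2))"
proof -
 let ?e = "%t z. exp (- (t * real (tnorm z)))"
 have parts: "triples c = half_triples c 1 \<union> half_triples c (-1)" "half_triples c 1 \<inter> half_triples c (-1) = {}"
  if c: "c : Cl" for c
 proof -
  have "chi3 z = 1 \<or> chi3 z = -1" if "z : triples c" for z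
  proof -
   obtain k a b where z: "z = (k, a, b)" by (metis prod_cases3)
   have "(a, b) : c" using that by (simp add: z triples_def)
   thus ?thesis using chi_values[OF class_mem(1)[OF c]] by (auto simp: z chi3_def)
  qed
  thus "triples c = half_triples c 1 \<union> half_triples c (-1)" by (auto simp: half_triples_def)
  show "half_triples c 1 \<inter> half_triples c (-1) = {}" by (auto simp: half_triples_def)
 qed
 have S: "?e t summable_on triples c" if "c : Cl" "t > 0" for c t
  unfolding parts(1)[OF that(1)] using class_psi(2)[OF that(1), of 1 t] class_psi(2)[OF that(1), of "-1" t] that(2)
  by (intro summable_on_Un_disjoint parts(2)[OF that(1)]) auto
 have signed: "infsum (%z. of_int (chi3 z) * ?e t z) (triples c) = half_sum c 1 t - half_sum c (-1) t"
  if c: "c : Cl" and t: "t > 0" for c t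
 proof -
  have e: "of_int (chi3 z) * ?e t z = of_int s * ?e t z" if "z : half_triples c s" for z s
   using that by (simp add: half_triples_def)
  have s: "(%z. of_int (chi3 z) * ?e t z) summable_on half_triples c s" if "s : {-1, 1}" for s
   by (rule summable_on_cong[OF e, THEN iffD2, OF _ summable_on_cmult_right[OF class_psi(2)[OF c that t]]])
  have i: "infsum (%z. of_int (chi3 z) * ?e t z) (half_triples c s) = of_int s * half_sum c s t" for s
  proof -
   have "infsum (%z. of_int (chi3 z) * ?e t z) (half_triples c s) = infsum (%z. of_int s * ?e t z) (half_triples c s)"
    by (rule infsum_cong) (rule e)
   thus ?thesis by (simp add: infsum_cmult_right' half_sum_def)
  qed
  have s1: "(%z. of_int (chi3 z) * ?e t z) summable_on half_triples c 1"
   "(%z. of_int (chi3 z) * ?e t z) summable_on half_triples c (-1)" using s by auto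
  have "infsum (%z. of_int (chi3 z) * ?e t z) (half_triples c 1 \<union> half_triples c (-1))
   = infsum (%z. of_int (chi3 z) * ?e t z) (half_triples c 1) + infsum (%z. of_int (chi3 z) * ?e t z) (half_triples c (-1))"
   by (rule infsum_Un_disjoint[OF s1 parts(2)[OF c]])
  thus ?thesis unfolding parts(1)[OF c, symmetric] i by simp
 qed
 have "asym_const (%t. \<Sum>c\<in>Cl. half_sum c 1 t - half_sum c (-1) t)
  (\<Sum>c\<in>Cl. real_of_int 1 * class_psi c / 12 - real_of_int (-1) * class_psi c / 12)"
  by (intro asym_const_sum[OF finite_classes] asym_const_diff class_psi(1)) auto
 moreover have "asym_const (%t. \<Sum>c\<in>Cl. half_sum c 1 t - half_sum c (-1) t) (char_L0 p1 (leg p1) * char_L0 p2 (leg p2))"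
 proof (rule asym_const_cong[OF asym_const_limit[OF double_char_sum_limit[OF periodic_char_leg[OF p1] periodic_char_leg[OF p2]]]])
  fix t :: real assume t: "t > 0"
  have lb: "\<bar>leg p n\<bar> <= 1" for p n using leg_values[of p n] by auto
  have "(\<Sum>c\<in>Cl. infsum (%s. of_int (chi3 s) * exp (- (t * real (tnorm s)))) (triples c))
   = infsum (%(d, e). of_int (leg p1 (Suc d)) * of_int (leg p2 (Suc e)) * exp (- (real (Suc d * Suc e) * t))) UNIV"
  proof (rule triples_sum_eq_pairs[where h = chi3 and w = "genus_char p1 p2"])
   show "?e t summable_on triples c" if "c : Cl" for c by (rule S[OF that t])
   show "chi3 (k, a, b) = genus_char p1 p2 (nat a)" if "(k, a, b) : triples forms" for k a b
    using that chi_genus_char[of a b] by (simp add: chi3_def triples_def forms_def)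
   show "\<bar>genus_char p1 p2 n\<bar> <= 1" for n
   proof (cases "n = 0")
    case False
    hence "genus_char p1 p2 n * genus_char p1 p2 n = 1" using genus_char_square[OF p1(1) p2(1) p_ne] by simp
    thus ?thesis by (auto simp: zmult_eq_1_iff)
   qed (simp add: genus_char_def)
   have C': "1 - 4 * C = int p1 * int p2" using D_eq D by simp
   show "dconv square_ind (%a. genus_char p1 p2 a * int (card (qroots C a))) n = dconv (leg p1) (leg p2) n" if "n > 0" for n
    by (rule genus_char_roots[OF p1 p2 p_ne C' that])
  qed (use t lb in auto)
  thus "infsum (%(d, e). of_int (leg p1 (Suc d)) * of_int (leg p2 (Suc e)) * exp (- (real (Suc d * Suc e) * t))) UNIV
    = (\<Sum>c\<in>Cl. half_sum c 1 t - half_sum c (-1) t)" using signed t by simp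
 qed
 ultimately have "(\<Sum>c\<in>Cl. real_of_int 1 * class_psi c / 12 - real_of_int (-1) * class_psi c / 12) = char_L0 p1 (leg p1) * char_L0 p2 (leg p2)"
  by (rule asym_const_unique)
 moreover have "(\<Sum>c\<in>Cl. real_of_int 1 * class_psi c / 12 - real_of_int (-1) * class_psi c / 12)
   = (\<Sum>c\<in>Cl. real_of_int (class_psi c)) / 6"
  unfolding sum_divide_distrib by (intro sum.cong refl) simp
 ultimately show ?thesis by simp
qed

end

subsection \<open>Continued fractions\<close>

text \<open>Words given by their run lengths, and the corresponding products of the matrices
 \<open>(0, 1; 1, k)\<close>.\<close>

fun run_word :: "nat list => bool list" where
 "run_word [] = []"
| "run_word (k # ks) = replicate k False @ map Not (run_word ks)"

fun kmat :: "nat list => int \<times> int \<times> int \<times> int" where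
 "kmat [] = (1, 0, 0, 1)"
| "kmat (k # ks) = (case kmat ks of (a, b, c, d) => (c, d, a + int k * c, b + int k * d))"

text \<open>Nonempty run words begin with \<open>L\<close>; the words beginning with
  \<open>T\<close> are their complements.\<close>

lemma run_word_exists:
 "EX ks. (\<forall>k\<in>set ks. k >= 1) & (W = run_word ks \<or> W = map Not (run_word ks))"
proof (induction W)
 case (Cons x V)
 then obtain ks where ks: "\<forall>k\<in>set ks. k >= 1" "V = run_word ks \<or> V = map Not (run_word ks)" by blast
 have ext: "EX ks'. (\<forall>k\<in>set ks'. k >= 1) & False # run_word ks = run_word ks'"
 proof (cases ks)
  case Nil
  thus ?thesis by (intro exI[of _ "[1]"]) simp
 next
  case (Cons k ks1)
  thus ?thesis using ks(1) by (intro exI[of _ "Suc k # ks1"]) simp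
 qed
 have one: "EX ks'. (\<forall>k\<in>set ks'. k >= 1) & False # map Not (run_word ks) = run_word ks'"
  using ks(1) by (intro exI[of _ "1 # ks"]) simp
 have nn: "map Not (map Not V) = V" for V by (induction V) simp_all
 from ks(2) consider "x = False" "V = run_word ks" | "x = False" "V = map Not (run_word ks)"
  | "x = True" "V = run_word ks" | "x = True" "V = map Not (run_word ks)" by (cases x) auto
 thus ?case
 proof cases
  case 1
  then obtain ks' where k: "\<forall>k\<in>set ks'. k >= 1" "False # run_word ks = run_word ks'" using ext by (elim exE conjE)
  show ?thesis by (rule exI[of _ ks'], rule conjI[OF k(1)], rule disjI1) (simp only: k(2)[symmetric] 1)
 next
  case 2
  then obtain ks' where k: "\<forall>k\<in>set ks'. k >= 1" "False # map Not (run_word ks) = run_word ks'" using one by (elim exE conjE)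
  show ?thesis by (rule exI[of _ ks'], rule conjI[OF k(1)], rule disjI1) (simp only: k(2)[symmetric] 2)
 next
  case 3
  obtain ks' where k: "\<forall>k\<in>set ks'. k >= 1" "False # map Not (run_word ks) = run_word ks'" using one by blast
  have "x # V = map Not (run_word ks')" unfolding k(2)[symmetric] using 3 nn by simp
  thus ?thesis by (intro exI[of _ ks'] conjI[OF k(1)] disjI2)
 next
  case 4
  obtain ks' where k: "\<forall>k\<in>set ks'. k >= 1" "False # run_word ks = run_word ks'" using ext by blast
  have "x # V = map Not (run_word ks')" unfolding k(2)[symmetric] using 4 by simp
  thus ?thesis by (intro exI[of _ ks'] conjI[OF k(1)] disjI2)
 qed
qed (rule exI[of _ "[]"], simp)

lemma word_mat_replicate_False:
 "word_mat V = (a, b, c, d) ==> word_mat (replicate k False @ V) = (a, b, c + int k * a, d + int k * b)"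
 by (induction k) (auto simp: alg)

text \<open>A run is a factor (0, 1; 1, k) up to a swap. The swaps cancel in pairs, and for an odd
  number of runs one exchange of the columns is left.\<close>

lemma word_mat_run_word:
 "kmat ks = (a, b, c, d) ==> word_mat (run_word ks) = (if even (length ks) then (a, b, c, d) else (b, a, d, c))"
proof (induction ks arbitrary: a b c d)
 case (Cons k ks)
 obtain a' b' c' d' where k: "kmat ks = (a', b', c', d')" by (metis prod_cases4)
 have e: "a = c'" "b = d'" "c = a' + int k * c'" "d = b' + int k * d'" using Cons(2) k by auto
 have "word_mat (map Not (run_word ks)) = (if even (length ks) then (d', c', b', a') else (c', d', a', b'))"
  using word_mat_swap[of "run_word ks"] Cons(1)[OF k] by auto
 thus ?case using word_mat_replicate_False[of "map Not (run_word ks)"] by (auto simp: e)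
qed simp

lemma word_psi_replicate_False: "word_psi (replicate k False) = - int k"
 by (induction k) simp_all

lemma word_psi_run_word: "word_psi (run_word ks) = (\<Sum>i<length ks. (-1) ^ Suc i * int (ks ! i))"
proof (induction ks)
 case (Cons k ks)
 have "(\<Sum>i<length (k # ks). (-1) ^ Suc i * int ((k # ks) ! i)) = - int k + (\<Sum>i<length ks. (-1) ^ Suc (Suc i) * int (ks ! i))"
  unfolding length_Cons sum.lessThan_Suc_shift by simp
 also have "(\<Sum>i<length ks. (-1) ^ Suc (Suc i) * int (ks ! i)) = - (\<Sum>i<length ks. (-1) ^ Suc i * int (ks ! i))"
  by (simp add: sum_negf)
 finally show ?case using Cons by (simp add: word_psi_replicate_False word_psi_swap)
qed simp

lemma kmat_append:
 assumes "kmat ks = (a, b, c, d)" "kmat ks' = (a', b', c', d')"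
 shows "kmat (ks @ ks') = (a * a' + b * c', a * b' + b * d', c * a' + d * c', c * b' + d * d')"
 using assms by (induction ks arbitrary: a b c d) (auto split: prod.splits simp: alg)

lemma kmat_props:
 assumes "kmat ks = (a, b, c, d)" "\<forall>k\<in>set ks. k >= 1"
 shows "a * d - b * c = (-1) ^ length ks & (ks ~= [] --> a >= 0 & b >= 1 & c >= 1 & d >= 1 & b >= a & d >= c)"
 using assms
proof (induction ks arbitrary: a b c d)
 case (Cons k ks)
 obtain a' b' c' d' where k: "kmat ks = (a', b', c', d')" by (metis prod_cases4)
 have e: "a = c'" "b = d'" "c = a' + int k * c'" "d = b' + int k * d'" using Cons(2) k by auto
 have IH: "a' * d' - b' * c' = (-1) ^ length ks" "ks ~= [] ==> a' >= 0 & b' >= 1 & c' >= 1 & d' >= 1 & b' >= a' & d' >= c'"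
  using Cons(1)[OF k] Cons(3) by auto
 have det: "a * d - b * c = (-1) ^ length (k # ks)" using IH(1) by (simp add: e alg)
 have k1: "int k >= 1" using Cons(3) by simp
 have "a >= 0 & b >= 1 & c >= 1 & d >= 1 & b >= a & d >= c"
 proof (cases "ks = []")
  case True
  thus ?thesis using k k1 by (auto simp: e)
 next
  case False
  hence h: "a' >= 0" "b' >= 1" "c' >= 1" "d' >= 1" "b' >= a'" "d' >= c'" using IH(2) by auto
  have "int k * c' >= 1 * 1" "int k * d' >= 1 * 1" "int k * c' <= int k * d'"
   using h k1 by (intro mult_mono; simp)+
  thus ?thesis using h unfolding e by linarith
 qed
 thus ?case using det by blast
qed auto

definition cf_val :: "nat list => real => real" where "cf_val ks \<rho> = foldr (%k z. real k + 1 / z) ks \<rho>"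

lemma cf_val_kmat:
 assumes "kmat ks = (a, b, c, d)" "\<rho> > 0"
 shows "a + b * \<rho> > 0 & c + d * \<rho> > 0 & cf_val ks \<rho> = (c + d * \<rho>) / (a + b * \<rho>)"
 using assms(1)
proof (induction ks arbitrary: a b c d)
 case Nil
 thus ?case using assms(2) by (auto simp: cf_val_def)
next
 case (Cons k ks)
 obtain a' b' c' d' where k: "kmat ks = (a', b', c', d')" by (metis prod_cases4)
 have e: "a = c'" "b = d'" "c = a' + int k * c'" "d = b' + int k * d'" using Cons(2) k by auto
 note h = Cons(1)[OF k]
 define X Y where "X = a' + b' * \<rho>" and "Y = c' + d' * \<rho>"
 have h': "X > 0" "Y > 0" "cf_val ks \<rho> = Y / X" using h by (simp_all add: X_def Y_def)
 have cd: "c + d * \<rho> = X + real k * Y" "a + b * \<rho> = Y" by (simp_all add: e X_def Y_def alg)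
 have "cf_val (k # ks) \<rho> = real k + 1 / cf_val ks \<rho>" by (simp add: cf_val_def)
 also have "... = (X + real k * Y) / Y" unfolding h'(3) using h'(1,2) by (simp add: field_simps)
 finally show ?case unfolding cd using h' by (simp add: add_pos_nonneg)
qed

lemma cf_remainder_shift: "cf_remainder \<xi> (Suc n) = cf_remainder (1 / frac \<xi>) n"
 by (induction n) simp_all

lemma cf_remainder_add: "cf_remainder \<xi> (m + n) = cf_remainder (cf_remainder \<xi> m) n"
 by (induction n) simp_all

lemma cf_val_coeffs:
 assumes "\<forall>k\<in>set ks. k >= 1" "\<rho> > 1"
 shows "cf_val ks \<rho> > 1 & (ALL i<length ks. cf_coeff (cf_val ks \<rho>) i = int (ks ! i)) & cf_remainder (cf_val ks \<rho>) (length ks) = \<rho>"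
 using assms(1)
proof (induction ks)
 case Nil
 thus ?case using assms(2) by (simp add: cf_val_def)
next
 case (Cons k ks)
 define z where "z = cf_val ks \<rho>"
 have IH: "z > 1" "ALL i<length ks. cf_coeff z i = int (ks ! i)" "cf_remainder z (length ks) = \<rho>"
  using Cons by (auto simp: z_def)
 have v: "cf_val (k # ks) \<rho> = real k + 1 / z" by (simp add: cf_val_def z_def)
 have z1: "0 < 1 / z" "1 / z < 1" using IH(1) by auto
 have fl: "\<lfloor>real k + 1 / z\<rfloor> = int k" using z1 by (simp add: floor_eq_iff)
 have fr: "1 / frac (real k + 1 / z) = z" using fl by (simp add: frac_def)
 have k1: "real k >= 1" using Cons(2) by simp
 show ?case unfolding v
 proof (intro conjI allI impI)
  show "1 < real k + 1 / z" using k1 z1 by linarith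
  show "cf_coeff (real k + 1 / z) i = int ((k # ks) ! i)" if "i < length (k # ks)" for i
   using that IH(2) fl by (cases i) (simp_all del: cf_remainder.simps(2) add: cf_coeff_def cf_remainder_shift fr)
  show "cf_remainder (real k + 1 / z) (length (k # ks)) = \<rho>"
   using IH(3) by (simp del: cf_remainder.simps(2) add: cf_remainder_shift fr)
 qed
qed

text \<open>The pre-period of the expansion below is 1, but it is only used that it is at most 1.\<close>

lemma hirzebruch_sum_eqI:
 fixes \<xi> :: real
 defines "c \<equiv> cf_coeff \<xi>"
 assumes m: "m > 0" "even m" and per: "!!i. c (Suc i + m) = c (Suc i)"
  and min: "!!l. 0 < l ==> l < m ==> EX i. c (Suc i + l) ~= c (Suc i)"
 shows "hirzebruch_sum \<xi> = (\<Sum>i<m. (-1) ^ Suc i * c (Suc i))"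
proof -
 have P1: "cf_periodic_from \<xi> 1 l \<longleftrightarrow> l > 0 & (ALL i. c (Suc i + l) = c (Suc i))" for l
  proof -
  have "(\<forall>i\<ge>1. c (i + l) = c i) \<longleftrightarrow> (ALL i. c (Suc i + l) = c (Suc i))"
  proof (intro iffI allI impI)
   fix i :: nat assume "ALL i. c (Suc i + l) = c (Suc i)" and i: "1 <= i"
   hence "c (Suc (i - 1) + l) = c (Suc (i - 1))" by blast
   thus "c (i + l) = c i" using i by simp
  next
   fix i :: nat assume "\<forall>i\<ge>1. c (i + l) = c i"
   hence "1 <= Suc i --> c (Suc i + l) = c (Suc i)" by blast
   thus "c (Suc i + l) = c (Suc i)" by simp
  qed
  thus ?thesis unfolding cf_periodic_from_def c_def by simp
 qed
 have m1: "cf_periodic_from \<xi> 1 m" using P1 m per by blast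
 have least1: "(LEAST l. cf_periodic_from \<xi> 1 l) = m"
 proof (rule Least_equality)
  show "cf_periodic_from \<xi> 1 m" by (rule m1)
  fix l assume "cf_periodic_from \<xi> 1 l"
  thus "m <= l" using min[of l] P1[of l] by (meson not_le_imp_less)
 qed
 have "cf_preperiod \<xi> <= 1" unfolding cf_preperiod_def by (rule Least_le) (use m1 in blast)
 then consider "cf_preperiod \<xi> = 1" | "cf_preperiod \<xi> = 0" by linarith
 thus ?thesis
 proof cases
  case 1
  thus ?thesis using m least1 by (simp add: hirzebruch_sum_def cf_period_def Let_def c_def)
 next
  case 2
  have "EX l. cf_periodic_from \<xi> (cf_preperiod \<xi>) l" unfolding cf_preperiod_def by (rule LeastI_ex) (use m1 in blast)
  then obtain l0 where l0: "cf_periodic_from \<xi> 0 l0" unfolding 2 by blast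
  have iter: "c (i + n * l) = c i" if "cf_periodic_from \<xi> k l" "i >= k" for k l i n
  proof (induction n)
   case (Suc n)
   have "c (i + n * l + l) = c (i + n * l)" using that unfolding cf_periodic_from_def c_def by simp
   thus ?case using Suc by (simp add: alg)
  qed simp
  \<comment> \<open>Going to the index l * l0 in steps of \<open>l0\<close> from 0 and in steps of
    \<open>l\<close> from l shows that c 0 = c l.\<close>
  have "cf_periodic_from \<xi> 0 l \<longleftrightarrow> cf_periodic_from \<xi> 1 l" for l
  proof
   assume "cf_periodic_from \<xi> 0 l" thus "cf_periodic_from \<xi> 1 l" by (simp add: cf_periodic_from_def)
  next
   assume h: "cf_periodic_from \<xi> 1 l"
   have l: "l > 0" "l0 > 0" using h l0 by (auto simp: cf_periodic_from_def)
   have "c 0 = c (0 + l * l0)" using iter[OF l0, of 0 l] by simp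
   also have "0 + l * l0 = l + (l0 - 1) * l" using l(2) by (cases l0) simp_all
   also have "c ... = c l" using iter[OF h, of l "l0 - 1"] l(1) by simp
   finally have c0: "c l = c 0" ..
   have "c (i + l) = c i" for i
    using c0 h unfolding P1 by (cases i) auto
   thus "cf_periodic_from \<xi> 0 l" using l by (simp add: cf_periodic_from_def c_def)
  qed
  hence "(LEAST l. cf_periodic_from \<xi> 0 l) = m" "cf_periodic_from \<xi> 0 m" using least1 m1 by simp_all
  moreover from this(2) have "0 <= (0::nat) --> c (0 + m) = c 0" unfolding cf_periodic_from_def c_def by blast
  ultimately have hs: "hirzebruch_sum \<xi> = (\<Sum>i<m. (-1) ^ i * c i)" and c0: "c m = c 0"
   using m 2 by (simp_all add: hirzebruch_sum_def cf_period_def Let_def c_def)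
  \<comment> \<open>Moving the window by one place exchanges \<open>c 0\<close> for
    \<open>c m\<close>; m is even, so both carry the sign +.\<close>
  have "(\<Sum>i<Suc m. (-1) ^ i * c i) = (\<Sum>i<m. (-1) ^ i * c i) + c m" using m(2) by simp
  moreover have "(\<Sum>i<Suc m. (-1) ^ i * c i) = c 0 + (\<Sum>i<m. (-1) ^ Suc i * c (Suc i))"
   unfolding sum.lessThan_Suc_shift by simp
  ultimately show ?thesis using hs c0 by linarith
 qed
qed

text \<open>M = P Q = Q P gives P M = P Q P = M P; three of the four entries are recorded.\<close>

lemma product_commutes:
 fixes p q r s :: int
 assumes "m1 = p * p' + q * r'" "m2 = p * q' + q * s'" "m3 = r * p' + s * r'" "m4 = r * q' + s * s'"
  and "m1 = p' * p + q' * r" "m2 = p' * q + q' * s" "m3 = r' * p + s' * r" "m4 = r' * q + s' * s"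
 shows "p * m2 + q * m4 = m1 * q + m2 * s" "r * m1 + s * m3 = m3 * p + m4 * r" "p * m1 + q * m3 = m1 * p + m2 * r"
proof -
 have "p * (p' * q + q' * s) + q * (r' * q + s' * s) = (p * p' + q * r') * q + (p * q' + q * s') * s"
  "r * (p' * p + q' * r) + s * (r' * p + s' * r) = (r * p' + s * r') * p + (r * q' + s * s') * r"
  "p * (p' * p + q' * r) + q * (r' * p + s' * r) = (p * p' + q * r') * p + (p * q' + q * s') * r" by (simp_all add: alg)
 thus "p * m2 + q * m4 = m1 * q + m2 * s" "r * m1 + s * m3 = m3 * p + m4 * r" "p * m1 + q * m3 = m1 * p + m2 * r"
  unfolding assms(5-8)[symmetric] unfolding assms(1-4)[symmetric] .
qed

section \<open>The continued fraction of omega and the fundamental unit\<close>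

context real_quad_disc
begin

text \<open>A matrix commuting with that of the fundamental unit is itself the matrix of a unit.\<close>

lemma commuting_unit:
 assumes f: "is_form 1 b" and M: "m11 = (et - b * eu) div 2" "m22 = (et + b * eu) div 2"
  and cm: "p * (- cc 1 b * eu) + q * m22 = m11 * q + (- cc 1 b * eu) * s"
   "r * m11 + s * eu = eu * p + m22 * r"
   "p * m11 + q * eu = m11 * p + (- cc 1 b * eu) * r"
  and det: "p * s - q * r = (-1) ^ n"
 shows "even n" "q = - cc 1 b * r" "r >= 1 ==> r >= eu"
proof -
 have "even (et + eu)" using unit_parity[of et eu 1] fund(3) by simp
 hence mm: "m22 - m11 = b * eu" unfolding M using form_odd[OF f] by (auto elim!: evenE oddE)
 have eu: "eu ~= 0" using fund(2) by simp
 have "eu * q = eu * (- cc 1 b * r)" using cm(3) by (simp add: alg)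
 thus q: "q = - cc 1 b * r" using mult_left_cancel[OF eu] by blast
 have "eu * (s - p) = (m22 - m11) * r" using cm(2) by (simp add: alg)
 hence "eu * (s - p) = eu * (b * r)" unfolding mm by simp
 hence sp: "s - p = b * r" using mult_left_cancel[OF eu] by blast
 obtain c where c: "c = cc 1 b" by blast
 have b4: "D = b^2 - 4 * c" using form_eq[OF f] by (simp add: c)
 have "(p + s)^2 - D * r^2 = (p + s)^2 - (b * r)^2 + 4 * c * r^2" unfolding b4 by (simp add: sq_simps)
 also have "... = 4 * (p * s - q * r)" unfolding sp[symmetric] q c[symmetric] by (simp add: sq_simps)
 finally have n: "(p + s)^2 - D * r^2 = 4 * (-1) ^ n" unfolding det .
 show ev: "even n"
 proof (rule ccontr)
  assume "odd n"
  hence "(p + s)^2 - D * r^2 = - 4" using n by simp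
  thus False using norm_minus_4 by blast
 qed
 show "r >= 1 ==> r >= eu" using fund_min[of "p + s" r] n ev by simp
qed

definition omega :: real where "omega = (1 + sq) / 2"

text \<open>b is the largest odd integer below sqrt D, so rho = 1 / frac omega is the complete
  quotient after the first one and satisfies 1 + b rho + c rho^2 = 0. The matrix of the fundamental
  unit fixes rho, hence the run lengths of its word form a period of rho, and the letters carry the
  signs of the Hirzebruch sum. Minimality of the period comes from minimality of
  \<open>eu\<close>.\<close>

lemma principal_hirzebruch:
 defines "b \<equiv> 2 * \<lfloor>omega\<rfloor> - 1"
 shows "is_form 1 b" "b >= 3" "b^2 < D" "unit_word 1 b 0 W ==> word_psi W = hirzebruch_sum omega"
proof -
 have D9: "D >= 9" using mult_mono[of 3 "int p1" 3 "int p2"] p_gt by (simp add: D_eq)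
 hence "sqrt (3^2) <= sqrt (real_of_int D)" by (intro real_sqrt_le_mono) simp
 hence sq3: "sq >= 3" by (simp add: sq_def)
 have fl: "of_int \<lfloor>omega\<rfloor> <= omega" "omega < of_int \<lfloor>omega\<rfloor> + 1" by linarith+
 have "\<lfloor>omega\<rfloor> >= 2" using sq3 by (simp add: omega_def le_floor_iff)
 thus b3: "b >= 3" unfolding b_def by linarith
 have odd_b: "odd b" by (simp add: b_def)
 have f: "is_form 1 b"
 proof -
  obtain k where "b = 2 * k + 1" using odd_b by (rule oddE)
  hence "b^2 - D = 4 * (k * k + k + C)" by (simp add: D sq_simps)
  thus ?thesis by (simp add: is_form_def)
 qed
 thus "is_form 1 b" .
 have bs: "real_of_int b <= sq" using fl(1) by (simp add: b_def omega_def)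
 have "b^2 <= D"
 proof -
  have "real_of_int b * b <= sq * sq" using bs b3 by (intro mult_mono) auto
  hence "real_of_int (b^2) <= D" by (simp add: sq_sq p2sq)
  thus ?thesis by simp
 qed
 moreover have "b^2 ~= D" using nonsquare[of "of_int b"] by (metis of_int_power)
 ultimately show bD: "b^2 < D" by simp
 have bs': "real_of_int b < sq"
 proof -
  have "real_of_int b ~= sq"
  proof
   assume "real_of_int b = sq"
   hence "real_of_int (b * b) = real_of_int D" using sq_sq by simp
   thus False using bD by (simp only: of_int_eq_iff p2sq)
  qed
  thus ?thesis using bs by simp
 qed
 define \<rho> where "\<rho> = 2 / (sq - b)"
 have fr: "frac omega = (sq - b) / 2" by (simp add: frac_def b_def omega_def field_simps)
 have rho: "\<rho> = 1 / frac omega" by (simp add: \<rho>_def fr)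
 have rho1: "\<rho> > 1"
 proof -
  have "0 < frac omega" "frac omega < 1" using bs' unfolding fr[symmetric] by (simp add: fr) (rule frac_lt_1)
  thus ?thesis unfolding rho by simp
 qed
 define c where "c = cc 1 b"
 have D4: "D = b * b - 4 * c" using form_eq[OF f] by (simp add: c_def p2sq)
 have rq: "1 + b * \<rho> + c * \<rho> * \<rho> = 0"
 proof -
  have i: "\<rho> * (sq - b) = 2"
   unfolding \<rho>_def by (rule nonzero_eq_divide_eq[THEN iffD1, OF _ refl]) (use bs' in simp)
  have q: "(\<rho> * (sq - b)) * (\<rho> * (sq - b)) + 2 * b * \<rho> * (\<rho> * (sq - b)) = \<rho> * \<rho> * (sq * sq - b * b)"
   by (simp add: alg)
  have "sq * sq - b * b = real_of_int (D - b * b)" by (simp add: sq_sq)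
  moreover have "D - b * b = - 4 * c" using D4 by linarith
  ultimately have "sq * sq - b * b = - 4 * real_of_int c" by simp
  hence "4 + 2 * b * \<rho> * 2 = \<rho> * \<rho> * (- 4 * real_of_int c)" using q unfolding i by simp
  thus ?thesis by (simp add: alg)
 qed
 assume W: "unit_word 1 b 0 W"
 define m11 m22 where "m11 = (et - b * eu) div 2" and "m22 = (et + b * eu) div 2"
 have WM: "word_mat W = (m11, - c * eu, eu, m22)" using W by (simp add: unit_word_def m11_def m22_def c_def)
 have "even (et + eu)" using unit_parity[of et eu 1] fund(3) by simp
 hence h2: "2 * m11 = et - b * eu" "2 * m22 = et + b * eu" unfolding m11_def m22_def using odd_b by auto
 have m22: "m22 > eu"
 proof -
  have "3 * eu <= b * eu" using b3 fund(2) by simp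
  thus ?thesis using h2(2) fund(1,2) by linarith
 qed
 note wp = word_mat_props[OF WM]
 \<comment> \<open>rho is a fixed point of the Moebius transformation of the unit matrix.\<close>
 have fixed: "eu + m22 * \<rho> = \<rho> * (m11 + (- c * eu) * \<rho>)"
 proof -
  have "2 * real_of_int m11 = et - b * eu" "2 * real_of_int m22 = et + b * eu" using h2 by (metis of_int_diff of_int_add of_int_mult of_int_numeral)+
  hence bu: "2 * real_of_int m22 - 2 * real_of_int m11 = 2 * (real_of_int b * eu)" by simp
  have "2 * (eu + m22 * \<rho> - \<rho> * (m11 + (- c * eu) * \<rho>)) = 2 * eu + \<rho> * (2 * real_of_int m22 - 2 * real_of_int m11) + 2 * c * eu * \<rho> * \<rho>"
   by (simp add: alg)
  also have "... = 2 * eu * (1 + b * \<rho> + c * \<rho> * \<rho>)" unfolding bu by (simp add: alg)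
  finally have "2 * (eu + m22 * \<rho> - \<rho> * (m11 + (- c * eu) * \<rho>)) = 2 * eu * (1 + b * \<rho> + c * \<rho> * \<rho>)" .
  thus ?thesis unfolding rq by simp
 qed
 obtain ks where ks: "\<forall>k\<in>set ks. k >= 1" "W = run_word ks \<or> W = map Not (run_word ks)" using run_word_exists by blast
 have ks0: "ks ~= []"
 proof
  assume "ks = []"
  hence "W = []" using ks(2) by simp
  thus False using WM fund(2) by simp
 qed
 \<comment> \<open>In the matrix of a word beginning with \<open>T\<close> the first row dominates
   the second, which would give a fixed point rho <= 1.\<close>
 have Wr: "W = run_word ks"
 proof (rule ccontr)
  assume "W ~= run_word ks"
  hence w: "W = map Not (run_word ks)" using ks(2) by simp
  obtain k ks' where k: "ks = k # ks'" "k >= 1" using ks0 ks(1) by (cases ks) auto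
  then obtain V where V: "W = True # V" unfolding w by (cases k) auto
  obtain a' b' c' d' where v: "word_mat V = (a', b', c', d')" by (metis prod_cases4)
  have e: "m11 = a' + eu" "- c * eu = b' + m22" using WM unfolding V word_mat.simps v by auto
  have "a' >= 0" "b' >= 0" using word_mat_props[OF v] by auto
  hence "real_of_int m11 >= eu" "real_of_int (- c * eu) >= m22" using e by linarith+
  hence 1: "m11 + (- c * eu) * \<rho> >= eu + m22 * \<rho>" using mult_right_mono[of "real_of_int m22" "real_of_int (- c * eu)" \<rho>] rho1 by simp
  have p: "eu + m22 * \<rho> > 0" using fund(2) m22 rho1 by (simp add: add_pos_pos)
  have "m11 + (- c * eu) * \<rho> > 0" using 1 p by linarith
  hence "1 * (m11 + (- c * eu) * \<rho>) < \<rho> * (m11 + (- c * eu) * \<rho>)" using rho1 by (intro mult_strict_right_mono)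
  thus False using leD[OF 1] unfolding fixed mult_1 by blast
 qed
 obtain k11 k12 k21 k22 where km: "kmat ks = (k11, k12, k21, k22)" by (metis prod_cases4)
 \<comment> \<open>For an odd number of runs the columns are exchanged, and
   \<open>kmat_props\<close> would give m22 <= eu.\<close>
 have ev: "even (length ks)"
 proof (rule ccontr)
  assume "odd (length ks)"
  hence "eu = k22" "m22 = k21" using word_mat_run_word[OF km] WM Wr by auto
  thus False using kmat_props[OF km ks(1)] ks0 m22 by simp
 qed
 hence kM: "kmat ks = (m11, - c * eu, eu, m22)" using word_mat_run_word[OF km] WM Wr km by simp
 define m where "m = length ks"
 have m0: "m > 0" using ks0 by (simp add: m_def)
 have rho0: "\<rho> > 0" using rho1 by simp
 have "cf_val ks \<rho> = \<rho>"
 proof -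
  have "m11 + real_of_int (- c * eu) * \<rho> > 0" "cf_val ks \<rho> = (eu + m22 * \<rho>) / (m11 + real_of_int (- c * eu) * \<rho>)"
   using cf_val_kmat[OF kM rho0] by auto
  thus ?thesis using fixed by simp
 qed
 hence cf: "!!i. i < m ==> cf_coeff \<rho> i = int (ks ! i)" "cf_remainder \<rho> m = \<rho>"
  using cf_val_coeffs[OF ks(1) rho1] by (auto simp: m_def)
 have sh: "cf_coeff omega (Suc i) = cf_coeff \<rho> i" for i
  unfolding cf_coeff_def cf_remainder_shift rho ..
 have per: "cf_coeff \<rho> (i + m) = cf_coeff \<rho> i" for i
  using cf_remainder_add[of \<rho> m i] cf(2) by (simp add: cf_coeff_def add.commute)
 define g where "g i = nat (cf_coeff \<rho> i)" for i
 have gks: "ks = map g [0..<m]"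
  by (rule nth_equalityI) (simp_all add: m_def g_def cf(1)[unfolded m_def])
 have g1: "g i >= 1" for i
 proof -
  have "g i = g (i mod m)"
  proof -
   have "g (j + n * m) = g j" for j n
    by (induction n) (use per in \<open>simp_all add: g_def add.assoc[symmetric] add.commute[of m]\<close>)
   thus ?thesis using mod_mult_div_eq[of i m] by (metis mult.commute)
  qed
  moreover have "g (i mod m) = ks ! (i mod m)" using m0 by (simp add: g_def cf(1))
  ultimately show ?thesis using ks(1) m0 by (simp add: m_def)
 qed
 \<comment> \<open>A shorter period l writes the product of the matrices as A B = B A. By
   \<open>commuting_unit\<close> both factors are matrices of units, with lower left entries r, r'
   >= eu; but eu = r p' + s r' >= r + r'.\<close>
 have min: "EX i. cf_coeff \<rho> (i + l) ~= cf_coeff \<rho> i" if l: "0 < l" "l < m" for l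
 proof (rule ccontr)
  assume "\<nexists>i. cf_coeff \<rho> (i + l) ~= cf_coeff \<rho> i"
  hence gl: "g (i + l) = g i" for i by (simp add: g_def)
  have gm: "g (i + m) = g i" for i using per by (simp add: g_def)
  define A B where "A = map g [0..<l]" and "B = map g [l..<m]"
  have AB: "A @ B = ks" unfolding A_def B_def gks using upt_add_eq_append[of 0 l "m - l"] l by (simp flip: map_append)
  have BA: "B @ A = ks"
  proof -
   have "A = map g (map (%i. i + m) [0..<l])" unfolding A_def map_map by (simp add: gm)
   hence A: "A = map g [m..<l + m]" by (simp add: map_add_upt)
   have "B @ A = map g ([l..<m] @ [m..<l + m])" unfolding A B_def by simp
   also have "[l..<m] @ [m..<l + m] = [l..<m + l]" using upt_add_eq_append[of l m l] l by (simp add: add.commute)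
   also have "... = map (%i. i + l) [0..<m]" by (simp add: map_add_upt)
   finally show ?thesis unfolding gks map_map by (simp add: gl)
  qed
  obtain p q r s where P: "kmat A = (p, q, r, s)" by (metis prod_cases4)
  obtain p' q' r' s' where Q: "kmat B = (p', q', r', s')" by (metis prod_cases4)
  have ne: "A ~= []" "B ~= []" "\<forall>k\<in>set A. k >= 1" "\<forall>k\<in>set B. k >= 1" using l g1 by (auto simp: A_def B_def)
  note pA = kmat_props[OF P ne(3)] and pB = kmat_props[OF Q ne(4)]
  have e1: "m11 = p * p' + q * r'" "- c * eu = p * q' + q * s'" "eu = r * p' + s * r'" "m22 = r * q' + s * s'"
   using kmat_append[OF P Q] kM unfolding AB by auto
  have e2: "m11 = p' * p + q' * r" "- c * eu = p' * q + q' * s" "eu = r' * p + s' * r" "m22 = r' * q + s' * s"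
   using kmat_append[OF Q P] kM unfolding BA by auto
  note cA = product_commutes[OF e1 e2] and cB = product_commutes[OF e2 e1]
  note uA = commuting_unit[OF f m11_def m22_def cA[unfolded c_def] conjunct1[OF pA]]
  note uB = commuting_unit[OF f m11_def m22_def cB[unfolded c_def] conjunct1[OF pB]]
  have A: "p >= 0" "q >= 1" "r >= 1" "s >= 1" using pA ne(1) by auto
  have B: "p' >= 0" "q' >= 1" "r' >= 1" "s' >= 1" using pB ne(2) by auto
  have "p' ~= 0"
  proof
   assume "p' = 0"
   hence "- (q' * r') = 1" using pB uB(1) by simp
   moreover have "q' * r' >= 0" using B by simp
   ultimately show False by simp
  qed
  hence "r * 1 <= r * p'" "1 * r' <= s * r'" using A B by (intro mult_mono; simp)+
  thus False using e1(3) uA(3)[OF A(3)] uB(3)[OF B(3)] fund(2) by linarith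
 qed
 have "hirzebruch_sum omega = (\<Sum>i<m. (-1) ^ Suc i * cf_coeff omega (Suc i))"
 proof (rule hirzebruch_sum_eqI[OF m0])
  show "even m" using ev by (simp add: m_def)
  show "cf_coeff omega (Suc i + m) = cf_coeff omega (Suc i)" for i using per[of i] by (simp add: sh)
  show "EX i. cf_coeff omega (Suc i + l) ~= cf_coeff omega (Suc i)" if "0 < l" "l < m" for l
   using min[OF that] by (simp add: sh)
 qed
 also have "... = word_psi W" unfolding Wr word_psi_run_word m_def[symmetric]
  by (rule sum.cong) (simp_all add: sh cf(1))
 finally show "word_psi W = hirzebruch_sum omega" ..
qed

end

subsection \<open>Congruences for the Rademacher function\<close>

abbreviation J :: "int => int => int" where "J a n \<equiv> jacobi a (nat n)"

lemma J_reciprocity: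
 assumes "odd x" "odd y" "x > 0" "y > 0" "coprime x y"
 shows "J x y = (if x mod 4 = 3 & y mod 4 = 3 then - J y x else J y x)"
proof -
 define m n where "m = nat x" and "n = nat y"
 have mn: "x = int m" "y = int n" using assms by (simp_all add: m_def n_def)
 have o: "odd m" "odd n" using assms(1,2) by (simp_all add: mn)
 have c: "coprime m n" "coprime (int m) (int n)" "coprime (int n) (int m)" using assms(5) by (simp_all add: mn coprime_commute)
 have md: "int k mod 4 = 3 \<longleftrightarrow> k mod 4 = 3" for k :: nat
 proof -
  have "int k mod 4 = int (k mod 4)" by (simp add: zmod_int)
  thus ?thesis by linarith
 qed
 show ?thesis unfolding mn md nat_int
  using jacobi_reciprocity[OF o c(1)] jacobi_coprime[OF o(2) c(2)] jacobi_coprime[OF o(1) c(3)] by (auto split: if_splits)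
qed

lemma J_minus: "odd y ==> y > 0 ==> J (- x) y = (if y mod 4 = 1 then J x y else - J x y)"
proof -
 assume y: "odd y" "y > 0"
 hence o: "odd (nat y)" by (simp add: even_nat_iff)
 have "nat y mod 4 = 1 \<longleftrightarrow> int (nat y) mod 4 = 1" by (metis of_nat_eq_iff of_nat_mod of_nat_numeral of_nat_1)
 hence "nat y mod 4 = 1 \<longleftrightarrow> y mod 4 = 1" using y(2) by simp
 thus ?thesis using jacobi_mult_left[OF o, of "-1" x] jacobi_minus_1[OF o] by simp
qed

lemma J_cong: "y > 0 ==> y dvd x - x' ==> J x y = J x' y"
 by (rule jacobi_cong) (simp add: cong_iff_dvd_diff)

lemma J_unit: "odd y ==> y > 0 ==> coprime x y ==> J x y = 1 \<or> J x y = -1"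
 using jacobi_coprime[of "nat y" x] by (auto simp: even_nat_iff)

lemma J_mult: "odd y ==> y > 0 ==> J (x * x') y = J x y * J x' y"
 by (rule jacobi_mult_left) (simp add: even_nat_iff)

lemma J_mult_right: "x > 0 ==> y > 0 ==> J a (x * y) = J a x * J a y"
 using jacobi_mult_right[of "nat x" "nat y" a] by (simp add: nat_mult_distrib)

lemma odd_mod_4_int: "odd (x::int) ==> x mod 4 = 1 \<or> x mod 4 = 3"
 by presburger

lemma even_mod_4_int: "even (x::int) ==> x mod 4 = 0 \<or> x mod 4 = 2"
 by presburger

lemma odd_add_2_mod_4: "odd (y::int) ==> (y mod 4 = 1 & (y + 2) mod 4 = 3) \<or> (y mod 4 = 3 & (y + 2) mod 4 = 1)"
 by presburger

lemma mod_4_add: "(x::int) mod 4 = 0 ==> (x + y) mod 4 = y mod 4" "x mod 4 = 2 ==> (x + y) mod 4 = (y + 2) mod 4"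
 by (metis add_0 mod_add_left_eq) (metis add.commute mod_add_left_eq)

lemma coprime_add: "coprime (a::int) c ==> coprime a (c + k * a)" "coprime (a::int) c ==> coprime (a + k * c) c"
proof -
 have 1: "coprime a c ==> coprime a (c + k * a)" for a c :: int
  unfolding coprime_iff_gcd_eq_1 add.commute[of c] gcd_add_mult .
 show "coprime a c ==> coprime a (c + k * a)" by (rule 1)
 show "coprime a c ==> coprime (a + k * c) c" using 1[of c a] by (simp add: coprime_commute)
qed

text \<open>An even entry cannot be reciprocated, but a = - c modulo a + c replaces it by the odd c.
  This shift and the next two are the changes of the symbol in \<open>psi8\<close> under one
  letter.\<close>

lemma J_shift_even:
 assumes "even a" "odd c" "a > 0" "c > 0" "coprime a c"
 shows "J a (a + c) = (if a mod 4 = 2 & c mod 4 = 1 then - J a c else J a c)"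
proof -
 have o: "odd (a + c)" "a + c > 0" using assms by simp_all
 have cp: "coprime c (a + c)" using coprime_add(2)[OF assms(5), of 1] by (simp add: coprime_commute)
 have "J a (a + c) = J (- c) (a + c)" by (rule J_cong) (use o in \<open>simp_all add: add.commute\<close>)
 also have "... = (if (a + c) mod 4 = 1 then J c (a + c) else - J c (a + c))" by (rule J_minus[OF o])
 also have "J c (a + c) = (if c mod 4 = 3 & (a + c) mod 4 = 3 then - J (a + c) c else J (a + c) c)"
  by (rule J_reciprocity[OF assms(2) o(1) assms(4) o(2) cp])
 also have "J (a + c) c = J a c" by (rule J_cong) (use assms in simp_all)
 finally have *: "J a (a + c) = (if (a + c) mod 4 = 1 then (if c mod 4 = 3 & (a + c) mod 4 = 3 then - J a c else J a c)
  else - (if c mod 4 = 3 & (a + c) mod 4 = 3 then - J a c else J a c))" .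
 have ac: "(a mod 4 = 0 & (a + c) mod 4 = c mod 4) \<or> (a mod 4 = 2 & (a + c) mod 4 = (c + 2) mod 4)"
  using even_mod_4_int[OF assms(1)] mod_4_add[of a c] by auto
 consider "c mod 4 = 1" "(c + 2) mod 4 = 3" | "c mod 4 = 3" "(c + 2) mod 4 = 1" using odd_add_2_mod_4[OF assms(2)] by blast
 thus ?thesis unfolding * by cases (use ac in auto)
qed

lemma J_shift_odd:
 assumes "odd a" "odd c" "a > 0" "c > 0" "coprime a c"
 shows "J a (c + 2 * a) = (if a mod 4 = 1 then J a c else - J a c)"
proof -
 have o: "odd (c + 2 * a)" "c + 2 * a > 0" using assms by simp_all
 have "J a (c + 2 * a) = (if a mod 4 = 3 & (c + 2 * a) mod 4 = 3 then - J (c + 2 * a) a else J (c + 2 * a) a)"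
  by (rule J_reciprocity[OF assms(1) o(1) assms(3) o(2) coprime_add(1)[OF assms(5)]])
 also have "J (c + 2 * a) a = J c a" by (rule J_cong) (use assms in simp_all)
 finally have 1: "J a (c + 2 * a) = (if a mod 4 = 3 & (c + 2 * a) mod 4 = 3 then - J c a else J c a)" .
 have 2: "J a c = (if a mod 4 = 3 & c mod 4 = 3 then - J c a else J c a)" by (rule J_reciprocity[OF assms])
 have "(2 * a) mod 4 = 2" using assms(1) by presburger
 from mod_4_add(2)[OF this, of c] have 3: "(c + 2 * a) mod 4 = (c + 2) mod 4" by (simp only: add.commute)
 consider "c mod 4 = 1" "(c + 2) mod 4 = 3" | "c mod 4 = 3" "(c + 2) mod 4 = 1" using odd_add_2_mod_4[OF assms(2)] by blast
 thus ?thesis unfolding 1 2 3 by cases (use odd_mod_4_int[OF assms(1)] in auto)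
qed

lemma J_shift_both:
 assumes "odd a" "even c" "a > 0" "c >= 0" "coprime a c"
 shows "J (a + c) (a + 2 * c) = (if (a + c) mod 4 = 3 & c mod 4 = 2 then - J a (a + c) else J a (a + c))"
proof -
 have o: "odd (a + c)" "a + c > 0" "odd (a + 2 * c)" "a + 2 * c > 0" using assms by simp_all
 have "coprime (a + c) c" using coprime_add(2)[OF assms(5), of 1] by simp
 hence cp: "coprime (a + c) (a + 2 * c)" using coprime_add(1)[of "a + c" c 1] by (simp add: alg)
 have "J (a + c) (a + 2 * c) = (if (a + c) mod 4 = 3 & (a + 2 * c) mod 4 = 3 then - J (a + 2 * c) (a + c) else J (a + 2 * c) (a + c))"
  by (rule J_reciprocity[OF o(1,3,2,4) cp])
 also have "J (a + 2 * c) (a + c) = J c (a + c)" by (rule J_cong) (use o in \<open>simp_all add: add.commute\<close>)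
 finally have 1: "J (a + c) (a + 2 * c) = (if (a + c) mod 4 = 3 & (a + 2 * c) mod 4 = 3 then - J c (a + c) else J c (a + c))" .
 have "J a (a + c) = J (- c) (a + c)" by (rule J_cong) (use o in \<open>simp_all add: add.commute\<close>)
 also have "... = (if (a + c) mod 4 = 1 then J c (a + c) else - J c (a + c))" by (rule J_minus[OF o(1,2)])
 finally have 2: "J a (a + c) = (if (a + c) mod 4 = 1 then J c (a + c) else - J c (a + c))" .
 have ac: "(c mod 4 = 0 & (a + 2 * c) mod 4 = (a + c) mod 4) \<or> (c mod 4 = 2 & (a + 2 * c) mod 4 = (a + c + 2) mod 4)"
  using even_mod_4_int[OF assms(2)] mod_4_add[of c "a + c"] by (auto simp: alg)
 consider "(a + c) mod 4 = 1" "(a + c + 2) mod 4 = 3" | "(a + c) mod 4 = 3" "(a + c + 2) mod 4 = 1" using odd_add_2_mod_4[OF o(1)] by blast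
 thus ?thesis unfolding 1 2 by cases (use ac in auto)
qed

text \<open>The classical formula for the Rademacher function modulo 8; for even \<open>c\<close> it is obtained by
 prefixing the letter \<open>L\<close>.\<close>

definition psi8_odd :: "int => int => int => int" where
 "psi8_odd a c d = c * (a + d - 1 + 2 * J a c) - 4"

definition psi8 :: "int => int => int => int => int" where
 "psi8 a b c d = (if odd c then psi8_odd a c d else psi8_odd a (c + a) (d + b) + 1)"

lemma mod_4_cases: "even (x::int) ==> (EX k. x = 4 * k) \<or> (EX k. x = 4 * k + 2)" "odd (x::int) ==> (EX k. x = 4 * k + 1) \<or> (EX k. x = 4 * k + 3)"
 by presburger+

lemma dvd_8_mult: "even x ==> 4 dvd y ==> 8 dvd x * (y::int)" "4 dvd x ==> even y ==> 8 dvd x * (y::int)"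
 using mult_dvd_mono[of 2 x 4 y] mult_dvd_mono[of 4 x 2 y] by simp_all

text \<open>For odd c the expression is c^2 - 1. For even c the two terms refer to the odd entries a
  + 2 c and a + c, and the sign E that reciprocity produces between their symbols is matched against
  the determinant modulo 4.\<close>

lemma psi8_T:
 assumes det: "a * d - b * c = 1" and pos: "a > 0" "c >= 0"
 shows "8 dvd psi8 (a + c) (b + d) c d - psi8 a b c d - 1"
proof -
 have "coprime a c"
 proof (rule coprimeI)
  fix x assume "x dvd a" "x dvd c"
  hence "x dvd a * d - b * c" by simp
  thus "is_unit x" using det by simp
 qed
 note cp = this
 show ?thesis
 proof (cases "odd c")
  case True
  hence c0: "c > 0" using pos by (cases "c = 0") auto
  have "J (a + c) c = J a c" by (rule J_cong[OF c0]) simp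
  hence "psi8 (a + c) (b + d) c d - psi8 a b c d - 1 = (c - 1) * (c + 1)"
   using True by (simp add: psi8_def psi8_odd_def alg)
  moreover obtain k where "c = 4 * k + 1 \<or> c = 4 * k + 3" using mod_4_cases(2)[OF True] by blast
  hence "8 dvd (c - 1) * (c + 1)"
  proof
   assume "c = 4 * k + 1" thus ?thesis by (intro dvd_8_mult) simp_all
  next
   assume "c = 4 * k + 3" thus ?thesis by (intro dvd_8_mult) simp_all
  qed
  ultimately show ?thesis by simp
 next
  case False
  hence c: "even c" by simp
  have ad: "odd a" "odd d" using arg_cong[OF det, of even] c by auto
  define m where "m = a + c"
  have m: "odd m" "m > 0" "coprime a m" using ad c pos coprime_add(1)[OF cp, of 1] by (simp_all add: m_def add.commute)
  obtain E where E: "J m (a + 2 * c) = E * J a m" "E = (if m mod 4 = 3 & c mod 4 = 2 then -1 else 1)"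
   using J_shift_both[OF ad(1) c pos cp] unfolding m_def by (metis mult_minus1 mult_1)
  define j where "j = J a m"
  have j: "odd j" using J_unit[OF m] by (auto simp: j_def)
  have e1: "psi8 (a + c) (b + d) c d = (a + 2 * c) * (a + c + d + (b + d) - 1 + 2 * (E * j)) - 3"
   using c E(1) by (simp add: psi8_def psi8_odd_def j_def m_def alg)
  have e2: "psi8 a b c d = (a + c) * (a + (d + b) - 1 + 2 * j) - 3"
   using c by (simp add: psi8_def psi8_odd_def j_def m_def alg)
  have "psi8 (a + c) (b + d) c d - psi8 a b c d - 1 =
   c * (2 * b + 3 * d - 1) + 2 * c * (m + E * j) + 2 * m * j * (E - 1) + 2 * (a * d - b * c - 1) - (a * d - b * c - 1)"
   unfolding e1 e2 m_def by (simp add: alg)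
  hence e: "psi8 (a + c) (b + d) c d - psi8 a b c d - 1 = c * (2 * b + 3 * d - 1) + (2 * c) * (m + E * j) + 2 * m * j * (E - 1)"
   using det by simp
  have "even (m + E * j)" using m(1) j E(2) by auto
  moreover have "4 dvd 2 * c" using c by auto
  ultimately have t2: "8 dvd (2 * c) * (m + E * j)" by (intro dvd_8_mult)
  have "8 dvd c * (2 * b + 3 * d - 1) + 2 * m * j * (E - 1)"
  proof -
   obtain l where "c = 4 * l \<or> c = 4 * l + 2" using mod_4_cases(1)[OF c] by blast
   thus ?thesis
   proof
    assume l: "c = 4 * l"
    hence "E = 1" using E(2) by simp
    moreover have "8 dvd c * (2 * b + 3 * d - 1)" using l ad by (intro dvd_8_mult) auto
    ultimately show ?thesis by simp
   next
    assume l: "c = 4 * l + 2"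
    obtain k where "a = 4 * k + 1 \<or> a = 4 * k + 3" using mod_4_cases(2)[OF ad(1)] by blast
    thus ?thesis
    proof
     assume k: "a = 4 * k + 3"
     hence "m mod 4 = 1" unfolding m_def l by presburger
     hence "E = 1" using E(2) by simp
     moreover have "2 * b + 3 * d - 1 = 4 * (b * l - k * d + b)" using det unfolding k l by (simp add: alg)
     hence "4 dvd 2 * b + 3 * d - 1" by (rule dvdI)
     hence "8 dvd c * (2 * b + 3 * d - 1)" by (rule dvd_8_mult(1)[OF c])
     ultimately show ?thesis by simp
    next
     assume k: "a = 4 * k + 1"
     hence "m mod 4 = 3" "c mod 4 = 2" unfolding m_def l by presburger+
     hence E1: "E = -1" using E(2) by simp
     have d3: "2 * b + 3 * d - 1 = 4 * (3 * (b * l - k * d) + 2 * b) + 2" using det unfolding k l by (simp add: alg)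
     have "c * (2 * b + 3 * d - 1) + 2 * m * j * (E - 1) = 8 * ((2 * l + 1) * (3 * (b * l - k * d) + 2 * b) + l) + 4 * (1 - m * j)"
      unfolding d3 unfolding E1 l by (simp add: alg)
     moreover have "even (1 - m * j)" using m(1) j by simp
     hence "8 dvd 4 * (1 - m * j)" by (intro dvd_8_mult) simp_all
     ultimately show ?thesis by (simp only: dvd_add dvd_triv_left)
    qed
   qed
  qed
  hence "8 dvd (c * (2 * b + 3 * d - 1) + 2 * m * j * (E - 1)) + (2 * c) * (m + E * j)" using t2 by (rule dvd_add)
  thus ?thesis unfolding e by (simp only: add_ac)
 qed
qed

text \<open>For even c the claim is the definition of \<open>psi8\<close>. For odd c the new entry c
  + a decides: if a is even, the symbol is taken modulo a + c, and if a is odd, modulo c + 2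
  a.\<close>

lemma psi8_L:
 assumes det: "a * d - b * c = 1" and pos: "a > 0" "c >= 0"
 shows "8 dvd psi8 a b (c + a) (d + b) - psi8 a b c d + 1"
proof -
 have cp: "coprime a c"
 proof (rule coprimeI)
  fix x assume "x dvd a" "x dvd c"
  hence "x dvd a * d - b * c" by simp
  thus "is_unit x" using det by simp
 qed
 show ?thesis
 proof (cases "odd c")
  case False
  hence "odd a" using arg_cong[OF det, of even] by auto
  thus ?thesis using False by (simp add: psi8_def)
 next
  case c: True
  hence c0: "c > 0" using pos by (cases "c = 0") auto
  define j where "j = J a c"
  have j: "j = 1 \<or> j = -1" using J_unit[OF c c0 cp] by (simp add: j_def)
  hence jo: "odd j" by auto
  show ?thesis
  proof (cases "odd a")
   case False
   hence a: "even a" by simp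
   hence b: "odd b" using arg_cong[OF det, of even] by auto
   obtain E where E: "J a (a + c) = E * j" "E = (if a mod 4 = 2 & c mod 4 = 1 then -1 else 1)"
    using J_shift_even[OF a c pos(1) c0 cp] unfolding j_def by (metis mult_minus1 mult_1)
   have e1: "psi8 a b (c + a) (d + b) = (c + a) * (a + (d + b) - 1 + 2 * (E * j)) - 4"
    using c a E(1) by (simp add: psi8_def psi8_odd_def add.commute[of c])
   have e2: "psi8 a b c d = c * (a + d - 1 + 2 * j) - 4" using c by (simp add: psi8_def psi8_odd_def j_def)
   have "psi8 a b (c + a) (d + b) - psi8 a b c d + 1 = a * (2 * d + a + b - 1 + 2 * (E * j)) + 2 * c * j * (E - 1) - (a * d - b * c - 1)"
    unfolding e1 e2 by (simp add: alg)
   hence e: "psi8 a b (c + a) (d + b) - psi8 a b c d + 1 = a * (2 * d + a + b - 1 + 2 * (E * j)) + 2 * c * j * (E - 1)" using det by simp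
   obtain k where "a = 4 * k \<or> a = 4 * k + 2" using mod_4_cases(1)[OF a] by blast
   thus ?thesis
   proof
    assume k: "a = 4 * k"
    hence "E = 1" using E(2) by simp
    moreover have "8 dvd a * (2 * d + a + b - 1 + 2 * (E * j))" using k b by (intro dvd_8_mult) auto
    ultimately show ?thesis unfolding e by simp
   next
    assume k: "a = 4 * k + 2"
    obtain l where "c = 4 * l + 1 \<or> c = 4 * l + 3" using mod_4_cases(2)[OF c] by blast
    thus ?thesis
    proof
     assume l: "c = 4 * l + 3"
     hence "c mod 4 = 3" by presburger
     hence E1: "E = 1" using E(2) by simp
     have "3 * b = 4 * (k * d - b * l) + 2 * d - 1" using det unfolding k l by (simp add: alg)
     hence "2 * d + a + b - 1 + 2 * (E * j) = 4 * (k - (k * d - b * l) + b) + 2 + 2 * j" unfolding E1 k by simp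
     moreover have "4 dvd 2 + 2 * j" using j by auto
     ultimately have "4 dvd 2 * d + a + b - 1 + 2 * (E * j)" by (simp only: dvd_add dvd_triv_left add.assoc)
     hence "8 dvd a * (2 * d + a + b - 1 + 2 * (E * j))" using a by (intro dvd_8_mult)
     thus ?thesis unfolding e using E1 by simp
    next
     assume l: "c = 4 * l + 1"
     hence "c mod 4 = 1" "a mod 4 = 2" unfolding k by presburger+
     hence E1: "E = -1" using E(2) by simp
     have "b = 4 * (k * d - b * l) + 2 * d - 1" using det unfolding k l by (simp add: alg)
     hence s: "2 * d + a + b - 1 + 2 * (E * j) = 4 * (k + (k * d - b * l) + d) - 2 * j" unfolding E1 k by simp
     have "a * (2 * d + a + b - 1 + 2 * (E * j)) + 2 * c * j * (E - 1) = 8 * ((2 * k + 1) * (k + (k * d - b * l) + d) - k * j) - 4 * (j * (1 + c))"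
      unfolding s unfolding E1 k by (simp add: alg)
     moreover have "even (j * (1 + c))" using c by simp
     hence "8 dvd 4 * (j * (1 + c))" by (intro dvd_8_mult) simp_all
     ultimately show ?thesis unfolding e by (simp only: dvd_diff dvd_triv_left)
    qed
   qed
  next
   case a: True
   obtain E where E: "J a (c + 2 * a) = E * j" "E = (if a mod 4 = 1 then 1 else -1)"
    using J_shift_odd[OF a c pos(1) c0 cp] unfolding j_def by (metis mult_minus1 mult_1)
   have e1: "psi8 a b (c + a) (d + b) = (c + 2 * a) * (a + (d + b + b) - 1 + 2 * (E * j)) - 3"
    using c a E(1) by (simp add: psi8_def psi8_odd_def alg)
   have e2: "psi8 a b c d = c * (a + d - 1 + 2 * j) - 4" using c by (simp add: psi8_def psi8_odd_def j_def)
   have "psi8 a b (c + a) (d + b) - psi8 a b c d + 1 = 2 * a * (a - 1) + 4 * a * (d + b + E * j) + 2 * c * j * (E - 1) - 2 * (a * d - b * c - 1)"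
    unfolding e1 e2 by (simp add: alg)
   hence e: "psi8 a b (c + a) (d + b) - psi8 a b c d + 1 = 2 * a * (a - 1) + 2 * c * j * (E - 1) + 4 * a * (d + b + E * j)" using det by simp
   have "even (d + b + E * j)" using arg_cong[OF det, of even] a c jo E(2) by auto
   hence t: "8 dvd 4 * a * (d + b + E * j)" by (intro dvd_8_mult) simp_all
   obtain k where "a = 4 * k + 1 \<or> a = 4 * k + 3" using mod_4_cases(2)[OF a] by blast
   hence "8 dvd 2 * a * (a - 1) + 2 * c * j * (E - 1)"
   proof
    assume k: "a = 4 * k + 1"
    hence "a mod 4 = 1" by presburger
    hence "E = 1" using E(2) by simp
    moreover have "8 dvd (2 * a) * (a - 1)" using k by (intro dvd_8_mult) simp_all
    ultimately show ?thesis by simp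
   next
    assume k: "a = 4 * k + 3"
    hence "a mod 4 = 3" by presburger
    hence E1: "E = -1" using E(2) by simp
    have "2 * a * (a - 1) + 2 * c * j * (E - 1) = 4 * (a * (2 * k + 1) - c * j)" unfolding E1 using k by (simp add: alg)
    moreover have "even (a * (2 * k + 1) - c * j)" using a c jo by simp
    hence "8 dvd 4 * (a * (2 * k + 1) - c * j)" by (intro dvd_8_mult) simp_all
    ultimately show ?thesis by simp
   qed
   thus ?thesis unfolding e using t by (rule dvd_add)
  qed
 qed
qed

lemma word_mat_pos: "word_mat W = (a, b, c, d) ==> a > 0 & c >= 0 & a * d - b * c = 1"
proof -
 assume W: "word_mat W = (a, b, c, d)"
 note p = word_mat_props[OF W]
 have "a ~= 0"
 proof
  assume "a = 0"
  hence "b * c = -1" using p by simp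
  moreover have "b * c >= 0" using p by simp
  ultimately show False by simp
 qed
 thus ?thesis using p by simp
qed

theorem word_psi_mod_8: "word_mat W = (a, b, c, d) ==> 8 dvd psi8 a b c d - word_psi W"
proof (induction W arbitrary: a b c d rule: word_mat.induct)
 case 1
 have "J 1 1 = 1" by simp
 thus ?case using 1 by (auto simp: psi8_def psi8_odd_def)
next
 case (2 V)
 obtain a' b' c' d' where V: "word_mat V = (a', b', c', d')" by (metis prod_cases4)
 have e: "a = a' + c'" "b = b' + d'" "c = c'" "d = d'" using 2(2) V by auto
 have "8 dvd psi8 (a' + c') (b' + d') c' d' - psi8 a' b' c' d' - 1" using psi8_T word_mat_pos[OF V] by blast
 from dvd_add[OF this 2(1)[OF V]] show ?case unfolding e by (simp add: alg)
next
 case (3 V)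
 obtain a' b' c' d' where V: "word_mat V = (a', b', c', d')" by (metis prod_cases4)
 have e: "a = a'" "b = b'" "c = c' + a'" "d = d' + b'" using 3(2) V by auto
 have "8 dvd psi8 a' b' (c' + a') (d' + b') - psi8 a' b' c' d' + 1" using psi8_L word_mat_pos[OF V] by blast
 from dvd_add[OF this 3(1)[OF V]] show ?case unfolding e by (simp add: alg)
qed

text \<open>Modulo 3 this is the exponent in the multiplier of the Dedekind eta function.\<close>

definition psi3 :: "int => int => int => int => int" where
 "psi3 a b c d = (a + d) * c - b * d * (c^2 - 1)"

lemma psi3_L_residues:
 "\<forall>a\<in>{0,1,2}. \<forall>b\<in>{0,1,2}. \<forall>c\<in>{0,1,2}. \<forall>d\<in>{0,1,2::int}. (a * d - b * c) mod 3 = 1 -->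
   (psi3 a b (c + a) (d + b) - psi3 a b c d + 1) mod 3 = 0 & (psi3 (a + c) (b + d) c d - psi3 a b c d - 1) mod 3 = 0"
 by (simp add: psi3_def)

lemma psi3_step:
 assumes det: "a * d - b * c = 1"
 shows "3 dvd psi3 a b (c + a) (d + b) - psi3 a b c d + 1" "3 dvd psi3 (a + c) (b + d) c d - psi3 a b c d - 1"
proof -
 have "x mod 3 = 0 \<or> x mod 3 = 1 \<or> x mod 3 = 2" for x :: int by presburger
 hence c: "x mod 3 : {0, 1, 2}" for x :: int by simp
 have r: "[x = x mod 3] (mod 3)" for x :: int by (simp add: cong_mod)
 have "[(a mod 3) * (d mod 3) - (b mod 3) * (c mod 3) = a * d - b * c] (mod 3)"
  by (intro cong_diff cong_mult cong_sym[OF r])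
 hence "((a mod 3) * (d mod 3) - (b mod 3) * (c mod 3)) mod 3 = 1 mod 3" by (simp only: cong_mod det)
 also have "1 mod 3 = (1::int)" by simp
 finally have "((a mod 3) * (d mod 3) - (b mod 3) * (c mod 3)) mod 3 = 1" .
 note R = psi3_L_residues[rule_format, OF c c c c this]
 have C1: "[psi3 a b (c + a) (d + b) - psi3 a b c d + 1 = psi3 (a mod 3) (b mod 3) (c mod 3 + a mod 3) (d mod 3 + b mod 3) - psi3 (a mod 3) (b mod 3) (c mod 3) (d mod 3) + 1] (mod 3)"
  unfolding psi3_def by (intro cong_add cong_diff cong_mult cong_pow cong_refl r)
 show "3 dvd psi3 a b (c + a) (d + b) - psi3 a b c d + 1"
  unfolding dvd_eq_mod_eq_0 by (rule trans[OF C1[unfolded cong_mod] conjunct1[OF R]])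
 have C2: "[psi3 (a + c) (b + d) c d - psi3 a b c d - 1 = psi3 (a mod 3 + c mod 3) (b mod 3 + d mod 3) (c mod 3) (d mod 3) - psi3 (a mod 3) (b mod 3) (c mod 3) (d mod 3) - 1] (mod 3)"
  unfolding psi3_def by (intro cong_add cong_diff cong_mult cong_pow cong_refl r)
 show "3 dvd psi3 (a + c) (b + d) c d - psi3 a b c d - 1"
  unfolding dvd_eq_mod_eq_0 by (rule trans[OF C2[unfolded cong_mod] conjunct2[OF R]])
qed

theorem word_psi_mod_3: "word_mat W = (a, b, c, d) ==> 3 dvd psi3 a b c d - word_psi W"
proof (induction W arbitrary: a b c d rule: word_mat.induct)
 case 1
 thus ?case by (auto simp: psi3_def)
next
 case (2 V)
 obtain a' b' c' d' where V: "word_mat V = (a', b', c', d')" by (metis prod_cases4)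
 have e: "a = a' + c'" "b = b' + d'" "c = c'" "d = d'" using 2(2) V by auto
 have "3 dvd psi3 (a' + c') (b' + d') c' d' - psi3 a' b' c' d' - 1" using psi3_step(2) word_mat_pos[OF V] by blast
 from dvd_add[OF this 2(1)[OF V]] show ?case unfolding e by (simp add: alg)
next
 case (3 V)
 obtain a' b' c' d' where V: "word_mat V = (a', b', c', d')" by (metis prod_cases4)
 have e: "a = a'" "b = b'" "c = c' + a'" "d = d' + b'" using 3(2) V by auto
 have "3 dvd psi3 a' b' (c' + a') (d' + b') - psi3 a' b' c' d' + 1" using psi3_step(1) word_mat_pos[OF V] by blast
 from dvd_add[OF this 3(1)[OF V]] show ?case unfolding e by (simp add: alg)
qed

section \<open>Factorisation of t^2 - 4 for the fundamental unit\<close>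

lemma coprime_square_factors:
 fixes m n w :: nat
 assumes "coprime m n" "m * n = w^2"
 shows "EX x y. m = x^2 & n = y^2 & x * y = w"
proof -
 have "is_nth_power 2 (m * n)" unfolding assms(2) by (auto simp: is_nth_power_def)
 hence "is_nth_power 2 m" "is_nth_power 2 n" using is_nth_power_mult_coprime_nat_iff[OF assms(1)] by blast+
 then obtain x y where xy: "m = x^2" "n = y^2" by (auto simp: is_nth_power_def)
 hence "(x * y)^2 = w^2" using assms(2) by (simp add: power_mult_distrib)
 hence "x * y = w" by (simp add: power2_eq_iff_nonneg)
 thus ?thesis using xy by blast
qed

lemma coprime_factors_two_primes:
 fixes p1 p2 m n w :: nat
 assumes p: "prime p1" "prime p2" "p1 ~= p2" and cp: "coprime m n" and e: "m * n = p1 * p2 * w^2"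
 shows "EX e f x y. (e, f) : {(1, p1 * p2), (p1, p2), (p2, p1), (p1 * p2, 1)} & m = e * x^2 & n = f * y^2 & x * y = w"
proof -
 have *: ?thesis if ef: "(e, f) : {(1, p1 * p2), (p1, p2), (p2, p1), (p1 * p2, 1)}" "e dvd m" "f dvd n" for e f
 proof -
  obtain m' n' where mn: "m = e * m'" "n = f * n'" using ef(2,3) by (elim dvdE)
  have P: "e * f = p1 * p2" using ef(1) by (auto simp: mult.commute)
  have "(p1 * p2) * (m' * n') = (p1 * p2) * w^2" using e unfolding mn P[symmetric] by (simp add: mult_ac)
  hence "m' * n' = w^2" using p by (simp add: prime_gt_0_nat)
  moreover have "coprime m' n'" using cp unfolding mn by simp
  ultimately obtain x y where "m' = x^2 & n' = y^2 & x * y = w" using coprime_square_factors by blast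
  thus ?thesis using ef(1) mn by blast
 qed
 have cpp: "coprime p1 p2" using p by (simp add: primes_coprime)
 have "p1 dvd m * n" "p2 dvd m * n" unfolding e by simp_all
 hence "p1 dvd m \<or> p1 dvd n" "p2 dvd m \<or> p2 dvd n" using p by (simp_all add: prime_dvd_mult_iff)
 then consider "p1 dvd m" "p2 dvd m" | "p1 dvd m" "p2 dvd n" | "p1 dvd n" "p2 dvd m" | "p1 dvd n" "p2 dvd n" by blast
 thus ?thesis
 proof cases
  case 1
  thus ?thesis using divides_mult[OF 1 cpp] by (intro *[of "p1 * p2" 1]) simp_all
 next
  case 2
  thus ?thesis by (intro *[of p1 p2]) simp_all
 next
  case 3
  thus ?thesis by (intro *[of p2 p1]) simp_all
 next
  case 4
  thus ?thesis using divides_mult[OF 4 cpp] by (intro *[of 1 "p1 * p2"]) simp_all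
 qed
qed

lemma mod_3_square: "~ 3 dvd (x::int) ==> 3 dvd x^2 - 1"
proof -
 assume "~ 3 dvd x"
 hence "(EX k. x = 3 * k + 1) \<or> (EX k. x = 3 * k + 2)" by presburger
 then obtain k where "x = 3 * k + 1 \<or> x = 3 * k + 2" by blast
 hence "x^2 - 1 = 3 * (3 * k^2 + 2 * k) \<or> x^2 - 1 = 3 * (3 * k^2 + 4 * k + 1)"
  by (auto simp: sq_simps)
 thus ?thesis by (elim disjE) (simp_all only: dvd_triv_left)
qed

text \<open>With s = a and s' = c this is right multiplication by the k-th power of
  \<open>T\<close>, a means of making a matrix nonnegative without changing the residue.\<close>

lemma psi8_shift:
 assumes "8 dvd k" shows "8 dvd psi8 a (b + k * s) c (d + k * s') - psi8 a b c d"
proof (cases "odd c")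
 case True
 hence "psi8 a (b + k * s) c (d + k * s') - psi8 a b c d = k * (c * s')" by (simp add: psi8_def psi8_odd_def alg)
 thus ?thesis using assms by simp
next
 case False
 hence "psi8 a (b + k * s) c (d + k * s') - psi8 a b c d = k * ((c + a) * (s + s'))" by (simp add: psi8_def psi8_odd_def alg)
 thus ?thesis using assms by simp
qed

lemma psi3_shift:
 assumes "3 dvd k" shows "3 dvd psi3 a (b + k * s) c (d + k * s') - psi3 a b c d"
proof -
 have "psi3 a (b + k * s) c (d + k * s') - psi3 a b c d = k * (s' * c - (b * s' + d * s + k * s * s') * (c^2 - 1))"
  by (simp add: psi3_def alg)
 thus ?thesis using assms by simp
qed

context real_quad_disc
begin

lemma unit_factors:
 assumes mn: "m * n = D * w^2" "coprime m n" "m > 0" "n > 0" "w > 0"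
 shows "EX e f x y. (e, f) : {(1, D), (int p1, int p2), (int p2, int p1), (D, 1)} & m = e * x^2 & n = f * y^2 & x * y = w & x > 0 & y > 0"
proof -
 define m' n' w' where "m' = nat m" and "n' = nat n" and "w' = nat w"
 have i: "m = int m'" "n = int n'" "w = int w'" using mn by (simp_all add: m'_def n'_def w'_def)
 have "int (m' * n') = int (p1 * p2 * w'^2)" using mn(1) by (simp add: i D_eq)
 hence "m' * n' = p1 * p2 * w'^2" by (simp only: of_nat_eq_iff)
 moreover have "coprime m' n'" using mn(2) by (simp add: i)
 ultimately have "EX e f x y. (e, f) : {(1, p1 * p2), (p1, p2), (p2, p1), (p1 * p2, 1)} & m' = e * x^2 & n' = f * y^2 & x * y = w'"
  by (intro coprime_factors_two_primes[OF p1(1) p2(1) p_ne])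
 then obtain e f x y where h: "(e, f) : {(1, p1 * p2), (p1, p2), (p2, p1), (p1 * p2, 1)}" "m' = e * x^2" "n' = f * y^2" "x * y = w'"
  by (elim exE conjE)
 have "x * y > 0" using h(4) mn(5) by (simp add: i)
 hence "x > 0" "y > 0" by simp_all
 moreover have "(int e, int f) : {(1, D), (int p1, int p2), (int p2, int p1), (D, 1)}" unfolding D_eq using h(1) by auto
 moreover have "int m' = int e * (int x)^2" "int n' = int f * (int y)^2" "int x * int y = int w'"
  unfolding h(2,3) h(4)[symmetric] by simp_all
 ultimately show ?thesis unfolding i
  by (intro exI[of _ "int e"] exI[of _ "int f"] exI[of _ "int x"] exI[of _ "int y"] conjI) simp_all
qed

text \<open>The factors \<open>1\<close> and \<open>D\<close> are excluded by the minimality of the unit and by the absence of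
 units of norm \<open>-1\<close>.\<close>

lemma unit_structure:
 "EX e f x y. (e, f) : {(int p1, int p2), (int p2, int p1)} & x > 0 & y > 0 &
  ((odd eu & et + 2 = e * x^2 & et - 2 = f * y^2 & eu = x * y) \<or>
   (even eu & et + 2 = 4 * (e * x^2) & et - 2 = 4 * (f * y^2) & eu = 4 * (x * y)))"
proof -
 have ev: "even (et + eu)" using unit_parity[of et eu 1] fund(3) by simp
 have pr: "(et + 2) * (et - 2) = D * eu^2" using fund(3) by (simp add: sq_simps)
 show ?thesis
 proof (cases "odd eu")
  case True
  hence ot: "odd (et - 2)" using ev by simp
  hence "coprime (et - 2) 2" by simp
  hence "coprime (et - 2) (2 * 2)" by (simp only: coprime_mult_right_iff)
  hence "coprime (et - 2) (4 + 1 * (et - 2))" by (intro coprime_add(1)) simp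
  moreover have "4 + 1 * (et - 2) = et + 2" by simp
  ultimately have cp: "coprime (et + 2) (et - 2)" by (simp only: coprime_commute)
  obtain e f x y where h: "(e, f) : {(1, D), (int p1, int p2), (int p2, int p1), (D, 1)}" "et + 2 = e * x^2" "et - 2 = f * y^2" "x * y = eu" "x > 0" "y > 0"
   using unit_factors[OF pr cp _ _ fund(2)] et_gt by auto
  \<comment> \<open>Otherwise x^2 - D y^2 = 4 forces y >= eu, although eu = x y with x > 2.\<close>
  have "(e, f) ~= (1, D)"
  proof
   assume "(e, f) = (1, D)"
   hence "x^2 - D * y^2 = 4" "x^2 = et + 2" using h(2,3) by simp_all
   hence "eu <= y" "2^2 < x^2" using fund_min[of x y] h(6) et_gt by simp_all
   hence "eu <= y" "2 < x" using power2_less_imp_less[of 2 x] h(5) by simp_all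
   hence "2 * y < x * y" using h(6) by simp
   thus False using \<open>eu <= y\<close> h(4,6) by simp
  qed
  moreover have "(e, f) ~= (D, 1)"
  proof
   assume "(e, f) = (D, 1)"
   hence "y^2 - D * x^2 = - 4" using h(2,3) by simp
   thus False using norm_minus_4 by blast
  qed
  ultimately have "(e, f) : {(int p1, int p2), (int p2, int p1)}" using h(1) by blast
  thus ?thesis using h(2-6) True by (intro exI[of _ e] exI[of _ f] exI[of _ x] exI[of _ y]) simp
 next
  case False
  hence "even et" using ev by simp
  then obtain t' u' where tu: "et = 2 * t'" "eu = 2 * u'" using False by (auto elim!: evenE)
  have n1: "t'^2 - D * u'^2 = 1" using fund(3) by (simp add: tu p2sq)
  \<comment> \<open>D = 1 mod 4, so t'^2 - D u'^2 = 1 has no solution with t' even.\<close>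
  have ot: "odd t'"
  proof
   assume t': "even t'"
   hence "odd u'" using arg_cong[OF n1, of even] odd_D by simp
   then obtain k l where kl: "t' = 2 * k" "u' = 2 * l + 1" using t' by (elim evenE oddE)
   have "4 * (k^2 - D * (l^2 + l) + C) = 2" using n1 unfolding kl by (simp add: D sq_simps)
   thus False by presburger
  qed
  hence "even u'" using arg_cong[OF n1, of even] odd_D by simp
  then obtain k w where kw: "t' = 2 * k + 1" "u' = 2 * w" using ot by (elim evenE oddE)
  have kk: "(k + 1) * k = D * w^2" using n1 unfolding kw by (simp add: sq_simps)
  have pos: "k > 0" "w > 0" using fund(2) et_gt unfolding tu kw by simp_all
  have cp: "coprime (k + 1) k" using coprime_add(2)[of 1 k 1] by (simp add: add.commute)
  obtain e f x y where h: "(e, f) : {(1, D), (int p1, int p2), (int p2, int p1), (D, 1)}" "k + 1 = e * x^2" "k = f * y^2" "x * y = w" "x > 0" "y > 0"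
   using unit_factors[OF kk cp _ pos] pos by auto
  have uw: "eu = 4 * w" "et = 4 * k + 2" by (simp_all add: tu kw)
  have "(e, f) ~= (1, D)"
  proof
   assume "(e, f) = (1, D)"
   hence "(2 * x)^2 - D * (2 * y)^2 = 4" using h(2,3) by (simp add: sq_simps)
   hence "eu <= 2 * y" using fund_min[of "2 * x" "2 * y"] h(6) by simp
   moreover have "1 * y <= x * y" using h(5,6) by (intro mult_right_mono) simp_all
   ultimately show False using h(4,6) uw by simp
  qed
  moreover have "(e, f) ~= (D, 1)"
  proof
   assume "(e, f) = (D, 1)"
   hence "(2 * y)^2 - D * (2 * x)^2 = - 4" using h(2,3) by (simp add: sq_simps)
   thus False using norm_minus_4 by blast
  qed
  ultimately have "(e, f) : {(int p1, int p2), (int p2, int p1)}" using h(1) by blast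
  thus ?thesis using h(2-6) False uw by (intro exI[of _ e] exI[of _ f] exI[of _ x] exI[of _ y]) simp
 qed
qed

lemma unit_halves:
 assumes "is_form r b"
 shows "(et - b * eu) div 2 + (et + b * eu) div 2 = et" "2 * ((et - b * eu) div 2) = et - b * eu"
proof -
 have "even (et + eu)" using unit_parity[of et eu 1] fund(3) by simp
 hence "even (et - b * eu)" "even (et + b * eu)" using form_odd[OF assms] by simp_all
 then obtain m n where "et - b * eu = 2 * m" "et + b * eu = 2 * n" by (elim evenE)
 thus "(et - b * eu) div 2 + (et + b * eu) div 2 = et" "2 * ((et - b * eu) div 2) = et - b * eu" by simp_all
qed

section \<open>Comparison of a class with the principal class\<close>

lemma J_square_unit: "odd r ==> r > 0 ==> coprime z r ==> J (x * (z * z)) r = J x r"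
 using J_unit[of r z] by (auto simp: J_mult)

text \<open>chi = 1 says that r is a square modulo p1, and reciprocity gives the symbol of p1 modulo
  r. Since r divides b^2 - D, the product p1 p2 is a square modulo r, so p2 has the same
  symbol.\<close>

lemma J_prime_form:
 assumes f: "is_form r b" and r: "odd r" "coprime r D" and ch: "chi r b = 1" and e: "e : {int p1, int p2}"
 shows "J e r = (if r mod 4 = 3 then -1 else 1)"
proof -
 have r0: "r > 0" by (rule form_pos[OF f])
 have cp: "coprime r (int p1)" "coprime r (int p2)" using r(2) by (simp_all add: D_eq)
 have o1: "odd (int p1)" "int p1 > 0" "int p1 mod 4 = 3" using p1(2) p_gt by presburger+
 have "~ int p1 dvd r"
 proof
  assume "int p1 dvd r"
  hence "int p1 dvd 1" using cp(1) by (metis coprime_absorb_right dvd_refl coprime_common_divisor)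
  thus False using p_gt(1) by simp
 qed
 hence J1: "J r (int p1) = 1" using ch jacobi_prime[OF p1(1), of r] by (simp add: chi_def)
 have Jp1: "J (int p1) r = (if r mod 4 = 3 then -1 else 1)"
  using J_reciprocity[OF o1(1) r(1) o1(2) r0] cp(1) o1(3) J1 by (simp add: coprime_commute)
 have "r dvd b * b - D" using form_eq[OF f] by (simp add: p2sq)
 hence "J (b * b) r = J D r" by (rule J_cong[OF r0])
 moreover have "coprime b r"
 proof (rule coprimeI)
  fix x assume x: "x dvd b" "x dvd r"
  hence "x dvd b * b - (b * b - D)" using \<open>r dvd b * b - D\<close> by (meson dvd_diff dvd_mult dvd_trans)
  hence "x dvd D" by simp
  thus "is_unit x" using x(2) r(2) coprime_common_divisor by blast
 qed
 hence "J (1 * (b * b)) r = J 1 r" by (rule J_square_unit[OF r(1) r0])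
 moreover have "J 1 r = 1" using jacobi_one_left[of "nat r"] r(1) r0 by (simp add: even_nat_iff)
 ultimately have "J (int p1) r * J (int p2) r = 1" using J_mult[OF r(1) r0, of "int p1" "int p2"] by (simp add: D_eq)
 hence "J (int p2) r = J (int p1) r" using Jp1 by (auto split: if_splits)
 thus ?thesis using e Jp1 by auto
qed

text \<open>a d = 1 modulo r and a + d = et give a (et + 2) = (a + 1)^2 modulo r. By
  \<open>unit_structure\<close> et + 2 is p1 or p2 times a square, so the symbol of a is the one
  known from \<open>J_prime_form\<close>.\<close>

lemma J_unit_entry:
 assumes f: "is_form r b" and r: "odd r" "coprime r (D * eu)" and ch: "chi r b = 1"
 shows "J ((et - b * eu) div 2) r = (if r mod 4 = 3 then -1 else 1)"
proof -
 have r0: "r > 0" by (rule form_pos[OF f])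
 have cp: "coprime r D" "coprime r eu" using r(2) by simp_all
 define a d where "a = (et - b * eu) div 2" and "d = (et + b * eu) div 2"
 have ad: "a * d - (- cc r b * eu) * (r * eu) = 1" using unit_det[OF f] by (simp add: a_def d_def)
 have s: "a + d = et" unfolding a_def d_def by (rule unit_halves(1)[OF f])
 have J2: "J (et + 2) r = (if r mod 4 = 3 then -1 else 1)"
 proof -
  obtain e f' x y where h: "(e, f') : {(int p1, int p2), (int p2, int p1)}"
   "(odd eu & et + 2 = e * x^2 & et - 2 = f' * y^2 & eu = x * y) \<or>
    (even eu & et + 2 = 4 * (e * x^2) & et - 2 = 4 * (f' * y^2) & eu = 4 * (x * y))" using unit_structure by blast
  have e: "e : {int p1, int p2}" using h(1) by auto
  have x: "coprime x r" using h(2) cp(2) by (auto simp: coprime_commute)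
  have "coprime 2 r" using r(1) by simp
  hence x2: "coprime (2 * x) r" using x by simp
  have "et + 2 = e * (x * x) \<or> et + 2 = e * ((2 * x) * (2 * x))" using h(2) by (auto simp: p2sq)
  hence "J (et + 2) r = J e r" using J_square_unit[OF r(1) r0 x] J_square_unit[OF r(1) r0 x2] by metis
  thus ?thesis using J_prime_form[OF f r(1) cp(1) ch e] by simp
 qed
 have "(et + 2) * (et - 2) = D * (eu * eu)" using fund(3) by (simp add: sq_simps)
 moreover have "coprime (D * (eu * eu)) r" using cp by (simp add: coprime_commute)
 ultimately have c2: "coprime (et + 2) r" by (metis coprime_mult_left_iff)
 have ca: "coprime a r"
 proof (rule coprimeI)
  fix x assume "x dvd a" "x dvd r"
  hence "x dvd a * d - (- cc r b * eu) * (r * eu)" by simp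
  thus "is_unit x" unfolding ad .
 qed
 have e: "a * (et + 2) - (a + 1) * (a + 1) = r * (- cc r b * eu * eu)"
  using ad unfolding s[symmetric] by (simp add: alg)
 have "coprime (a + 1) r"
 proof (rule coprimeI)
  fix x assume x: "x dvd a + 1" "x dvd r"
  hence "x dvd r * (- cc r b * eu * eu) + (a + 1) * (a + 1)" by simp
  hence "x dvd a * (et + 2)" unfolding e[symmetric] by simp
  moreover have "coprime (a * (et + 2)) r" using ca c2 by simp
  ultimately show "is_unit x" using x(2) coprime_common_divisor by blast
 qed
 hence "J (1 * ((a + 1) * (a + 1))) r = J 1 r" by (rule J_square_unit[OF r(1) r0])
 moreover have "J 1 r = 1" using jacobi_one_left[of "nat r"] r(1) r0 by (simp add: even_nat_iff)
 moreover have "J (a * (et + 2)) r = J ((a + 1) * (a + 1)) r" by (rule J_cong[OF r0]) (simp only: e dvd_triv_left)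
 ultimately have "J a r * J (et + 2) r = 1" using J_mult[OF r(1) r0] by simp
 thus ?thesis unfolding J2 a_def[symmetric] by (auto split: if_splits)
qed

text \<open>The unit matrices of (r, b) and (1, b) have the same diagonal; the factor r moves from
  the lower left to the upper right entry. The symbol changes by the symbol of a modulo r, which is
  r modulo 4 by \<open>J_unit_entry\<close>. The rest comes from et = 1 mod 4 if eu is odd, and from
  4 | eu and a = 3 mod 4 if eu is even.\<close>

lemma psi8_compare:
 assumes f: "is_form r b" and b: "b <= 0" and r: "odd r" "coprime r (D * eu)" and ch: "chi r b = 1"
  and ad: "a = (et - b * eu) div 2" "d = (et + b * eu) div 2" and be: "bet = - cc r b * eu"
 shows "8 dvd psi8 a bet (r * eu) d - psi8 a (r * bet) eu d"
proof -
 have r0: "r > 0" by (rule form_pos[OF f])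
 have Ja: "J a r = (if r mod 4 = 3 then -1 else 1)" unfolding ad by (rule J_unit_entry[OF f r ch])
 obtain \<delta> where \<delta>: "J a r = \<delta>" "4 dvd r * \<delta> - 1" "\<delta> * \<delta> = 1"
 proof -
  obtain k where "r = 4 * k + 1 \<or> r = 4 * k + 3" using mod_4_cases(2)[OF r(1)] by blast
  thus ?thesis
  proof
   assume k: "r = 4 * k + 1"
   hence "r mod 4 = 1" by presburger
   thus ?thesis using Ja k by (intro that[of 1]) simp_all
  next
   assume k: "r = 4 * k + 3"
   hence "r mod 4 = 3" by presburger
   moreover have "r * (-1) - 1 = 4 * (- k - 1)" using k by simp
   hence "4 dvd r * (-1) - 1" by (rule dvdI)
   ultimately show ?thesis using Ja by (intro that[of "-1"]) simp_all
  qed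
 qed
 have det: "a * d - bet * (r * eu) = 1" using unit_det[OF f] by (simp add: ad be)
 have s: "a + d = et" and a2: "2 * a = et - b * eu" unfolding ad by (rule unit_halves[OF f])+
 have "b * eu <= 0" using b fund(2) by (simp add: mult_nonpos_nonneg)
 hence a0: "a > 0" using a2 fund(1) by linarith
 obtain e f' x y where h: "(e, f') : {(int p1, int p2), (int p2, int p1)}"
   "(odd eu & et + 2 = e * x^2 & et - 2 = f' * y^2 & eu = x * y) \<or>
    (even eu & et + 2 = 4 * (e * x^2) & et - 2 = 4 * (f' * y^2) & eu = 4 * (x * y))" using unit_structure by blast
 have "int p1 mod 4 = 3" "int p2 mod 4 = 3" using p1(2) p2(2) by presburger+
 hence "e mod 4 = 3" "f' mod 4 = 3" using h(1) by auto
 hence "EX k l. e = 4 * k + 3 & f' = 4 * l + 3" by presburger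
 then obtain k l where kl: "e = 4 * k + 3" "f' = 4 * l + 3" by blast
 have cau: "coprime a (r * eu)"
 proof (rule coprimeI)
  fix x assume "x dvd a" "x dvd r * eu"
  hence "x dvd a * d - bet * (r * eu)" by simp
  thus "is_unit x" unfolding det .
 qed
 show ?thesis
 proof (cases "odd eu")
  case True
  hence hx: "et + 2 = e * x^2" "odd x" using h(2) by auto
  obtain z where z: "x = 2 * z + 1" using hx(2) by (rule oddE)
  have "et - 1 = 4 * (k * (4 * z * z + 4 * z + 1) + 3 * (z * z + z))"
   using hx(1) unfolding kl z by (simp add: sq_simps)
  hence et4: "4 dvd et - 1" by (rule dvdI)
  define j where "j = J a eu"
  have "J a (r * eu) = \<delta> * j" using J_mult_right[OF r0 fund(2)] \<delta>(1) by (simp add: j_def)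
  hence "psi8 a bet (r * eu) d - psi8 a (r * bet) eu d = eu * ((r - 1) * (a + d - 1)) + eu * ((2 * j) * (r * \<delta> - 1))"
   using True r(1) by (simp add: psi8_def psi8_odd_def j_def alg)
  moreover have "8 dvd (r - 1) * (a + d - 1)" unfolding s using et4 r(1) by (intro dvd_8_mult) simp_all
  moreover have "8 dvd (2 * j) * (r * \<delta> - 1)" using \<delta>(2) by (intro dvd_8_mult) simp_all
  ultimately show ?thesis by (simp only: dvd_add dvd_mult)
 next
  case False
  hence hx: "et + 2 = 4 * (e * x^2)" "et - 2 = 4 * (f' * y^2)" "eu = 4 * (x * y)" using h(2) by auto
  have exy: "e * (x * x) - f' * (y * y) = 1" using hx(1,2) by (simp add: p2sq)
  \<comment> \<open>e and f' are 3 mod 4, so e x^2 - f' y^2 = 1 is impossible modulo 4 with x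
    odd.\<close>
  have "even x"
  proof (rule ccontr)
   assume "odd x"
   then obtain z where z: "x = 2 * z + 1" by (auto elim: oddE)
   show False
   proof (cases "even y")
    case True
    then obtain w where w: "y = 2 * w" by (rule evenE)
    have "4 * (k * (x * x) + 3 * (z * z + z) - f' * (w * w)) = -2" using exy unfolding kl(1) w by (simp add: z alg)
    thus False by presburger
   next
    case False
    then obtain w where w: "y = 2 * w + 1" by (rule oddE)
    have "4 * (k * (x * x) + 3 * (z * z + z) - l * (y * y) - 3 * (w * w + w)) = 1" using exy unfolding kl by (simp add: z w alg)
    thus False by presburger
   qed
  qed
  then obtain z where z: "x = 2 * z" by (rule evenE)
  have "a = 4 * (2 * e * (z * z) - b * (z * y) - 1) + 3" using a2 hx(1,3) unfolding z by (simp add: sq_simps)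
  hence a3: "a mod 4 = 3" by presburger
  have u4: "4 dvd eu" using hx(3) by simp
  hence ru: "r * eu mod 4 = 0" "eu mod 4 = 0" "even eu" by (auto simp: mod_eq_0_iff_dvd)
  have m4: "(r * eu + a) mod 4 = 3" "(eu + a) mod 4 = 3" using mod_4_add(1)[OF ru(1)] mod_4_add(1)[OF ru(2)] a3 by simp_all
  have oa: "odd a" "odd (r * eu + a)" "odd (eu + a)" using a3 ru(3) by (auto; presburger)+
  have "r * eu > 0" using r0 fund(2) by simp
  hence pos: "r * eu + a > 0" "eu + a > 0" using a0 fund(2) by simp_all
  have cu: "coprime a eu" "coprime a r" using cau by simp_all
  have "J a (r * eu + a) = - J (r * eu + a) a"
   using J_reciprocity[OF oa(1,2) a0 pos(1)] coprime_add(1)[OF cau, of 1] m4(1) a3 by simp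
  also have "J (r * eu + a) a = J (r * eu) a" by (rule J_cong[OF a0]) simp
  also have "J (r * eu) a = J r a * J eu a" by (rule J_mult[OF oa(1) a0])
  also have "J r a = 1"
  proof -
   have "J r a = (if r mod 4 = 3 then - J a r else J a r)"
    using J_reciprocity[OF r(1) oa(1) r0 a0] cu(2) a3 by (simp add: coprime_commute)
   thus ?thesis using Ja by simp
  qed
  also have "J eu a = J (eu + a) a" by (rule J_cong[OF a0]) simp
  also have "- (1 * J (eu + a) a) = J a (eu + a)"
   using J_reciprocity[OF oa(1,3) a0 pos(2)] coprime_add(1)[OF cu(1), of 1] m4(2) a3 by simp
  finally have JJ: "J a (r * eu + a) = J a (eu + a)" .
  have "psi8 a bet (r * eu) d - psi8 a (r * bet) eu d
   = (r - 1) * ((a + d - 1 + 2 * J a (eu + a)) * eu - a * bet)"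
   using ru(3) JJ by (simp add: psi8_def psi8_odd_def alg)
  moreover have "4 dvd bet" using u4 by (simp add: be)
  hence "4 dvd (a + d - 1 + 2 * J a (eu + a)) * eu - a * bet" using u4 by (intro dvd_diff dvd_mult)
  hence "8 dvd (r - 1) * ((a + d - 1 + 2 * J a (eu + a)) * eu - a * bet)" using r(1) by (intro dvd_8_mult) simp_all
  ultimately show ?thesis by simp
 qed
qed

text \<open>If 3 divides eu, both terms vanish modulo 3. If not, D = et^2 - 4 modulo 3, so 3 divides
  the trace et, because it does not divide D; moreover (r eu)^2 = 1 modulo 3.\<close>

lemma psi3_zero:
 assumes f: "is_form r b" and r: "~ 3 dvd r" and D3: "~ 3 dvd D"
  and ad: "a = (et - b * eu) div 2" "d = (et + b * eu) div 2" and be: "bet = - cc r b * eu"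
 shows "3 dvd psi3 a bet (r * eu) d"
proof (cases "3 dvd eu")
 case True
 thus ?thesis by (simp add: psi3_def be)
next
 case False
 have pr: "prime (3::int)" by simp
 have s: "a + d = et" unfolding ad by (rule unit_halves(1)[OF f])
 have u1: "3 dvd eu^2 - 1" by (rule mod_3_square[OF False])
 have "3 dvd et"
 proof (rule ccontr)
  assume "~ 3 dvd et"
  hence "3 dvd et^2 - 1" by (rule mod_3_square)
  moreover have "D = (et^2 - 1) - 3 - D * (eu^2 - 1)" using fund(3) by (simp add: alg)
  moreover have "3 dvd (et^2 - 1) - 3 - D * (eu^2 - 1)"
   by (rule dvd_diff[OF dvd_diff[OF calculation(1) dvd_refl] dvd_mult[OF u1]])
  ultimately show False using D3 by simp
 qed
 moreover have "~ 3 dvd r * eu" using r False prime_dvd_mult_iff[OF pr] by simp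
 hence "3 dvd (r * eu)^2 - 1" by (rule mod_3_square)
 ultimately show ?thesis unfolding psi3_def s by (intro dvd_diff[OF dvd_mult2 dvd_mult])
qed

text \<open>b <= 0 makes the first column positive. A high power of \<open>T\<close> on the right
  makes the second column nonnegative, and its exponent j is subtracted again in \<Psi>; being a
  multiple of 24 it is invisible modulo 8 and modulo 3.\<close>

lemma class_psi_mod:
 assumes c: "c : Cl" "(r, b) : c" and b: "b <= 0" and ch: "chi r b = 1"
  and ad: "a = (et - b * eu) div 2" "d = (et + b * eu) div 2" and be: "bet = - cc r b * eu"
 shows "8 dvd psi8 a bet (r * eu) d - class_psi c" "3 dvd psi3 a bet (r * eu) d - class_psi c"
proof -
 have f: "is_form r b" by (rule class_mem(1)[OF c])
 have r0: "r > 0" by (rule form_pos[OF f])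
 have det: "a * d - bet * (r * eu) = 1" using unit_det[OF f] by (simp add: ad be)
 have "b * eu <= 0" using b fund(2) by (simp add: mult_nonpos_nonneg)
 hence "et - b * eu >= 1" using fund(1) by linarith
 hence a0: "a >= 0" unfolding ad by linarith
 have ru: "r * eu >= 1" using mult_mono[of 1 r 1 eu] r0 fund(2) by simp
 have "a ~= 0"
 proof
  assume "a = 0"
  have "2 * a = et - b * eu" unfolding ad by (rule unit_halves(2)[OF f])
  thus False using \<open>a = 0\<close> \<open>et - b * eu >= 1\<close> by simp
 qed
 hence a1: "a >= 1" using a0 by simp
 define j where "j = 24 * (\<bar>bet\<bar> + \<bar>d\<bar>)"
 have j: "j >= \<bar>bet\<bar>" "j >= \<bar>d\<bar>" "j >= 0" "8 dvd j" "3 dvd j" by (simp_all add: j_def)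
 have ja: "j * 1 <= j * a" "j * 1 <= j * (r * eu)" using j(3) a1 ru by (intro mult_left_mono; simp)+
 have "EX W. word_mat W = (a, bet + j * a, r * eu, d + j * (r * eu))"
  by (rule word_exists) (use a0 ru j ja det in \<open>auto simp: alg\<close>)
 then obtain W where W: "word_mat W = (a, bet + j * a, r * eu, d + j * (r * eu))" by blast
 hence "unit_word r b j W" by (simp add: unit_word_def ad be)
 from class_psi_word[OF c this] have p: "class_psi c = word_psi W - j" using ch by simp
 have "8 dvd (psi8 a (bet + j * a) (r * eu) (d + j * (r * eu)) - word_psi W) - (psi8 a (bet + j * a) (r * eu) (d + j * (r * eu)) - psi8 a bet (r * eu) d) + j"
  by (intro dvd_add dvd_diff word_psi_mod_8[OF W] psi8_shift j)
 thus "8 dvd psi8 a bet (r * eu) d - class_psi c" unfolding p by (simp add: alg)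
 have "3 dvd (psi3 a (bet + j * a) (r * eu) (d + j * (r * eu)) - word_psi W) - (psi3 a (bet + j * a) (r * eu) (d + j * (r * eu)) - psi3 a bet (r * eu) d) + j"
  by (intro dvd_add dvd_diff word_psi_mod_3[OF W] psi3_shift j)
 thus "3 dvd psi3 a bet (r * eu) d - class_psi c" unfolding p by (simp add: alg)
qed

text \<open>Modulo a prime q of N the value is a x^2, c y^2 or b x y: q divides y only, x only or
  neither of them, according to whether q does not divide a, divides a but not c, or divides both.
  In the last case q does not divide b by primitivity.\<close>

lemma coprime_value:
 assumes f: "is_form a b" and N: "N > 0"
 shows "EX x y. coprime (qf a b x y) N & qf a b x y > 0"
proof -
 have a0: "a > 0" by (rule form_pos[OF f])
 define A where "A = {q : prime_factors N. ~ q dvd a}"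
 define B where "B = {q : prime_factors N. q dvd a & ~ q dvd cc a b}"
 have fin: "finite A" "finite B" by (simp_all add: A_def B_def)
 define x0 y where "x0 = \<Prod>B" and "y = \<Prod>A"
 have pr: "prime q" if "q : A \<union> B" for q using that by (auto simp: A_def B_def)
 have dv: "q dvd \<Prod>S \<longleftrightarrow> q : S" if "prime q" "finite S" "S \<subseteq> A \<union> B" for q S
 proof -
  have "q dvd \<Prod>S \<longleftrightarrow> (\<exists>p\<in>S. q dvd p)" using prime_dvd_prod_iff[OF that(2,1), of "%x. x"] by simp
  also have "... \<longleftrightarrow> q : S" using that(1,3) pr primes_dvd_imp_eq by (metis dvd_refl subsetD)
  finally show ?thesis .
 qed
 have "x0 > 0" unfolding x0_def by (rule prod_pos) (use pr prime_gt_0_int in auto)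
 hence x1: "x0 >= 1" by simp
 \<comment> \<open>\<open>M\<close> bounds the terms with b and c. Adding N M to \<open>x0\<close>
   makes the value positive and leaves divisibility by the primes of N unchanged.\<close>
 define M where "M = \<bar>b * y\<bar> + \<bar>cc a b * y^2\<bar>"
 define x where "x = x0 + N * M"
 have "1 * M <= N * M" using N by (intro mult_right_mono) (simp_all add: M_def)
 hence xM: "x >= M + 1" using x1 by (simp add: x_def)
 have pos: "qf a b x y > 0"
 proof -
  have x0': "x >= 1" using xM by (simp add: M_def)
  have "1 * (x * x) <= a * (x * x)" using a0 by (intro mult_right_mono) simp_all
  moreover have "x * (1 + \<bar>cc a b * y^2\<bar>) <= x * (x - \<bar>b * y\<bar>)" using xM x0' by (intro mult_left_mono) (simp_all add: M_def)
  moreover have "1 * \<bar>cc a b * y^2\<bar> <= x * \<bar>cc a b * y^2\<bar>" using x0' by (intro mult_right_mono) simp_all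
  moreover have "x * \<bar>b * y\<bar> = \<bar>b * x * y\<bar>" using x0' by (simp add: abs_mult)
  ultimately have "a * (x * x) - \<bar>b * x * y\<bar> - \<bar>cc a b * y^2\<bar> >= x" by (simp add: alg)
  moreover have "- \<bar>b * x * y\<bar> <= b * x * y" "- \<bar>cc a b * y^2\<bar> <= cc a b * y^2" by linarith+
  ultimately show ?thesis using x0' unfolding qf_def p2sq[of x] by linarith
 qed
 have nd: "~ q dvd qf a b x y" if q: "prime q" "q dvd N" for q
 proof
  assume d: "q dvd qf a b x y"
  have qN: "q : prime_factors N" using q N by (simp add: in_prime_factors_iff)
  have qx: "q dvd x \<longleftrightarrow> q : B" using dv[OF q(1) fin(2)] q(2) by (simp add: x_def x0_def dvd_add_left_iff)
  have qy: "q dvd y \<longleftrightarrow> q : A" using dv[OF q(1) fin(1)] by (simp add: y_def)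
  consider "~ q dvd a" | "q dvd a" "~ q dvd cc a b" | "q dvd a" "q dvd cc a b" by blast
  thus False
  proof cases
   case 1
   hence "q dvd y" "~ q dvd x" using qx qy qN by (auto simp: A_def B_def)
   hence "q dvd b * x * y + cc a b * y^2" by (simp add: p2sq)
   hence "q dvd qf a b x y - (b * x * y + cc a b * y^2)" using d by (rule dvd_diff[rotated])
   hence "q dvd a * (x * x)" by (simp add: qf_def p2sq)
   thus False using 1 \<open>~ q dvd x\<close> q(1) by (simp add: prime_dvd_mult_iff)
  next
   case 2
   hence "~ q dvd y" "q dvd x" using qx qy qN by (auto simp: A_def B_def)
   hence "q dvd a * x^2 + b * x * y" by (simp add: p2sq)
   hence "q dvd qf a b x y - (a * x^2 + b * x * y)" using d by (rule dvd_diff[rotated])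
   hence "q dvd cc a b * (y * y)" by (simp add: qf_def p2sq)
   thus False using 2 \<open>~ q dvd y\<close> q(1) by (simp add: prime_dvd_mult_iff)
  next
   case 3
   hence n: "~ q dvd y" "~ q dvd x" using qx qy qN by (auto simp: A_def B_def)
   have "q dvd a * x^2 + cc a b * y^2" using 3 by simp
   hence "q dvd qf a b x y - (a * x^2 + cc a b * y^2)" using d by (rule dvd_diff[rotated])
   hence "q dvd b * (x * y)" by (simp add: qf_def mult.assoc)
   hence "q dvd b" using n q(1) by (simp add: prime_dvd_mult_iff)
   moreover obtain i j k where "i * a + j * b + k * cc a b = 1" using form_coprime[OF f] by blast
   ultimately have "q dvd 1" using 3 by (metis dvd_add dvd_mult)
   thus False using q(1) not_prime_unit by blast
  qed
 qed
 have "coprime (qf a b x y) N"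
 proof (rule coprimeI)
  fix z assume z: "z dvd qf a b x y" "z dvd N"
  show "is_unit z"
  proof (rule ccontr)
   assume "~ is_unit z"
   moreover have "z ~= 0" using z(2) N by auto
   ultimately obtain q where "q dvd z" "prime q" using prime_divisor_exists by blast
   thus False using nd z dvd_trans by blast
  qed
 qed
 thus ?thesis using pos by blast
qed

text \<open>One of a form with b^2 < D and its swap has chi = 1. A positive value of it prime to N
  equals k^2 r for a form (r, b') in the class with the same chi, and subtracting 2 r makes the
  middle coefficient negative.\<close>

lemma class_representative:
 assumes c: "c : Cl" and N: "N > 0"
 shows "EX r b. (r, b) : c & b <= 0 & coprime r N & chi r b = 1"
proof -
 obtain a0 b0 where ab0: "(a0, b0) : c" "b0^2 < D" using class_reduced[OF c] by (elim exE conjE)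
 have f0: "is_form a0 b0" by (rule class_mem(1)[OF c ab0(1)])
 obtain W where W: "unit_word a0 b0 0 W" using unit_word_exists[OF f0 ab0(2)] by blast
 note s = swap_form[OF c ab0 W]
 obtain a b where ab: "(a, b) : c" "chi a b = 1"
 proof (cases "chi a0 b0 = 1")
  case True
  thus ?thesis using ab0(1) by (intro that)
 next
  case False
  hence "chi (- cc a0 b0) (- b0) = 1" using s(2) chi_values[OF f0] by auto
  thus ?thesis using s(1) by (intro that)
 qed
 have f: "is_form a b" by (rule class_mem(1)[OF c ab(1)])
 \<comment> \<open>With p1 included, r is prime to p1, so \<open>chi\<close> depends on r alone and
   survives the shift of b'.\<close>
 have N': "N * int p1 > 0" using N p_gt by simp
 obtain x y where xy: "coprime (qf a b x y) (N * int p1)" "qf a b x y > 0" using coprime_value[OF f N'] by (elim exE conjE)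
 have nz: "(x, y) ~= (0, 0)" using xy(2) by (auto simp: qf_def)
 obtain k r b' where T: "Theta a b x y = (k, r, b')" by (metis prod_cases3)
 note P = Theta_props[OF f nz T]
 have "k^2 * r = qf a b x y" using P(6) xy(2) by simp
 hence "coprime (k^2 * r) (N * int p1)" using xy(1) by simp
 hence cp: "coprime r N" "coprime r (int p1)" by simp_all
 have rc: "(r, b') : c" using P(5) class_mem(2)[OF c ab(1), of r b'] by simp
 have "[b' = b' - 2 * r] (mod 2 * r)" by (simp add: cong_iff_dvd_diff)
 hence "((r, b'), (r, b' - 2 * r)) : form_rel" by (rule form_rel_shift[OF P(2)])
 hence rc': "(r, b' - 2 * r) : c" using class_mem(2)[OF c rc, of r "b' - 2 * r"] by simp
 have nd: "~ int p1 dvd r"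
 proof
  assume "int p1 dvd r"
  hence "is_unit (int p1)" using cp(2) coprime_common_divisor[of r "int p1" "int p1"] by simp
  thus False using p_gt(1) by simp
 qed
 have "chi r b' = 1" using chi_Theta[OF f nz T] ab(2) xy(2) by simp
 hence "chi r (b' - 2 * r) = 1" using nd by (simp add: chi_def)
 thus ?thesis using rc' cp(1) P(4) by (intro exI[of _ r] exI[of _ "b' - 2 * r"]) simp
qed

definition principal_class :: "(int \<times> int) set" where "principal_class = form_rel `` {(1, 1)}"

lemma principal_class: "principal_class : Cl" "odd b ==> (1, b) : principal_class"
proof -
 show "principal_class : Cl"
  unfolding principal_class_def by (rule quotientI) (simp add: forms_def principal_form)
 show "odd b ==> (1, b) : principal_class"
  unfolding principal_class_def using form_rel_shift[OF principal_form(1), of b] by (auto simp: cong_iff_dvd_diff)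
qed

text \<open>The form (r, b) is compared with (1, b), which lies in the principal class because b is
  odd; 6 D eu collects the conditions on r in \<open>psi8_compare\<close> and
  \<open>psi3_zero\<close>.\<close>

theorem class_psi_cong:
 assumes c: "c : Cl"
 shows "8 dvd class_psi c - class_psi principal_class" and "~ 3 dvd D ==> 3 dvd class_psi c"
proof -
 have "6 * D * eu > 0" using D_pos fund(2) by simp
 then obtain r b where rb: "(r, b) : c" "b <= 0" "coprime r (6 * D * eu)" "chi r b = 1"
  using class_representative[OF c, of "6 * D * eu"] by blast
 have f: "is_form r b" by (rule class_mem(1)[OF c rb(1)])
 have cp: "coprime r (2 * 3)" "coprime r D" "coprime r eu" using rb(3) by simp_all
 hence "coprime r 2" "coprime r 3" by (simp_all only: coprime_mult_right_iff)
 hence r: "odd r" "~ 3 dvd r" by (auto dest: coprime_common_divisor[of r 3 3])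
 define a d bet where "a = (et - b * eu) div 2" and "d = (et + b * eu) div 2" and "bet = - cc r b * eu"
 have ob: "odd b" by (rule form_odd[OF f])
 note p = principal_class(1) principal_class(2)[OF ob]
 have f1: "is_form 1 b" by (rule class_mem(1)[OF p])
 have "4 * cc 1 b = 4 * (r * cc r b)" using form_eq[OF f] form_eq[OF f1] by simp
 hence be: "r * bet = - cc 1 b * eu" by (simp add: bet_def)
 have ch1: "chi 1 b = 1" using p_gt(1) Legendre_1[OF p1(1)] by (simp add: chi_def)
 note h1 = class_psi_mod[OF c rb(1,2,4) a_def d_def bet_def]
 note h2 = class_psi_mod[OF p rb(2) ch1 a_def d_def be]
 have "coprime r (D * eu)" using cp by simp
 note h3 = psi8_compare[OF f rb(2) r(1) this rb(4) a_def d_def bet_def]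
 have "8 dvd (psi8 a (r * bet) (1 * eu) d - class_psi principal_class) - (psi8 a bet (r * eu) d - class_psi c) + (psi8 a bet (r * eu) d - psi8 a (r * bet) eu d)"
  by (intro dvd_add dvd_diff h1(1) h2(1) h3)
 thus "8 dvd class_psi c - class_psi principal_class" by simp
 assume D3: "~ 3 dvd D"
 have "3 dvd psi3 a bet (r * eu) d - (psi3 a bet (r * eu) d - class_psi c)"
  by (intro dvd_diff h1(2) psi3_zero[OF f r(2) D3 a_def d_def bet_def])
 thus "3 dvd class_psi c" by simp
qed

end

subsection \<open>Conjugation of ideal classes\<close>

context quad_disc
begin

lemma cj_0: "cj 0 = 0" using cj_emb[of 0 0] by (simp add: emb_def)

lemma cj_1: "cj 1 = 1" using cj_emb[of 1 0] by (simp add: emb_def)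

lemma cj_of_int: "cj (of_int n) = of_int n" by (simp add: of_int_emb)

lemma cj_nonzero: "z : K ==> z ~= 0 ==> cj z ~= 0"
 using cj_cj[of z] cj_0 by metis

lemma cj_scale_lat:
 assumes "alp : K"
 shows "cj ` scale alp (lat a b) = scale (cj alp) (lat a (- b))"
proof -
 have "cj ` (%z. alp * z) ` lat a b = (%z. cj alp * z) ` cj ` lat a b"
  unfolding image_image by (rule image_cong[OF refl]) (simp add: cj_mult assms lat_K)
 thus ?thesis by (simp add: scale_def cj_lat)
qed

lemma form_rel_conj:
 assumes "((a, b), (a', b')) : form_rel"
 shows "((a, - b), (a', - b')) : form_rel"
proof -
 obtain alp where h: "is_form a b" "is_form a' b'" "alp : K" "alp ~= 0" "lat a' b' = scale alp (lat a b)"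
  using assms unfolding form_rel_iff by blast
 have "lat a' (- b') = scale (cj alp) (lat a (- b))"
  using cj_scale_lat[OF h(3), of a b] cj_lat[of a' b'] h(5) by simp
 thus ?thesis unfolding form_rel_iff using is_form_uminus[OF h(1)] is_form_uminus[OF h(2)] K_cj[OF h(3)] cj_nonzero[OF h(3,4)] by blast
qed

definition conj_class :: "(int \<times> int) set => (int \<times> int) set" where
 "conj_class c = (%(a, b). (a, - b)) ` c"

lemma conj_class_mem: "(a, b) : conj_class c \<longleftrightarrow> (a, - b) : c"
proof
 assume "(a, - b) : c"
 hence "(%(a, b). (a, - b)) (a, - b) : conj_class c" unfolding conj_class_def by (rule imageI)
 thus "(a, b) : conj_class c" by simp
qed (auto simp: conj_class_def)

lemma conj_conj_class: "conj_class (conj_class c) = c"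
 by (auto simp: conj_class_def image_image case_prod_beta')

lemma conj_class_in:
 assumes c: "c : Cl"
 shows "conj_class c : Cl"
proof -
 obtain a b where ab: "(a, b) : c" using class_nonempty[OF c] by blast
 have "(a', b') : conj_class c \<longleftrightarrow> ((a, - b), (a', b')) : form_rel" for a' b'
  unfolding conj_class_mem class_mem(2)[OF c ab, symmetric]
  using form_rel_conj[of a b a' "- b'"] form_rel_conj[of a "- b" a' b'] by auto
 hence "conj_class c = form_rel `` {(a, - b)}" by auto
 thus ?thesis using is_form_uminus[OF class_mem(1)[OF c ab]] by (auto simp: forms_def intro!: quotientI)
qed

lemma K_multiple_in_R:
 assumes "z : K"
 shows "EX N. N > 0 & of_int N * z : R"
proof -
 obtain x y where z: "z = emb x y" using assms by (auto simp: K_iff)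
 obtain p q where pq: "quotient_of x = (p, q)" by (cases "quotient_of x")
 obtain r s where rs: "quotient_of y = (r, s)" by (cases "quotient_of y")
 have x: "x = of_int p / of_int q" "q > 0" using quotient_of_div[OF pq] quotient_of_denom_pos[OF pq] by simp_all
 have y: "y = of_int r / of_int s" "s > 0" using quotient_of_div[OF rs] quotient_of_denom_pos[OF rs] by simp_all
 have "of_int (q * s) * z = emb (of_int (2 * (p * s)) / 2) (of_int (2 * (r * q)) / 2)"
  using x(2) y(2) unfolding z of_int_emb[of "q * s"] emb_mult by (simp add: x(1) y(1))
 moreover have "even (2 * (p * s) + 2 * (r * q))" by simp
 ultimately have "of_int (q * s) * z : R" unfolding R_iff by blast
 thus ?thesis using x(2) y(2) by (intro exI[of _ "q * s"]) simp
qed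

text \<open>As alp times its conjugate is 1, the conjugate of 1 + alp multiplied by alp is 1 + alp
  again; for alp = -1, where this vanishes, sqrt D does it.\<close>

lemma hilbert_90:
 assumes a: "alp : K" "nm alp = 1"
 shows "\<exists>bet\<in>K. bet ~= 0 & cj bet * alp = bet"
proof (cases "alp = - 1")
 case True
 have "cj (emb 0 1) * alp = emb 0 1" by (simp add: True emb_minus)
 thus ?thesis by (intro bexI[of _ "emb 0 1"]) simp_all
next
 case False
 have n: "alp * cj alp = 1" using mult_cj[OF a(1)] a(2) by simp
 have "cj (1 + alp) * alp = alp + alp * cj alp" using cj_add[OF one_K a(1)] by (simp add: cj_1 alg)
 hence "cj (1 + alp) * alp = 1 + alp" unfolding n by simp
 moreover have "1 + alp ~= 0" using False by (simp add: add_eq_0_iff)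
 moreover have "1 + alp : K"
 proof -
  obtain x y where x: "alp = emb x y" using a(1) unfolding K_iff by blast
  have "1 + alp = emb (1 + x) (0 + y)" unfolding x one_emb emb_add ..
  thus ?thesis by simp
 qed
 ultimately show ?thesis by blast
qed

text \<open>If the conjugate of \<open>I\<close> is \<open>\<alpha> I\<close> with \<open>\<alpha>\<close> of norm 1, a multiple of \<open>I\<close> equals its conjugate.\<close>

lemma ambiguous_form:
 assumes f: "is_form a b" and a: "alp : K" "nm alp = 1" "lat a (- b) = scale alp (lat a b)"
 shows "EX a' b'. ((a, b), (a', b')) : form_rel & a' dvd b'"
proof -
 obtain bet where b: "bet : K" "bet ~= 0" "cj bet * alp = bet" using hilbert_90[OF a(1,2)] by blast
 obtain N where N: "N > 0" "of_int N * bet : R" using K_multiple_in_R[OF b(1)] by blast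
 define \<gamma> where "\<gamma> = of_int N * bet"
 have g: "\<gamma> : R" "\<gamma> : K" "\<gamma> ~= 0" using N b R_K by (auto simp: \<gamma>_def)
 have "of_int N : K" by (simp add: of_int_emb)
 hence "cj \<gamma> * alp = of_int N * (cj bet * alp)" using b(1) by (simp add: \<gamma>_def cj_mult cj_of_int)
 hence ga: "cj \<gamma> * alp = \<gamma>" using b(3) by (simp add: \<gamma>_def)
 define J where "J = scale \<gamma> (lat a b)"
 have "EX g a' b'. g > 0 & is_form a' b' & J = scale (of_int g) (lat a' b')"
 proof (rule integral_ideal_lat)
  show "J \<subseteq> R"
  proof
   fix z assume "z : J"
   then obtain w where "z = \<gamma> * w" "w : lat a b" by (auto simp: J_def scale_def)
   thus "z : R" using g(1) lat_R[OF f] by (auto intro: R_mult)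
  qed
  show "z - w : J" if "z : J" "w : J" for z w
   using that unfolding J_def by (rule scale_lat_diff)
  show "r * z : J" if rz: "r : R" "z : J" for r z
  proof -
   obtain w where "z = \<gamma> * w" "w : lat a b" using rz(2) by (auto simp: J_def scale_def)
   thus ?thesis using scale_mem[OF lat_mult_R[OF f rz(1)], of w \<gamma>] by (simp add: J_def mult.left_commute)
  qed
  show "\<gamma> * pt a b 1 0 : J" unfolding J_def by (rule scale_mem[OF lat_pt])
  show "\<gamma> * pt a b 1 0 ~= 0" using g(3) pt_eq_0[OF f, of 1 0] by simp
 qed
 then obtain k a' b' where k: "k > 0" "is_form a' b'" "J = scale (of_int k) (lat a' b')" by (elim exE conjE)
 have "cj ` J = scale (cj \<gamma>) (scale alp (lat a b))" unfolding J_def cj_scale_lat[OF g(2)] a(3) ..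
 hence "cj ` J = J" by (simp add: scale_scale ga J_def)
 moreover have "of_int k : K" by (simp add: of_int_emb)
 hence "cj ` J = scale (of_int k) (lat a' (- b'))" unfolding k(3) by (simp add: cj_scale_lat cj_of_int)
 ultimately have e: "scale (of_rat (of_int k)) (lat a' b') = scale (of_rat (of_int k)) (lat a' (- b'))" using k(3) by simp
 have k0: "(of_int k :: rat) > 0" using k(1) by simp
 have "[b' = - b'] (mod 2 * a')" by (rule scale_lat_unique(3)[OF k(2) is_form_uminus[OF k(2)] k0 k0 e])
 hence "2 * a' dvd 2 * b'" by (simp add: cong_iff_dvd_diff)
 hence "a' dvd b'" by simp
 have "lat a' b' = scale (inverse (of_int k)) J" using scale_cancel[of "of_int k" "lat a' b'" J] k by simp
 hence "lat a' b' = scale (\<gamma> / of_int k) (lat a b)" by (simp add: J_def scale_scale field_simps)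
 moreover have "\<gamma> / of_int k : K" "\<gamma> / of_int k ~= 0" using g k(1) \<open>of_int k : K\<close> by auto
 ultimately have "((a, b), (a', b')) : form_rel" unfolding form_rel_iff using f k(2) by blast
 thus ?thesis using \<open>a' dvd b'\<close> by blast
qed

end

lemma involution_sum_dvd:
 fixes f :: "'a => int"
 assumes "finite A" and "!!x. x : A ==> \<sigma> x : A" "!!x. x : A ==> \<sigma> (\<sigma> x) = x"
  and "!!x. x : A ==> f (\<sigma> x) = f x" "!!x. x : A ==> \<sigma> x = x ==> f x = 0" "!!x. x : A ==> k dvd f x"
 shows "2 * k dvd (\<Sum>x\<in>A. f x)"
 using assms
proof (induction A rule: finite_psubset_induct)
 case (psubset A)
 show ?case
 proof (cases "A = {}")
  case False
  then obtain x where x: "x : A" by blast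
  define B where "B = A - {x, \<sigma> x}"
  have "B \<subset> A" using x by (auto simp: B_def)
  hence "2 * k dvd (\<Sum>x\<in>B. f x)"
  proof (rule psubset.IH)
   show "\<sigma> y : B" if "y : B" for y
   proof -
    have y: "y : A" "y ~= x" "y ~= \<sigma> x" using that by (auto simp: B_def)
    have "\<sigma> y ~= x" using psubset.prems(2)[OF y(1)] y(3) by metis
    moreover have "\<sigma> y ~= \<sigma> x" using psubset.prems(2)[OF y(1)] psubset.prems(2)[OF x] y(2) by metis
    ultimately show ?thesis using psubset.prems(1)[OF y(1)] by (simp add: B_def)
   qed
  qed (use psubset.prems in \<open>auto simp: B_def\<close>)
  moreover have "2 * k dvd (\<Sum>x\<in>{x, \<sigma> x}. f x)"
  proof (cases "\<sigma> x = x")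
   case True
   thus ?thesis using psubset.prems(4)[OF x] by simp
  next
   case False
   have "(\<Sum>x\<in>{x, \<sigma> x}. f x) = 2 * f x" using False psubset.prems(3)[OF x] by simp
   thus ?thesis using psubset.prems(5)[OF x] by simp
  qed
  moreover have "(\<Sum>x\<in>A. f x) = (\<Sum>x\<in>B. f x) + (\<Sum>x\<in>{x, \<sigma> x}. f x)"
   unfolding B_def by (rule sum.subset_diff) (use x psubset in auto)
  ultimately show ?thesis by simp
 qed simp
qed

section \<open>Self-conjugate classes\<close>

context real_quad_disc
begin

text \<open>The change from b to - b exchanges the diagonal entries of the unit matrix, which
  reverses its word and keeps its letters; \<open>chi\<close> does not see the sign of b.\<close>

lemma class_psi_conj:
 assumes c: "c : Cl"
 shows "class_psi (conj_class c) = class_psi c"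
proof -
 obtain a b where ab: "(a, b) : c" "b^2 < D" using class_reduced[OF c] by (elim exE conjE)
 have f: "is_form a b" by (rule class_mem(1)[OF c ab(1)])
 obtain W where W: "unit_word a b 0 W" using unit_word_exists[OF f ab(2)] by blast
 have W': "unit_word a (- b) 0 (rev W)" using W word_mat_rev[of W] by (simp add: unit_word_def cc_uminus)
 have "(a, - b) : conj_class c" using ab(1) by (simp add: conj_class_mem)
 from class_psi_word[OF conj_class_in[OF c] this W'] class_psi_word[OF c ab(1) W]
 have "chi a (- b) * class_psi (conj_class c) = chi a b * class_psi c" by (simp add: word_psi_rev)
 moreover have "chi a (- b) = chi a b" by (simp add: chi_def cc_uminus)
 ultimately show ?thesis using chi_values[OF f] by auto
qed

lemma prime_divisor_dvd:
 assumes f: "is_form e b" and q: "prime q" "q dvd e" "q dvd D"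
 shows "q dvd b"
proof -
 have "b^2 = D + 4 * e * cc e b" using form_eq[OF f] by simp
 hence "q dvd b^2" using q(2,3) by simp
 thus ?thesis using q(1) prime_dvd_power by blast
qed

lemma divisor_dvd:
 assumes f: "is_form e b" and e: "e : {1, int p1, int p2, D}"
 shows "e dvd b"
proof -
 have d: "int p1 dvd D" "int p2 dvd D" by (simp_all add: D_eq)
 have pr: "prime (int p1)" "prime (int p2)" using p1 p2 by simp_all
 have "coprime p1 p2" using p1 p2 p_ne by (simp add: primes_coprime)
 hence cp: "coprime (int p1) (int p2)" by simp
 consider "e = 1" | "e = int p1" | "e = int p2" | "e = D" using e by blast
 thus ?thesis
 proof cases
  case 4
  hence "int p1 dvd b" "int p2 dvd b" using prime_divisor_dvd[OF f pr(1)] prime_divisor_dvd[OF f pr(2)] d by simp_all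
  hence "int p1 * int p2 dvd b" using cp by (rule divides_mult)
  thus ?thesis using 4 by (simp only: D_eq)
 qed (use prime_divisor_dvd[OF f pr(1)] prime_divisor_dvd[OF f pr(2)] d in simp_all)
qed

lemma principal_value:
 assumes "even (X - Y)" "X^2 - D * Y^2 = 4 * v"
 shows "EX x y. qf 1 1 x y = v"
proof -
 obtain x where x: "X - Y = 2 * x" using assms(1) by (rule evenE)
 have X: "2 * x + Y = X" using x by simp
 have "4 * qf 1 1 x Y = (2 * x + Y) * (2 * x + Y) - D * Y^2" using disc_qf[OF principal_form(1), of x Y] by simp
 also have "... = 4 * v" using assms(2) unfolding X by (simp add: p2sq)
 finally show ?thesis by (intro exI[of _ x] exI[of _ Y]) simp
qed

text \<open>\<open>unit_structure\<close> gives e x^2 - f y^2 = 4 or 1 with e f = D. Multiplied by e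
  this exhibits e as a norm, multiplied by - f it exhibits - f; and sqrt D has norm - D.\<close>

lemma divisor_value:
 assumes e: "e : {1, int p1, int p2, D}"
 shows "EX x y. \<bar>qf 1 1 x y\<bar> = e"
proof -
 have half: "(EX x y. qf 1 1 x y = int p1) & (EX x y. qf 1 1 x y = - int p2) \<or> (EX x y. qf 1 1 x y = int p2) & (EX x y. qf 1 1 x y = - int p1)"
 proof -
  obtain e f x y where h: "(e, f) : {(int p1, int p2), (int p2, int p1)}"
   "(odd eu & et + 2 = e * x^2 & et - 2 = f * y^2 & eu = x * y) \<or>
    (even eu & et + 2 = 4 * (e * x^2) & et - 2 = 4 * (f * y^2) & eu = 4 * (x * y))" using unit_structure by blast
  have ef: "D = e * f" using h(1) by (auto simp: D_eq)
  have "odd e" "odd f" using odd_D unfolding ef by simp_all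
  have "(EX x y. qf 1 1 x y = e) & (EX x y. qf 1 1 x y = - f)"
   using h(2)
  proof
   assume o: "odd eu & et + 2 = e * x^2 & et - 2 = f * y^2 & eu = x * y"
   hence d: "e * x^2 - f * y^2 = 4" "odd x" "odd y" by auto
   have "(e * x)^2 - D * y^2 = e * (e * x^2 - f * y^2)" "(f * y)^2 - D * x^2 = - f * (e * x^2 - f * y^2)"
    by (simp_all add: ef sq_simps)
   hence "(e * x)^2 - D * y^2 = 4 * e" "(f * y)^2 - D * x^2 = 4 * (- f)" unfolding d(1) by simp_all
   thus ?thesis using principal_value[of "e * x" y e] principal_value[of "f * y" x "- f"] d(2,3) \<open>odd e\<close> \<open>odd f\<close> by simp
  next
   assume o: "even eu & et + 2 = 4 * (e * x^2) & et - 2 = 4 * (f * y^2) & eu = 4 * (x * y)"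
   hence d: "e * x^2 - f * y^2 = 1" by linarith
   have "(2 * e * x)^2 - D * (2 * y)^2 = 4 * e * (e * x^2 - f * y^2)" "(2 * f * y)^2 - D * (2 * x)^2 = - 4 * f * (e * x^2 - f * y^2)"
    by (simp_all add: ef sq_simps)
   hence "(2 * e * x)^2 - D * (2 * y)^2 = 4 * e" "(2 * f * y)^2 - D * (2 * x)^2 = 4 * (- f)" unfolding d by simp_all
   thus ?thesis using principal_value[of "2 * e * x" "2 * y" e] principal_value[of "2 * f * y" "2 * x" "- f"] by simp
  qed
  thus ?thesis using h(1) by auto
 qed
 have abs: "EX x y. \<bar>qf 1 1 x y\<bar> = int q" if "(EX x y. qf 1 1 x y = int q) \<or> (EX x y. qf 1 1 x y = - int q)" for q
  using that by (metis abs_minus_cancel abs_of_nat)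
 consider "e = 1" | "e = int p1" | "e = int p2" | "e = D" using e by blast
 thus ?thesis
 proof cases
  case 1
  thus ?thesis using principal_value[of 2 0 1] by (metis abs_1 diff_zero even_numeral mult_zero_right mult_1_right p2sq mult_2_right numeral_Bit0 zero_power2)
 next
  case 2
  thus ?thesis using half abs[of p1] by blast
 next
  case 3
  thus ?thesis using half abs[of p2] by blast
 next
  case 4
  obtain x y where "qf 1 1 x y = - D" using principal_value[of 0 2 "- D"] by auto
  thus ?thesis using 4 D_pos by (intro exI[of _ x] exI[of _ y]) simp
 qed
qed

text \<open>An element of norm e or - e generates an ideal of norm e. Since e is squarefree, k = 1,
  and since e divides the odd middle coefficient, only one residue modulo 2 e is possible for
  it.\<close>

lemma principal_divisor:
 assumes f: "is_form e b" and e: "e : {1, int p1, int p2, D}"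
 shows "(e, b) : principal_class"
proof -
 have eD: "e dvd D" "e > 0" using e D_pos p_gt by (auto simp: D_eq)
 obtain x y where xy: "\<bar>qf 1 1 x y\<bar> = e" using divisor_value[OF e] by blast
 have nz: "(x, y) ~= (0, 0)" using xy eD(2) by (auto simp: qf_def)
 obtain k e' b' where T: "Theta 1 1 x y = (k, e', b')" by (metis prod_cases3)
 note P = Theta_props[OF principal_form(1) nz T]
 have k2: "k^2 * e' = e" using P(6) xy by simp
 have "k = 1"
 proof (rule ccontr)
  assume "k ~= 1"
  hence "nat k ~= 1" "nat k > 0" using P(1) by simp_all
  then obtain q where q: "prime q" "q dvd nat k" using prime_factor_nat by blast
  hence "int q dvd k" using P(1) by (metis int_dvd_int_iff int_nat_eq less_le)
  hence "(int q)^2 dvd k^2" by (rule dvd_power_same)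
  hence "(int q)^2 dvd D" using k2 eD(1) by (metis dvd_mult2 dvd_trans)
  thus False using squarefree[OF q(1)] by simp
 qed
 hence e': "e' = e" using k2 by simp
 have "((1, 1), (e, b')) : form_rel" using P(5) e' by simp
 hence m: "(e, b') : principal_class" by (simp add: principal_class_def)
 have f': "is_form e b'" using P(2) e' by simp
 have "e dvd b' - b" using divisor_dvd[OF f e] divisor_dvd[OF f' e] by simp
 moreover have "2 dvd b' - b" using form_odd[OF f] form_odd[OF f'] by simp
 moreover have "coprime 2 e" using eD(1) odd_D by auto
 ultimately have "2 * e dvd b' - b" by (intro divides_mult)
 hence "[b' = b] (mod 2 * e)" by (simp add: cong_iff_dvd_diff)
 hence "((e, b'), (e, b)) : form_rel" by (rule form_rel_shift[OF f'])
 thus ?thesis using class_mem(2)[OF principal_class(1) m, of e b] by simp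
qed

text \<open>The conjugate lattice is alp L with |nm alp| = 1. Norm -1 would change
  \<open>chi\<close>, which is the same for b and - b; so \<open>ambiguous_form\<close> gives a form
  in the class with a' | b'. Then a' divides D, and all such forms are principal by
  \<open>principal_divisor\<close>.\<close>

lemma self_conj_class:
 assumes c: "c : Cl" "conj_class c = c"
 shows "c = principal_class"
proof -
 obtain a b where ab: "(a, b) : c" using class_nonempty[OF c(1)] by blast
 have f: "is_form a b" by (rule class_mem(1)[OF c(1) ab])
 note f' = is_form_uminus[OF f]
 have "(a, - b) : c" using ab c(2) conj_class_mem[of a "- b" c] by simp
 hence "((a, b), (a, - b)) : form_rel" using class_mem(2)[OF c(1) ab] by blast
 then obtain alp where alp: "alp : K" "alp ~= 0" "lat a (- b) = scale alp (lat a b)" unfolding form_rel_iff by blast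
 have e: "scale (of_int 1) (lat a (- b)) = scale alp (lat a b)" using alp(3) by simp
 have a0: "(of_int a :: rat) > 0" using form_pos[OF f] by simp
 have "(of_int (1^2 * a) :: rat) = \<bar>nm alp\<bar> * of_int a" by (rule scale_lat_norm(1)[OF f f' _ alp(1) e]) simp
 hence n: "\<bar>nm alp\<bar> = 1" using a0 by simp
 have nm1: "nm alp = 1"
 proof (rule ccontr)
  assume "nm alp ~= 1"
  hence n1: "sgn (nm alp) = -1" using n by (auto simp: abs_if sgn_if split: if_splits)
  obtain x y where xy: "~ int p1 dvd qf a (- b) x y"
  proof (cases "int p1 dvd a")
   case True
   hence "~ int p1 dvd qf a (- b) 0 1" using p1_ndvd_cc[OF f' True] by (simp add: qf_def)
   thus ?thesis by (rule that)
  next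
   case False
   hence "~ int p1 dvd qf a (- b) 1 0" by (simp add: qf_def)
   thus ?thesis by (rule that)
  qed
  have "EX u v. (of_int (qf a (- b) x y) :: rat) = sgn (nm alp) * of_int (qf a b u v)"
   by (rule scale_lat_norm(2)[OF f f' _ alp(1) e]) simp
  then obtain u v where "(of_int (qf a (- b) x y) :: rat) = sgn (nm alp) * of_int (qf a b u v)" by (elim exE)
  hence "(of_int (qf a (- b) x y) :: rat) = of_int (- qf a b u v)" unfolding n1 by simp
  hence uv: "qf a (- b) x y = -1 * qf a b u v" by (simp only: of_int_eq_iff mult_minus1)
  hence nd: "~ int p1 dvd qf a b u v" using xy by simp
  have "chi a (- b) = - chi a b"
   using chi_value[OF f' xy] chi_value[OF f nd] unfolding uv Leg_mult Leg_m1 by simp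
  moreover have "chi a (- b) = chi a b" by (simp add: chi_def cc_uminus)
  ultimately show False using chi_values[OF f] by auto
 qed
 obtain a' b' where ab': "((a, b), (a', b')) : form_rel" "a' dvd b'" using ambiguous_form[OF f alp(1) nm1 alp(3)] by (elim exE conjE)
 have c': "(a', b') : c" using class_mem(2)[OF c(1) ab] ab'(1) by blast
 have f2: "is_form a' b'" by (rule class_mem(1)[OF c(1) c'])
 have "D = b'^2 - a' * (4 * cc a' b')" using form_eq[OF f2] by simp
 moreover have "a' dvd b'^2 - a' * (4 * cc a' b')" using ab'(2) by (simp add: p2sq)
 ultimately have aD: "a' dvd int p1 * int p2" using D_eq by simp
 obtain r s where rs: "a' = r * s" "r dvd int p1" "s dvd int p2" using division_decomp[OF aD] by (elim exE conjE)
 have a'0: "a' > 0" by (rule form_pos[OF f2])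
 have "\<bar>r\<bar> = 1 \<or> \<bar>r\<bar> = int p1"
 proof -
  have "nat \<bar>r\<bar> dvd p1" using rs(2) by (simp add: nat_abs_dvd_iff)
  hence "nat \<bar>r\<bar> = 1 \<or> nat \<bar>r\<bar> = p1" using p1(1) prime_nat_iff by blast
  thus ?thesis by auto
 qed
 moreover have "\<bar>s\<bar> = 1 \<or> \<bar>s\<bar> = int p2"
 proof -
  have "nat \<bar>s\<bar> dvd p2" using rs(3) by (simp add: nat_abs_dvd_iff)
  hence "nat \<bar>s\<bar> = 1 \<or> nat \<bar>s\<bar> = p2" using p2(1) prime_nat_iff by blast
  thus ?thesis by auto
 qed
 moreover have "a' = \<bar>r\<bar> * \<bar>s\<bar>" using a'0 rs(1) by (simp flip: abs_mult)
 ultimately have "a' : {1, int p1, int p2, D}" unfolding D_eq by auto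
 from principal_divisor[OF f2 this] have "c \<inter> principal_class ~= {}" using c' by blast
 thus ?thesis using quotient_disj[OF equiv_form_rel c(1) principal_class(1)] by blast
qed

lemma principal_psi: "class_psi principal_class = hirzebruch_sum omega"
proof -
 define b where "b = 2 * \<lfloor>omega\<rfloor> - 1"
 note h = principal_hirzebruch[folded b_def]
 obtain W where W: "unit_word 1 b 0 W" using unit_word_exists[OF h(1,3)] by blast
 have "(1, b) : principal_class" by (rule principal_class(2)[OF form_odd[OF h(1)]])
 from class_psi_word[OF principal_class(1) this W]
 have "chi 1 b * class_psi principal_class = word_psi W" by simp
 moreover have "chi 1 b = 1" using p_gt(1) Legendre_1[OF p1(1)] by (simp add: chi_def)
 ultimately show ?thesis using h(4)[OF W] by simp
qed

text \<open>The difference \<open>class_psi c - psi0\<close> vanishes at the only fixed point of the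
  conjugation, and the other classes come in pairs with equal multiples of 8. This gives 16; if 3
  does not divide D, all terms are multiples of 3 as well.\<close>

theorem char_L0_product_cong:
 "EX z::int. 6 * (char_L0 p1 (leg p1) * char_L0 p2 (leg p2)) =
   real (class_number D) * hirzebruch_sum omega + (if 3 dvd D then 16 else 48) * z"
proof -
 define S where "S = (\<Sum>c\<in>Cl. class_psi c)"
 define h where "h = class_number D"
 define psi0 where "psi0 = hirzebruch_sum omega"
 have "S - int h * psi0 = (\<Sum>c\<in>Cl. class_psi c - psi0)"
  by (simp add: S_def h_def class_number_forms sum_subtractf)
 moreover have "2 * 8 dvd (\<Sum>c\<in>Cl. class_psi c - psi0)"
 proof (rule involution_sum_dvd[OF finite_classes, where \<sigma> = conj_class])
  fix c assume c: "c : Cl"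
  show "conj_class c : Cl" by (rule conj_class_in[OF c])
  show "conj_class (conj_class c) = c" by (rule conj_conj_class)
  show "class_psi (conj_class c) - psi0 = class_psi c - psi0" by (simp add: class_psi_conj[OF c])
  show "8 dvd class_psi c - psi0" using class_psi_cong(1)[OF c] by (simp add: principal_psi psi0_def)
  show "class_psi c - psi0 = 0" if "conj_class c = c" using self_conj_class[OF c that] by (simp add: principal_psi psi0_def)
 qed
 ultimately have 16: "16 dvd S - int h * psi0" by simp
 have 48: "48 dvd S - int h * psi0" if D3: "~ 3 dvd D"
 proof -
  have "3 dvd S" unfolding S_def using class_psi_cong(2) D3 by (intro dvd_sum) blast
  moreover have "3 dvd psi0" using class_psi_cong(2)[OF principal_class(1) D3] by (simp add: principal_psi psi0_def)
  ultimately have "3 dvd S - int h * psi0" by simp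
  moreover have "48 dvd X" if "16 dvd X" "3 dvd X" for X :: int using that by presburger
  ultimately show ?thesis using 16 by blast
 qed
 have "(if 3 dvd D then 16 else 48) dvd S - int h * psi0" using 16 48 by simp
 then obtain z where "S - int h * psi0 = (if 3 dvd D then 16 else 48) * z" by (rule dvdE)
 hence "S = int h * psi0 + (if 3 dvd D then 16 else 48) * z" by simp
 hence "real_of_int S = real h * psi0 + (if 3 dvd D then 16 else 48) * z" by (auto split: if_splits)
 moreover have "real_of_int S = 6 * (char_L0 p1 (leg p1) * char_L0 p2 (leg p2))"
  unfolding S_def of_int_sum by (rule sum_class_psi)
 ultimately show ?thesis unfolding h_def psi0_def by (intro exI[of _ z]) simp
qed

end

section \<open>Specialisation to the discriminants -p and p1 p2\<close>

lemma imag_quad_disc_prime: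
 assumes p: "prime p" "p mod 4 = 3"
 shows "imag_quad_disc (- int p) ((1 + int p) div 4)"
proof
 have "int p mod 4 = 3" using p(2) by presburger
 thus "- int p = 1 - 4 * ((1 + int p) div 4)" by presburger
 have p0: "int p > 0" using p(1) by (simp add: prime_gt_0_nat)
 thus "- int p < 0" by simp
 show "r^2 ~= of_int (- int p)" for r :: rat
 proof -
  have "r^2 >= 0" "(of_int (- int p) :: rat) < 0" using p0 by simp_all
  thus ?thesis by linarith
 qed
 show "~ (int q)^2 dvd - int p" if q: "prime q" for q
 proof
  assume "(int q)^2 dvd - int p"
  hence d: "q * q dvd p" by (simp add: p2sq flip: of_nat_mult)
  hence "q dvd p" by (rule dvd_mult_left)
  hence "q = p" using p q primes_dvd_imp_eq by blast
  hence "p * p dvd p * 1" using d by simp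
  hence "p dvd 1" using p0 by (simp only: nat_mult_dvd_cancel_disj) auto
  thus False using p(1) by simp
 qed
qed

text \<open>Q(sqrt (-3)) has six units and the other fields have two, so w / 2 is 3 or 1.\<close>

lemma class_number_neg_prime:
 assumes p: "prime p" "p mod 4 = 3"
 shows "real (class_number (- int p)) = (if p = 3 then 3 else 1) * char_L0 p (leg p)"
proof -
 interpret I: imag_quad_disc "- int p" "(1 + int p) div 4" by (rule imag_quad_disc_prime[OF p])
 have "quad_char ((1 + int p) div 4) (leg p)" by (rule quad_char_neg_prime[OF p]) (simp only: I.D[symmetric])
 from I.class_number_eq_L0[OF periodic_char_leg[OF p] this]
 have h: "real (class_number (- int p)) = real (card I.units) / 2 * char_L0 p (leg p)" .
 have "card I.units = (if p = 3 then 6 else 2)"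
 proof (cases "p = 3")
  case True
  have "I.units = {(2, 0), (-2, 0), (1, 1), (1, -1), (-1, 1), (-1, -1)}"
  proof (intro equalityI subsetI)
   fix z assume "z : I.units"
   then obtain t u where z: "z = (t, u)" "t^2 + int p * u^2 = 4" by (auto simp: I.units_def)
   have z: "z = (t, u)" "t^2 + 3 * u^2 = 4" using z True by simp_all
   hence "u^2 <= 1^2" "t^2 <= 2^2" using zero_le_power2[of t] zero_le_power2[of u] by (simp_all, linarith+)
   hence "\<bar>u\<bar> <= 1" "\<bar>t\<bar> <= 2" using abs_le_square_iff[of u 1] abs_le_square_iff[of t 2] by simp_all
   hence "u : {-1, 0, 1}" "t : {-2, -1, 0, 1, 2}" by auto
   thus "z : {(2, 0), (-2, 0), (1, 1), (1, -1), (-1, 1), (-1, -1)}" using z by auto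
  next
   fix z :: "int \<times> int" assume "z : {(2, 0), (-2, 0), (1, 1), (1, -1), (-1, 1), (-1, -1)}"
   thus "z : I.units" unfolding I.units_def using True by auto
  qed
  thus ?thesis using True by simp
 next
  case False
  hence p7: "int p > 4" using prime_3_mod_4[OF p] p(2) by (cases "p = 4") auto
  have "I.units = {(2, 0), (-2, 0)}"
  proof (intro equalityI subsetI)
   fix z assume "z : I.units"
   then obtain t u where z: "z = (t, u)" "t^2 + int p * u^2 = 4" by (auto simp: I.units_def)
   have "u = 0"
   proof (rule ccontr)
    assume "u ~= 0"
    hence "u^2 >= 1" by (simp add: int_one_le_iff_zero_less)
    hence "int p * 1 <= int p * u^2" by (intro mult_left_mono) simp_all
    thus False using z(2) p7 zero_le_power2[of t] by linarith
   qed
   moreover from this have "t^2 = 2^2" using z(2) by simp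
   hence "t = 2 \<or> t = -2" by (simp only: power2_eq_iff)
   ultimately show "z : {(2, 0), (-2, 0)}" by (auto simp: z)
  qed (auto simp: I.units_def)
  thus ?thesis using False by simp
 qed
 thus ?thesis using h by (auto split: if_splits)
qed

lemma real_quad_disc_primes:
 assumes p1: "prime p1" "p1 mod 4 = 3" and p2: "prime p2" "p2 mod 4 = 3" and ne: "p1 ~= p2"
 shows "real_quad_disc (int p1 * int p2) ((1 - int p1 * int p2) div 4) p1 p2"
proof -
 have "int (p1 mod 4) = 3" "int (p2 mod 4) = 3" using p1(2) p2(2) by simp_all
 hence "int p1 mod 4 = 3" "int p2 mod 4 = 3" unfolding zmod_int by simp_all
 then obtain k l where kl: "int p1 = 4 * k + 3" "int p2 = 4 * l + 3"
  using div_mod_decomp_int[of "int p1" 4] div_mod_decomp_int[of "int p2" 4] by (metis mult.commute)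
 have e: "int p1 * int p2 = 1 - 4 * (- (4 * k * l + 3 * k + 3 * l + 2))" unfolding kl by (simp add: alg)
 define m where "m = - (4 * k * l + 3 * k + 3 * l + 2)"
 have "1 - int p1 * int p2 = 4 * m" using e unfolding m_def by linarith
 hence dm: "(1 - int p1 * int p2) div 4 = m" by simp
 have D: "int p1 * int p2 = 1 - 4 * ((1 - int p1 * int p2) div 4)" unfolding dm m_def by (rule e)
 interpret Q: quad_char "(1 - int p1 * int p2) div 4" "%n. leg p1 n * leg p2 n"
  by (rule quad_char_prime_product[OF p1 p2 ne D[symmetric]])
 have sf: "~ (int q)^2 dvd int p1 * int p2" if "prime q" for q
  using Q.squarefree[OF that] unfolding D[symmetric] .
 show ?thesis
 proof
  show "int p1 * int p2 = 1 - 4 * ((1 - int p1 * int p2) div 4)" by (rule D)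
  show "~ (int q)^2 dvd int p1 * int p2" if "prime q" for q by (rule sf[OF that])
  show "r^2 ~= of_int (int p1 * int p2)" for r :: rat
  proof
   assume r: "r^2 = of_int (int p1 * int p2)"
   obtain x y where xy: "quotient_of r = (x, y)" by (cases "quotient_of r")
   have y0: "y > 0" and cp: "coprime x y" and r': "r = of_int x / of_int y"
    using quotient_of_denom_pos[OF xy] quotient_of_coprime[OF xy] quotient_of_div[OF xy] by simp_all
   have "(of_int x :: rat)^2 = of_int (int p1 * int p2) * (of_int y)^2"
    using r y0 unfolding r' by (simp add: power_divide field_simps)
   hence "(of_int (x^2) :: rat) = of_int (int p1 * int p2 * y^2)" by simp
   hence x2: "x^2 = int p1 * int p2 * y^2" by (simp only: of_int_eq_iff)
   hence "y dvd x^2" by (simp add: p2sq)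
   moreover have "coprime y (x^2)" using cp by (simp add: coprime_commute)
   ultimately have "is_unit y" using coprime_common_divisor[of y "x^2" y] by simp
   hence "y = 1" using y0 by simp
   hence x2': "x^2 = int p1 * int p2" using x2 by simp
   hence "int p1 dvd x^2" by simp
   hence "int p1 dvd x" using p1(1) prime_dvd_power by (metis prime_nat_int_transfer)
   hence "(int p1)^2 dvd x^2" by (rule dvd_power_same)
   thus False using sf[OF p1(1)] x2' by simp
  qed
 qed (use assms in simp_all)
qed

theorem theorem1p3:
  fixes p1 p2 n :: nat
  assumes "prime p1" and "prime p2" and "p1 \<noteq> p2"
    and "[p1 = 3] (mod 4)" and "[p2 = 3] (mod 4)"
    and "n = (if min p1 p2 > 3 then 6 else 2)"
  shows "[real (class_number (- int p1)) * real (class_number (- int p2))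
          = real (class_number (int p1 * int p2)) *
            (real_of_int (hirzebruch_sum ((1 + sqrt (real p1 * real p2)) / 2)) / real n)]
         (rmod 8)"
proof -
 have m: "p1 mod 4 = 3" "p2 mod 4 = 3" using assms(4,5) by (simp_all add: cong_mod)
 interpret real_quad_disc "int p1 * int p2" "(1 - int p1 * int p2) div 4" p1 p2
  by (rule real_quad_disc_primes[OF assms(1) m(1) assms(2) m(2) assms(3)])
 define L1 L2 where "L1 = char_L0 p1 (leg p1)" and "L2 = char_L0 p2 (leg p2)"
 define h where "h = real (class_number (int p1 * int p2))"
 define psi0 where "psi0 = real_of_int (hirzebruch_sum ((1 + sqrt (real p1 * real p2)) / 2))"
 have om: "omega = (1 + sqrt (real p1 * real p2)) / 2" by (simp add: omega_def sq_def)
 have g: "p1 >= 3" "p2 >= 3" using p_gt by simp_all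
 have pr3: "prime (3::nat)" by simp
 have "(3::int) dvd int p1 * int p2 \<longleftrightarrow> 3 dvd p1 * p2" by (metis int_dvd_int_iff of_nat_mult of_nat_numeral)
 also have "... \<longleftrightarrow> p1 = 3 \<or> p2 = 3"
  using prime_dvd_mult_iff[OF pr3] primes_dvd_imp_eq[OF pr3] assms(1,2) by auto
 finally have d3: "(3::int) dvd int p1 * int p2 \<longleftrightarrow> p1 = 3 \<or> p2 = 3" .
 have "real (class_number (- int p1)) = (if p1 = 3 then 3 else 1) * L1" "real (class_number (- int p2)) = (if p2 = 3 then 3 else 1) * L2"
  using class_number_neg_prime assms(1,2) m by (simp_all add: L1_def L2_def)
 hence hh: "real (class_number (- int p1)) * real (class_number (- int p2)) = (if p1 = 3 \<or> p2 = 3 then 3 else 1) * (L1 * L2)"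
  using assms(3) by auto
 obtain z :: int where z: "6 * (L1 * L2) = h * psi0 + (if p1 = 3 \<or> p2 = 3 then 16 else 48) * real_of_int z"
  using char_L0_product_cong unfolding d3 om L1_def L2_def h_def psi0_def by blast
 have n: "real n = (if p1 = 3 \<or> p2 = 3 then 2 else 6)" using assms(6) g by (auto simp: min_def)
 \<comment> \<open>If one of the primes is 3, the product of class numbers is 3 L1 L2, and 16 / 2 =
   8; otherwise it is L1 L2, and 48 / 6 = 8.\<close>
 have "h * (psi0 / real n) = real (class_number (- int p1)) * real (class_number (- int p2)) + real_of_int (- z) * 8"
  using z unfolding hh n by (auto simp: field_simps split: if_splits)
 thus ?thesis unfolding rcong_altdef h_def psi0_def by blast
qed

end
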